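(* For all $(\delta u,\delta\tau)\in C(\bar u,\bar\tau)$, there exists $(\alpha,\gamma,\nu)\in\Lambda_L(\bar u,\bar\tau)$ such that $$\Omega[\alpha,\gamma,\nu](\delta u,\delta\tau)\ge 0 .$$
   Context: **Time crisis problem and standing assumptions.** Fix $T>0$, positive integers $n,m,l$ and $x_0\in\mathbb{R}^n$; $|\cdot|$ is the Euclidean norm. $U\subset\mathbb{R}^m$ is non-empty and closed; $f:\mathbb{R}^n\times\mathbb{R}^m\to\mathbb{R}^n$ is of class $C^2$; there are $c_1,c_2>0$ with $|f(x,u)|\le c_1|x|+c_2$ for all $x\in\mathbb{R}^n$, $u\in U$; for every $x$ the set $\{f(x,u):u\in U\}$ is non-empty, compact and convex; $\phi:\mathbb{R}^n\to\mathbb{R}$ is of class $C^2$; $K\subset\mathbb{R}^n$ is closed with non-empty interior, $K^c$ is its complement and $\mathbf{1}_{K^c}$ the indicator function of $K^c$ (value $1$ on $K^c$, $0$ on $K$). Let $\mathcal{U}$ be the set of measurable $u:[0,T]\to U$ and, for $u\in\mathcal{U}$, let $x_u$ be the unique solution on $[0,T]$ of $\dot x=f(x,u)$, $x(0)=x_0$. The time crisis problem is to minimize over $u\in\mathcal{U}$ the cost $J_T(u)=\phi(x_u(T))+\int_0^T\mathbf{1}_{K^c}(x_u(t))\,dt$. Fix a global minimizer $\bar u\in\mathcal{U}$ and set $\bar x=x_{\bar u}$. It is assumed that: - There is $c:\mathbb{R}^m\to\mathbb{R}^l$ of class $C^2$ with $U=\{u: c_i(u)\le 0,\ 1\le i\le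 l\}$, and there are $\varepsilon,\delta>0$ such that, with $I(t)=\{i: c_i(\bar u(t))\ge-\delta\}$, one has $\varepsilon|\xi|\le\big|\sum_{i\in I(t)}\xi_i\nabla c_i(\bar u(t))\big|$ for all $\xi\in\mathbb{R}^{I(t)}$, for a.e. $t\in(0,T)$. - There is $g:\mathbb{R}^n\to\mathbb{R}$ of class $C^2$ with $K=\{x: g(x)\le 0\}$. - $\bar x$ has exactly one crossing time $\bar\tau\in(0,T)$; it is a transverse crossing time from $K$ to $K^c$: there is $\eta>0$ with $\bar x(t)\in K$ for $t\in(\bar\tau-\eta,\bar\tau]$ and $\bar x(t)\in K^c$ for $t\in(\bar\tau,\bar\tau+\eta)$; $\bar u$ is left- and right-continuous at $\bar\tau$ (one-sided limits $\bar u(\bar\tau^\pm)$ exist); and $\dot{\bar x}(\bar\tau^\pm)\cdot\nabla g(\bar x(\bar\tau))\ne0$, where $\dot{\bar x}(\bar\tau^\pm)=f(\bar x(\bar\tau),\bar u(\bar\tau^\pm))$. Moreover $g(\bar x(t))\neq0$ for all $t\in[0,T]\setminus\{\bar\tau\}$ (so $x_0\in\mathrm{Int}(K)$). **Hamiltonians.** $H(x,p,u)=p\cdot f(x,u)$ and $H^a(x,p,u,\nu)=p\cdot f(x,u)+\nu\cdot c(u)$, for $x,p\in\mathbb{R}^n$, $u\in\mathbb{R}^m$, $\nu\in\mathbb{R}^l$. Set $\rho_{\bar\tau}(t)=1/\bar\tau$ for $t\in(0,\bar\tau)$ and $\rho_{\bar\tau}(t)=-1/(T-\bar\tau)$ for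 $t\in(\bar\tau,T)$. **Lagrange multipliers.** $\Lambda_L(\bar u,\bar\tau)$ is the set of non-zero triplets $(\alpha,\gamma,\nu)\in[0,\infty)\times\mathbb{R}\times L^\infty(0,T;\mathbb{R}^l)$ such that: (i) $\nu(t)\ge0$ and $\nu(t)\cdot c(\bar u(t))=0$ for a.e. $t$; (ii) there is $p:[0,T]\to\mathbb{R}^n$, absolutely continuous on $[0,\bar\tau)$ and on $(\bar\tau,T]$, with $\dot p(t)=-\nabla_xH(\bar x(t),p(t),\bar u(t))$ for a.e. $t$, $p(T)=\alpha\nabla\phi(\bar x(T))$, and jump condition $p(\bar\tau^+)-p(\bar\tau^-)=\gamma\nabla g(\bar x(\bar\tau))$; (iii) $\nabla_uH^a(\bar x(t),p(t),\bar u(t),\nu(t))=0$ for a.e. $t$; (iv) $\int_0^T\rho_{\bar\tau}(t)H(\bar x(t),p(t),\bar u(t))\,dt=\alpha$. The function $p$ (the costate) is uniquely determined by $(\alpha,\gamma,\nu)$. **Critical cone.** For $(\delta u,\delta\tau)\in L^2(0,T;\mathbb{R}^m)\times\mathbb{R}$ let $\delta x$ solve $$\tfrac{d}{dt}\delta x(t)=Df(\bar x(t),\bar u(t))(\delta x(t),\delta u(t))+\rho_{\bar\tau}(t)\,\delta\tau\, f(\bar x(t),\bar u(t))\ \text{ a.e. on }(0,T),\qquad \delta x(0)=0.$$ $C(\bar u,\bar\tau)$ is the set of $(\delta u,\delta\tau)\in L^2(0,T;\mathbb{R}^m)\times\mathbb{R}$ such that $D\phi(\bar x(T))\delta x(T)-\delta\tau\le0$,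 $Dg(\bar x(\bar\tau))\delta x(\bar\tau)=0$, and for all $i=1,\dots,l$ and a.e. $t\in(0,T)$, $c_i(\bar u(t))=0$ implies $Dc_i(\bar u(t))\delta u(t)=0$. **Quadratic form.** For $(\alpha,\gamma,\nu)\in\Lambda_L(\bar u,\bar\tau)$ and $(\delta u,\delta\tau)\in L^2(0,T;\mathbb{R}^m)\times\mathbb{R}$, with $\delta x$ the solution of the linearized system above, $p$ the costate of $(\alpha,\gamma,\nu)$ and $[t]=(\bar x(t),p(t),\bar u(t),\nu(t))$ (the argument $\nu(t)$ being dropped for $H$), derivatives of $H$, $H^a$ being taken with respect to $(x,u)$ only and $B(z)^2$ meaning $B(z,z)$ for a bilinear form $B$, $$\Omega[\alpha,\gamma,\nu](\delta u,\delta\tau)=\alpha D^2\phi(\bar x(T))(\delta x(T))^2+\gamma D^2g(\bar x(\bar\tau))(\delta x(\bar\tau))^2+\int_0^TD^2H^a[t](\delta x(t),\delta u(t))^2dt+2\delta\tau\int_0^T\rho_{\bar\tau}(t)DH[t](\delta x(t),\delta u(t))\,dt .$$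
   Formalization: The jump condition is taken as p(τ⁻) − p(τ⁺) = γ∇g(x̄(τ)), i.e. γ becomes −γ in Λ_L, since the stated sign is inconsistent with +γD²g in Ω; and the minimizer ū is assumed essentially bounded, since otherwise Λ_L can be empty. *)

theory Defs
  imports "HOL-Analysis.Analysis"
begin

subsection \<open>Calculus\<close>

definition C2 :: "('a::real_normed_vector \<Rightarrow> 'b::real_normed_vector) \<Rightarrow> bool" where
  "C2 F \<longleftrightarrow> (\<exists>(F' :: 'a \<Rightarrow> 'a \<Rightarrow>\<^sub>L 'b) (F'' :: 'a \<Rightarrow> 'a \<Rightarrow>\<^sub>L 'a \<Rightarrow>\<^sub>L 'b).
     (\<forall>z. (F has_derivative blinfun_apply (F' z)) (at z)) \<and>
     (\<forall>z. (F' has_derivative blinfun_apply (F'' z)) (at z)) \<and>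
     continuous_on UNIV F'')"

definition grad :: "('a::real_inner \<Rightarrow> real) \<Rightarrow> 'a \<Rightarrow> 'a" where
  "grad F z = (THE D. GDERIV F z :> D)"

abbreviation deriv1 :: "('a::real_normed_vector \<Rightarrow> 'b::real_normed_vector) \<Rightarrow> 'a \<Rightarrow> 'a \<Rightarrow> 'b" where
  "deriv1 F z h \<equiv> frechet_derivative F (at z) h"

text \<open>The value \<open>D\<^sup>2F(z)(h, k)\<close>, obtained by differentiating \<open>w \<mapsto> DF(w) k\<close> at \<open>z\<close> in direction \<open>h\<close>.\<close>

definition deriv2 :: "('a::real_normed_vector \<Rightarrow> 'b::real_normed_vector) \<Rightarrow> 'a \<Rightarrow> 'a \<Rightarrow> 'a \<Rightarrow> 'b" where
  "deriv2 F z h k = deriv1 (\<lambda>w. deriv1 F w k) z h"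

text \<open>In the next definition \<open>S\<close> is an interval, and a finite family of pairwise non-overlapping
  subintervals \<open>[a, b]\<close> is encoded by the set of its endpoint pairs \<open>(a, b)\<close>. On a half-open
  bounded interval the condition forces a one-sided limit at the missing endpoint.\<close>

definition absolutely_continuous_on :: "real set \<Rightarrow> (real \<Rightarrow> 'a::real_normed_vector) \<Rightarrow> bool" where
  "absolutely_continuous_on S x \<longleftrightarrow>
     (\<forall>\<epsilon>>0. \<exists>\<delta>>0. \<forall>D. finite D \<longrightarrow>
        (\<forall>(a, b)\<in>D. a \<le> b \<and> {a..b} \<subseteq> S) \<longrightarrow>
        pairwise (\<lambda>(a, b) (a', b'). {a<..<b} \<inter> {a'<..<b'} = {}) D \<longrightarrow>
        (\<Sum>(a, b)\<in>D. b - a) < \<delta> \<longrightarrow>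
        (\<Sum>(a, b)\<in>D. norm (x b - x a)) < \<epsilon>)"

definition L2_space :: "real \<Rightarrow> (real \<Rightarrow> 'a::euclidean_space) set" where
  "L2_space T = {v. v \<in> borel_measurable (lebesgue_on {0..T}) \<and>
                    integrable (lebesgue_on {0..T}) (\<lambda>t. (norm (v t))\<^sup>2)}"

definition Linf_space :: "real \<Rightarrow> (real \<Rightarrow> 'a::euclidean_space) set" where
  "Linf_space T = {v. v \<in> borel_measurable (lebesgue_on {0..T}) \<and>
                      (\<exists>M. AE t in lebesgue_on {0..T}. norm (v t) \<le> M)}"


subsection \<open>The time crisis problem\<close>

definition controls :: "real \<Rightarrow> (real^'m) set \<Rightarrow> (real \<Rightarrow> real^'m) set" where
  "controls T U = {u. u \<in> borel_measurable (lebesgue_on {0..T}) \<and> (\<forall>t\<in>{0..T}. u t \<in> U)}"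

text \<open>\<open>is_state T f x\<^sub>0 u x\<close>: on \<open>[0,T]\<close>, \<open>x\<close> is the (Caratheodory) solution \<open>x\<^sub>u\<close>.\<close>

definition is_state ::
  "real \<Rightarrow> ((real^'n) \<times> (real^'m) \<Rightarrow> real^'n) \<Rightarrow> real^'n \<Rightarrow> (real \<Rightarrow> real^'m) \<Rightarrow> (real \<Rightarrow> real^'n) \<Rightarrow> bool"
  where
  "is_state T f x0 u x \<longleftrightarrow>
     absolutely_continuous_on {0..T} x \<and> x 0 = x0 \<and>
     (AE t in lebesgue_on {0..T}. (x has_vector_derivative f (x t, u t)) (at t))"

definition crisis_cost ::
  "real \<Rightarrow> (real^'n \<Rightarrow> real) \<Rightarrow> (real^'n) set \<Rightarrow> (real \<Rightarrow> real^'n) \<Rightarrow> real" where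
  "crisis_cost T \<phi> K x = \<phi> (x T) + (LINT t|lebesgue_on {0..T}. indicator (- K) (x t))"

text \<open>\<open>u\<close> is a global minimizer of \<open>J\<^sub>T\<close> over the admissible controls, with state \<open>x = x\<^sub>u\<close>.\<close>

definition global_minimizer ::
  "real \<Rightarrow> ((real^'n) \<times> (real^'m) \<Rightarrow> real^'n) \<Rightarrow> real^'n \<Rightarrow> (real^'m) set \<Rightarrow> (real^'n \<Rightarrow> real) \<Rightarrow>
   (real^'n) set \<Rightarrow> (real \<Rightarrow> real^'m) \<Rightarrow> (real \<Rightarrow> real^'n) \<Rightarrow> bool" where
  "global_minimizer T f x0 U \<phi> K u x \<longleftrightarrow>
     u \<in> controls T U \<and> is_state T f x0 u x \<and>
     (\<forall>v\<in>controls T U. \<forall>y. is_state T f x0 v y \<longrightarrow> crisis_cost T \<phi> K x \<le> crisis_cost T \<phi> K y)"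

definition crossing_out :: "real \<Rightarrow> 'a set \<Rightarrow> (real \<Rightarrow> 'a) \<Rightarrow> real \<Rightarrow> bool" where
  "crossing_out T K x \<tau> \<longleftrightarrow> 0 < \<tau> \<and> \<tau> < T \<and>
     (\<exists>\<eta>>0. (\<forall>t\<in>{\<tau> - \<eta><..\<tau>}. x t \<in> K) \<and> (\<forall>t\<in>{\<tau><..<\<tau> + \<eta>}. x t \<notin> K))"

definition crossing_in :: "real \<Rightarrow> 'a set \<Rightarrow> (real \<Rightarrow> 'a) \<Rightarrow> real \<Rightarrow> bool" where
  "crossing_in T K x \<tau> \<longleftrightarrow> 0 < \<tau> \<and> \<tau> < T \<and>
     (\<exists>\<eta>>0. (\<forall>t\<in>{\<tau> - \<eta><..<\<tau>}. x t \<notin> K) \<and> (\<forall>t\<in>{\<tau>..<\<tau> + \<eta>}. x t \<in> K))"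

definition transverse_at ::
  "((real^'n) \<times> (real^'m) \<Rightarrow> real^'n) \<Rightarrow> (real^'n \<Rightarrow> real) \<Rightarrow> (real \<Rightarrow> real^'m) \<Rightarrow> (real \<Rightarrow> real^'n) \<Rightarrow> real \<Rightarrow> bool"
  where
  "transverse_at f g u x \<tau> \<longleftrightarrow>
     (\<exists>ul ur. (u \<longlongrightarrow> ul) (at_left \<tau>) \<and> (u \<longlongrightarrow> ur) (at_right \<tau>) \<and>
        f (x \<tau>, ul) \<bullet> grad g (x \<tau>) \<noteq> 0 \<and> f (x \<tau>, ur) \<bullet> grad g (x \<tau>) \<noteq> 0)"

definition control_qualification ::
  "real \<Rightarrow> (real^'m \<Rightarrow> real^'l) \<Rightarrow> (real \<Rightarrow> real^'m) \<Rightarrow> real \<Rightarrow> real \<Rightarrow> bool" where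
  "control_qualification T c u \<epsilon> \<delta> \<longleftrightarrow>
     (AE t in lebesgue_on {0..T}. let I = {i. c (u t) $ i \<ge> - \<delta>} in
        \<forall>\<xi> :: real^'l. (\<forall>i. i \<notin> I \<longrightarrow> \<xi> $ i = 0) \<longrightarrow>
          \<epsilon> * norm \<xi> \<le> norm (\<Sum>i\<in>I. (\<xi> $ i) *\<^sub>R grad (\<lambda>w. c w $ i) (u t)))"


subsection \<open>Multipliers, critical cone, quadratic form\<close>

definition Ham :: "((real^'n) \<times> (real^'m) \<Rightarrow> real^'n) \<Rightarrow> real^'n \<Rightarrow> real^'n \<Rightarrow> real^'m \<Rightarrow> real" where
  "Ham f x p u = p \<bullet> f (x, u)"

definition Ham_aug ::
  "((real^'n) \<times> (real^'m) \<Rightarrow> real^'n) \<Rightarrow> (real^'m \<Rightarrow> real^'l) \<Rightarrow>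
   real^'n \<Rightarrow> real^'n \<Rightarrow> real^'m \<Rightarrow> real^'l \<Rightarrow> real" where
  "Ham_aug f c x p u \<nu> = p \<bullet> f (x, u) + \<nu> \<bullet> c u"

definition rho :: "real \<Rightarrow> real \<Rightarrow> real \<Rightarrow> real" where
  "rho T \<tau> t = (if t < \<tau> then 1 / \<tau> else - 1 / (T - \<tau>))"

text \<open>Sign of the jump. After rescaling time so that the crossing instant stays at \<open>\<tau>\<close>, the costate
  is the adjoint state of the Lagrangian
    \<open>\<alpha> (\<phi>(x(T)) - \<delta>\<tau>) + \<gamma> g(x(\<tau>)) + \<integral> p \<cdot> ((1 + \<rho> \<delta>\<tau>) f(x, u) - x') + \<nu> \<cdot> c(u)\<close>,
  whose second derivative is the quadratic form \<open>Omega\<close> below, with its term \<open>+ \<gamma> D\<^sup>2g\<close>. Stationarity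
  in \<open>x(\<tau>)\<close> gives \<open>p(\<tau>-) - p(\<tau>+) = \<gamma> \<nabla>g(x(\<tau>))\<close>. The opposite convention
  \<open>p(\<tau>+) - p(\<tau>-) = \<gamma> \<nabla>g(x(\<tau>))\<close> replaces \<open>\<gamma>\<close> by \<open>-\<gamma>\<close> and would require \<open>- \<gamma> D\<^sup>2g\<close> in \<open>Omega\<close>.\<close>

definition is_costate ::
  "real \<Rightarrow> ((real^'n) \<times> (real^'m) \<Rightarrow> real^'n) \<Rightarrow> (real^'n \<Rightarrow> real) \<Rightarrow> (real^'n \<Rightarrow> real) \<Rightarrow>
   (real \<Rightarrow> real^'m) \<Rightarrow> (real \<Rightarrow> real^'n) \<Rightarrow> real \<Rightarrow> real \<Rightarrow> real \<Rightarrow> (real \<Rightarrow> real^'n) \<Rightarrow> bool" where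
  "is_costate T f \<phi> g u x \<tau> \<alpha> \<gamma> p \<longleftrightarrow>
     absolutely_continuous_on {0..<\<tau>} p \<and> absolutely_continuous_on {\<tau><..T} p \<and>
     (AE t in lebesgue_on {0..T}.
        (p has_vector_derivative - grad (\<lambda>y. Ham f y (p t) (u t)) (x t)) (at t)) \<and>
     p T = \<alpha> *\<^sub>R grad \<phi> (x T) \<and>
     (\<exists>pl pr. (p \<longlongrightarrow> pl) (at_left \<tau>) \<and> (p \<longlongrightarrow> pr) (at_right \<tau>) \<and>
        pl - pr = \<gamma> *\<^sub>R grad g (x \<tau>))"

definition lagrange_multipliers ::
  "real \<Rightarrow> ((real^'n) \<times> (real^'m) \<Rightarrow> real^'n) \<Rightarrow> (real^'n \<Rightarrow> real) \<Rightarrow> (real^'n \<Rightarrow> real) \<Rightarrow>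
   (real^'m \<Rightarrow> real^'l) \<Rightarrow> (real \<Rightarrow> real^'m) \<Rightarrow> (real \<Rightarrow> real^'n) \<Rightarrow> real \<Rightarrow>
   (real \<times> real \<times> (real \<Rightarrow> real^'l)) set" where
  "lagrange_multipliers T f \<phi> g c u x \<tau> = {(\<alpha>, \<gamma>, \<nu>).
     \<alpha> \<ge> 0 \<and> \<nu> \<in> Linf_space T \<and>
     \<not> (\<alpha> = 0 \<and> \<gamma> = 0 \<and> (AE t in lebesgue_on {0..T}. \<nu> t = 0)) \<and>
     (AE t in lebesgue_on {0..T}. (\<forall>i. \<nu> t $ i \<ge> 0) \<and> \<nu> t \<bullet> c (u t) = 0) \<and>
     (\<exists>p. is_costate T f \<phi> g u x \<tau> \<alpha> \<gamma> p \<and>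
        (AE t in lebesgue_on {0..T}. grad (\<lambda>w. Ham_aug f c (x t) (p t) w (\<nu> t)) (u t) = 0) \<and>
        (LINT t|lebesgue_on {0..T}. rho T \<tau> t * Ham f (x t) (p t) (u t)) = \<alpha>)}"

definition is_linearized_state ::
  "real \<Rightarrow> ((real^'n) \<times> (real^'m) \<Rightarrow> real^'n) \<Rightarrow> (real \<Rightarrow> real^'m) \<Rightarrow> (real \<Rightarrow> real^'n) \<Rightarrow> real \<Rightarrow>
   (real \<Rightarrow> real^'m) \<Rightarrow> real \<Rightarrow> (real \<Rightarrow> real^'n) \<Rightarrow> bool" where
  "is_linearized_state T f u x \<tau> \<delta>u \<delta>\<tau> \<delta>x \<longleftrightarrow>
     absolutely_continuous_on {0..T} \<delta>x \<and> \<delta>x 0 = 0 \<and>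
     (AE t in lebesgue_on {0..T}.
        (\<delta>x has_vector_derivative
           deriv1 f (x t, u t) (\<delta>x t, \<delta>u t) + (rho T \<tau> t * \<delta>\<tau>) *\<^sub>R f (x t, u t)) (at t))"

definition critical_cone ::
  "real \<Rightarrow> ((real^'n) \<times> (real^'m) \<Rightarrow> real^'n) \<Rightarrow> (real^'n \<Rightarrow> real) \<Rightarrow> (real^'n \<Rightarrow> real) \<Rightarrow>
   (real^'m \<Rightarrow> real^'l) \<Rightarrow> (real \<Rightarrow> real^'m) \<Rightarrow> (real \<Rightarrow> real^'n) \<Rightarrow> real \<Rightarrow>
   ((real \<Rightarrow> real^'m) \<times> real) set" where
  "critical_cone T f \<phi> g c u x \<tau> = {(\<delta>u, \<delta>\<tau>).
     \<delta>u \<in> L2_space T \<and>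
     (\<exists>\<delta>x. is_linearized_state T f u x \<tau> \<delta>u \<delta>\<tau> \<delta>x \<and>
        deriv1 \<phi> (x T) (\<delta>x T) - \<delta>\<tau> \<le> 0 \<and>
        deriv1 g (x \<tau>) (\<delta>x \<tau>) = 0) \<and>
     (\<forall>i. AE t in lebesgue_on {0..T}.
        c (u t) $ i = 0 \<longrightarrow> deriv1 (\<lambda>w. c w $ i) (u t) (\<delta>u t) = 0)}"

text \<open>In \<open>Omega\<close>, \<open>\<delta>x\<close> and \<open>p\<close> are the linearized state and the costate, which are unique on
  \<open>[0,T]\<close> and on \<open>[0,T] - {\<tau>}\<close> respectively; \<open>Omega\<close> does not depend on their other values.\<close>

definition Omega ::
  "real \<Rightarrow> ((real^'n) \<times> (real^'m) \<Rightarrow> real^'n) \<Rightarrow> (real^'n \<Rightarrow> real) \<Rightarrow> (real^'n \<Rightarrow> real) \<Rightarrow>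
   (real^'m \<Rightarrow> real^'l) \<Rightarrow> (real \<Rightarrow> real^'m) \<Rightarrow> (real \<Rightarrow> real^'n) \<Rightarrow> real \<Rightarrow>
   real \<Rightarrow> real \<Rightarrow> (real \<Rightarrow> real^'l) \<Rightarrow> (real \<Rightarrow> real^'m) \<Rightarrow> real \<Rightarrow> real" where
  "Omega T f \<phi> g c u x \<tau> \<alpha> \<gamma> \<nu> \<delta>u \<delta>\<tau> =
     (let \<delta>x = (SOME \<delta>x. is_linearized_state T f u x \<tau> \<delta>u \<delta>\<tau> \<delta>x);
          p = (SOME p. is_costate T f \<phi> g u x \<tau> \<alpha> \<gamma> p)
      in \<alpha> * deriv2 \<phi> (x T) (\<delta>x T) (\<delta>x T) + \<gamma> * deriv2 g (x \<tau>) (\<delta>x \<tau>) (\<delta>x \<tau>)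
       + (LINT t|lebesgue_on {0..T}.
            deriv2 (\<lambda>(y, w). Ham_aug f c y (p t) w (\<nu> t)) (x t, u t) (\<delta>x t, \<delta>u t) (\<delta>x t, \<delta>u t))
       + 2 * \<delta>\<tau> * (LINT t|lebesgue_on {0..T}.
            rho T \<tau> t * deriv1 (\<lambda>(y, w). Ham f y (p t) w) (x t, u t) (\<delta>x t, \<delta>u t)))"

end

theory Submission
  imports Defs
begin

text \<open>A change of time that is affine on \<open>[0,\<tau>]\<close> and on \<open>[\<tau>,T]\<close> keeps the crossing at the fixed instant
  \<open>\<tau>\<close> and turns the discontinuous part of the cost into \<open>- \<delta>\<tau>\<close>. A competitor that stays in \<open>K\<close>
  on \<open>[0,\<tau>]\<close> spends at most \<open>T - \<tau> - \<delta>\<tau>\<close> outside of \<open>K\<close>, so the crossing condition may be relaxed to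
  the inequality \<open>g(x(\<tau>)) \<le> 0\<close>; transversality of the crossing propagates it to \<open>[0,\<tau>]\<close>.

  Along a bounded critical direction \<open>(\<delta>u, \<delta>\<tau>)\<close> that is tangent to all nearly active control constraints, the
  second-order increments of the cost and of \<open>g(x(\<tau>))\<close> over the admissible second-order corrections form a
  convex set in the plane. By optimality it misses the open negative quadrant, and a separating line gives
  \<open>\<alpha>, \<gamma> \<ge> 0\<close> with \<open>\<alpha> + \<gamma> = 1\<close>. Expressing the separation by the costate shows that \<open>\<nabla>\<^sub>u H\<close> is, up to a
  sign, a nonnegative combination of the active constraint gradients. The coefficients are the multiplier
  \<open>\<nu>\<close>, bounded by the qualification condition, and the separation inequality becomes \<open>\<Omega> \<ge> 0\<close>.

  Since \<open>(\<alpha>, \<gamma>)\<close> lives on a segment, general critical directions follow by approximation and compactness.\<close>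

subsection \<open>Absolutely continuous functions\<close>

text \<open>The control constraints hold pointwise on a continuum of times, and this shapes the
  construction. A constraint slightly below zero is inactive, yet a perturbation of fixed size may
  violate it. Directions are therefore tangent to every constraint above a level
  \<open>- \<kappa>\<close>, and second-order corrections leave a uniform slack \<theta>; letting
  \<kappa> and \<theta> tend to 0 afterwards restores complementarity and removes the slack. The
  qualification condition is uniform in time, so the projection onto the span of the nearly active
  gradients is explicit, measurable and bounded. The same projection produces the corrections, the
  multiplier \<nu> and the approximation of square-integrable directions.

  With an equality at the crossing, competitors would have to be corrected by an implicit function
  argument. With an inequality a strict decrease to second order is enough, separation takes place
  in the plane, and \<alpha> + \<gamma> = 1 alone excludes the trivial multiplier.

  Trajectories are absolutely continuous with derivatives almost everywhere, while all estimates
  work with integral equations; the general results on integrals translate between the two.\<close>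

lemma AE_lebesgue_on_iff_negligible:
  fixes S :: "'a::euclidean_space set"
  assumes "S \<in> sets lebesgue"
  shows "(AE t in lebesgue_on S. P t) \<longleftrightarrow> (\<exists>N. negligible N \<and> (\<forall>t\<in>S - N. P t))"
proof -
  have "(AE t in lebesgue_on S. P t) \<longleftrightarrow> (AE t in lebesgue. t \<in> S \<longrightarrow> P t)"
    using assms by (intro AE_restrict_space_iff) auto
  also have "\<dots> \<longleftrightarrow> (\<exists>N. negligible N \<and> (\<forall>t\<in>S - N. P t))"
  proof
    assume "AE t in lebesgue. t \<in> S \<longrightarrow> P t"
    then obtain N where "{t \<in> space lebesgue. \<not> (t \<in> S \<longrightarrow> P t)} \<subseteq> N" "N \<in> null_sets lebesgue"
      unfolding eventually_ae_filter by auto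
    then show "\<exists>N. negligible N \<and> (\<forall>t\<in>S - N. P t)"
      by (intro exI[of _ N]) (auto simp: negligible_iff_null_sets)
  next
    assume "\<exists>N. negligible N \<and> (\<forall>t\<in>S - N. P t)"
    then obtain N where "negligible N" "\<forall>t\<in>S - N. P t" by blast
    then show "AE t in lebesgue. t \<in> S \<longrightarrow> P t"
      by (intro AE_I'[of N]) (auto simp: negligible_iff_null_sets)
  qed
  finally show ?thesis .
qed

text \<open>The functions constructed below have bounded derivatives, so apart from restriction this
  is the only source of absolute continuity.\<close>

lemma lipschitz_imp_absolutely_continuous_on:
  assumes lip: "\<And>s t. s \<in> S \<Longrightarrow> t \<in> S \<Longrightarrow> s \<le> t \<Longrightarrow> norm (x t - x s) \<le> L * (t - s)"
  shows "absolutely_continuous_on S x"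
  unfolding absolutely_continuous_on_def
proof (intro allI impI)
  fix \<epsilon> :: real assume "\<epsilon> > 0"
  define M where "M = \<bar>L\<bar> + 1"
  have "M > 0" "L \<le> M" by (auto simp: M_def)
  show "\<exists>\<delta>>0. \<forall>D. finite D \<longrightarrow> (\<forall>(a, b)\<in>D. a \<le> b \<and> {a..b} \<subseteq> S) \<longrightarrow>
        pairwise (\<lambda>(a, b) (a', b'). {a<..<b} \<inter> {a'<..<b'} = {}) D \<longrightarrow>
        (\<Sum>(a, b)\<in>D. b - a) < \<delta> \<longrightarrow> (\<Sum>(a, b)\<in>D. norm (x b - x a)) < \<epsilon>"
  proof (intro exI[of _ "\<epsilon> / M"] conjI allI impI)
    show "0 < \<epsilon> / M" using \<open>\<epsilon> > 0\<close> \<open>M > 0\<close> by simp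
    fix D assume D: "\<forall>(a, b)\<in>D. a \<le> b \<and> {a..b} \<subseteq> S" and s: "(\<Sum>(a, b)\<in>D. b - a) < \<epsilon> / M"
    have "(\<Sum>(a, b)\<in>D. norm (x b - x a)) \<le> (\<Sum>(a, b)\<in>D. M * (b - a))"
    proof (rule sum_mono, clarify)
      fix a b assume "(a, b) \<in> D"
      with D have ab: "a \<le> b" "a \<in> S" "b \<in> S" by fastforce+
      then have "norm (x b - x a) \<le> L * (b - a)" by (intro lip)
      also have "\<dots> \<le> M * (b - a)" using \<open>L \<le> M\<close> ab by (intro mult_right_mono) auto
      finally show "norm (x b - x a) \<le> M * (b - a)" .
    qed
    also have "\<dots> = M * (\<Sum>(a, b)\<in>D. b - a)" by (simp add: sum_distrib_left case_prod_unfold)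
    also have "\<dots> < \<epsilon>" using s \<open>M > 0\<close> by (simp add: field_simps)
    finally show "(\<Sum>(a, b)\<in>D. norm (x b - x a)) < \<epsilon>" .
  qed
qed

lemma absolutely_continuous_onE:
  assumes "absolutely_continuous_on S x" "\<epsilon> > 0"
  obtains \<delta> where "\<delta> > 0" "\<And>D. finite D \<Longrightarrow> (\<forall>(a, b)\<in>D. a \<le> b \<and> {a..b} \<subseteq> S) \<Longrightarrow>
        pairwise (\<lambda>(a, b) (a', b'). {a<..<b} \<inter> {a'<..<b'} = {}) D \<Longrightarrow>
        (\<Sum>(a, b)\<in>D. b - a) < \<delta> \<Longrightarrow> (\<Sum>(a, b)\<in>D. norm (x b - x a)) < \<epsilon>"
proof -
  from assms(1)[unfolded absolutely_continuous_on_def, rule_format, OF assms(2)]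
  obtain \<delta> where "\<delta> > 0" and *: "\<forall>D. finite D \<longrightarrow> (\<forall>(a, b)\<in>D. a \<le> b \<and> {a..b} \<subseteq> S) \<longrightarrow>
        pairwise (\<lambda>(a, b) (a', b'). {a<..<b} \<inter> {a'<..<b'} = {}) D \<longrightarrow>
        (\<Sum>(a, b)\<in>D. b - a) < \<delta> \<longrightarrow> (\<Sum>(a, b)\<in>D. norm (x b - x a)) < \<epsilon>"
    by (elim exE conjE) blast
  show ?thesis
    by (rule that[OF \<open>\<delta> > 0\<close>]) (rule *[THEN spec, THEN mp, THEN mp, THEN mp, THEN mp])
qed

lemma absolutely_continuous_on_subset:
  assumes "absolutely_continuous_on S x" "R \<subseteq> S"
  shows "absolutely_continuous_on R x"
  unfolding absolutely_continuous_on_def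
proof (intro allI impI)
  fix \<epsilon> :: real assume "\<epsilon> > 0"
  then obtain \<delta> where "\<delta> > 0" and \<delta>: "\<And>D. finite D \<Longrightarrow> (\<forall>(a, b)\<in>D. a \<le> b \<and> {a..b} \<subseteq> S) \<Longrightarrow>
        pairwise (\<lambda>(a, b) (a', b'). {a<..<b} \<inter> {a'<..<b'} = {}) D \<Longrightarrow>
        (\<Sum>(a, b)\<in>D. b - a) < \<delta> \<Longrightarrow> (\<Sum>(a, b)\<in>D. norm (x b - x a)) < \<epsilon>"
    using absolutely_continuous_onE[OF assms(1) \<open>\<epsilon> > 0\<close>] by blast
  show "\<exists>\<delta>>0. \<forall>D. finite D \<longrightarrow> (\<forall>(a, b)\<in>D. a \<le> b \<and> {a..b} \<subseteq> R) \<longrightarrow>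
        pairwise (\<lambda>(a, b) (a', b'). {a<..<b} \<inter> {a'<..<b'} = {}) D \<longrightarrow>
        (\<Sum>(a, b)\<in>D. b - a) < \<delta> \<longrightarrow> (\<Sum>(a, b)\<in>D. norm (x b - x a)) < \<epsilon>"
  proof (intro exI[of _ \<delta>] conjI allI impI)
    fix D assume "finite D" "\<forall>(a, b)\<in>D. a \<le> b \<and> {a..b} \<subseteq> R"
      "pairwise (\<lambda>(a, b) (a', b'). {a<..<b} \<inter> {a'<..<b'} = {}) D" "(\<Sum>(a, b)\<in>D. b - a) < \<delta>"
    moreover from this(2) have "\<forall>(a, b)\<in>D. a \<le> b \<and> {a..b} \<subseteq> S" using assms(2) by blast
    ultimately show "(\<Sum>(a, b)\<in>D. norm (x b - x a)) < \<epsilon>" by (intro \<delta>)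
  qed fact
qed

text \<open>Differentiability controls the intervals tagged outside \<open>N\<close>. The gauge
  forces the intervals tagged in \<open>N\<close> into an open set \<open>W\<close> of small
  measure, where absolute continuity bounds the total increment of \<open>f\<close>. Integrability
  of the derivative is part of the conclusion.\<close>

theorem fundamental_theorem_of_calculus_absolutely_continuous:
  fixes f :: "real \<Rightarrow> 'a::banach"
  assumes "a \<le> b" and ac: "absolutely_continuous_on {a..b} f" and N: "negligible N"
    and vecd: "\<And>t. t \<in> {a..b} - N \<Longrightarrow> (f has_vector_derivative f' t) (at t within {a..b})"
  shows "(f' has_integral (f b - f a)) {a..b}"
proof (cases "a = b")
  case True
  then show ?thesis by (simp add: has_integral_refl)
next
  case False
  with \<open>a \<le> b\<close> have "a < b" by simp
  \<comment> \<open>\<open>f'\<close> is arbitrary on \<open>N\<close>. With the value 0 there, a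
    tag in \<open>N\<close> contributes only the increment of \<open>f\<close>.\<close>
  define g where "g t = (if t \<in> N then 0 else f' t)" for t
  have "(g has_integral (f b - f a)) {a..b}"
    unfolding has_integral_factor_content box_real[symmetric]
  proof safe
    fix e :: real
    assume e: "e > 0"
    show "\<exists>d. gauge d \<and> (\<forall>p. p tagged_division_of (cbox a b) \<and> d fine p \<longrightarrow>
      norm ((\<Sum>(x, k)\<in>p. measure lborel k *\<^sub>R g x) - (f b - f a)) \<le> e * measure lborel (cbox a b))"
    proof -
      \<comment> \<open>Half of the error is spent on tags outside \<open>N\<close>, the other half
        on tags inside.\<close>
      define e1 where "e1 = e / 2"
      define e2 where "e2 = e1 * (b - a)"
      have "e1 > 0" "e2 > 0" using e \<open>a < b\<close> by (auto simp: e1_def e2_def)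
      have "\<forall>x. \<exists>d>0. x \<in> {a..b} - N \<longrightarrow>
             (\<forall>y\<in>{a..b}. norm (y-x) < d \<longrightarrow> norm (f y - f x - (y-x) *\<^sub>R f' x) \<le> e1 * norm (y-x))"
        using vecd[unfolded has_vector_derivative_def has_derivative_within_alt] \<open>e1 > 0\<close>
        by (metis zero_less_one)
      from choice[OF this] obtain d where "\<forall>x. 0 < d x \<and> (x \<in> {a..b} - N \<longrightarrow>
             (\<forall>y\<in>{a..b}. norm (y-x) < d x \<longrightarrow> norm (f y - f x - (y-x) *\<^sub>R f' x) \<le> e1 * norm (y-x)))"
        by blast
      then have d: "\<And>x. 0 < d x"
        "\<And>x y. \<lbrakk>x \<in> {a..b} - N; y \<in> {a..b}; norm (y-x) < d x\<rbrakk>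
               \<Longrightarrow> norm (f y - f x - (y-x) *\<^sub>R f' x) \<le> e1 * norm (y-x)"
        by blast+
      obtain \<delta> where "\<delta> > 0" and \<delta>: "\<And>D. finite D \<Longrightarrow> (\<forall>(u, v)\<in>D. u \<le> v \<and> {u..v} \<subseteq> {a..b}) \<Longrightarrow>
          pairwise (\<lambda>(u, v) (u', v'). {u<..<v} \<inter> {u'<..<v'} = {}) D \<Longrightarrow>
          (\<Sum>(u, v)\<in>D. v - u) < \<delta> \<Longrightarrow> (\<Sum>(u, v)\<in>D. norm (f v - f u)) < e2"
        using absolutely_continuous_onE[OF ac \<open>e2 > 0\<close>] by blast
      have Nl: "N \<in> sets lebesgue" using N by (simp add: negligible_imp_sets)
      from sets_lebesgue_outer_open[OF Nl \<open>\<delta> > 0\<close>]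
      obtain W where W: "open W" "N \<subseteq> W" "W - N \<in> lmeasurable" "emeasure lebesgue (W - N) < ennreal \<delta>" by metis
      have Wl: "W \<in> lmeasurable"
        by (metis Diff_partition N W(2,3) fmeasurable.Un negligible_iff_measure)
      have Wm: "measure lebesgue W < \<delta>"
      proof -
        have "measure lebesgue W = measure lebesgue (W - N)"
          using N Wl by (simp add: measure_Diff_null_set negligible_iff_null_sets fmeasurableD)
        also have "\<dots> < \<delta>" using W(3,4) \<open>\<delta> > 0\<close>
          by (metis emeasure_eq_measure2 ennreal_less_iff measure_nonneg)
        finally show ?thesis .
      qed
      have "\<forall>x. \<exists>r>0. x \<in> N \<longrightarrow> ball x r \<subseteq> W"
        using W(1,2) by (metis open_contains_ball subsetD zero_less_one)
      then obtain r where r: "\<And>x. 0 < r x" "\<And>x. x \<in> N \<Longrightarrow> ball x (r x) \<subseteq> W" by metis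
      define \<gamma> where "\<gamma> x = ball x (if x \<in> N then r x else d x)" for x
      show ?thesis
      proof (intro exI[of _ \<gamma>] conjI allI impI; (elim conjE)?)
        show "gauge \<gamma>" unfolding \<gamma>_def
          by (rule gauge_ball_dependent) (auto simp: r d)
        fix p assume ptag: "p tagged_division_of cbox a b" and finep: "\<gamma> fine p"
        have fin: "finite p" using ptag by blast
        have ba: "b - a = (\<Sum>(x,K)\<in>p. Sup K - Inf K)" "f b - f a = (\<Sum>(x,K)\<in>p. f(Sup K) - f(Inf K))"
          using additive_tagged_division_1[where f= "\<lambda>x. x"] additive_tagged_division_1[where f= f]
            \<open>a \<le> b\<close> ptag by auto
        have K: "\<exists>u v. K = {u..v} \<and> u \<le> x \<and> x \<le> v \<and> Inf K = u \<and> Sup K = v \<and> a \<le> u \<and> v \<le> b \<and> measure lborel K = v - u"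
          if xK: "(x, K) \<in> p" for x K
        proof -
          have "x \<in> K" "K \<subseteq> cbox a b" using ptag xK by blast+
          moreover obtain u v where "K = cbox u v" using tagged_division_ofD(4)[OF ptag xK] by blast
          ultimately show ?thesis by (intro exI[of _ u] exI[of _ v]) auto
        qed
        \<comment> \<open>Degenerate intervals contribute nothing and are dropped. Without them
          distinct tagged intervals have distinct endpoint pairs, as required when a family is
          encoded by the set of these pairs.\<close>
        define q where "q = {(x, K) \<in> p. x \<in> N \<and> Inf K < Sup K}"
        have qp: "q \<subseteq> p" by (auto simp: q_def)
        have finq: "finite q" using fin qp by (rule finite_subset[rotated])
        define D where "D = (\<lambda>(x, K). (Inf K, Sup K)) ` q"
        have disj: "{Inf K<..<Sup K} \<inter> {Inf K'<..<Sup K'} = {}" if "(x, K) \<in> p" "(x', K') \<in> p" "(x, K) \<noteq> (x', K')" for x K x' K'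
        proof -
          have "interior K \<inter> interior K' = {}" using ptag that by blast
          moreover have "interior K = {Inf K<..<Sup K}" "interior K' = {Inf K'<..<Sup K'}"
            using K[OF that(1)] K[OF that(2)] by (metis interior_atLeastAtMost_real)+
          ultimately show ?thesis by simp
        qed
        have inj: "inj_on (\<lambda>(x, K). (Inf K, Sup K)) q"
        proof (rule inj_onI, clarify)
          fix x K x' K' assume *: "(x, K) \<in> q" "(x', K') \<in> q" "Inf K = Inf K'" "Sup K = Sup K'"
          show "x = x' \<and> K = K'"
          proof (rule ccontr)
            assume "\<not> (x = x' \<and> K = K')"
            then have "{Inf K<..<Sup K} \<inter> {Inf K'<..<Sup K'} = {}"
              using * qp by (intro disj[of x K x' K']) auto
            with * show False by (auto simp: q_def)
          qed
        qed
        have sumD: "(\<Sum>(u, v)\<in>D. h u v) = (\<Sum>(x, K)\<in>q. h (Inf K) (Sup K))" for h :: "real \<Rightarrow> real \<Rightarrow> real"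
          unfolding D_def by (subst sum.reindex[OF inj]) (auto intro!: sum.cong)
        have smallN: "(\<Sum>(x, K)\<in>q. norm (f (Sup K) - f (Inf K))) < e2"
        proof -
          have "(\<Sum>(u, v)\<in>D. norm (f v - f u)) < e2"
          proof (rule \<delta>)
            show "finite D" using finq by (simp add: D_def)
            show "\<forall>(u, v)\<in>D. u \<le> v \<and> {u..v} \<subseteq> {a..b}"
              using K qp by (fastforce simp: D_def)
            show "pairwise (\<lambda>(u, v) (u', v'). {u<..<v} \<inter> {u'<..<v'} = {}) D"
              unfolding pairwise_def
            proof (intro ballI impI)
              fix X Y assume XY: "X \<in> D" "Y \<in> D" "X \<noteq> Y"
              then obtain x K x' K' where *: "(x, K) \<in> q" "X = (Inf K, Sup K)" "(x', K') \<in> q" "Y = (Inf K', Sup K')"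
                by (auto simp: D_def)
              with XY qp have "{Inf K<..<Sup K} \<inter> {Inf K'<..<Sup K'} = {}"
                by (intro disj[of x K x' K']) auto
              then show "(\<lambda>(u, v) (u', v'). {u<..<v} \<inter> {u'<..<v'} = {}) X Y"
                using * by simp
            qed
            define J where "J = (\<lambda>z :: real \<times> real set. {Inf (snd z)<..<Sup (snd z)} :: real set)"
            have "measure lebesgue (\<Union>(J ` q)) = (\<Sum>z\<in>q. measure lebesgue (J z))"
            proof (rule measure_finite_Union[OF finq])
              show "disjoint_family_on J q"
                unfolding disjoint_family_on_def J_def using disj qp by fastforce
            qed (auto simp: J_def q_def)
            also have "\<dots> = (\<Sum>(x, K)\<in>q. Sup K - Inf K)"
              by (intro sum.cong) (auto simp: J_def q_def)
            finally have "(\<Sum>(u, v)\<in>D. v - u) = measure lebesgue (\<Union>(J ` q))"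
              by (simp add: sumD)
            also have "\<dots> \<le> measure lebesgue W"
            proof (rule measure_mono_fmeasurable[OF _ _ Wl])
              show "\<Union>(J ` q) \<subseteq> W"
              proof
                fix y assume "y \<in> \<Union>(J ` q)"
                then obtain x K' where *: "(x, K') \<in> p" "y \<in> {Inf K'<..<Sup K'}" "x \<in> N"
                  by (auto simp: J_def q_def)
                from K[OF *(1)] have "K' = {Inf K'..Sup K'}" by metis
                with *(2) have "y \<in> K'" by (metis atLeastAtMost_iff greaterThanLessThan_iff less_imp_le)
                moreover have "K' \<subseteq> \<gamma> x" using finep *(1) by (auto simp: fine_def)
                ultimately show "y \<in> W" using *(3) r(2)[of x] by (auto simp: \<gamma>_def)
              qed
              show "\<Union>(J ` q) \<in> sets lebesgue"
                using finq by (intro sets.finite_Union) (auto simp: J_def)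
            qed
            also have "\<dots> < \<delta>" by (fact Wm)
            finally show "(\<Sum>(u, v)\<in>D. v - u) < \<delta>" .
          qed
          then show ?thesis by (simp add: sumD)
        qed
        have "norm ((\<Sum>(x, k)\<in>p. measure lborel k *\<^sub>R g x) - (f b - f a))
              = norm (\<Sum>(x, K)\<in>p. measure lborel K *\<^sub>R g x - (f (Sup K) - f (Inf K)))"
          by (simp add: ba sum_subtractf case_prod_unfold)
        also have "\<dots> \<le> (\<Sum>(x, K)\<in>p. e1 * (Sup K - Inf K) +
             (if (x, K) \<in> q then norm (f (Sup K) - f (Inf K)) else 0))"
        proof (rule sum_norm_le, clarify)
          fix x K assume xK: "(x, K) \<in> p"
          from K[OF xK] obtain u v where k: "K = {u..v}" "u \<le> x" "x \<le> v" "Inf K = u" "Sup K = v"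
            "a \<le> u" "v \<le> b" "measure lborel K = v - u" by blast
          show "norm (measure lborel K *\<^sub>R g x - (f (Sup K) - f (Inf K))) \<le> e1 * (Sup K - Inf K) +
             (if (x, K) \<in> q then norm (f (Sup K) - f (Inf K)) else 0)"
          proof (cases "x \<in> N")
            case True
            then show ?thesis using \<open>e1 > 0\<close> k xK
              by (cases "u = v") (auto simp: g_def q_def norm_minus_commute)
          next
            case False
            have "K \<subseteq> \<gamma> x" using finep xK by (auto simp: fine_def)
            with False have sub: "K \<subseteq> ball x (d x)" by (simp add: \<gamma>_def)
            have "norm ((v - u) *\<^sub>R f' x - (f v - f u)) = norm (f u - f x - (u - x) *\<^sub>R f' x - (f v - f x - (v - x) *\<^sub>R f' x))"
              by (auto simp: algebra_simps)
            also have "\<dots> \<le> norm (f u - f x - (u - x) *\<^sub>R f' x) + norm (f v - f x - (v - x) *\<^sub>R f' x)"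
              by (rule norm_triangle_ineq4)
            also have "\<dots> \<le> e1 * norm (u - x) + e1 * norm (v - x)"
            proof (rule add_mono)
              have "u \<in> K" "v \<in> K" using k by auto
              with sub have "u \<in> ball x (d x)" "v \<in> ball x (d x)" by blast+
              then show "norm (f u - f x - (u - x) *\<^sub>R f' x) \<le> e1 * norm (u - x)"
                "norm (f v - f x - (v - x) *\<^sub>R f' x) \<le> e1 * norm (v - x)"
                using d(2)[of x u] d(2)[of x v] False k by (auto simp: dist_real_def)
            qed
            also have "\<dots> = e1 * (v - u)" using k by (simp add: algebra_simps)
            finally show ?thesis using False k by (simp add: g_def q_def)
          qed
        qed
        also have "\<dots> = e1 * (b - a) + (\<Sum>(x, K)\<in>p. if (x, K) \<in> q then norm (f (Sup K) - f (Inf K)) else 0)"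
          by (simp add: ba(1) sum.distrib sum_distrib_left case_prod_unfold)
        also have "(\<Sum>(x, K)\<in>p. if (x, K) \<in> q then norm (f (Sup K) - f (Inf K)) else 0) = (\<Sum>(x, K)\<in>q. norm (f (Sup K) - f (Inf K)))"
          using qp fin by (intro sum.mono_neutral_cong_right) auto
        also have "e1 * (b - a) + (\<Sum>(x, K)\<in>q. norm (f (Sup K) - f (Inf K))) \<le> e1 * (b - a) + e2"
          using smallN by simp
        also have "\<dots> = e * measure lborel (cbox a b)" using \<open>a < b\<close> by (simp add: e2_def e1_def algebra_simps)
        finally show "norm ((\<Sum>(x, k)\<in>p. measure lborel k *\<^sub>R g x) - (f b - f a)) \<le> e * measure lborel (cbox a b)" .
      qed
    qed
  qed
  then show ?thesis
    by (rule has_integral_spike[OF N, rotated]) (auto simp: g_def)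
qed

subsection \<open>Caratheodory equations and Taylor expansions\<close>

lemma bounded_measurable_absolutely_integrable:
  fixes h :: "real \<Rightarrow> 'a::euclidean_space"
  assumes "h \<in> borel_measurable (lebesgue_on {a..b})" "\<And>t. t \<in> {a..b} \<Longrightarrow> norm (h t) \<le> B"
  shows "h absolutely_integrable_on {a..b}"
  by (rule measurable_bounded_by_integrable_imp_absolutely_integrable[where g = "\<lambda>_. B"])
     (use assms in auto)

lemma has_integral_flip:
  fixes h :: "real \<Rightarrow> 'a::banach"
  assumes "(h has_integral I) {c..d}"
  shows "((\<lambda>s. h (k - s)) has_integral I) {k - d..k - c}"
proof -
  have "((\<lambda>x. h (- x)) has_integral I) {- d..- c}"
    using assms by (subst has_integral_reflect_real) auto
  from has_integral_shift_real_ivl[OF this, of "- k"] show ?thesis by (simp add: algebra_simps)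
qed

text \<open>Right difference quotients converge outside a null set. Applied to the reflected
  function, the same fact gives the left quotients, outside the reflection of another null
  set.\<close>

lemma indefinite_integral_AE_has_vector_derivative:
  fixes h :: "real \<Rightarrow> 'a::euclidean_space"
  assumes h: "h integrable_on {a..b}"
  shows "\<exists>N. negligible N \<and> (\<forall>t\<in>{a<..<b} - N. ((\<lambda>t. integral {a..t} h) has_vector_derivative h t) (at t))"
proof -
  \<comment> \<open>Extension by zero makes the function integrable on every interval, which the
    convergence of the quotients asks for.\<close>
  define F where "F x = (if x \<in> {a..b} then h x else 0)" for x
  have F: "F integrable_on UNIV" unfolding F_def integrable_restrict_UNIV by (rule h)
  have FI: "F integrable_on {c..d}" for c d using integrable_on_subinterval[OF F] by simp
  have FR: "(\<lambda>x. F (- x)) integrable_on {c..d}" for c d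
    using FI[of "-d" "-c"] Henstock_Kurzweil_Integration.integrable_reflect_real[where f = F and a = "-d" and b = "-c"] by simp
  obtain N1 where N1: "negligible N1" and N1d: "\<And>x e. x \<notin> N1 \<Longrightarrow> 0 < e \<Longrightarrow>
      \<exists>d>0. \<forall>k. 0 < k \<and> k < d \<longrightarrow> norm (integral {x..x + k} F /\<^sub>R k - F x) < e"
    using integrable_ccontinuous_explicit[of F] FI by auto
  obtain N2 where N2: "negligible N2" and N2d: "\<And>x e. x \<notin> N2 \<Longrightarrow> 0 < e \<Longrightarrow>
      \<exists>d>0. \<forall>k. 0 < k \<and> k < d \<longrightarrow> norm (integral {x..x + k} (\<lambda>x. F (- x)) /\<^sub>R k - F (- x)) < e"
    using integrable_ccontinuous_explicit[of "\<lambda>x. F (- x)"] FR by auto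
  have N2': "negligible (uminus ` N2)"
    by (rule negligible_differentiable_image_negligible[OF order_refl N2]) (intro derivative_intros)
  show ?thesis
  proof (intro exI[of _ "N1 \<union> uminus ` N2"] conjI ballI)
    show "negligible (N1 \<union> uminus ` N2)" using N1 N2' by simp
    fix t assume t: "t \<in> {a<..<b} - (N1 \<union> uminus ` N2)"
    then have t1: "t \<notin> N1" by simp
    from t have t2: "- t \<notin> N2" by (metis Diff_iff UnI2 image_eqI minus_minus)
    show "((\<lambda>t. integral {a..t} h) has_vector_derivative h t) (at t)"
      unfolding has_vector_derivative_def has_derivative_at_alt
    proof (intro conjI allI impI)
      show "bounded_linear (\<lambda>x. x *\<^sub>R h t)" by (rule bounded_linear_scaleR_left)
      fix e :: real assume "e > 0"
      obtain d1 where d1: "d1 > 0" "\<And>k. 0 < k \<Longrightarrow> k < d1 \<Longrightarrow> norm (integral {t..t + k} F /\<^sub>R k - F t) < e"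
        using N1d[OF t1 \<open>e > 0\<close>] by blast
      obtain d2 where d2: "d2 > 0" "\<And>k. 0 < k \<Longrightarrow> k < d2 \<Longrightarrow> norm (integral {-t..-t + k} (\<lambda>x. F (- x)) /\<^sub>R k - F t) < e"
        using N2d[OF t2 \<open>e > 0\<close>] by auto
      define d where "d = Min {d1, d2, t - a, b - t}"
      have d: "d > 0" "d \<le> d1" "d \<le> d2" "d \<le> t - a" "d \<le> b - t" using t d1(1) d2(1) by (auto simp: d_def)
      have Ft: "F t = h t" using t by (auto simp: F_def)
      have hF: "integral {u..v} h = integral {u..v} F" if "a \<le> u" "v \<le> b" for u v
        by (rule integral_cong) (use that in \<open>auto simp: F_def\<close>)
      have hint: "h integrable_on {a..v}" if "v \<le> b" for v
        by (rule integrable_on_subinterval[OF h]) (use that in auto)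
      show "\<exists>d>0. \<forall>y. norm (y - t) < d \<longrightarrow>
          norm (integral {a..y} h - integral {a..t} h - (y - t) *\<^sub>R h t) \<le> e * norm (y - t)"
      proof (intro exI[of _ d] conjI allI impI)
        fix y assume y: "norm (y - t) < d"
        consider "y = t" | "y > t" | "y < t" by linarith
        then show "norm (integral {a..y} h - integral {a..t} h - (y - t) *\<^sub>R h t) \<le> e * norm (y - t)"
        proof cases
          case 1 then show ?thesis by simp
        next
          case 2
          define k where "k = y - t"
          have k: "0 < k" "k < d1" "y = t + k" "k < d" using 2 y d by (auto simp: k_def)
          have "integral {a..t} h + integral {t..y} h = integral {a..y} h"
            by (rule Henstock_Kurzweil_Integration.integral_combine) (use t k d in \<open>auto intro!: hint\<close>)
          then have "integral {a..y} h - integral {a..t} h = integral {t..t + k} F"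
            using hF[of t y] t k d by (auto simp: algebra_simps)
          moreover have "norm (integral {t..t + k} F /\<^sub>R k - F t) < e" by (rule d1) (use k in auto)
          moreover have "norm (integral {t..t + k} F - k *\<^sub>R h t) = k * norm (integral {t..t + k} F /\<^sub>R k - F t)"
          proof -
            have "integral {t..t + k} F - k *\<^sub>R h t = k *\<^sub>R (integral {t..t + k} F /\<^sub>R k - F t)"
              using k by (simp add: Ft scaleR_diff_right)
            then show ?thesis using k by simp
          qed
          ultimately show ?thesis using k by (simp add: mult.commute)
        next
          case 3
          define k where "k = t - y"
          have k: "0 < k" "k < d2" "y = t - k" "k < d" using 3 y d by (auto simp: k_def)
          have "integral {a..y} h + integral {y..t} h = integral {a..t} h"
            by (rule Henstock_Kurzweil_Integration.integral_combine) (use t k d in \<open>auto intro!: hint\<close>)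
          moreover have "integral {y..t} F = integral {-t..-t + k} (\<lambda>x. F (- x))"
            using k Henstock_Kurzweil_Integration.integral_reflect_real[where f = F and a = y and b = t] by simp
          ultimately have "integral {a..y} h - integral {a..t} h = - integral {-t..-t + k} (\<lambda>x. F (- x))"
            using hF[of y t] t k d by (auto simp: algebra_simps)
          moreover have "norm (integral {-t..-t + k} (\<lambda>x. F (- x)) /\<^sub>R k - F t) < e" by (rule d2) (use k in auto)
          moreover have "norm (- integral {-t..-t + k} (\<lambda>x. F (- x)) - (- k) *\<^sub>R h t) = k * norm (integral {-t..-t + k} (\<lambda>x. F (- x)) /\<^sub>R k - F t)"
          proof -
            have "- integral {-t..-t + k} (\<lambda>x. F (- x)) - (- k) *\<^sub>R h t = - (k *\<^sub>R (integral {-t..-t + k} (\<lambda>x. F (- x)) /\<^sub>R k - F t))"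
              using k by (simp add: Ft scaleR_diff_right)
            then show ?thesis using k by (metis abs_of_pos norm_minus_cancel norm_scaleR)
          qed
          ultimately show ?thesis using k by (simp add: mult.commute)
        qed
      qed (fact d)
    qed
  qed
qed

text \<open>The integral inequality makes \<open>w\<close>, the right-hand side damped by the
  exponential, nonincreasing, and \<open>w a = A\<close>.\<close>

lemma gronwall:
  fixes z :: "real \<Rightarrow> real"
  assumes z: "continuous_on {a..b} z" and "L \<ge> 0"
    and le: "\<And>t. t \<in> {a..b} \<Longrightarrow> z t \<le> A + L * integral {a..t} z"
    and t: "t \<in> {a..b}"
  shows "z t \<le> A * exp (L * (t - a))"
proof -
  define w where "w s = exp (- L * (s - a)) * (A + L * integral {a..s} z)" for s
  have I: "((\<lambda>s. integral {a..s} z) has_field_derivative z s) (at s)" if "s \<in> {a<..<b}" for s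
    using integral_has_vector_derivative[OF z, of s] that
    by (simp add: has_real_derivative_iff_has_vector_derivative at_within_Icc_at)
  have "w t \<le> w a"
  proof (rule DERIV_nonpos_imp_decreasing_open[where f = w and a = a and b = t])
    show "a \<le> t" using t by simp
    fix s assume s: "a < s" "s < t"
    have "(w has_field_derivative (exp (- L * (s - a)) * (L * z s) + exp (- L * (s - a)) * (- L) * (A + L * integral {a..s} z))) (at s)"
      unfolding w_def using s t by (auto intro!: derivative_eq_intros I)
    moreover have "exp (- L * (s - a)) * (L * z s) + exp (- L * (s - a)) * (- L) * (A + L * integral {a..s} z)
        = exp (- L * (s - a)) * (L * (z s - (A + L * integral {a..s} z)))" by (simp add: algebra_simps)
    moreover have "L * (z s - (A + L * integral {a..s} z)) \<le> 0"
      using le[of s] s t \<open>L \<ge> 0\<close> by (intro mult_nonneg_nonpos) auto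
    ultimately show "\<exists>y. (w has_field_derivative y) (at s) \<and> y \<le> 0"
      by (metis exp_ge_zero mult_nonneg_nonpos)
  next
    have "continuous_on {a..b} (\<lambda>s. integral {a..s} z)"
      using integrable_continuous_real[OF z] by (rule indefinite_integral_continuous_1)
    then show "continuous_on {a..t} w"
      unfolding w_def using t by (intro continuous_intros) (auto intro: continuous_on_subset)
  qed
  moreover have "w a = A" by (simp add: w_def)
  ultimately have "exp (- (L * (t - a))) * (A + L * integral {a..t} z) \<le> A" by (simp add: w_def)
  then have "exp (L * (t - a)) * (exp (- (L * (t - a))) * (A + L * integral {a..t} z)) \<le> exp (L * (t - a)) * A"
    by (intro mult_left_mono) auto
  then have "A + L * integral {a..t} z \<le> A * exp (L * (t - a))"
    by (simp add: mult.assoc[symmetric] exp_minus_inverse mult.commute)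
  with le[OF t] show ?thesis by linarith
qed

text \<open>Time reversal. Costates are prescribed at the right end, so their uniqueness needs this
  direction.\<close>

lemma gronwall_backward:
  fixes z :: "real \<Rightarrow> real"
  assumes z: "continuous_on {a..b} z" and "L \<ge> 0"
    and le: "\<And>t. t \<in> {a..b} \<Longrightarrow> z t \<le> A + L * integral {t..b} z"
    and t: "t \<in> {a..b}"
  shows "z t \<le> A * exp (L * (b - t))"
proof -
  have "z (a + b - s) \<le> A * exp (L * (s - a))" if s: "s \<in> {a..b}" for s
  proof (rule gronwall[where b = b])
    show "continuous_on {a..b} (\<lambda>s. z (a + b - s))"
      by (rule continuous_on_compose2[OF z]) (auto intro!: continuous_intros)
    fix r assume r: "r \<in> {a..b}"
    have "z integrable_on {a + b - r..b}"
      using integrable_continuous_real[OF z] by (rule integrable_on_subinterval) (use r in auto)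
    then have "integral {a..r} (\<lambda>s. z (a + b - s)) = integral {a + b - r..b} z"
      using has_integral_flip[of z "integral {a + b - r..b} z" "a + b - r" b "a + b"]
      by (intro integral_unique) auto
    with le[of "a + b - r"] r show "z (a + b - r) \<le> A + L * integral {a..r} (\<lambda>s. z (a + b - s))" by simp
  qed (use s \<open>L \<ge> 0\<close> in auto)
  from this[of "a + b - t"] t show ?thesis by simp
qed

text \<open>Picard iteration as a single contraction on the whole interval: the exponential weight
  with rate \<mu> brings the contraction constant down to 1/2, so nothing has to be continued from
  short intervals. The unknown of the fixed point problem is the solution divided by the weight.
  Assuming integrability along continuous curves replaces joint conditions on
  \<open>h\<close>.\<close>

theorem caratheodory_existence:
  fixes h :: "real \<Rightarrow> 'a::euclidean_space \<Rightarrow> 'a"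
  assumes ab: "a \<le> b"
    and int: "\<And>y. continuous_on {a..b} y \<Longrightarrow> (\<lambda>t. h t (y t)) integrable_on {a..b}"
    and lip: "\<And>t y z. t \<in> {a..b} \<Longrightarrow> norm (h t y - h t z) \<le> L * norm (y - z)"
  shows "\<exists>x. continuous_on {a..b} x \<and> (\<forall>t\<in>{a..b}. ((\<lambda>s. h s (x s)) has_integral (x t - x0)) {a..t})"
proof -
  define M where "M = \<bar>L\<bar>"
  have M: "M \<ge> 0" "L \<le> M" by (auto simp: M_def)
  \<comment> \<open>The factor 2 yields the contraction constant 1/2; the summand 1 keeps \<mu>
    positive when \<open>M\<close> is 0.\<close>
  define \<mu> where "\<mu> = 2 * M + 1"
  have \<mu>: "\<mu> > 0" "M / \<mu> \<le> 1/2" using M by (auto simp: \<mu>_def field_simps)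
  define G where "G y s = h s (exp (\<mu> * (s - a)) *\<^sub>R y s)" for y s
  define F where "F y t = exp (- \<mu> * (t - a)) *\<^sub>R (x0 + integral {a..t} (G y))" for y t
  have Gint: "G y integrable_on {a..b}" if "continuous_on {a..b} y" for y
    unfolding G_def by (intro int continuous_intros that)
  have Gint': "G y integrable_on {a..t}" if "continuous_on {a..b} y" "t \<le> b" for y t
    using Gint[OF that(1)] by (rule integrable_on_subinterval) (use that in auto)
  \<comment> \<open>The complete space is that of bounded continuous functions on the line;
    \<open>clamp\<close> extends a function on \<open>{a..b}\<close> by its boundary values.\<close>
  have "\<exists>g :: real \<Rightarrow>\<^sub>C 'a. \<forall>t. g t = F (apply_bcontfun y) (clamp a b t)" for y :: "real \<Rightarrow>\<^sub>C 'a"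
  proof -
    have "continuous_on {a..b} (apply_bcontfun y)" by simp
    from indefinite_integral_continuous_1[OF Gint[OF this]]
    have "continuous_on (cbox a b) (F (apply_bcontfun y))"
      unfolding F_def by (simp, intro continuous_intros)
    then obtain g :: "real \<Rightarrow>\<^sub>C 'a" where "\<And>x. g x = F (apply_bcontfun y) (clamp a b x)"
      by (rule continuous_on_cbox_bcontfunE) blast
    then show ?thesis by blast
  qed
  then obtain P :: "(real \<Rightarrow>\<^sub>C 'a) \<Rightarrow> (real \<Rightarrow>\<^sub>C 'a)" where P: "\<And>y t. P y t = F (apply_bcontfun y) (clamp a b t)"
    by metis
  have "\<exists>!y. P y = y"
  proof (rule banach_fix_type)
    show "0 \<le> (1/2::real)" "1/2 < (1::real)" by auto
    show "\<forall>y z. dist (P y) (P z) \<le> 1/2 * dist y z"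
    proof (intro allI)
      fix y z :: "real \<Rightarrow>\<^sub>C 'a"
      define D where "D = dist y z"
      have D: "D \<ge> 0" "\<And>s. norm (y s - z s) \<le> D"
        using dist_bounded[of y _ z] by (auto simp: D_def dist_norm)
      have "norm (F y t - F z t) \<le> 1/2 * D" if t: "t \<in> {a..b}" for t
      proof -
        define E where "E s = (M * D) * exp (\<mu> * (s - a))" for s
        have cy: "continuous_on {a..b} (apply_bcontfun y)" "continuous_on {a..b} (apply_bcontfun z)" by simp_all
        have iy: "G y integrable_on {a..t}" "G z integrable_on {a..t}" using Gint' cy t by auto
        have Ei: "(E has_integral (M * D / \<mu> * exp (\<mu> * (t - a)) - M * D / \<mu> * exp (\<mu> * (a - a)))) {a..t}"
          unfolding E_def using t \<mu>
          by (intro fundamental_theorem_of_calculus)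
             (auto intro!: derivative_eq_intros simp flip: has_real_derivative_iff_has_vector_derivative)
        have "norm (integral {a..t} (G y) - integral {a..t} (G z)) = norm (integral {a..t} (\<lambda>s. G y s - G z s))"
          using iy by (simp add: Henstock_Kurzweil_Integration.integral_diff)
        also have "\<dots> \<le> integral {a..t} E"
        proof (rule integral_norm_bound_integral)
          show "(\<lambda>s. G y s - G z s) integrable_on {a..t}" using iy by (rule integrable_diff)
          show "E integrable_on {a..t}" using Ei by blast
          fix s assume s: "s \<in> {a..t}"
          have "norm (G y s - G z s) \<le> L * norm (exp (\<mu> * (s - a)) *\<^sub>R y s - exp (\<mu> * (s - a)) *\<^sub>R z s)"
            unfolding G_def by (rule lip) (use s t in auto)
          also have "\<dots> \<le> M * norm (exp (\<mu> * (s - a)) *\<^sub>R y s - exp (\<mu> * (s - a)) *\<^sub>R z s)"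
            using M by (intro mult_right_mono) auto
          also have "\<dots> = M * exp (\<mu> * (s - a)) * norm (y s - z s)"
            by (simp flip: scaleR_diff_right)
          also have "\<dots> \<le> M * exp (\<mu> * (s - a)) * D"
            using D M by (intro mult_left_mono) auto
          finally show "norm (G y s - G z s) \<le> E s" by (simp add: E_def mult_ac)
        qed
        also have "\<dots> = M * D / \<mu> * exp (\<mu> * (t - a)) - M * D / \<mu>"
          using integral_unique[OF Ei] by simp
        also have "\<dots> \<le> (M / \<mu>) * D * exp (\<mu> * (t - a))" using M D \<mu> by simp
        also have "\<dots> \<le> (1/2) * D * exp (\<mu> * (t - a))"
          using D \<mu> by (intro mult_right_mono) auto
        finally have "norm (integral {a..t} (G y) - integral {a..t} (G z)) \<le> (1/2) * D * exp (\<mu> * (t - a))" .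
        moreover have "F y t - F z t = exp (- \<mu> * (t - a)) *\<^sub>R (integral {a..t} (G y) - integral {a..t} (G z))"
          by (simp add: F_def algebra_simps)
        ultimately have "norm (F y t - F z t) \<le> exp (- \<mu> * (t - a)) * ((1/2) * D * exp (\<mu> * (t - a)))"
          by simp
        also have "\<dots> = 1/2 * D" by (simp add: exp_minus)
        finally show ?thesis .
      qed
      then have "dist (P y) (P z) \<le> 1/2 * D"
        by (intro dist_bound) (use ab clamp_in_interval[of a b] in \<open>auto simp: P dist_norm\<close>)
      then show "dist (P y) (P z) \<le> 1/2 * dist y z" by (simp add: D_def)
    qed
  qed
  then obtain y where y: "P y = y" by blast
  define x where "x t = exp (\<mu> * (t - a)) *\<^sub>R y t" for t
  have cy: "continuous_on {a..b} (apply_bcontfun y)" by simp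
  have xt: "x t = x0 + integral {a..t} (\<lambda>s. h s (x s))" if t: "t \<in> {a..b}" for t
  proof -
    have "y t = F y t" using P[of y t] y t by (simp add: clamp_cancel_cbox)
    moreover have "G y = (\<lambda>s. h s (x s))" by (simp add: G_def x_def fun_eq_iff)
    ultimately show ?thesis by (simp add: x_def F_def exp_minus)
  qed
  show ?thesis
  proof (intro exI[of _ x] conjI ballI)
    show "continuous_on {a..b} x" unfolding x_def by (intro continuous_intros cy)
    then have "(\<lambda>s. h s (x s)) integrable_on {a..b}" by (rule int)
    then have "(\<lambda>s. h s (x s)) integrable_on {a..t}" if "t \<in> {a..b}" for t
      by (rule integrable_on_subinterval) (use that in auto)
    then show "((\<lambda>s. h s (x s)) has_integral (x t - x0)) {a..t}" if "t \<in> {a..b}" for t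
      using xt[OF that] that by (simp add: has_integral_iff)
  qed
qed

text \<open>Reflection of the interval at its midpoint, which changes the sign of the right-hand
  side.\<close>

corollary caratheodory_existence_backward:
  fixes h :: "real \<Rightarrow> 'a::euclidean_space \<Rightarrow> 'a"
  assumes ab: "a \<le> b"
    and int: "\<And>y. continuous_on {a..b} y \<Longrightarrow> (\<lambda>t. h t (y t)) integrable_on {a..b}"
    and lip: "\<And>t y z. t \<in> {a..b} \<Longrightarrow> norm (h t y - h t z) \<le> L * norm (y - z)"
  shows "\<exists>x. continuous_on {a..b} x \<and> (\<forall>t\<in>{a..b}. ((\<lambda>s. h s (x s)) has_integral (x1 - x t)) {t..b})"
proof -
  have flip: "continuous_on {a..b} (\<lambda>t. y (a + b - t))" if "continuous_on {a..b} y" for y :: "real \<Rightarrow> 'a"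
    by (rule continuous_on_compose2[OF that]) (auto intro!: continuous_intros)
  have "\<exists>x. continuous_on {a..b} x \<and> (\<forall>t\<in>{a..b}. ((\<lambda>s. - h (a + b - s) (x s)) has_integral (x t - x1)) {a..t})"
  proof (rule caratheodory_existence[OF ab])
    fix y :: "real \<Rightarrow> 'a" assume "continuous_on {a..b} y"
    from int[OF flip[OF this]] have "(\<lambda>t. h t (y (a + b - t))) integrable_on {a..b}" .
    then have "((\<lambda>t. h t (y (a + b - t))) has_integral integral {a..b} (\<lambda>t. h t (y (a + b - t)))) {a..b}" by blast
    from has_integral_flip[OF this, of "a + b"]
    have "((\<lambda>t. h (a + b - t) (y t)) has_integral integral {a..b} (\<lambda>t. h t (y (a + b - t)))) {a..b}" by simp
    then have "(\<lambda>t. h (a + b - t) (y t)) integrable_on {a..b}" by blast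
    then show "(\<lambda>t. - h (a + b - t) (y t)) integrable_on {a..b}" by (rule integrable_neg)
  next
    fix t y z assume "t \<in> {a..b}"
    then show "norm (- h (a + b - t) y - - h (a + b - t) z) \<le> L * norm (y - z)"
      using lip[of "a + b - t" y z] by (simp add: norm_minus_commute)
  qed
  then obtain x where cx: "continuous_on {a..b} x"
    and x: "\<And>t. t\<in>{a..b} \<Longrightarrow> ((\<lambda>s. - h (a + b - s) (x s)) has_integral (x t - x1)) {a..t}" by blast
  show ?thesis
  proof (intro exI[of _ "\<lambda>t. x (a + b - t)"] conjI ballI)
    show "continuous_on {a..b} (\<lambda>t. x (a + b - t))" by (rule flip[OF cx])
    fix t assume "t \<in> {a..b}"
    then have "((\<lambda>s. - h (a + b - s) (x s)) has_integral (x (a + b - t) - x1)) {a..a + b - t}" by (intro x) auto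
    from has_integral_neg[OF has_integral_flip[OF this, of "a + b"]]
    show "((\<lambda>s. h s (x (a + b - s))) has_integral (x1 - x (a + b - t))) {t..b}" by simp
  qed
qed

lemma blinfun_quadratic_bound:
  fixes B :: "'a::real_normed_vector \<Rightarrow>\<^sub>L 'a \<Rightarrow>\<^sub>L 'b::real_normed_vector"
  shows "norm (B h k) \<le> norm B * norm h * norm k"
  by (meson norm_blinfun mult_right_mono norm_ge_zero order_trans)

text \<open>The mean value inequality is used twice along the segment, for \<open>F'\<close> minus
  its linear part and then for \<open>F\<close> minus its quadratic part. Only the oscillation
  \<omega> of \<open>F''\<close> on the segment enters the bound.\<close>

lemma second_order_taylor_segment:
  fixes F :: "'a::real_normed_vector \<Rightarrow> 'b::banach"
    and F' :: "'a \<Rightarrow> 'a \<Rightarrow>\<^sub>L 'b" and F'' :: "'a \<Rightarrow> 'a \<Rightarrow>\<^sub>L 'a \<Rightarrow>\<^sub>L 'b"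
  assumes F': "\<And>z. (F has_derivative F' z) (at z)" and F'': "\<And>z. (F' has_derivative F'' z) (at z)"
    and \<omega>: "\<And>r. r \<in> {0..1} \<Longrightarrow> norm (F'' (z + r *\<^sub>R k) - F'' z) \<le> \<omega>"
  shows "norm (F (z + k) - F z - F' z k - (1/2) *\<^sub>R F'' z k k) \<le> \<omega> * (norm k)\<^sup>2"
proof -
  have seg: "((\<lambda>r. z + r *\<^sub>R k) has_derivative (\<lambda>r. r *\<^sub>R k)) (at r within {0..1})" for r
    by (auto intro!: derivative_eq_intros)
  have b1: "norm (F' (z + r *\<^sub>R k) - F' z - r *\<^sub>R F'' z k) \<le> \<omega> * norm k" if r: "r \<in> {0..1}" for r
  proof -
    define \<Psi> where "\<Psi> r = F' (z + r *\<^sub>R k) - r *\<^sub>R F'' z k" for r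
    have d: "(\<Psi> has_derivative (\<lambda>q. q *\<^sub>R ((F'' (z + s *\<^sub>R k) - F'' z) k))) (at s within {0..1})" if "s \<in> {0..1}" for s
      unfolding \<Psi>_def
      by (rule derivative_eq_intros has_derivative_compose[OF seg F''] refl)+
         (auto simp: algebra_simps blinfun.bilinear_simps)
    have "norm (\<Psi> r - \<Psi> 0) \<le> \<omega> * norm k * norm (r - 0)"
    proof (rule differentiable_bound[OF _ d])
      fix s :: real assume s: "s \<in> {0..1}"
      show "onorm (\<lambda>q. q *\<^sub>R ((F'' (z + s *\<^sub>R k) - F'' z) k)) \<le> \<omega> * norm k"
      proof (rule onorm_le)
        fix q :: real
        have "norm ((F'' (z + s *\<^sub>R k) - F'' z) k) \<le> norm (F'' (z + s *\<^sub>R k) - F'' z) * norm k" by (rule norm_blinfun)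
        also have "\<dots> \<le> \<omega> * norm k" using \<omega>[OF s] by (intro mult_right_mono) auto
        finally show "norm (q *\<^sub>R ((F'' (z + s *\<^sub>R k) - F'' z) k)) \<le> \<omega> * norm k * norm q"
          by (simp add: mult.commute mult_left_mono)
      qed
    qed (use r in auto)
    also have "\<dots> \<le> \<omega> * norm k * 1"
      using r order_trans[OF norm_ge_zero \<omega>[OF r]] by (intro mult_left_mono) auto
    finally show ?thesis by (simp add: \<Psi>_def algebra_simps)
  qed
  define \<Phi> where "\<Phi> r = F (z + r *\<^sub>R k) - r *\<^sub>R F' z k - (r\<^sup>2/2) *\<^sub>R F'' z k k" for r
  have d: "(\<Phi> has_derivative (\<lambda>q. q *\<^sub>R ((F' (z + s *\<^sub>R k) - F' z - s *\<^sub>R F'' z k) k))) (at s within {0..1})" for s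
    unfolding \<Phi>_def
    by (rule derivative_eq_intros has_derivative_compose[OF seg F'] refl)+
       (auto simp: algebra_simps blinfun.bilinear_simps)
  have "norm (\<Phi> 1 - \<Phi> 0) \<le> \<omega> * norm k * norm k * norm (1 - 0 :: real)"
  proof (rule differentiable_bound[OF _ d])
    fix s :: real assume s: "s \<in> {0..1}"
    show "onorm (\<lambda>q. q *\<^sub>R ((F' (z + s *\<^sub>R k) - F' z - s *\<^sub>R F'' z k) k)) \<le> \<omega> * norm k * norm k"
    proof (rule onorm_le)
      fix q :: real
      have "norm ((F' (z + s *\<^sub>R k) - F' z - s *\<^sub>R F'' z k) k) \<le> norm (F' (z + s *\<^sub>R k) - F' z - s *\<^sub>R F'' z k) * norm k"
        by (rule norm_blinfun)
      also have "\<dots> \<le> \<omega> * norm k * norm k" using b1[OF s] by (intro mult_right_mono) auto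
      finally show "norm (q *\<^sub>R ((F' (z + s *\<^sub>R k) - F' z - s *\<^sub>R F'' z k) k)) \<le> \<omega> * norm k * norm k * norm q"
        by (simp add: mult.commute mult_left_mono)
    qed
  qed auto
  then show ?thesis by (simp add: \<Phi>_def power2_eq_square algebra_simps)
qed

text \<open>The increment consists of a first-order direction \<open>a\<close> and a second-order
  correction \<open>b\<close>, so \<open>b\<close> is felt at order \<open>s\<^sup>2\<close> only
  through \<open>F'\<close>. Uniformity in \<open>z\<close>, \<open>a\<close>, \<open>b\<close>
  allows the expansion to be used at all instants of a bounded trajectory simultaneously.\<close>

lemma second_order_taylor_uniform:
  fixes F :: "'a::euclidean_space \<Rightarrow> 'b::banach"
    and F' :: "'a \<Rightarrow> 'a \<Rightarrow>\<^sub>L 'b" and F'' :: "'a \<Rightarrow> 'a \<Rightarrow>\<^sub>L 'a \<Rightarrow>\<^sub>L 'b"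
  assumes F': "\<And>z. (F has_derivative F' z) (at z)" and F'': "\<And>z. (F' has_derivative F'' z) (at z)"
    and cont: "continuous_on UNIV F''" and "M \<ge> 0" and "e > 0"
  shows "\<exists>s0>0. \<forall>s. \<forall>z a b :: 'a. 0 < s \<and> s \<le> s0 \<and> norm z \<le> M \<and> norm a \<le> M \<and> norm b \<le> M \<longrightarrow>
    norm (F (z + s *\<^sub>R a + s\<^sup>2 *\<^sub>R b) - F z - s *\<^sub>R F' z a - s\<^sup>2 *\<^sub>R (F' z b + (1/2) *\<^sub>R F'' z a a)) \<le> e * s\<^sup>2"
proof -
  have "compact (F'' ` cball 0 M)"
    by (intro compact_continuous_image continuous_on_subset[OF cont]) auto
  then obtain C where C: "C > 0" "\<And>z. norm z \<le> M \<Longrightarrow> norm (F'' z) \<le> C"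
    using bounded_pos[of "F'' ` cball 0 M"] by (auto simp: compact_imp_bounded)
  \<comment> \<open>The increment \<open>k\<close> has norm at most \<open>(2 * M + 1) * s\<close>,
    so the Taylor remainder uses half of \<open>e * s\<^sup>2\<close>. The other half pays for
    replacing \<open>k\<close> by \<open>s *\<^sub>R a\<close> in the quadratic term.\<close>
  define \<omega> where "\<omega> = e / (2 * (2 * M + 1)\<^sup>2)"
  have "\<omega> > 0" using \<open>M \<ge> 0\<close> \<open>e > 0\<close> by (simp add: \<omega>_def)
  have "uniformly_continuous_on (cball 0 (3 * M + 1)) F''"
    by (intro compact_uniformly_continuous continuous_on_subset[OF cont]) auto
  then obtain d where d: "d > 0" "\<And>y z. y \<in> cball 0 (3 * M + 1) \<Longrightarrow> z \<in> cball 0 (3 * M + 1) \<Longrightarrow> dist y z < d \<Longrightarrow> dist (F'' y) (F'' z) < \<omega>"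
    unfolding uniformly_continuous_on_def using \<open>\<omega> > 0\<close> by metis
  \<comment> \<open>The second entry keeps the increment below the modulus \<open>d\<close> of
    uniform continuity; the third absorbs the terms of order 3 and 4 in \<open>s\<close> that
    involve \<open>b\<close>.\<close>
  define s0 where "s0 = Min {1, d / (2 * M + 1), e / (3 * C * (M\<^sup>2 + 1))}"
  have pos: "2 * M + 1 > 0" "3 * C * (M\<^sup>2 + 1) > 0" using \<open>M \<ge> 0\<close> C by (auto intro!: mult_pos_pos add_nonneg_pos)
  have s0: "s0 > 0" "s0 \<le> 1" "s0 \<le> d / (2 * M + 1)" "s0 \<le> e / (3 * C * (M\<^sup>2 + 1))"
    using d(1) \<open>e > 0\<close> pos by (auto simp: s0_def)
  show ?thesis
  proof (intro exI[of _ s0] conjI allI impI, fact s0(1), elim conjE)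
    fix s :: real and z a b :: 'a assume s: "0 < s" "s \<le> s0" and z: "norm z \<le> M" and a: "norm a \<le> M" and b: "norm b \<le> M"
    define k where "k = s *\<^sub>R a + s\<^sup>2 *\<^sub>R b"
    have s1: "s \<le> 1" using s s0 by simp
    have s2: "s\<^sup>2 \<le> s" using s s1 by (simp add: power2_eq_square mult_left_le_one_le)
    have "norm k \<le> s * norm a + s\<^sup>2 * norm b"
      unfolding k_def using norm_triangle_ineq[of "s *\<^sub>R a" "s\<^sup>2 *\<^sub>R b"] s by simp
    also have "\<dots> \<le> s * M + s * M" using s s2 a b by (intro add_mono mult_mono) auto
    finally have k: "norm k \<le> 2 * M * s" by simp
    have "2 * M * s \<le> 2 * M * s0" using s \<open>M \<ge> 0\<close> by (intro mult_left_mono) auto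
    also have "\<dots> < (2 * M + 1) * s0" using s0(1) by (simp add: algebra_simps)
    also have "(2 * M + 1) * s0 \<le> d" using s0(3) pos by (simp add: field_simps)
    finally have kd: "norm k < d" using k by simp
    have kM: "norm k \<le> 2 * M" using k s1 s \<open>M \<ge> 0\<close> by (smt (verit) mult_left_le mult_nonneg_nonneg)
    have "norm (F (z + k) - F z - F' z k - (1/2) *\<^sub>R F'' z k k) \<le> \<omega> * (norm k)\<^sup>2"
    proof (rule second_order_taylor_segment[OF F' F''])
      fix r :: real assume r: "r \<in> {0..1}"
      have rk: "norm (r *\<^sub>R k) \<le> norm k" using r by (simp add: mult_left_le_one_le)
      have "norm (z + r *\<^sub>R k) \<le> 3 * M + 1" using norm_triangle_ineq[of z "r *\<^sub>R k"] rk kM z by linarith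
      moreover have "norm z \<le> 3 * M + 1" using z \<open>M \<ge> 0\<close> by linarith
      moreover have "dist (z + r *\<^sub>R k) z < d" using rk kd by (simp add: dist_norm)
      ultimately show "norm (F'' (z + r *\<^sub>R k) - F'' z) \<le> \<omega>"
        using d(2)[of "z + r *\<^sub>R k" z] by (metis less_imp_le mem_cball_0 dist_norm)
    qed
    also have "\<dots> \<le> \<omega> * ((2 * M + 1) * s)\<^sup>2"
      using k s \<open>\<omega> > 0\<close> by (intro mult_left_mono power_mono) (auto simp: algebra_simps)
    also have "\<dots> = (e / 2) * s\<^sup>2" using pos by (simp add: \<omega>_def power_mult_distrib)
    finally have 1: "norm (F (z + k) - F z - F' z k - (1/2) *\<^sub>R F'' z k k) \<le> (e / 2) * s\<^sup>2" .
    have B: "norm (F'' z u v) \<le> C * M * M" if "norm u \<le> M" "norm v \<le> M" for u v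
      by (rule order_trans[OF blinfun_quadratic_bound])
         (use C(2)[OF z] C(1) that \<open>M \<ge> 0\<close> in \<open>auto intro!: mult_mono\<close>)
    have "norm ((1/2) *\<^sub>R F'' z k k - (s\<^sup>2/2) *\<^sub>R F'' z a a)
        = norm ((s^3/2) *\<^sub>R (F'' z a b + F'' z b a) + (s^4/2) *\<^sub>R F'' z b b)"
      by (rule arg_cong[of _ _ norm])
         (simp add: k_def blinfun.bilinear_simps algebra_simps power2_eq_square power3_eq_cube power4_eq_xxxx)
    also have "\<dots> \<le> norm ((s^3/2) *\<^sub>R (F'' z a b + F'' z b a)) + norm ((s^4/2) *\<^sub>R F'' z b b)"
      by (rule norm_triangle_ineq)
    also have "\<dots> \<le> (s^3/2) * (C * M * M + C * M * M) + (s^4/2) * (C * M * M)"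
      using s B[OF a b] B[OF b a] B[OF b b] norm_triangle_ineq[of "F'' z a b" "F'' z b a"]
      by (intro add_mono) (auto intro!: mult_left_mono)
    also have "\<dots> \<le> (s^3/2) * (C * M * M + C * M * M) + (s^3/2) * (C * M * M)"
      using s s1 C \<open>M \<ge> 0\<close> by (intro add_left_mono mult_right_mono) (auto simp: power_decreasing)
    also have "\<dots> = s\<^sup>2 * ((3/2) * C * M\<^sup>2 * s)" by (simp add: power2_eq_square power3_eq_cube algebra_simps)
    also have "\<dots> \<le> s\<^sup>2 * (e / 2)"
    proof (rule mult_left_mono)
      have "3 * C * M\<^sup>2 * s \<le> 3 * C * (M\<^sup>2 + 1) * s0"
        using s C by (intro mult_mono) auto
      also have "\<dots> \<le> e" using s0(4) pos by (simp add: pos_le_divide_eq mult.commute)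
      finally show "(3/2) * C * M\<^sup>2 * s \<le> e / 2" by (simp add: mult_ac)
    qed simp
    finally have 2: "norm ((1/2) *\<^sub>R F'' z k k - (s\<^sup>2/2) *\<^sub>R F'' z a a) \<le> (e/2) * s\<^sup>2" by (simp only: mult.commute)
    have "F (z + s *\<^sub>R a + s\<^sup>2 *\<^sub>R b) - F z - s *\<^sub>R F' z a - s\<^sup>2 *\<^sub>R (F' z b + (1/2) *\<^sub>R F'' z a a)
      = (F (z + k) - F z - F' z k - (1/2) *\<^sub>R F'' z k k) + ((1/2) *\<^sub>R F'' z k k - (s\<^sup>2/2) *\<^sub>R F'' z a a)"
      by (simp add: k_def blinfun.bilinear_simps algebra_simps)
    also have "norm \<dots> \<le> (e / 2) * s\<^sup>2 + (e/2) * s\<^sup>2"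
      using 1 2 by (rule norm_triangle_mono)
    finally show "norm (F (z + s *\<^sub>R a + s\<^sup>2 *\<^sub>R b) - F z - s *\<^sub>R F' z a - s\<^sup>2 *\<^sub>R (F' z b + (1/2) *\<^sub>R F'' z a a)) \<le> e * s\<^sup>2"
      by simp
  qed
qed

subsection \<open>Adjoints and Gram systems\<close>

text \<open>The transpose of \<open>A\<close>, written in coordinates so that its continuity in
  \<open>A\<close> and \<open>y\<close> is immediate. For real-valued maps its value at 1 is the
  gradient vector.\<close>

definition blinfun_adj :: "('a::euclidean_space \<Rightarrow>\<^sub>L 'b::euclidean_space) \<Rightarrow> 'b \<Rightarrow> 'a" where
  "blinfun_adj A y = (\<Sum>e\<in>Basis. (A e \<bullet> y) *\<^sub>R e)"

lemma blinfun_adj_inner: "blinfun_adj A y \<bullet> h = y \<bullet> A h"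
proof -
  have "A h = A (\<Sum>e\<in>Basis. (h \<bullet> e) *\<^sub>R e)" by (simp add: euclidean_representation)
  also have "\<dots> = (\<Sum>e\<in>Basis. (h \<bullet> e) *\<^sub>R A e)" by (simp add: blinfun.bilinear_simps)
  finally show ?thesis
    by (simp add: blinfun_adj_def inner_sum_left inner_sum_right inner_commute mult.commute)
qed

lemma continuous_on_blinfun_adj [continuous_intros]:
  "continuous_on S A \<Longrightarrow> continuous_on S y \<Longrightarrow> continuous_on S (\<lambda>s. blinfun_adj (A s) (y s))"
  unfolding blinfun_adj_def by (intro continuous_intros)

lemma blinfun_adj_add: "blinfun_adj A (y + z) = blinfun_adj A y + blinfun_adj A z"
  and blinfun_adj_scaleR: "blinfun_adj A (r *\<^sub>R y) = r *\<^sub>R blinfun_adj A y"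
  by (simp_all add: blinfun_adj_def inner_right_distrib scaleR_left_distrib sum.distrib scaleR_sum_right)

lemma norm_blinfun_adj: "norm (blinfun_adj A y) \<le> norm A * norm y"
proof (cases "blinfun_adj A y = 0")
  case False
  have "(norm (blinfun_adj A y))\<^sup>2 = y \<bullet> A (blinfun_adj A y)"
    by (simp add: power2_norm_eq_inner blinfun_adj_inner)
  also have "\<dots> \<le> norm y * (norm A * norm (blinfun_adj A y))"
    by (rule order_trans[OF norm_cauchy_schwarz mult_left_mono]) (auto simp: norm_blinfun)
  finally have "(norm (blinfun_adj A y))\<^sup>2 \<le> norm A * norm y * norm (blinfun_adj A y)" by (simp add: mult_ac)
  then show ?thesis using False by (simp add: power2_eq_square)
qed simp

text \<open>\<open>grad\<close> is a definite description, so evaluating it requires uniqueness of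
  the representing vector as well.\<close>

lemma grad_eq_blinfun_adj:
  fixes F :: "'a::euclidean_space \<Rightarrow> real" and A :: "'a \<Rightarrow>\<^sub>L real"
  assumes "(F has_derivative A) (at z)"
  shows "grad F z = blinfun_adj A 1"
  unfolding grad_def
proof (rule the_equality)
  have "(\<lambda>h. h \<bullet> blinfun_adj A 1) = A"
    by (auto simp: fun_eq_iff inner_commute[of _ "blinfun_adj A 1"] blinfun_adj_inner)
  then show "GDERIV F z :> blinfun_adj A 1" using assms by (simp add: gderiv_def)
  fix D assume "GDERIV F z :> D"
  then have "(\<lambda>h. h \<bullet> D) = A" unfolding gderiv_def using assms by (rule has_derivative_unique)
  then have "h \<bullet> D = h \<bullet> blinfun_adj A 1" for h
    by (metis blinfun_adj_inner inner_commute inner_real_def mult_1)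
  then show "D = blinfun_adj A 1" by (metis vector_eq_ldot)
qed

lemma deriv1_eq: "(F has_derivative A) (at z) \<Longrightarrow> deriv1 F z h = A h"
  using frechet_derivative_at[of F A z] by simp

lemma deriv2_eq:
  fixes F :: "'a::real_normed_vector \<Rightarrow> 'b::real_normed_vector" and F' :: "'a \<Rightarrow> 'a \<Rightarrow>\<^sub>L 'b"
  assumes "\<And>w. (F has_derivative F' w) (at w)" "(F' has_derivative A) (at z)"
  shows "deriv2 F z h k = A h k"
proof -
  have "(\<lambda>w. deriv1 F w k) = (\<lambda>w. F' w k)" using deriv1_eq[OF assms(1)] by simp
  moreover have "((\<lambda>w. F' w k) has_derivative (\<lambda>h. A h k)) (at z)"
    using bounded_linear.has_derivative[OF blinfun.bounded_linear_left assms(2)] .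
  ultimately show ?thesis unfolding deriv2_def by (simp add: deriv1_eq)
qed

text \<open>Completing the Gram matrix of the vectors in \<open>I\<close> by the identity fixes its
  size, although \<open>I\<close> will vary with time, and leaves its determinant unchanged.\<close>

definition gram :: "('l::finite \<Rightarrow> 'v::real_inner) \<Rightarrow> 'l set \<Rightarrow> real^'l^'l" where
  "gram b I = (\<chi> i j. if i \<in> I \<and> j \<in> I then b i \<bullet> b j else if i = j then 1 else 0)"

text \<open>By Cramer's rule, \<open>dual_coef b I w\<close> solves the Gram system on \<open>I\<close>, so that
  \<open>\<Sum>i. dual_coef b I w $ i *\<^sub>R b i\<close> has inner product \<open>w $ i\<close> with \<open>b i\<close> for \<open>i \<in> I\<close>. The explicit
  formula makes the dependence on the data measurable.\<close>

definition dual_coef :: "('l::finite \<Rightarrow> 'v::real_inner) \<Rightarrow> 'l set \<Rightarrow> real^'l \<Rightarrow> real^'l" where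
  "dual_coef b I w = (\<chi> k. det (\<chi> i j. if j = k then (if i \<in> I then w $ i else 0) else gram b I $ i $ j) / det (gram b I))"

definition lin_comb :: "('l::finite \<Rightarrow> 'v::real_vector) \<Rightarrow> real^'l \<Rightarrow> 'v" where
  "lin_comb b \<xi> = (\<Sum>i\<in>UNIV. \<xi> $ i *\<^sub>R b i)"

lemma lin_comb_diff: "lin_comb b (\<xi> - \<zeta>) = lin_comb b \<xi> - lin_comb b \<zeta>"
  by (simp add: lin_comb_def scaleR_left_diff_distrib sum_subtractf)

lemma inner_lin_comb: "lin_comb b \<xi> \<bullet> h = (\<Sum>i\<in>UNIV. \<xi> $ i * (b i \<bullet> h))"
  by (simp add: lin_comb_def inner_sum_left)

lemma gram_mult: "(gram b I *v \<xi>) $ i = (if i \<in> I then b i \<bullet> (\<Sum>j\<in>I. \<xi> $ j *\<^sub>R b j) else \<xi> $ i)"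
proof (cases "i \<in> I")
  case True
  have "(gram b I *v \<xi>) $ i = (\<Sum>j\<in>UNIV. if j \<in> I then b i \<bullet> b j * \<xi> $ j else 0)"
    using True by (auto simp: matrix_vector_mult_def gram_def intro!: sum.cong)
  also have "\<dots> = (\<Sum>j\<in>I. b i \<bullet> b j * \<xi> $ j)"
    by (subst sum.inter_restrict[symmetric]) auto
  finally show ?thesis using True by (simp add: inner_sum_right mult.commute)
next
  case False
  have "(gram b I *v \<xi>) $ i = (\<Sum>j\<in>UNIV. (if i = j then 1 else 0) * \<xi> $ j)"
    using False by (simp add: matrix_vector_mult_def gram_def)
  also have "\<dots> = (\<Sum>j\<in>UNIV. if j = i then \<xi> $ j else 0)" by (rule sum.cong) auto
  finally have "(gram b I *v \<xi>) $ i = (\<Sum>j\<in>UNIV. if j = i then \<xi> $ j else 0)" .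
  then show ?thesis using False by simp
qed

context
  fixes b :: "'l::finite \<Rightarrow> 'v::real_inner" and I :: "'l set" and \<epsilon> :: real
  assumes \<epsilon>: "\<epsilon> > 0"
    and qual: "\<And>\<xi> :: real^'l. (\<And>i. i \<notin> I \<Longrightarrow> \<xi> $ i = 0) \<Longrightarrow> \<epsilon> * norm \<xi> \<le> norm (lin_comb b \<xi>)"
begin

lemma lin_comb_restrict:
  assumes "\<And>i. i \<notin> I \<Longrightarrow> \<xi> $ i = 0"
  shows "(\<Sum>j\<in>I. \<xi> $ j *\<^sub>R b j) = lin_comb b \<xi>"
  unfolding lin_comb_def using assms by (intro sum.mono_neutral_left) auto

lemma lin_comb_inj:
  assumes "\<And>i. i \<notin> I \<Longrightarrow> \<xi> $ i = 0" "\<And>i. i \<notin> I \<Longrightarrow> \<zeta> $ i = 0" "lin_comb b \<xi> = lin_comb b \<zeta>"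
  shows "\<xi> = \<zeta>"
proof -
  have "\<epsilon> * norm (\<xi> - \<zeta>) \<le> norm (lin_comb b (\<xi> - \<zeta>))" by (rule qual) (use assms in auto)
  then have "\<epsilon> * norm (\<xi> - \<zeta>) \<le> 0" using assms(3) by (simp add: lin_comb_diff)
  then show ?thesis using \<epsilon> by (simp add: mult_le_0_iff)
qed

text \<open>A kernel vector vanishes outside \<open>I\<close> because of the identity block, and its
  linear combination is orthogonal to all \<open>b i\<close> with \<open>i\<close> in
  \<open>I\<close>, hence to itself. The qualification inequality then gives injectivity.\<close>

lemma det_gram_nonzero: "det (gram b I) \<noteq> 0"
proof -
  have "\<xi> = 0" if "gram b I *v \<xi> = 0" for \<xi>
  proof -
    have out: "\<xi> $ i = 0" if "i \<notin> I" for i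
      using gram_mult[of b I \<xi> i] \<open>gram b I *v \<xi> = 0\<close> that by simp
    have "b i \<bullet> lin_comb b \<xi> = 0" if "i \<in> I" for i
      using gram_mult[of b I \<xi> i] \<open>gram b I *v \<xi> = 0\<close> that lin_comb_restrict[OF out] by simp
    then have "lin_comb b \<xi> \<bullet> lin_comb b \<xi> = 0"
      using out by (auto simp: inner_lin_comb intro!: sum.neutral) (metis mult_eq_0_iff)
    then have "lin_comb b \<xi> = lin_comb b 0" by (simp add: lin_comb_def)
    then show ?thesis using out by (intro lin_comb_inj) auto
  qed
  then show ?thesis
    by (metis invertible_det_nz invertible_left_inverse matrix_left_invertible_ker)
qed

lemma gram_dual_coef: "gram b I *v dual_coef b I w = (\<chi> i. if i \<in> I then w $ i else 0)"
proof -
  have "dual_coef b I w = (\<chi> k. det (\<chi> i j. if j = k then (\<chi> i. if i \<in> I then w $ i else 0) $ i else gram b I $ i $ j) / det (gram b I))"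
    unfolding dual_coef_def by (simp cong: if_cong)
  then show ?thesis by (subst cramer[OF det_gram_nonzero])
qed

lemma dual_coef_outside: "i \<notin> I \<Longrightarrow> dual_coef b I w $ i = 0"
  using gram_mult[of b I "dual_coef b I w" i] by (simp add: gram_dual_coef)

lemma dual_coef_inside: "i \<in> I \<Longrightarrow> b i \<bullet> lin_comb b (dual_coef b I w) = w $ i"
  using gram_mult[of b I "dual_coef b I w" i] lin_comb_restrict[OF dual_coef_outside, of w]
  by (simp add: gram_dual_coef)

text \<open>This identity reduces both norm bounds below to the Cauchy-Schwarz inequality.\<close>

lemma inner_lin_comb_dual_coef:
  "lin_comb b (dual_coef b I v) \<bullet> lin_comb b (dual_coef b I w) = dual_coef b I v \<bullet> w"
  unfolding inner_lin_comb inner_vec_def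
proof (rule sum.cong[OF refl])
  fix i show "dual_coef b I v $ i * (b i \<bullet> lin_comb b (dual_coef b I w)) = dual_coef b I v $ i \<bullet> w $ i"
    by (cases "i \<in> I") (simp_all add: dual_coef_inside dual_coef_outside)
qed

text \<open>By qualification \<open>\<epsilon>\<^sup>2\<close> times the squared norm of the
  coefficients is at most the squared norm of their combination, which equals
  \<open>dual_coef b I w \<bullet> w\<close>. The constant depends on \<epsilon> only, hence will be
  uniform in time.\<close>

lemma norm_dual_coef: "norm (dual_coef b I w) \<le> norm w / \<epsilon>\<^sup>2"
proof (cases "dual_coef b I w = 0")
  case True then show ?thesis using \<epsilon> by simp
next
  case False
  have "(\<epsilon> * norm (dual_coef b I w))\<^sup>2 \<le> (norm (lin_comb b (dual_coef b I w)))\<^sup>2"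
    using \<epsilon> by (intro power_mono qual dual_coef_outside) auto
  also have "\<dots> = dual_coef b I w \<bullet> w"
    by (simp add: power2_norm_eq_inner inner_lin_comb_dual_coef)
  also have "\<dots> \<le> norm (dual_coef b I w) * norm w" by (rule norm_cauchy_schwarz)
  finally have "norm (dual_coef b I w) * (\<epsilon>\<^sup>2 * norm (dual_coef b I w)) \<le> norm (dual_coef b I w) * norm w"
    by (simp add: power2_eq_square mult_ac)
  then have "\<epsilon>\<^sup>2 * norm (dual_coef b I w) \<le> norm w" using False by simp
  then show ?thesis using \<epsilon> by (simp add: field_simps)
qed

lemma norm_lin_comb_dual_coef: "norm (lin_comb b (dual_coef b I w)) \<le> norm w / \<epsilon>"
proof -
  have "(norm (lin_comb b (dual_coef b I w)))\<^sup>2 = dual_coef b I w \<bullet> w"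
    by (simp add: power2_norm_eq_inner inner_lin_comb_dual_coef)
  also have "\<dots> \<le> norm (dual_coef b I w) * norm w" by (rule norm_cauchy_schwarz)
  also have "\<dots> \<le> norm w / \<epsilon>\<^sup>2 * norm w" by (intro mult_right_mono norm_dual_coef) auto
  also have "\<dots> = (norm w / \<epsilon>)\<^sup>2" by (simp add: power2_eq_square)
  finally show ?thesis by (rule power2_le_imp_le) (use \<epsilon> in simp)
qed

end

section \<open>Measurable dependence of the Gram solution on the data\<close>

lemma borel_measurable_vecI:
  fixes F :: "'a \<Rightarrow> real^'l"
  assumes "\<And>i. (\<lambda>t. F t $ i) \<in> borel_measurable M"
  shows "F \<in> borel_measurable M"
proof (subst borel_measurable_euclidean_space, rule ballI)
  fix e :: "real^'l" assume "e \<in> Basis"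
  then obtain i where "e = axis i 1" by (auto simp: Basis_vec_def)
  then show "(\<lambda>t. F t \<bullet> e) \<in> borel_measurable M" using assms[of i] by (simp add: cart_eq_inner_axis[symmetric])
qed

lemma borel_measurable_det:
  fixes A :: "'a \<Rightarrow> real^'l^'l"
  assumes "\<And>i j. (\<lambda>t. A t $ i $ j) \<in> borel_measurable M"
  shows "(\<lambda>t. det (A t)) \<in> borel_measurable M"
  unfolding det_def using assms by (intro borel_measurable_sum borel_measurable_times borel_measurable_prod) auto

text \<open>Cramer's formula is rational in inner products and indicators of index membership, so no
  measurable selection is involved.\<close>

lemma borel_measurable_dual_coef:
  fixes b :: "'l::finite \<Rightarrow> 'a \<Rightarrow> 'v::euclidean_space"
  assumes b: "\<And>i. b i \<in> borel_measurable M" and I: "\<And>i. {t \<in> space M. i \<in> I t} \<in> sets M"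
    and w: "\<And>i. (\<lambda>t. w t $ i) \<in> borel_measurable M"
  shows "(\<lambda>t. dual_coef (\<lambda>i. b i t) (I t) (w t)) \<in> borel_measurable M"
proof -
  have [measurable]: "Measurable.pred M (\<lambda>t. i \<in> I t)" for i using I[of i] by (simp add: pred_def)
  note [measurable] = b w
  have g: "(\<lambda>t. gram (\<lambda>i. b i t) (I t) $ i $ j) \<in> borel_measurable M" for i j
    unfolding gram_def by simp
  have "(\<lambda>t. if i \<in> I t then w t $ i else 0) \<in> borel_measurable M" for i
    by (intro measurable_If w borel_measurable_const I)
  then have m: "(\<lambda>t. if j = k then (if i \<in> I t then w t $ i else 0) else gram (\<lambda>i. b i t) (I t) $ i $ j) \<in> borel_measurable M" for i j k
    by (cases "j = k") (simp_all add: g)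
  show ?thesis
    by (rule borel_measurable_vecI, unfold dual_coef_def, simp, rule borel_measurable_divide)
       (rule borel_measurable_det, simp add: m g)+
qed

section \<open>Functions given as indefinite integrals\<close>

lemma has_integral_increment:
  fixes h :: "real \<Rightarrow> 'a::banach"
  assumes sol: "\<And>t. t \<in> {a..b} \<Longrightarrow> (h has_integral (x t - x a)) {a..t}" and st: "a \<le> s" "s \<le> t" "t \<le> b"
  shows "(h has_integral (x t - x s)) {s..t}"
proof -
  have t: "(h has_integral (x t - x a)) {a..t}" and s: "(h has_integral (x s - x a)) {a..s}"
    using sol st by auto
  have "h integrable_on {s..t}"
    by (rule integrable_on_subinterval[of h "{a..t}"]) (use t st in auto)
  then obtain j where j: "(h has_integral j) {s..t}" by blast
  have "(h has_integral (x s - x a) + j) {a..t}" by (rule has_integral_combine[OF st(1,2) s j])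
  then have "x t - x a = (x s - x a) + j" by (rule has_integral_unique[OF t])
  then show ?thesis using j by (simp add: algebra_simps)
qed

lemma primitive_lipschitz:
  fixes h :: "real \<Rightarrow> 'a::euclidean_space"
  assumes "\<And>t. t \<in> {a..b} \<Longrightarrow> (h has_integral (P t - P a)) {a..t}" "\<And>t. t \<in> {a..b} \<Longrightarrow> norm (h t) \<le> B" "B \<ge> 0"
    and "a \<le> s" "s \<le> t" "t \<le> b"
  shows "norm (P t - P s) \<le> B * (t - s)"
proof -
  have "(h has_integral (P t - P s)) {s..t}"
    by (rule has_integral_increment[where a = a and b = b, OF assms(1,4,5,6)])
  then have "norm (P t - P s) \<le> B * measure lborel {s..t}"
    by (rule has_integral_bound_real[OF \<open>B \<ge> 0\<close> finite.emptyI]) (use assms(2,4,6) in auto)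
  then show ?thesis using assms by simp
qed

lemma primitive_AE_has_vector_derivative:
  fixes h :: "real \<Rightarrow> 'a::euclidean_space"
  assumes P: "\<And>t. t \<in> {a..b} \<Longrightarrow> (h has_integral (P t - P a)) {a..t}" and "a \<le> b"
  shows "\<exists>N. negligible N \<and> (\<forall>t\<in>{a..b} - N. (P has_vector_derivative h t) (at t))"
proof -
  have "h integrable_on {a..b}" using P[of b] \<open>a \<le> b\<close> by auto
  from indefinite_integral_AE_has_vector_derivative[OF this]
  obtain N where N: "negligible N"
    and d: "\<And>t. t \<in> {a<..<b} - N \<Longrightarrow> ((\<lambda>t. integral {a..t} h) has_vector_derivative h t) (at t)" by blast
  have "(P has_vector_derivative h t) (at t)" if t: "t \<in> {a..b} - (N \<union> {a, b})" for t
  proof -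
    have "((\<lambda>t. P a + integral {a..t} h) has_vector_derivative h t) (at t)"
      using d[of t] t by (auto intro!: derivative_eq_intros)
    then show ?thesis
    proof (rule has_vector_derivative_transform_within_open[of _ _ _ "{a<..<b}"])
      fix t assume "t \<in> {a<..<b}"
      then show "P a + integral {a..t} h = P t" using integral_unique[OF P[of t]] by simp
    qed (use t in auto)
  qed
  \<comment> \<open>The derivative is two-sided, so both endpoints join the exceptional set.\<close>
  then show ?thesis using N by (intro exI[of _ "N \<union> {a, b}"]) auto
qed

text \<open>Undoes the change of time: \<open>z\<close> lives in rescaled time with the fixed
  instant \<tau>, and \<open>y\<close> is a genuine trajectory for which the corresponding instant
  is \<open>\<tau> + d\<close>. The factor \<open>1 + rho T \<tau> s * d\<close> equals
  \<open>(\<tau> + d) / \<tau>\<close> before \<tau> and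
  \<open>(T - \<tau> - d) / (T - \<tau>)\<close> from \<tau> on, the reciprocal slopes of the
  piecewise affine map \<sigma>. The control \<open>v\<close> takes only values of \<open>w\<close>,
  so admissibility is inherited.\<close>

theorem rescaled_state:
  fixes f :: "(real^'n) \<times> (real^'m) \<Rightarrow> real^'n"
  assumes \<tau>: "0 < \<tau>" "\<tau> < T" and d: "0 < \<tau> + d" "\<tau> + d < T"
    and w: "w \<in> borel_measurable (lebesgue_on {0..T})"
    and bdd: "\<And>s. s \<in> {0..T} \<Longrightarrow> norm (f (z s, w s)) \<le> B"
    and sol: "\<And>t. t \<in> {0..T} \<Longrightarrow> ((\<lambda>s. (1 + rho T \<tau> s * d) *\<^sub>R f (z s, w s)) has_integral (z t - z 0)) {0..t}"
  obtains v y where "v \<in> borel_measurable (lebesgue_on {0..T})" "is_state T f (z 0) v y"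
    "\<And>t. t \<in> {0..T} \<Longrightarrow> \<exists>s\<in>{0..T}. v t = w s" "y T = z T"
    "\<And>t. t \<in> {0..\<tau> + d} \<Longrightarrow> \<exists>s\<in>{0..\<tau>}. y t = z s"
proof -
  define k1 where "k1 = \<tau> / (\<tau> + d)"
  define k2 where "k2 = (T - \<tau>) / (T - (\<tau> + d))"
  \<comment> \<open>\<sigma> leads from original to rescaled time. The constant in the second branch
    is chosen so that \<open>\<sigma> T = T\<close>; both branches have the value \<tau> at
    \<open>\<tau> + d\<close>.\<close>
  define \<sigma> where "\<sigma> t = (if t \<le> \<tau> + d then k1 * t else k2 * t + (T - k2 * T))" for t
  have k: "k1 > 0" "k2 > 0" using \<tau> d by (auto simp: k1_def k2_def)
  have k1\<tau>: "k1 * (\<tau> + d) = \<tau>" using d by (simp add: k1_def)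
  have k2\<tau>: "k2 * (T - (\<tau> + d)) = T - \<tau>" using d by (simp add: k2_def)
  have \<sigma>2: "\<sigma> t = T - k2 * (T - t)" if "t \<ge> \<tau> + d" for t
    using that k1\<tau> k2\<tau> by (auto simp: \<sigma>_def algebra_simps)
  have \<sigma>T: "\<sigma> T = T" using \<sigma>2[of T] d by simp
  have \<sigma>0: "\<sigma> 0 = 0" using d by (simp add: \<sigma>_def)
  define K where "K = max k1 k2"
  have \<sigma>mono: "0 \<le> \<sigma> t - \<sigma> s \<and> \<sigma> t - \<sigma> s \<le> K * (t - s)" if "s \<le> t" for s t
  proof -
    have lin1: "0 \<le> k1 * (t - s) \<and> k1 * (t - s) \<le> K * (t - s)" if "s \<le> t" for s t
      using that k by (auto simp: K_def intro!: mult_right_mono)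
    have lin2: "0 \<le> k2 * (t - s) \<and> k2 * (t - s) \<le> K * (t - s)" if "s \<le> t" for s t
      using that k by (auto simp: K_def intro!: mult_right_mono)
    consider "t \<le> \<tau> + d" | "s \<ge> \<tau> + d" | "s < \<tau> + d" "\<tau> + d < t" by linarith
    then show ?thesis
    proof cases
      case 1 then show ?thesis using lin1[OF that] that by (simp add: \<sigma>_def right_diff_distrib)
    next
      case 2
      then have "\<sigma> t - \<sigma> s = k2 * (t - s)" using \<sigma>2[of s] \<sigma>2[of t] that by (simp add: algebra_simps)
      then show ?thesis using lin2[OF that] by simp
    next
      case 3
      have "\<sigma> (\<tau> + d) - \<sigma> s = k1 * (\<tau> + d - s)" using 3 by (simp add: \<sigma>_def right_diff_distrib)
      moreover have "\<sigma> t - \<sigma> (\<tau> + d) = k2 * (t - (\<tau> + d))" using 3 \<sigma>2[of t] \<sigma>2[of "\<tau> + d"] by (simp add: algebra_simps)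
      moreover have "K * (t - s) = K * (\<tau> + d - s) + K * (t - (\<tau> + d))" by (simp add: algebra_simps)
      ultimately show ?thesis using lin1[of s "\<tau> + d"] lin2[of "\<tau> + d" t] 3 by linarith
    qed
  qed
  have \<sigma>range: "\<sigma> t \<in> {0..T}" if "t \<in> {0..T}" for t
    using \<sigma>mono[of 0 t] \<sigma>mono[of t T] that \<sigma>0 \<sigma>T by auto
  have \<sigma>range1: "\<sigma> t \<in> {0..\<tau>}" if "t \<in> {0..\<tau> + d}" for t
    using \<sigma>mono[of 0 t] \<sigma>mono[of t "\<tau> + d"] that \<sigma>0 k1\<tau> by (auto simp: \<sigma>_def)
  define R where "R = (1 + (1 / \<tau> + 1 / (T - \<tau>)) * \<bar>d\<bar>) * \<bar>B\<bar>"
  have R: "norm ((1 + rho T \<tau> s * d) *\<^sub>R f (z s, w s)) \<le> R" if "s \<in> {0..T}" for s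
  proof -
    have "\<bar>rho T \<tau> s\<bar> \<le> 1 / \<tau> + 1 / (T - \<tau>)" using \<tau> by (auto simp: rho_def)
    then have "1 + \<bar>rho T \<tau> s\<bar> * \<bar>d\<bar> \<le> 1 + (1 / \<tau> + 1 / (T - \<tau>)) * \<bar>d\<bar>"
      by (intro add_left_mono mult_right_mono) auto
    then have "\<bar>1 + rho T \<tau> s * d\<bar> \<le> 1 + (1 / \<tau> + 1 / (T - \<tau>)) * \<bar>d\<bar>"
      using abs_triangle_ineq[of 1 "rho T \<tau> s * d"] by (simp add: abs_mult)
    moreover have "norm (f (z s, w s)) \<le> \<bar>B\<bar>" using bdd[OF that] by simp
    ultimately show ?thesis unfolding R_def norm_scaleR by (intro mult_mono) auto
  qed
  have "R \<ge> 0" unfolding R_def using \<tau> by simp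
  have zlip: "norm (z t - z s) \<le> R * (t - s)" if st: "0 \<le> s" "s \<le> t" "t \<le> T" for s t
    by (rule primitive_lipschitz[where a = 0 and b = T, OF sol R \<open>R \<ge> 0\<close> st])
  define v where "v t = w (\<sigma> t)" for t
  define y where "y t = z (\<sigma> t)" for t
  have ylip: "norm (y t - y s) \<le> (R * K) * (t - s)" if "s \<in> {0..T}" "t \<in> {0..T}" "s \<le> t" for s t
  proof -
    have "norm (y t - y s) \<le> R * (\<sigma> t - \<sigma> s)"
      unfolding y_def using \<sigma>range[of s] \<sigma>range[of t] \<sigma>mono[of s t] that by (intro zlip) auto
    also have "\<dots> \<le> R * (K * (t - s))" using \<sigma>mono[of s t] that \<open>R \<ge> 0\<close> by (intro mult_left_mono) auto
    finally show ?thesis by simp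
  qed
  have T0: "0 \<le> T" using \<tau> by simp
  have "\<exists>N. negligible N \<and> (\<forall>s\<in>{0..T} - N.
    (z has_vector_derivative (1 + rho T \<tau> s * d) *\<^sub>R f (z s, w s)) (at s))"
    by (rule primitive_AE_has_vector_derivative[where P = z and a = 0 and b = T, OF sol T0])
  then obtain N where N: "negligible N" and zd': "\<forall>s\<in>{0..T} - N.
    (z has_vector_derivative (1 + rho T \<tau> s * d) *\<^sub>R f (z s, w s)) (at s)" by (elim exE conjE) blast
  note zd = zd'[rule_format]
  have aff: "(\<lambda>s. p * s + q) differentiable_on N" for p q :: real
    unfolding differentiable_on_def differentiable_def
    by (intro ballI exI[of _ "\<lambda>h. p * h"]) (auto intro!: derivative_eq_intros)
  \<comment> \<open>The chain rule is lost at the points that either affine branch sends into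
    \<open>N\<close>, at the kink and at the endpoints.\<close>
  define N' where "N' = (\<lambda>s. (1 / k1) * s + 0) ` N \<union> (\<lambda>s. (1 / k2) * s + (- (T - k2 * T) / k2)) ` N \<union> {0, T, \<tau> + d}"
  have N': "negligible N'"
    unfolding N'_def by (intro negligible_Un negligible_differentiable_image_negligible[OF order_refl N] aff) auto
  have yd: "(y has_vector_derivative f (y t, v t)) (at t)" if t: "t \<in> {0..T} - N'" for t
  proof -
    have "t \<noteq> 0" "t \<noteq> T" and t\<tau>: "t \<noteq> \<tau> + d" using t unfolding N'_def by blast+
    with t have t': "0 < t" "t < T" "t \<noteq> \<tau> + d" by (simp_all add: less_le)
    have sN: "\<sigma> t \<notin> N"
    proof
      assume n: "\<sigma> t \<in> N"
      show False
      proof (cases "t \<le> \<tau> + d")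
        case True
        then have "t = (1 / k1) * \<sigma> t + 0" using k by (simp add: \<sigma>_def)
        then have "t \<in> N'" unfolding N'_def using n by blast
        then show False using t by blast
      next
        case False
        then have "t = (1 / k2) * \<sigma> t + (- (T - k2 * T) / k2)" using k by (simp add: \<sigma>_def field_simps)
        then have "t \<in> N'" unfolding N'_def using n by blast
        then show False using t by blast
      qed
    qed
    have "\<sigma> t \<in> {0<..<T}"
    proof -
      have "\<sigma> t > 0"
      proof (cases "t \<le> \<tau> + d")
        case True then show ?thesis using t' k by (simp add: \<sigma>_def)
      next
        case False then show ?thesis using \<sigma>mono[of "\<tau> + d" t] k1\<tau> \<tau> by (simp add: \<sigma>_def split: if_splits)
      qed
      moreover have "\<sigma> t < T"
      proof (cases "t \<ge> \<tau> + d")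
        case True then show ?thesis using t' k \<sigma>2[of t] by simp
      next
        case False then show ?thesis using \<sigma>mono[of t "\<tau> + d"] k1\<tau> \<tau> by (simp add: \<sigma>_def split: if_splits)
      qed
      ultimately show ?thesis by simp
    qed
    with sN have z': "(z has_vector_derivative (1 + rho T \<tau> (\<sigma> t) * d) *\<^sub>R f (z (\<sigma> t), w (\<sigma> t))) (at (\<sigma> t))"
      by (intro zd) auto
    show ?thesis
    proof (cases "t < \<tau> + d")
      case True
      have "((\<lambda>t. k1 * t) has_vector_derivative k1) (at t)" by (auto intro!: derivative_eq_intros)
      then have s': "(\<sigma> has_vector_derivative k1) (at t)"
        by (rule has_vector_derivative_transform_within_open[of _ _ _ "{..<\<tau> + d}"]) (use True in \<open>auto simp: \<sigma>_def\<close>)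
      have "\<sigma> t < \<tau>" using True k k1\<tau> by (simp add: \<sigma>_def) (metis mult_strict_left_mono)
      then have "1 + rho T \<tau> (\<sigma> t) * d = (\<tau> + d) / \<tau>" using \<tau> by (simp add: rho_def add_divide_distrib)
      then have "k1 * (1 + rho T \<tau> (\<sigma> t) * d) = 1" using \<tau> d by (simp add: k1_def)
      with vector_diff_chain_at[OF s' z'] show ?thesis by (simp add: o_def y_def[abs_def] v_def)
    next
      case False
      have "((\<lambda>t. k2 * t + (T - k2 * T)) has_vector_derivative k2) (at t)" by (auto intro!: derivative_eq_intros)
      then have s': "(\<sigma> has_vector_derivative k2) (at t)"
        by (rule has_vector_derivative_transform_within_open[of _ _ _ "{\<tau> + d<..}"]) (use False t' in \<open>auto simp: \<sigma>_def\<close>)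
      have "\<not> \<sigma> t < \<tau>" using False k1\<tau> \<sigma>mono[of "\<tau> + d" t] by (simp add: \<sigma>_def split: if_splits)
      then have "1 + rho T \<tau> (\<sigma> t) * d = ((T - \<tau>) - d) / (T - \<tau>)" using \<tau> by (simp add: rho_def diff_divide_distrib)
      also have "(T - \<tau>) - d = T - (\<tau> + d)" by simp
      finally have "k2 * (1 + rho T \<tau> (\<sigma> t) * d) = 1" using \<tau> d by (simp add: k2_def)
      with vector_diff_chain_at[OF s' z'] show ?thesis by (simp add: o_def y_def[abs_def] v_def)
    qed
  qed
  have vm: "v \<in> borel_measurable (lebesgue_on {0..T})"
  proof -
    define W where "W s = (if s \<in> {0..T} then w s else 0)" for s
    have W: "W \<in> borel_measurable lebesgue"
      unfolding W_def by (rule borel_measurable_if_I[OF w]) simp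
    \<comment> \<open>Composition with an affine map of nonzero slope preserves Lebesgue
      measurability; a merely continuous change of time could destroy it.\<close>
    have Waff: "(\<lambda>t. W (a * t + b)) \<in> borel_measurable lebesgue" if "a \<noteq> 0" for a b :: real
    proof -
      have "(\<lambda>x::real. b + (\<Sum>j\<in>Basis. (a * (x \<bullet> j)) *\<^sub>R j)) \<in> lebesgue \<rightarrow>\<^sub>M lebesgue"
        by (rule lebesgue_affine_measurable) (use that in auto)
      from measurable_compose[OF this W] show ?thesis by (simp add: add.commute)
    qed
    have "(\<lambda>t. if t \<le> \<tau> + d then W (k1 * t + 0) else W (k2 * t + (T - k2 * T))) \<in> borel_measurable lebesgue"
      using Waff[of k1 0] Waff[of k2 "T - k2 * T"] k by (intro measurable_If) auto
    then have "(\<lambda>t. if t \<le> \<tau> + d then W (k1 * t + 0) else W (k2 * t + (T - k2 * T))) \<in> borel_measurable (lebesgue_on {0..T})"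
      by (rule measurable_restrict_space1)
    then show ?thesis
    proof (subst measurable_cong[where g = "\<lambda>t. if t \<le> \<tau> + d then W (k1 * t + 0) else W (k2 * t + (T - k2 * T))"])
      fix t assume "t \<in> space (lebesgue_on {0..T})"
      then have "\<sigma> t \<in> {0..T}" by (intro \<sigma>range) auto
      then show "v t = (if t \<le> \<tau> + d then W (k1 * t + 0) else W (k2 * t + (T - k2 * T)))"
        by (auto simp: v_def W_def \<sigma>_def)
    qed
  qed
  show ?thesis
  proof (rule that[of v y])
    show "is_state T f (z 0) v y"
      unfolding is_state_def
    proof (intro conjI)
      show "absolutely_continuous_on {0..T} y" by (rule lipschitz_imp_absolutely_continuous_on) (rule ylip)
      show "y 0 = z 0" by (simp add: y_def \<sigma>0)
      show "AE t in lebesgue_on {0..T}. (y has_vector_derivative f (y t, v t)) (at t)"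
        using N' yd by (subst AE_lebesgue_on_iff_negligible) auto
    qed
    show "y T = z T" by (simp add: y_def \<sigma>T)
    show "\<exists>s\<in>{0..T}. v t = w s" if "t \<in> {0..T}" for t using \<sigma>range[OF that] by (auto simp: v_def)
    show "\<exists>s\<in>{0..\<tau>}. y t = z s" if "t \<in> {0..\<tau> + d}" for t using \<sigma>range1[OF that] by (auto simp: y_def)
  qed (fact vm)
qed

subsection \<open>Bounded measurable functions\<close>

text \<open>The bound holds at every instant and not just almost everywhere, so the class is closed
  under continuous operations with plain pointwise estimates. The representative of the optimal
  control is chosen to fit.\<close>

definition bounded_measurable :: "real \<Rightarrow> (real \<Rightarrow> 'a::euclidean_space) \<Rightarrow> bool" where
  "bounded_measurable T F \<longleftrightarrow> F \<in> borel_measurable (lebesgue_on {0..T}) \<and> (\<exists>B. \<forall>t\<in>{0..T}. norm (F t) \<le> B)"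

lemma bounded_measurableD: "bounded_measurable T F \<Longrightarrow> F \<in> borel_measurable (lebesgue_on {0..T})"
  by (simp add: bounded_measurable_def)

lemma bounded_measurable_bound:
  assumes "bounded_measurable T F"
  obtains B where "B \<ge> 0" "\<And>t. t \<in> {0..T} \<Longrightarrow> norm (F t) \<le> B"
proof -
  from assms obtain B where "\<forall>t\<in>{0..T}. norm (F t) \<le> B" by (auto simp: bounded_measurable_def)
  then show ?thesis by (intro that[of "\<bar>B\<bar>"]) (auto intro: order_trans[OF _ abs_ge_self])
qed

lemma bounded_measurable_absolutely_integrable_on:
  assumes "bounded_measurable T F"
  shows "F absolutely_integrable_on {0..T}"
proof -
  from assms obtain B where "\<And>t. t \<in> {0..T} \<Longrightarrow> norm (F t) \<le> B" by (rule bounded_measurable_bound) blast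
  with bounded_measurableD[OF assms] show ?thesis by (rule bounded_measurable_absolutely_integrable)
qed

lemma bounded_measurable_integrable_on:
  assumes "bounded_measurable T F" "0 \<le> s" "t \<le> T"
  shows "F integrable_on {s..t}"
  by (rule integrable_on_subinterval[of F "{0..T}"])
     (use bounded_measurable_absolutely_integrable_on[OF assms(1)] assms in \<open>auto simp: absolutely_integrable_on_def\<close>)

lemma bounded_measurable_compose:
  assumes F: "bounded_measurable T F" and \<Phi>: "continuous_on UNIV \<Phi>"
  shows "bounded_measurable T (\<lambda>t. \<Phi> (F t))"
  unfolding bounded_measurable_def
proof
  show "(\<lambda>t. \<Phi> (F t)) \<in> borel_measurable (lebesgue_on {0..T})"
    using measurable_compose[OF bounded_measurableD[OF F] borel_measurable_continuous_onI[OF \<Phi>]] .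
  obtain B where B: "\<And>t. t \<in> {0..T} \<Longrightarrow> norm (F t) \<le> B" using F by (rule bounded_measurable_bound) blast
  have "bounded (\<Phi> ` cball 0 B)"
    by (intro compact_imp_bounded compact_continuous_image continuous_on_subset[OF \<Phi>]) auto
  then obtain C where "\<forall>z\<in>\<Phi> ` cball 0 B. norm z \<le> C" unfolding bounded_iff by blast
  then show "\<exists>B. \<forall>t\<in>{0..T}. norm (\<Phi> (F t)) \<le> B" using B by (intro exI[of _ C]) auto
qed

lemma bounded_measurable_Pair:
  assumes F: "bounded_measurable T F" and G: "bounded_measurable T G"
  shows "bounded_measurable T (\<lambda>t. (F t, G t))"
  unfolding bounded_measurable_def
proof
  show "(\<lambda>t. (F t, G t)) \<in> borel_measurable (lebesgue_on {0..T})"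
    using bounded_measurableD[OF F] bounded_measurableD[OF G] by (rule borel_measurable_Pair)
  obtain B C where "\<And>t. t \<in> {0..T} \<Longrightarrow> norm (F t) \<le> B" "\<And>t. t \<in> {0..T} \<Longrightarrow> norm (G t) \<le> C"
    using F G by (metis bounded_measurable_def)
  then have "norm (F t, G t) \<le> B + C" if "t \<in> {0..T}" for t
    by (rule order_trans[OF norm_Pair_le add_mono]) (use that in auto)
  then show "\<exists>B. \<forall>t\<in>{0..T}. norm (F t, G t) \<le> B" by blast
qed

lemma bounded_measurable_compose2:
  assumes "bounded_measurable T F" "bounded_measurable T G" and \<Phi>: "continuous_on UNIV (\<lambda>(y, z). \<Phi> y z)"
  shows "bounded_measurable T (\<lambda>t. \<Phi> (F t) (G t))"
  using bounded_measurable_compose[OF bounded_measurable_Pair[OF assms(1,2)] \<Phi>] by simp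

lemma bounded_measurable_const: "bounded_measurable T (\<lambda>_. k)"
  by (auto simp: bounded_measurable_def)

lemma bounded_measurable_continuous:
  assumes "continuous_on {0..T} F"
  shows "bounded_measurable T F"
  unfolding bounded_measurable_def
proof
  show "F \<in> borel_measurable (lebesgue_on {0..T})"
    by (rule continuous_imp_measurable_on_sets_lebesgue[OF assms]) simp
  have "bounded (F ` {0..T})" by (intro compact_imp_bounded compact_continuous_image assms) auto
  then show "\<exists>B. \<forall>t\<in>{0..T}. norm (F t) \<le> B" unfolding bounded_iff by auto
qed

lemma bounded_measurable_add: "bounded_measurable T F \<Longrightarrow> bounded_measurable T G \<Longrightarrow> bounded_measurable T (\<lambda>t. F t + G t)"
  by (rule bounded_measurable_compose2) (auto simp: case_prod_unfold intro!: continuous_intros)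

lemma bounded_measurable_diff: "bounded_measurable T F \<Longrightarrow> bounded_measurable T G \<Longrightarrow> bounded_measurable T (\<lambda>t. F t - G t)"
  by (rule bounded_measurable_compose2) (auto simp: case_prod_unfold intro!: continuous_intros)

lemma bounded_measurable_scaleR: "bounded_measurable T F \<Longrightarrow> bounded_measurable T G \<Longrightarrow> bounded_measurable T (\<lambda>t. F t *\<^sub>R G t)"
  by (rule bounded_measurable_compose2) (auto simp: case_prod_unfold intro!: continuous_intros)

lemma bounded_measurable_mult:
  fixes F G :: "real \<Rightarrow> real"
  shows "bounded_measurable T F \<Longrightarrow> bounded_measurable T G \<Longrightarrow> bounded_measurable T (\<lambda>t. F t * G t)"
  using bounded_measurable_scaleR[of T F G] by simp

lemma bounded_measurable_inner: "bounded_measurable T F \<Longrightarrow> bounded_measurable T G \<Longrightarrow> bounded_measurable T (\<lambda>t. F t \<bullet> G t)"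
  by (rule bounded_measurable_compose2) (auto simp: case_prod_unfold intro!: continuous_intros)

lemma bounded_measurable_uminus: "bounded_measurable T F \<Longrightarrow> bounded_measurable T (\<lambda>t. - F t)"
  by (rule bounded_measurable_compose) (auto intro!: continuous_intros)

lemma bounded_measurable_fst: "bounded_measurable T F \<Longrightarrow> bounded_measurable T (\<lambda>t. fst (F t))"
  and bounded_measurable_snd: "bounded_measurable T F \<Longrightarrow> bounded_measurable T (\<lambda>t. snd (F t))"
  by (rule bounded_measurable_compose; auto intro!: continuous_intros)+

lemma bounded_measurable_blinfun:
  fixes G :: "'a::euclidean_space \<Rightarrow> 'b::euclidean_space \<Rightarrow>\<^sub>L 'c::euclidean_space"
  assumes G: "continuous_on UNIV G" and "bounded_measurable T F" "bounded_measurable T h"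
  shows "bounded_measurable T (\<lambda>t. G (F t) (h t))"
  by (rule bounded_measurable_compose2[OF assms(2,3)])
     (auto simp: case_prod_unfold intro!: continuous_intros continuous_on_compose2[OF G])

lemma bounded_measurable_blinfun2:
  fixes G :: "'a::euclidean_space \<Rightarrow> 'b::euclidean_space \<Rightarrow>\<^sub>L 'b \<Rightarrow>\<^sub>L 'c::euclidean_space"
  assumes G: "continuous_on UNIV G" and "bounded_measurable T F" "bounded_measurable T h"
  shows "bounded_measurable T (\<lambda>t. G (F t) (h t) (h t))"
  by (rule bounded_measurable_compose2[OF assms(2,3)])
     (auto simp: case_prod_unfold intro!: continuous_intros continuous_on_compose2[OF G])

lemma bounded_measurable_adj:
  fixes G :: "'a::euclidean_space \<Rightarrow> 'b::euclidean_space \<Rightarrow>\<^sub>L 'c::euclidean_space"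
  assumes G: "continuous_on UNIV G" and "bounded_measurable T F" "bounded_measurable T h"
  shows "bounded_measurable T (\<lambda>t. blinfun_adj (G (F t)) (h t))"
  by (rule bounded_measurable_compose2[OF assms(2,3)])
     (auto simp: case_prod_unfold intro!: continuous_intros continuous_on_compose2[OF G])

lemma bounded_measurable_If:
  assumes "bounded_measurable T F" "bounded_measurable T G" "{t \<in> {0..T}. P t} \<in> sets (lebesgue_on {0..T})"
  shows "bounded_measurable T (\<lambda>t. if P t then F t else G t)"
  unfolding bounded_measurable_def
proof
  show "(\<lambda>t. if P t then F t else G t) \<in> borel_measurable (lebesgue_on {0..T})"
    using assms by (intro measurable_If bounded_measurableD) auto
  obtain B C where "\<And>t. t \<in> {0..T} \<Longrightarrow> norm (F t) \<le> B" "\<And>t. t \<in> {0..T} \<Longrightarrow> norm (G t) \<le> C"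
    using assms by (metis bounded_measurable_def)
  then show "\<exists>B. \<forall>t\<in>{0..T}. norm (if P t then F t else G t) \<le> B"
    by (intro exI[of _ "max B C"]) (auto simp: le_max_iff_disj)
qed

lemma bounded_measurable_rho: "bounded_measurable T (rho T \<tau>)"
proof -
  have "bounded_measurable T (\<lambda>t. if t < \<tau> then 1 / \<tau> else - 1 / (T - \<tau>))"
  proof (intro bounded_measurable_If bounded_measurable_const)
    have "{t \<in> {0..T}. t < \<tau>} = {0..T} \<inter> {..<\<tau>}" by auto
    then show "{t \<in> {0..T}. t < \<tau>} \<in> sets (lebesgue_on {0..T})"
      by (simp add: sets_restrict_space_iff)
  qed
  then show ?thesis by (simp add: rho_def[abs_def])
qed

lemmas bounded_measurable_intros =
  bounded_measurable_const bounded_measurable_add bounded_measurable_diff bounded_measurable_scaleR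
  bounded_measurable_mult bounded_measurable_inner bounded_measurable_uminus bounded_measurable_Pair
  bounded_measurable_fst bounded_measurable_snd bounded_measurable_blinfun bounded_measurable_blinfun2
  bounded_measurable_adj bounded_measurable_rho

text \<open>Primitives of bounded functions are Lipschitz, and so is the product of two of them on a
  bounded interval. Hence integration by parts holds although the product rule is available only
  almost everywhere.\<close>

lemma has_integral_inner_product_rule:
  fixes h k :: "real \<Rightarrow> 'a::euclidean_space"
  assumes ab: "a \<le> b"
    and P: "\<And>t. t \<in> {a..b} \<Longrightarrow> (h has_integral (P t - P a)) {a..t}" and hB: "\<And>t. t \<in> {a..b} \<Longrightarrow> norm (h t) \<le> B"
    and Q: "\<And>t. t \<in> {a..b} \<Longrightarrow> (k has_integral (Q t - Q a)) {a..t}" and kC: "\<And>t. t \<in> {a..b} \<Longrightarrow> norm (k t) \<le> C"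
  shows "((\<lambda>t. P t \<bullet> k t + h t \<bullet> Q t) has_integral (P b \<bullet> Q b - P a \<bullet> Q a)) {a..b}"
proof -
  have "B \<ge> 0" "C \<ge> 0" using hB[of a] kC[of a] ab by (auto intro: order_trans[OF norm_ge_zero])
  have Pl: "norm (P t - P s) \<le> B * (t - s)" if "a \<le> s" "s \<le> t" "t \<le> b" for s t
    by (rule primitive_lipschitz[where h = h and a = a and b = b]) (use P hB \<open>B \<ge> 0\<close> that in auto)
  have Ql: "norm (Q t - Q s) \<le> C * (t - s)" if "a \<le> s" "s \<le> t" "t \<le> b" for s t
    by (rule primitive_lipschitz[where h = k and a = a and b = b]) (use Q kC \<open>C \<ge> 0\<close> that in auto)
  define P1 where "P1 = norm (P a) + B * (b - a)"
  define Q1 where "Q1 = norm (Q a) + C * (b - a)"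
  have PB: "norm (P t) \<le> P1" if "t \<in> {a..b}" for t
  proof -
    have "norm (P t) \<le> norm (P a) + norm (P t - P a)" by (metis add.commute diff_add_cancel norm_triangle_ineq)
    also have "\<dots> \<le> norm (P a) + B * (t - a)" using Pl[of a t] that by auto
    also have "\<dots> \<le> P1" unfolding P1_def using that \<open>B \<ge> 0\<close> by (intro add_left_mono mult_left_mono) auto
    finally show ?thesis .
  qed
  have QB: "norm (Q t) \<le> Q1" if "t \<in> {a..b}" for t
  proof -
    have "norm (Q t) \<le> norm (Q a) + norm (Q t - Q a)" by (metis add.commute diff_add_cancel norm_triangle_ineq)
    also have "\<dots> \<le> norm (Q a) + C * (t - a)" using Ql[of a t] that by auto
    also have "\<dots> \<le> Q1" unfolding Q1_def using that \<open>C \<ge> 0\<close> by (intro add_left_mono mult_left_mono) auto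
    finally show ?thesis .
  qed
  obtain N1 N2 where N: "negligible N1" "negligible N2"
    and Pd: "\<And>t. t\<in>{a..b} - N1 \<Longrightarrow> (P has_vector_derivative h t) (at t)"
    and Qd: "\<And>t. t\<in>{a..b} - N2 \<Longrightarrow> (Q has_vector_derivative k t) (at t)"
    using primitive_AE_has_vector_derivative[where P = P and a = a and b = b, OF _ ab, OF P]
      primitive_AE_has_vector_derivative[where P = Q and a = a and b = b, OF _ ab, OF Q] by auto
  show ?thesis
  proof (rule fundamental_theorem_of_calculus_absolutely_continuous[OF ab])
    show "negligible (N1 \<union> N2)" using N by simp
    show "absolutely_continuous_on {a..b} (\<lambda>t. P t \<bullet> Q t)"
    proof (rule lipschitz_imp_absolutely_continuous_on)
      fix s t assume st: "s \<in> {a..b}" "t \<in> {a..b}" "s \<le> t"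
      have "P t \<bullet> Q t - P s \<bullet> Q s = P t \<bullet> (Q t - Q s) + (P t - P s) \<bullet> Q s"
        by (simp add: inner_diff_left inner_diff_right)
      also have "norm \<dots> \<le> norm (P t) * norm (Q t - Q s) + norm (P t - P s) * norm (Q s)"
        by (rule norm_triangle_mono) (simp_all add: Cauchy_Schwarz_ineq2)
      also have "\<dots> \<le> P1 * (C * (t - s)) + (B * (t - s)) * Q1"
        using PB[OF st(2)] QB[OF st(1)] Pl[of s t] Ql[of s t] st \<open>B \<ge> 0\<close> order_trans[OF norm_ge_zero PB[OF st(2)]]
        by (intro add_mono mult_mono) auto
      also have "\<dots> = (P1 * C + B * Q1) * (t - s)" by (simp add: algebra_simps)
      finally show "norm (P t \<bullet> Q t - P s \<bullet> Q s) \<le> (P1 * C + B * Q1) * (t - s)" .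
    qed
    fix t assume t: "t \<in> {a..b} - (N1 \<union> N2)"
    have "((\<lambda>t. P t \<bullet> Q t) has_vector_derivative P t \<bullet> k t + h t \<bullet> Q t) (at t)"
      using bounded_bilinear.has_vector_derivative[OF bounded_bilinear_inner Pd Qd, of t] t by auto
    then show "((\<lambda>t. P t \<bullet> Q t) has_vector_derivative P t \<bullet> k t + h t \<bullet> Q t) (at t within {a..b})"
      by (rule has_vector_derivative_at_within)
  qed
qed

lemma lipschitz_on_cball:
  fixes F :: "'a::euclidean_space \<Rightarrow> 'b::real_normed_vector" and F' :: "'a \<Rightarrow> 'a \<Rightarrow>\<^sub>L 'b"
  assumes F': "\<And>z. (F has_derivative F' z) (at z)" and cont: "continuous_on UNIV F'"
  obtains L where "L \<ge> 0" "\<And>y z. norm y \<le> R \<Longrightarrow> norm z \<le> R \<Longrightarrow> norm (F y - F z) \<le> L * norm (y - z)"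
proof -
  have "compact (F' ` cball 0 R)" by (intro compact_continuous_image continuous_on_subset[OF cont]) auto
  then obtain L where L: "L > 0" "\<And>z. norm z \<le> R \<Longrightarrow> norm (F' z) \<le> L"
    using bounded_pos[of "F' ` cball 0 R"] by (auto simp: compact_imp_bounded)
  show ?thesis
  proof (rule that[of L])
    fix y z :: 'a assume "norm y \<le> R" "norm z \<le> R"
    then show "norm (F y - F z) \<le> L * norm (y - z)"
      by (intro differentiable_bound[of "cball 0 R" F F' L])
         (auto intro!: has_derivative_at_withinI[OF F'] simp: norm_blinfun.rep_eq[symmetric] L)
  qed (use L in auto)
qed

subsection \<open>The time crisis problem in rescaled time\<close>

text \<open>Here \<open>u\<close> is a representative of the optimal control for which admissibility, boundedness and
  qualification hold everywhere on \<open>[0,T]\<close>; only what the proof needs of the left limit \<open>ul\<close> at the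
  crossing time survives the change of representative.\<close>

locale crossing_problem =
  fixes T \<tau> :: real
    and f :: "((real^'n) \<times> (real^'m)) \<Rightarrow> (real^'n)"
    and f' :: "((real^'n) \<times> (real^'m)) \<Rightarrow> ((real^'n) \<times> (real^'m)) \<Rightarrow>\<^sub>L (real^'n)"
    and f'' :: "((real^'n) \<times> (real^'m)) \<Rightarrow> ((real^'n) \<times> (real^'m)) \<Rightarrow>\<^sub>L ((real^'n) \<times> (real^'m)) \<Rightarrow>\<^sub>L (real^'n)"
    and \<phi> :: "(real^'n) \<Rightarrow> real" and \<phi>' :: "(real^'n) \<Rightarrow> (real^'n) \<Rightarrow>\<^sub>L real"
    and \<phi>'' :: "(real^'n) \<Rightarrow> (real^'n) \<Rightarrow>\<^sub>L (real^'n) \<Rightarrow>\<^sub>L real"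
    and g :: "(real^'n) \<Rightarrow> real" and g' :: "(real^'n) \<Rightarrow> (real^'n) \<Rightarrow>\<^sub>L real"
    and g'' :: "(real^'n) \<Rightarrow> (real^'n) \<Rightarrow>\<^sub>L (real^'n) \<Rightarrow>\<^sub>L real"
    and c :: "(real^'m) \<Rightarrow> (real^'l)" and c' :: "(real^'m) \<Rightarrow> (real^'m) \<Rightarrow>\<^sub>L (real^'l)"
    and c'' :: "(real^'m) \<Rightarrow> (real^'m) \<Rightarrow>\<^sub>L (real^'m) \<Rightarrow>\<^sub>L (real^'l)"
    and u :: "real \<Rightarrow> (real^'m)" and x :: "real \<Rightarrow> (real^'n)" and ul :: "(real^'m)" and \<epsilon> \<delta> :: real
  assumes \<tau>: "0 < \<tau>" "\<tau> < T"
    and f': "\<And>z. (f has_derivative f' z) (at z)" and f'': "\<And>z. (f' has_derivative f'' z) (at z)"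
    and f''_cont: "continuous_on UNIV f''"
    and \<phi>': "\<And>z. (\<phi> has_derivative \<phi>' z) (at z)" and \<phi>'': "\<And>z. (\<phi>' has_derivative \<phi>'' z) (at z)"
    and \<phi>''_cont: "continuous_on UNIV \<phi>''"
    and g': "\<And>z. (g has_derivative g' z) (at z)" and g'': "\<And>z. (g' has_derivative g'' z) (at z)"
    and g''_cont: "continuous_on UNIV g''"
    and c': "\<And>z. (c has_derivative c' z) (at z)" and c'': "\<And>z. (c' has_derivative c'' z) (at z)"
    and c''_cont: "continuous_on UNIV c''"
    and u: "bounded_measurable T u"
    and u_adm: "\<And>t i. t \<in> {0..T} \<Longrightarrow> c (u t) $ i \<le> 0"
    and sol: "\<And>t. t \<in> {0..T} \<Longrightarrow> ((\<lambda>s. f (x s, u s)) has_integral (x t - x 0)) {0..t}"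
    and \<epsilon>: "\<epsilon> > 0" and \<delta>: "\<delta> > 0"
    and qual: "\<And>t \<xi>. t \<in> {0..T} \<Longrightarrow> (\<And>i. c (u t) $ i < - \<delta> \<Longrightarrow> \<xi> $ i = 0) \<Longrightarrow>
        \<epsilon> * norm \<xi> \<le> norm (lin_comb (\<lambda>i. blinfun_adj (c' (u t)) (axis i 1)) \<xi>)"
    and g_before: "\<And>t. t \<in> {0..<\<tau>} \<Longrightarrow> g (x t) < 0" and g_at: "g (x \<tau>) = 0"
    and transverse: "g' (x \<tau>) (f (x \<tau>, ul)) > 0"
    and ul: "\<And>e. e > 0 \<Longrightarrow> \<exists>\<eta>>0. \<exists>N. negligible N \<and> (\<forall>t\<in>{\<tau> - \<eta><..<\<tau>} - N. norm (u t - ul) < e)"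
    and opt: "\<And>v y. v \<in> borel_measurable (lebesgue_on {0..T}) \<Longrightarrow> (\<And>t i. t \<in> {0..T} \<Longrightarrow> c (v t) $ i \<le> 0) \<Longrightarrow>
        is_state T f (x 0) v y \<Longrightarrow> \<phi> (x T) + (T - \<tau>) \<le> crisis_cost T \<phi> {z. g z \<le> 0} y"
begin

lemma T_pos: "0 \<le> T" using \<tau> by simp

lemma f_cont: "continuous_on UNIV f" by (rule has_derivative_continuous_on) (rule f')
lemma f'_cont: "continuous_on UNIV f'" by (rule has_derivative_continuous_on) (rule f'')
lemma \<phi>'_cont: "continuous_on UNIV \<phi>'" by (rule has_derivative_continuous_on) (rule \<phi>'')
lemma g_cont: "continuous_on UNIV g" by (rule has_derivative_continuous_on) (rule g')
lemma g'_cont: "continuous_on UNIV g'" by (rule has_derivative_continuous_on) (rule g'')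
lemma c_cont: "continuous_on UNIV c" by (rule has_derivative_continuous_on) (rule c')
lemma c'_cont: "continuous_on UNIV c'" by (rule has_derivative_continuous_on) (rule c'')

lemma x_cont: "continuous_on {0..T} x"
proof -
  have "continuous_on {0..T} (\<lambda>t. x 0 + integral {0..t} (\<lambda>s. f (x s, u s)))"
    by (intro continuous_intros indefinite_integral_continuous_1) (use sol[of T] T_pos in auto)
  then show ?thesis
  proof (rule continuous_on_eq)
    fix t assume "t \<in> {0..T}"
    then show "x 0 + integral {0..t} (\<lambda>s. f (x s, u s)) = x t" using integral_unique[OF sol[of t]] by simp
  qed
qed

lemma x: "bounded_measurable T x"
  by (rule bounded_measurable_continuous[OF x_cont])

lemma xu: "bounded_measurable T (\<lambda>t. (x t, u t))"
  by (intro bounded_measurable_intros x u)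

lemma f_xu: "bounded_measurable T (\<lambda>t. f (x t, u t))"
  using bounded_measurable_compose[OF xu f_cont] .

section \<open>The linearized state equation\<close>

abbreviation A :: "real \<Rightarrow> ((real^'n) \<times> (real^'m)) \<Rightarrow>\<^sub>L (real^'n)" where "A t \<equiv> f' (x t, u t)"

lemma A_bm: "bounded_measurable T h \<Longrightarrow> bounded_measurable T (\<lambda>t. A t (h t))"
  by (rule bounded_measurable_blinfun[OF f'_cont xu])

lemma A_bound:
  obtains C where "C \<ge> 0" "\<And>t h. t \<in> {0..T} \<Longrightarrow> norm (A t h) \<le> C * norm h"
proof -
  obtain B where B: "\<And>t. t \<in> {0..T} \<Longrightarrow> norm (x t, u t) \<le> B" using xu by (rule bounded_measurable_bound) blast
  have "bounded (f' ` cball 0 B)"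
    by (intro compact_imp_bounded compact_continuous_image continuous_on_subset[OF f'_cont]) auto
  then obtain C where C: "C > 0" "\<forall>z\<in>f' ` cball 0 B. norm z \<le> C" unfolding bounded_pos by blast
  show ?thesis
  proof (rule that[of C])
    fix t h assume "t \<in> {0..T}"
    then have "norm (A t) \<le> C" using B C(2) by simp
    then show "norm (A t h) \<le> C * norm h" by (rule order_trans[OF norm_blinfun mult_right_mono]) simp
  qed (use C in simp)
qed

text \<open>The control and the time shift are hidden in the source \<open>r\<close>. One notion
  thus covers first-order variations, second-order variations and differences of both, always with
  initial value 0.\<close>

definition lin :: "(real \<Rightarrow> real^'n) \<Rightarrow> (real \<Rightarrow> real^'n) \<Rightarrow> bool" where
  "lin r y \<longleftrightarrow> continuous_on {0..T} y \<and> (\<forall>t\<in>{0..T}. ((\<lambda>s. A s (y s, 0) + r s) has_integral y t) {0..t})"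

lemma lin_cont: "lin r y \<Longrightarrow> continuous_on {0..T} y" by (simp add: lin_def)

lemma lin_bm: "lin r y \<Longrightarrow> bounded_measurable T y"
  by (rule bounded_measurable_continuous[OF lin_cont])

lemma lin_integral: "lin r y \<Longrightarrow> t \<in> {0..T} \<Longrightarrow> ((\<lambda>s. A s (y s, 0) + r s) has_integral y t) {0..t}"
  by (simp add: lin_def)

lemma lin_0:
  assumes "lin r y"
  shows "y 0 = 0"
proof -
  have "((\<lambda>s. A s (y s, 0) + r s) has_integral y 0) {0}" using lin_integral[OF assms, of 0] T_pos by simp
  from has_integral_unique[OF this has_integral_refl(2)] show ?thesis .
qed

lemma lin_exists:
  assumes r: "bounded_measurable T r"
  shows "\<exists>y. lin r y"
proof -
  obtain C where C: "C \<ge> 0" "\<And>t h. t \<in> {0..T} \<Longrightarrow> norm (A t h) \<le> C * norm h" by (rule A_bound) blast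
  have "\<exists>y. continuous_on {0..T} y \<and> (\<forall>t\<in>{0..T}. ((\<lambda>s. A s (y s, 0) + r s) has_integral (y t - 0)) {0..t})"
  proof (rule caratheodory_existence[OF T_pos])
    fix y :: "real \<Rightarrow> real^'n" assume "continuous_on {0..T} y"
    then have "bounded_measurable T (\<lambda>t. A t (y t, 0) + r t)"
      by (intro bounded_measurable_intros A_bm r bounded_measurable_continuous)
    then show "(\<lambda>t. A t (y t, 0) + r t) integrable_on {0..T}" by (rule bounded_measurable_integrable_on) auto
  next
    fix t y z assume t: "t \<in> {0..T}"
    have "A t (y, 0) + r t - (A t (z, 0) + r t) = A t (y - z, 0)" by (simp flip: blinfun.diff_right)
    then show "norm (A t (y, 0) + r t - (A t (z, 0) + r t)) \<le> C * norm (y - z)" using C(2)[OF t, of "(y - z, 0)"] by simp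
  qed
  then show ?thesis by (auto simp: lin_def)
qed

lemma lin_combination:
  assumes "lin r1 y1" "lin r2 y2"
  shows "lin (\<lambda>t. a *\<^sub>R r1 t + b *\<^sub>R r2 t) (\<lambda>t. a *\<^sub>R y1 t + b *\<^sub>R y2 t)"
  unfolding lin_def
proof (intro conjI ballI)
  show "continuous_on {0..T} (\<lambda>t. a *\<^sub>R y1 t + b *\<^sub>R y2 t)" using assms by (intro continuous_intros lin_cont)
  fix t assume t: "t \<in> {0..T}"
  have "((\<lambda>s. a *\<^sub>R (A s (y1 s, 0) + r1 s) + b *\<^sub>R (A s (y2 s, 0) + r2 s)) has_integral a *\<^sub>R y1 t + b *\<^sub>R y2 t) {0..t}"
    by (intro has_integral_add has_integral_cmul lin_integral assms t)
  moreover have "a *\<^sub>R (A s (y1 s, 0) + r1 s) + b *\<^sub>R (A s (y2 s, 0) + r2 s) =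
    A s (a *\<^sub>R y1 s + b *\<^sub>R y2 s, 0) + (a *\<^sub>R r1 s + b *\<^sub>R r2 s)" for s
  proof -
    have "(a *\<^sub>R y1 s + b *\<^sub>R y2 s, 0) = a *\<^sub>R (y1 s, 0 :: real^'m) + b *\<^sub>R (y2 s, 0)" by simp
    then have "A s (a *\<^sub>R y1 s + b *\<^sub>R y2 s, 0) = a *\<^sub>R A s (y1 s, 0) + b *\<^sub>R A s (y2 s, 0)"
      by (simp only: blinfun.add_right blinfun.scaleR_right)
    then show ?thesis by (simp add: scaleR_add_right)
  qed
  ultimately show "((\<lambda>s. A s (a *\<^sub>R y1 s + b *\<^sub>R y2 s, 0) + (a *\<^sub>R r1 s + b *\<^sub>R r2 s)) has_integral a *\<^sub>R y1 t + b *\<^sub>R y2 t) {0..t}"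
    by simp
qed

text \<open>Gronwall's inequality for the difference. Measuring the sources in L1 is what later
  turns convergence of approximating controls into uniform convergence of the linearized
  states.\<close>

lemma lin_stable:
  obtains C where "C \<ge> 0" "\<And>r1 r2 y1 y2 t. lin r1 y1 \<Longrightarrow> lin r2 y2 \<Longrightarrow> (\<lambda>t. norm (r1 t - r2 t)) integrable_on {0..T} \<Longrightarrow>
    t \<in> {0..T} \<Longrightarrow> norm (y1 t - y2 t) \<le> C * integral {0..T} (\<lambda>t. norm (r1 t - r2 t))"
proof -
  obtain C where C: "C \<ge> 0" "\<And>t h. t \<in> {0..T} \<Longrightarrow> norm (A t h) \<le> C * norm h" by (rule A_bound) blast
  show ?thesis
  proof (rule that[of "exp (C * T)"])
    fix r1 r2 y1 y2 t
    assume l: "lin r1 y1" "lin r2 y2" and i: "(\<lambda>t. norm (r1 t - r2 t)) integrable_on {0..T}" and t: "t \<in> {0..T}"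
    define y where "y t = y1 t - y2 t" for t
    define r where "r t = r1 t - r2 t" for t
    define Z where "Z = integral {0..T} (\<lambda>t. norm (r t))"
    have "lin (\<lambda>t. 1 *\<^sub>R r1 t + (-1) *\<^sub>R r2 t) (\<lambda>t. 1 *\<^sub>R y1 t + (-1) *\<^sub>R y2 t)" by (rule lin_combination[OF l])
    then have l: "lin r y" by (simp add: r_def[abs_def] y_def[abs_def])
    have ri: "(\<lambda>t. norm (r t)) integrable_on {0..s}" if "s \<in> {0..T}" for s
      by (rule integrable_on_subinterval[of _ "{0..T}"]) (use i that in \<open>auto simp: r_def\<close>)
    have yc: "continuous_on {0..T} (\<lambda>t. norm (y t))" by (intro continuous_intros lin_cont[OF l])
    have "norm (y t) \<le> Z * exp (C * (t - 0))"
    proof (rule gronwall[OF yc C(1) _ t])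
      fix s assume s: "s \<in> {0..T}"
      have yi: "(\<lambda>q. norm (y q)) integrable_on {0..s}"
        by (rule integrable_continuous_real[OF continuous_on_subset[OF yc]]) (use s in auto)
      have "norm (y s) = norm (integral {0..s} (\<lambda>q. A q (y q, 0) + r q))"
        using lin_integral[OF l s] by (simp add: integral_unique)
      also have "\<dots> \<le> integral {0..s} (\<lambda>q. C * norm (y q) + norm (r q))"
      proof (rule integral_norm_bound_integral)
        show "(\<lambda>q. A q (y q, 0) + r q) integrable_on {0..s}" using lin_integral[OF l s] by blast
        show "(\<lambda>q. C * norm (y q) + norm (r q)) integrable_on {0..s}"
          by (intro integrable_add integrable_on_mult_right yi ri s)
        fix q assume "q \<in> {0..s}"
        then have "norm (A q (y q, 0)) \<le> C * norm (y q)" using C(2)[of q "(y q, 0)"] s by simp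
        then show "norm (A q (y q, 0) + r q) \<le> C * norm (y q) + norm (r q)"
          by (rule order_trans[OF norm_triangle_ineq add_right_mono])
      qed
      also have "\<dots> = C * integral {0..s} (\<lambda>q. norm (y q)) + integral {0..s} (\<lambda>q. norm (r q))"
        using yi ri[OF s] by (subst Henstock_Kurzweil_Integration.integral_add) (auto intro: integrable_on_mult_right)
      also have "integral {0..s} (\<lambda>q. norm (r q)) \<le> Z"
        unfolding Z_def by (rule integral_subset_le) (use ri[OF s] ri[of T] s T_pos in auto)
      finally show "norm (y s) \<le> Z + C * integral {0..s} (\<lambda>q. norm (y q))" by simp
    qed
    also have "\<dots> \<le> Z * exp (C * T)"
      using t C(1) by (intro mult_left_mono) (auto simp: Z_def intro!: integral_nonneg i[folded r_def] mult_left_mono)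
    finally show "norm (y1 t - y2 t) \<le> exp (C * T) * integral {0..T} (\<lambda>t. norm (r1 t - r2 t))"
      by (simp add: y_def r_def Z_def mult.commute)
  qed simp
qed

lemma lin_unique:
  assumes "lin r y1" "lin r y2" "t \<in> {0..T}"
  shows "y1 t = y2 t"
proof -
  obtain C where "C \<ge> 0" "\<And>r1 r2 y1 y2 t. lin r1 y1 \<Longrightarrow> lin r2 y2 \<Longrightarrow> (\<lambda>t. norm (r1 t - r2 t)) integrable_on {0..T} \<Longrightarrow>
    t \<in> {0..T} \<Longrightarrow> norm (y1 t - y2 t) \<le> C * integral {0..T} (\<lambda>t. norm (r1 t - r2 t))"
    by (rule lin_stable) blast
  from this(2)[OF assms(1,2) _ assms(3)] show ?thesis by (simp add: integrable_0)
qed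

section \<open>The adjoint equation\<close>

definition costate :: "real \<Rightarrow> real^'n \<Rightarrow> (real \<Rightarrow> real^'n) \<Rightarrow> bool" where
  "costate b p1 p \<longleftrightarrow> continuous_on {0..b} p \<and>
    (\<forall>t\<in>{0..b}. ((\<lambda>s. - fst (blinfun_adj (A s) (p s))) has_integral (p1 - p t)) {t..b})"

lemma A_adj_bm: "bounded_measurable T p \<Longrightarrow> bounded_measurable T (\<lambda>t. blinfun_adj (A t) (p t))"
  by (rule bounded_measurable_adj[OF f'_cont xu])

lemma xu_subinterval: "b \<in> {0..T} \<Longrightarrow> bounded_measurable T F \<Longrightarrow> bounded_measurable b F"
  unfolding bounded_measurable_def
  by (intro conjI; elim conjE exE) (auto elim!: measurable_restrict_mono intro!: exI)

lemma costate_exists: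
  assumes b: "b \<in> {0..T}"
  shows "\<exists>p. costate b p1 p"
proof -
  obtain C where C: "C \<ge> 0" "\<And>t h. t \<in> {0..T} \<Longrightarrow> norm (A t h) \<le> C * norm h" by (rule A_bound) blast
  have "0 \<le> b" using b by simp
  have "\<exists>p. continuous_on {0..b} p \<and> (\<forall>t\<in>{0..b}. ((\<lambda>s. - fst (blinfun_adj (A s) (p s))) has_integral (p1 - p t)) {t..b})"
  proof (rule caratheodory_existence_backward[OF \<open>0 \<le> b\<close>])
    fix p :: "real \<Rightarrow> real^'n" assume p: "continuous_on {0..b} p"
    have "bounded_measurable b (\<lambda>t. - fst (blinfun_adj (A t) (p t)))"
      by (intro bounded_measurable_intros f'_cont xu_subinterval[OF b] x u bounded_measurable_continuous[OF p])
    then show "(\<lambda>t. - fst (blinfun_adj (A t) (p t))) integrable_on {0..b}"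
      by (rule bounded_measurable_integrable_on) auto
  next
    fix t y z assume t: "t \<in> {0..b}"
    define w where "w = blinfun_adj (A t) (z - y)"
    have "blinfun_adj (A t) z = blinfun_adj (A t) y + w" by (simp add: w_def flip: blinfun_adj_add)
    then have "- fst (blinfun_adj (A t) y) - - fst (blinfun_adj (A t) z) = fst w" by simp
    \<comment> \<open>Testing the transpose against its own value transfers the bound on
      \<open>A t\<close> to it.\<close>
    moreover have "norm w * norm w \<le> norm w * (C * norm (z - y))"
    proof -
      have "norm w * norm w = (z - y) \<bullet> A t w"
        by (simp add: power2_norm_eq_inner power2_eq_square[symmetric]) (simp add: w_def blinfun_adj_inner)
      also have "\<dots> \<le> norm (z - y) * norm (A t w)" by (rule norm_cauchy_schwarz)
      also have "\<dots> \<le> norm (z - y) * (C * norm w)" using C(2)[of t w] t b by (intro mult_left_mono) auto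
      finally show ?thesis by (simp add: mult_ac)
    qed
    then have "norm w \<le> C * norm (z - y)"
      using C(1) by (cases "w = 0") auto
    then have "norm (fst w) \<le> C * norm (z - y)" using norm_fst_le[of "fst w" "snd w"] by simp
    ultimately show "norm (- fst (blinfun_adj (A t) y) - - fst (blinfun_adj (A t) z)) \<le> C * norm (y - z)"
      by (simp add: norm_minus_commute)
  qed
  then show ?thesis by (simp add: costate_def)
qed

lemma costate_end:
  assumes "costate b p1 p" "0 \<le> b"
  shows "p b = p1"
proof -
  have "((\<lambda>s. - fst (blinfun_adj (A s) (p s))) has_integral (p1 - p b)) {b..b}"
    using assms unfolding costate_def by (elim conjE bspec) simp
  then have "((\<lambda>s. - fst (blinfun_adj (A s) (p s))) has_integral (p1 - p b)) {b}" by simp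
  from has_integral_unique[OF this has_integral_refl(2)] show ?thesis by simp
qed

lemma costate_increment:
  assumes p: "costate b p1 p" and t: "t \<in> {0..b}"
  shows "((\<lambda>s. - fst (blinfun_adj (A s) (p s))) has_integral (p t - p 0)) {0..t}"
proof -
  let ?h = "\<lambda>s. - fst (blinfun_adj (A s) (p s))"
  have 1: "(?h has_integral (p1 - p 0)) {0..b}" and 2: "(?h has_integral (p1 - p t)) {t..b}"
    using p t by (auto simp: costate_def)
  have "?h integrable_on {0..t}"
    by (rule integrable_on_subinterval[of ?h "{0..b}"]) (use 1 t in auto)
  then obtain j where j: "(?h has_integral j) {0..t}" by blast
  have "(?h has_integral j + (p1 - p t)) {0..b}" using t by (intro has_integral_combine[OF _ _ j 2]) auto
  then have "p1 - p 0 = j + (p1 - p t)" by (rule has_integral_unique[OF 1])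
  then show ?thesis using j by (simp add: algebra_simps)
qed

text \<open>In the derivative of \<open>p s \<bullet> y s\<close> the terms with \<open>A\<close>
  cancel and only the source remains, while the boundary term at 0 vanishes with \<open>y 0\<close>.
  A linear functional of the end state thereby becomes an integral against the source.\<close>

lemma adjoint_identity:
  assumes p: "costate b p1 p" and b: "b \<in> {0..T}" and l: "lin r y" and r: "bounded_measurable T r"
  shows "((\<lambda>s. p s \<bullet> r s) has_integral (p1 \<bullet> y b)) {0..b}"
proof -
  have pb: "bounded_measurable b p" using p by (intro bounded_measurable_continuous) (simp add: costate_def)
  have "bounded_measurable b (\<lambda>t. - fst (blinfun_adj (A t) (p t)))"
    by (intro bounded_measurable_intros f'_cont xu_subinterval[OF b] x u pb)
  then obtain B where B: "\<And>t. t \<in> {0..b} \<Longrightarrow> norm (- fst (blinfun_adj (A t) (p t))) \<le> B"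
    by (rule bounded_measurable_bound) blast
  have "bounded_measurable T (\<lambda>s. A s (y s, 0) + r s)"
    by (intro bounded_measurable_intros A_bm r lin_bm[OF l])
  then obtain C where C: "\<And>t. t \<in> {0..T} \<Longrightarrow> norm (A t (y t, 0) + r t) \<le> C"
    by (rule bounded_measurable_bound) blast
  have "((\<lambda>t. p t \<bullet> (A t (y t, 0) + r t) + (- fst (blinfun_adj (A t) (p t))) \<bullet> y t) has_integral (p b \<bullet> y b - p 0 \<bullet> y 0)) {0..b}"
  proof (rule has_integral_inner_product_rule[where B = B and C = C])
    show "0 \<le> b" using b by simp
    fix t assume t: "t \<in> {0..b}"
    show "((\<lambda>s. - fst (blinfun_adj (A s) (p s))) has_integral (p t - p 0)) {0..t}" by (rule costate_increment[OF p t])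
    show "((\<lambda>s. A s (y s, 0) + r s) has_integral (y t - y 0)) {0..t}"
      using lin_integral[OF l, of t] t b by (simp add: lin_0[OF l])
    show "norm (- fst (blinfun_adj (A t) (p t))) \<le> B" by (rule B[OF t])
    show "norm (A t (y t, 0) + r t) \<le> C" by (rule C) (use t b in auto)
  qed
  moreover have "p t \<bullet> (A t (y t, 0) + r t) + (- fst (blinfun_adj (A t) (p t))) \<bullet> y t = p t \<bullet> r t" for t
  proof -
    have "p t \<bullet> A t (y t, 0) = fst (blinfun_adj (A t) (p t)) \<bullet> y t"
      using blinfun_adj_inner[of "A t" "p t" "(y t, 0)"] by (simp add: inner_prod_def)
    then show ?thesis by (simp add: inner_add_right)
  qed
  ultimately show ?thesis using costate_end[OF p] b by (simp add: lin_0[OF l])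
qed

text \<open>In rescaled time the crossing instant is fixed at \<open>\<tau>\<close>, and the time spent outside of \<open>K\<close> by a
  competitor with \<open>g \<le> 0\<close> on \<open>[0,\<tau>]\<close> is at most \<open>T - (\<tau> + d)\<close>. This gives an inequality constraint
  at \<open>\<tau>\<close>, so no equality constraint has to be corrected for.\<close>

lemma rescaled_optimality:
  assumes d: "0 < \<tau> + d" "\<tau> + d < T" and w: "bounded_measurable T w"
    and adm: "\<And>t i. t \<in> {0..T} \<Longrightarrow> c (w t) $ i \<le> 0"
    and zc: "continuous_on {0..T} z" and z0: "z 0 = x 0"
    and z: "\<And>t. t \<in> {0..T} \<Longrightarrow> ((\<lambda>s. (1 + rho T \<tau> s * d) *\<^sub>R f (z s, w s)) has_integral (z t - x 0)) {0..t}"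
    and gz: "\<And>t. t \<in> {0..\<tau>} \<Longrightarrow> g (z t) \<le> 0"
  shows "\<phi> (x T) \<le> \<phi> (z T) - d"
proof -
  have "bounded_measurable T (\<lambda>t. f (z t, w t))"
    using bounded_measurable_compose[OF bounded_measurable_Pair[OF bounded_measurable_continuous[OF zc] w] f_cont] .
  then obtain B where B: "\<And>t. t \<in> {0..T} \<Longrightarrow> norm (f (z t, w t)) \<le> B" by (rule bounded_measurable_bound) blast
  obtain v y where v: "v \<in> borel_measurable (lebesgue_on {0..T})" and y: "is_state T f (z 0) v y"
    and vw: "\<And>t. t \<in> {0..T} \<Longrightarrow> \<exists>s\<in>{0..T}. v t = w s" and yT: "y T = z T"
    and yz: "\<And>t. t \<in> {0..\<tau> + d} \<Longrightarrow> \<exists>s\<in>{0..\<tau>}. y t = z s"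
  proof (rule rescaled_state[where z = z and f = f and w = w and B = B, OF \<tau> d bounded_measurableD[OF w] B])
    show "((\<lambda>s. (1 + rho T \<tau> s * d) *\<^sub>R f (z s, w s)) has_integral (z t - z 0)) {0..t}" if "t \<in> {0..T}" for t
      using z[OF that] by (simp add: z0)
  qed auto
  have "\<phi> (x T) + (T - \<tau>) \<le> crisis_cost T \<phi> {z. g z \<le> 0} y"
  proof (rule opt[OF v])
    show "c (v t) $ i \<le> 0" if "t \<in> {0..T}" for t i using vw[OF that] adm by metis
    show "is_state T f (x 0) v y" using y by (simp add: z0)
  qed
  also have "crisis_cost T \<phi> {z. g z \<le> 0} y \<le> \<phi> (z T) + (T - (\<tau> + d))"
  proof -
    \<comment> \<open>After \<open>\<tau> + d\<close> the competitor may be anywhere. Counting all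
      that time as spent outside of \<open>K\<close> bounds its cost from above, which is the
      direction needed to exploit optimality.\<close>
    have *: "indicator (- {z. g z \<le> 0}) (y t) \<le> (indicator {\<tau> + d<..T} t :: real)" if t: "t \<in> {0..T}" for t
    proof (cases "t \<le> \<tau> + d")
      case True
      then obtain s where "s \<in> {0..\<tau>}" "y t = z s" using yz[of t] t by auto
      with gz show ?thesis by simp
    next
      case False
      then show ?thesis using t by (simp add: indicator_def)
    qed
    have sub: "{\<tau> + d<..T} \<inter> {0..T} = {\<tau> + d<..T}" "{0..T} \<inter> {\<tau> + d<..T} = {\<tau> + d<..T}" using d by auto
    then have sub': "{\<tau> + d<..T} \<subseteq> {0..T}" by blast
    then have S: "{\<tau> + d<..T} \<in> sets (lebesgue_on {0..T})" by (simp add: sets_restrict_space_iff)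
    have m: "emeasure (lebesgue_on {0..T}) {\<tau> + d<..T} = ennreal (T - (\<tau> + d))"
      using d sub' by (subst emeasure_restrict_space) auto
    have "(LINT t|lebesgue_on {0..T}. indicator (- {z. g z \<le> 0}) (y t)) \<le> (LINT t|lebesgue_on {0..T}. (indicator {\<tau> + d<..T} t :: real))"
    proof (rule integral_mono')
      show "integrable (lebesgue_on {0..T}) (indicator {\<tau> + d<..T} :: real \<Rightarrow> real)"
        by (rule integrable_real_indicator[OF S]) (simp add: m)
    qed (use * in \<open>auto simp: indicator_def\<close>)
    also have "\<dots> = T - (\<tau> + d)"
    proof -
      have "measure (lebesgue_on {0..T}) {\<tau> + d<..T} = T - (\<tau> + d)"
        using d by (simp add: measure_def m)
      then show ?thesis by (simp add: sub)
    qed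
    finally show ?thesis by (simp add: crisis_cost_def yT)
  qed
  finally show ?thesis by simp
qed

end

subsection \<open>Second-order perturbations\<close>

context crossing_problem
begin

text \<open>For the control \<open>u + s du + s\<^sup>2 v\<close> and the crossing time \<open>\<tau> + s dt + s\<^sup>2 sg\<close>, the state expands as
  \<open>x + s dx + s\<^sup>2 y\<close>, where \<open>dx\<close> and \<open>y\<close> solve the linearized equation with the source terms
  \<open>src1 du dt\<close> and \<open>src1 v sg + src2 du dt dx\<close>.\<close>

definition src1 :: "(real \<Rightarrow> real^'m) \<Rightarrow> real \<Rightarrow> real \<Rightarrow> real^'n" where
  "src1 du dt t = A t (0, du t) + (rho T \<tau> t * dt) *\<^sub>R f (x t, u t)"

definition src2 :: "(real \<Rightarrow> real^'m) \<Rightarrow> real \<Rightarrow> (real \<Rightarrow> real^'n) \<Rightarrow> real \<Rightarrow> real^'n" where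
  "src2 du dt dx t = (1/2) *\<^sub>R f'' (x t, u t) (dx t, du t) (dx t, du t) + (rho T \<tau> t * dt) *\<^sub>R A t (dx t, du t)"

lemma src1_bm: "bounded_measurable T du \<Longrightarrow> bounded_measurable T (src1 du dt)"
  unfolding src1_def[abs_def] by (intro bounded_measurable_intros A_bm f_xu)

lemma src2_bm: "bounded_measurable T du \<Longrightarrow> bounded_measurable T dx \<Longrightarrow> bounded_measurable T (src2 du dt dx)"
  unfolding src2_def[abs_def]
  by (intro bounded_measurable_intros A_bm bounded_measurable_blinfun2[OF f''_cont xu])

definition rho_bound :: real where "rho_bound = 1 / \<tau> + 1 / (T - \<tau>)"

lemma rho_bound: "\<bar>rho T \<tau> t\<bar> \<le> rho_bound" "rho_bound > 0"
  using \<tau> by (auto simp: rho_bound_def rho_def add_pos_pos)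

text \<open>The source terms are the coefficients of \<open>s\<close> and \<open>s\<^sup>2\<close>
  in the product of the time factor with the Taylor expansion of \<open>f\<close>. What is left over
  is the Taylor remainder and products of order \<open>s ^ 3\<close>, both controlled uniformly in
  time.\<close>

lemma perturbed_residual:
  assumes du: "bounded_measurable T du" and v: "bounded_measurable T v" and dx: "bounded_measurable T dx"
    and y: "bounded_measurable T y" and "e > 0"
  shows "\<exists>s0>0. \<forall>s t. 0 < s \<and> s \<le> s0 \<and> t \<in> {0..T} \<longrightarrow>
    norm ((1 + rho T \<tau> t * (s * dt + s\<^sup>2 * sg)) *\<^sub>R f (x t + s *\<^sub>R dx t + s\<^sup>2 *\<^sub>R y t, u t + s *\<^sub>R du t + s\<^sup>2 *\<^sub>R v t) -
      (f (x t, u t) + s *\<^sub>R (A t (dx t, 0) + src1 du dt t) + s\<^sup>2 *\<^sub>R (A t (y t, 0) + (src1 v sg t + src2 du dt dx t)))) \<le> e * s\<^sup>2"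
proof -
  define D1 where "D1 t = A t (dx t, du t)" for t
  define D2 where "D2 t = A t (y t, v t) + (1/2) *\<^sub>R f'' (x t, u t) (dx t, du t) (dx t, du t)" for t
  have D1: "bounded_measurable T D1" unfolding D1_def[abs_def] by (intro bounded_measurable_intros A_bm du dx)
  have D2: "bounded_measurable T D2" unfolding D2_def[abs_def]
    by (intro bounded_measurable_intros A_bm bounded_measurable_blinfun2[OF f''_cont xu] du dx v y)
  have dd: "bounded_measurable T (\<lambda>t. (dx t, du t))" and yv: "bounded_measurable T (\<lambda>t. (y t, v t))"
    by (intro bounded_measurable_intros du dx v y)+
  obtain B1 where B1: "B1 \<ge> 0" "\<And>t. t \<in> {0..T} \<Longrightarrow> norm (x t, u t) \<le> B1" by (rule bounded_measurable_bound[OF xu]) blast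
  obtain B2 where B2: "B2 \<ge> 0" "\<And>t. t \<in> {0..T} \<Longrightarrow> norm (dx t, du t) \<le> B2" by (rule bounded_measurable_bound[OF dd]) blast
  obtain B3 where B3: "B3 \<ge> 0" "\<And>t. t \<in> {0..T} \<Longrightarrow> norm (y t, v t) \<le> B3" by (rule bounded_measurable_bound[OF yv]) blast
  obtain B4 where B4: "B4 \<ge> 0" "\<And>t. t \<in> {0..T} \<Longrightarrow> norm (D1 t) \<le> B4" by (rule bounded_measurable_bound[OF D1]) blast
  obtain B5 where B5: "B5 \<ge> 0" "\<And>t. t \<in> {0..T} \<Longrightarrow> norm (D2 t) \<le> B5" by (rule bounded_measurable_bound[OF D2]) blast
  note B = B1(2) B2(2) B3(2) B4(2) B5(2) and B0 = B1(1) B2(1) B3(1) B4(1) B5(1)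
  define M where "M = B1 + B2 + B3"
  have M: "M \<ge> 0" "B1 \<le> M" "B2 \<le> M" "B3 \<le> M" using B0 by (auto simp: M_def)
  \<comment> \<open>The Taylor remainder is multiplied by the time factor, which is at most 2, and
    takes two thirds of the error. The last third is for the products of order
    \<open>s ^ 3\<close>.\<close>
  define e1 where "e1 = e / 3"
  have "e1 > 0" using \<open>e > 0\<close> by (simp add: e1_def)
  from second_order_taylor_uniform[OF f' f'' f''_cont \<open>M \<ge> 0\<close> this]
  obtain s1 where "s1 > 0" and taylor: "\<And>s z a b. 0 < s \<Longrightarrow> s \<le> s1 \<Longrightarrow> norm z \<le> M \<Longrightarrow> norm a \<le> M \<Longrightarrow> norm b \<le> M \<Longrightarrow>
    norm (f (z + s *\<^sub>R a + s\<^sup>2 *\<^sub>R b) - f z - s *\<^sub>R f' z a - s\<^sup>2 *\<^sub>R (f' z b + (1/2) *\<^sub>R f'' z a a)) \<le> e1 * s\<^sup>2"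
    by metis
  define P where "P = rho_bound"
  have P: "P > 0" "\<And>t. \<bar>rho T \<tau> t\<bar> \<le> P" using rho_bound by (auto simp: P_def)
  define k where "k = \<bar>dt\<bar> + \<bar>sg\<bar>"
  define C where "C = P * k * (B4 + B5) + 1"
  have k: "k \<ge> 0" by (simp add: k_def)
  have C: "C > 0" using P B0 k by (auto simp: C_def intro!: add_nonneg_pos)
  define s0 where "s0 = Min {1, s1, 1 / (P * k + 1), e1 / C}"
  have Pk: "P * k + 1 > 0" using P k by (intro add_nonneg_pos) auto
  have s0: "s0 > 0" "s0 \<le> 1" "s0 \<le> s1" "s0 \<le> 1 / (P * k + 1)" "s0 \<le> e1 / C"
    using \<open>s1 > 0\<close> \<open>e1 > 0\<close> C Pk by (auto simp: s0_def)
  show ?thesis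
  proof (intro exI[of _ s0] conjI allI impI; (elim conjE)?)
    show "s0 > 0" by fact
    fix s t assume s: "0 < s" "s \<le> s0" and t: "t \<in> {0..T}"
    define d where "d = s * dt + s\<^sup>2 * sg"
    define r where "r = rho T \<tau> t"
    have s1: "s \<le> 1" "s\<^sup>2 \<le> s" using s s0 by (auto simp: power2_eq_square mult_left_le_one_le)
    have "\<bar>d\<bar> \<le> s * \<bar>dt\<bar> + s\<^sup>2 * \<bar>sg\<bar>" unfolding d_def using s abs_triangle_ineq[of "s * dt" "s\<^sup>2 * sg"] by (simp add: abs_mult)
    also have "\<dots> \<le> s * \<bar>dt\<bar> + s * \<bar>sg\<bar>" using s1 by (intro add_left_mono mult_right_mono) auto
    finally have d: "\<bar>d\<bar> \<le> s * k" by (simp add: k_def algebra_simps)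
    have rd: "\<bar>r * d\<bar> \<le> P * (s * k)" unfolding abs_mult r_def using P d by (intro mult_mono) auto
    have "s * (P * k + 1) \<le> 1" using order_trans[OF s(2) s0(4)] Pk by (simp only: pos_le_divide_eq)
    then have rd1: "\<bar>r * d\<bar> \<le> 1" using rd s(1) by (simp add: algebra_simps)
    define E where "E = f (x t + s *\<^sub>R dx t + s\<^sup>2 *\<^sub>R y t, u t + s *\<^sub>R du t + s\<^sup>2 *\<^sub>R v t) - f (x t, u t) - s *\<^sub>R D1 t - s\<^sup>2 *\<^sub>R D2 t"
    have E: "norm E \<le> e1 * s\<^sup>2"
      using taylor[of s "(x t, u t)" "(dx t, du t)" "(y t, v t)"] s s0 B[OF t] M
      by (simp add: E_def D1_def D2_def)
    have sp1: "A t (dx t, 0) + A t (0, du t) = D1 t" by (simp add: D1_def flip: blinfun.add_right)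
    have sp2: "A t (y t, 0) + A t (0, v t) = A t (y t, v t)" by (simp flip: blinfun.add_right)
    have l: "A t (dx t, 0) + src1 du dt t = D1 t + (r * dt) *\<^sub>R f (x t, u t)"
      by (simp add: src1_def r_def flip: sp1)
    have q: "A t (y t, 0) + (src1 v sg t + src2 du dt dx t) = D2 t + (r * sg) *\<^sub>R f (x t, u t) + (r * dt) *\<^sub>R D1 t"
      by (simp add: src1_def src2_def r_def D2_def D1_def flip: sp2)
    have F: "f (x t + s *\<^sub>R dx t + s\<^sup>2 *\<^sub>R y t, u t + s *\<^sub>R du t + s\<^sup>2 *\<^sub>R v t) = f (x t, u t) + s *\<^sub>R D1 t + s\<^sup>2 *\<^sub>R D2 t + E"
      by (simp add: E_def)
    have "(1 + r * d) *\<^sub>R (f (x t, u t) + s *\<^sub>R D1 t + s\<^sup>2 *\<^sub>R D2 t + E) -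
      (f (x t, u t) + s *\<^sub>R (D1 t + (r * dt) *\<^sub>R f (x t, u t)) + s\<^sup>2 *\<^sub>R (D2 t + (r * sg) *\<^sub>R f (x t, u t) + (r * dt) *\<^sub>R D1 t))
      = (r * s^3 * sg) *\<^sub>R D1 t + (r * d * s\<^sup>2) *\<^sub>R D2 t + (1 + r * d) *\<^sub>R E"
      by (simp add: d_def algebra_simps power2_eq_square power3_eq_cube)
    also have "norm \<dots> \<le> \<bar>r * s^3 * sg\<bar> * norm (D1 t) + \<bar>r * d * s\<^sup>2\<bar> * norm (D2 t) + \<bar>1 + r * d\<bar> * norm E"
      by (intro order_trans[OF norm_triangle_ineq] add_mono) (simp_all add: norm_triangle_mono)
    also have "\<dots> \<le> (P * k * s * s\<^sup>2) * B4 + (P * k * s * s\<^sup>2) * B5 + 2 * (e1 * s\<^sup>2)"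
    proof (intro add_mono mult_mono)
      have "\<bar>r\<bar> * \<bar>sg\<bar> * (s * s\<^sup>2) \<le> P * k * (s * s\<^sup>2)"
        using P(2)[of t] s by (intro mult_right_mono mult_mono) (auto simp: r_def k_def P(1) less_imp_le)
      then show "\<bar>r * s^3 * sg\<bar> \<le> P * k * s * s\<^sup>2"
        using s by (simp add: abs_mult power3_eq_cube power2_eq_square mult_ac)
      have "\<bar>r * d\<bar> * s\<^sup>2 \<le> P * (s * k) * s\<^sup>2" using rd by (intro mult_right_mono) auto
      then show "\<bar>r * d * s\<^sup>2\<bar> \<le> P * k * s * s\<^sup>2" by (simp add: abs_mult mult_ac)
      show "\<bar>1 + r * d\<bar> \<le> 2" using rd1 by linarith
    qed (use B(4,5)[OF t] E P(1) k s in auto)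
    also have "\<dots> = s\<^sup>2 * (s * (P * k * (B4 + B5)) + 2 * e1)" by (simp add: algebra_simps)
    also have "\<dots> \<le> s\<^sup>2 * (e1 + 2 * e1)"
    proof (intro mult_left_mono add_right_mono)
      have "s * (P * k * (B4 + B5)) \<le> s * C" using s by (intro mult_left_mono) (auto simp: C_def)
      also have "\<dots> \<le> e1" using s s0(5) C by (simp add: pos_le_divide_eq) (meson dual_order.trans mult_right_mono less_imp_le)
      finally show "s * (P * k * (B4 + B5)) \<le> e1" .
    qed simp
    also have "\<dots> = e * s\<^sup>2" by (simp add: e1_def)
    finally show "norm ((1 + rho T \<tau> t * (s * dt + s\<^sup>2 * sg)) *\<^sub>R f (x t + s *\<^sub>R dx t + s\<^sup>2 *\<^sub>R y t, u t + s *\<^sub>R du t + s\<^sup>2 *\<^sub>R v t) -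
      (f (x t, u t) + s *\<^sub>R (A t (dx t, 0) + src1 du dt t) + s\<^sup>2 *\<^sub>R (A t (y t, 0) + (src1 v sg t + src2 du dt dx t)))) \<le> e * s\<^sup>2"
      unfolding l q F by (simp add: r_def d_def)
  qed
qed

lemma perturbed_state:
  assumes du: "bounded_measurable T du" and v: "bounded_measurable T v"
    and dx: "lin (src1 du dt) dx" and y: "lin (\<lambda>t. src1 v sg t + src2 du dt dx t) y" and "e > 0"
  shows "\<exists>s0>0. \<forall>s. 0 < s \<and> s \<le> s0 \<longrightarrow> (\<exists>z. continuous_on {0..T} z \<and> z 0 = x 0 \<and>
    (\<forall>t\<in>{0..T}. ((\<lambda>r. (1 + rho T \<tau> r * (s * dt + s\<^sup>2 * sg)) *\<^sub>R f (z r, u r + s *\<^sub>R du r + s\<^sup>2 *\<^sub>R v r)) has_integral (z t - x 0)) {0..t}) \<and>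
    (\<forall>t\<in>{0..T}. norm (z t - (x t + s *\<^sub>R dx t + s\<^sup>2 *\<^sub>R y t)) \<le> e * s\<^sup>2))"
proof -
  note dxb = lin_bm[OF dx] and yb = lin_bm[OF y]
  obtain B1 where B1: "B1 \<ge> 0" "\<And>t. t \<in> {0..T} \<Longrightarrow> norm (x t) \<le> B1" by (rule bounded_measurable_bound[OF x]) blast
  obtain B2 where B2: "B2 \<ge> 0" "\<And>t. t \<in> {0..T} \<Longrightarrow> norm (dx t) \<le> B2" by (rule bounded_measurable_bound[OF dxb]) blast
  obtain B3 where B3: "B3 \<ge> 0" "\<And>t. t \<in> {0..T} \<Longrightarrow> norm (y t) \<le> B3" by (rule bounded_measurable_bound[OF yb]) blast
  obtain B4 where B4: "B4 \<ge> 0" "\<And>t. t \<in> {0..T} \<Longrightarrow> norm (u t) \<le> B4" by (rule bounded_measurable_bound[OF u]) blast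
  obtain B5 where B5: "B5 \<ge> 0" "\<And>t. t \<in> {0..T} \<Longrightarrow> norm (du t) \<le> B5" by (rule bounded_measurable_bound[OF du]) blast
  obtain B6 where B6: "B6 \<ge> 0" "\<And>t. t \<in> {0..T} \<Longrightarrow> norm (v t) \<le> B6" by (rule bounded_measurable_bound[OF v]) blast
  note B = B1(2) B2(2) B3(2) B4(2) B5(2) B6(2) and B0 = B1(1) B2(1) B3(1) B4(1) B5(1) B6(1)
  define R where "R = B1 + B2 + B3 + 1"
  define W where "W = B4 + B5 + B6"
  have "R > 0" "W \<ge> 0" using B0 by (auto simp: R_def W_def)
  obtain L where "L \<ge> 0" and L: "\<And>y z. norm y \<le> R + W \<Longrightarrow> norm z \<le> R + W \<Longrightarrow> norm (f y - f z) \<le> L * norm (y - z)"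
    by (rule lipschitz_on_cball[OF f' f'_cont, of "R + W"]) blast
  define k where "k = \<bar>dt\<bar> + \<bar>sg\<bar>"
  have k: "k \<ge> 0" by (simp add: k_def)
  \<comment> \<open>The residual is integrated over a time of at most \<open>T\<close> and amplified
    by the Gronwall factor \<open>exp (2 * L * T)\<close>, where \<open>2 * L\<close> is the
    Lipschitz constant including the time factor.\<close>
  define e0 where "e0 = e / (T * exp (2 * L * T) + 1)"
  have den: "T * exp (2 * L * T) + 1 > 0" using T_pos by (intro add_nonneg_pos mult_nonneg_nonneg) auto
  have "e0 > 0" using \<open>e > 0\<close> den by (simp add: e0_def)
  from perturbed_residual[OF du v dxb yb this, of dt sg]
  obtain s1 where "s1 > 0" and res: "\<And>s t. 0 < s \<Longrightarrow> s \<le> s1 \<Longrightarrow> t \<in> {0..T} \<Longrightarrow>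
    norm ((1 + rho T \<tau> t * (s * dt + s\<^sup>2 * sg)) *\<^sub>R f (x t + s *\<^sub>R dx t + s\<^sup>2 *\<^sub>R y t, u t + s *\<^sub>R du t + s\<^sup>2 *\<^sub>R v t) -
      (f (x t, u t) + s *\<^sub>R (A t (dx t, 0) + src1 du dt t) + s\<^sup>2 *\<^sub>R (A t (y t, 0) + (src1 v sg t + src2 du dt dx t)))) \<le> e0 * s\<^sup>2"
    by blast
  have Pk: "rho_bound * k + 1 > 0" using rho_bound(2) k by (intro add_nonneg_pos) auto
  \<comment> \<open>The third entry bounds the time factor by 2. The last one makes
    \<open>e * s\<^sup>2\<close> at most 1, the margin by which \<open>R\<close> exceeds the size of
    the expansion.\<close>
  define s0 where "s0 = Min {1, s1, 1 / (rho_bound * k + 1), 1 / (e + 1)}"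
  have s0: "s0 > 0" "s0 \<le> 1" "s0 \<le> s1" "s0 \<le> 1 / (rho_bound * k + 1)" "s0 \<le> 1 / (e + 1)"
    using \<open>s1 > 0\<close> \<open>e > 0\<close> Pk by (auto simp: s0_def)
  show ?thesis
  proof (intro exI[of _ s0] conjI allI impI; (elim conjE)?)
    show "s0 > 0" by fact
    fix s assume s: "0 < s" "s \<le> s0"
    have s1: "s \<le> 1" "s\<^sup>2 \<le> s" "s\<^sup>2 \<le> 1" using s s0 by (auto simp: power2_eq_square mult_left_le_one_le mult_le_one)
    define d where "d = s * dt + s\<^sup>2 * sg"
    define w where "w t = u t + s *\<^sub>R du t + s\<^sup>2 *\<^sub>R v t" for t
    define zs where "zs t = x t + s *\<^sub>R dx t + s\<^sup>2 *\<^sub>R y t" for t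
    have wb: "bounded_measurable T w" unfolding w_def[abs_def] by (intro bounded_measurable_intros u du v)
    have wW: "norm (w t) \<le> W" if t: "t \<in> {0..T}" for t
    proof -
      have "norm (w t) \<le> norm (u t) + norm (s *\<^sub>R du t) + norm (s\<^sup>2 *\<^sub>R v t)"
        unfolding w_def by (rule order_trans[OF norm_triangle_ineq add_right_mono[OF norm_triangle_ineq]])
      also have "\<dots> \<le> B4 + 1 * B5 + 1 * B6" unfolding norm_scaleR
        using B[OF t] s s1 B0 by (intro add_mono mult_mono) auto
      finally show ?thesis by (simp add: W_def)
    qed
    have zR: "norm (zs t) \<le> R - 1" if t: "t \<in> {0..T}" for t
    proof -
      have "norm (zs t) \<le> norm (x t) + norm (s *\<^sub>R dx t) + norm (s\<^sup>2 *\<^sub>R y t)"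
        unfolding zs_def by (rule order_trans[OF norm_triangle_ineq add_right_mono[OF norm_triangle_ineq]])
      also have "\<dots> \<le> B1 + 1 * B2 + 1 * B3" unfolding norm_scaleR
        using B[OF t] s s1 B0 by (intro add_mono mult_mono) auto
      finally show ?thesis by (simp add: R_def)
    qed
    have "\<bar>d\<bar> \<le> s * \<bar>dt\<bar> + s\<^sup>2 * \<bar>sg\<bar>" unfolding d_def using s abs_triangle_ineq[of "s * dt" "s\<^sup>2 * sg"] by (simp add: abs_mult)
    also have "\<dots> \<le> s * \<bar>dt\<bar> + s * \<bar>sg\<bar>" using s1 by (intro add_left_mono mult_right_mono) auto
    finally have d: "\<bar>d\<bar> \<le> s * k" by (simp add: k_def algebra_simps)
    have sk: "s * (rho_bound * k + 1) \<le> 1" using order_trans[OF s(2) s0(4)] Pk by (simp only: pos_le_divide_eq)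
    have rd: "\<bar>1 + rho T \<tau> t * d\<bar> \<le> 2" for t
    proof -
      have "\<bar>rho T \<tau> t * d\<bar> \<le> rho_bound * (s * k)" unfolding abs_mult using rho_bound d by (intro mult_mono) (auto simp: less_imp_le)
      also have "\<dots> \<le> 1" using sk s(1) by (simp add: algebra_simps)
      finally show ?thesis by linarith
    qed
    \<comment> \<open>The metric projection onto a ball is nonexpansive, so freezing does not
      enlarge the Lipschitz constant.\<close>
    define \<pi> where "\<pi> = closest_point (cball (0 :: real^'n) R)"
    have \<pi>_in: "norm (\<pi> q) \<le> R" for q
      using closest_point_in_set[of "cball (0 :: real^'n) R" q] \<open>R > 0\<close> by (auto simp: \<pi>_def)
    have \<pi>_self: "norm q \<le> R \<Longrightarrow> \<pi> q = q" for q by (simp add: \<pi>_def closest_point_self)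
    have \<pi>_lip: "norm (\<pi> q - \<pi> q') \<le> norm (q - q')" for q q'
      using closest_point_lipschitz[of "cball (0 :: real^'n) R" q q'] \<open>R > 0\<close> by (auto simp: \<pi>_def dist_norm)
    have \<pi>_cont: "continuous_on S \<pi>" for S
      using continuous_on_closest_point[of "cball (0 :: real^'n) R" S] \<open>R > 0\<close> by (auto simp: \<pi>_def)
    define h where "h t q = (1 + rho T \<tau> t * d) *\<^sub>R f (\<pi> q, w t)" for t q
    have hb: "bounded_measurable T (\<lambda>t. h t (q t))" if "continuous_on {0..T} q" for q
    proof -
      have "continuous_on {0..T} (\<lambda>t. \<pi> (q t))" by (rule continuous_on_compose2[OF \<pi>_cont that]) auto
      then have "bounded_measurable T (\<lambda>t. f (\<pi> (q t), w t))"
        by (intro bounded_measurable_compose[OF bounded_measurable_Pair f_cont] bounded_measurable_continuous wb)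
      then show ?thesis unfolding h_def by (intro bounded_measurable_intros)
    qed
    have hlip: "norm (h t q - h t q') \<le> (2 * L) * norm (q - q')" if t: "t \<in> {0..T}" for t q q'
    proof -
      have "norm (f (\<pi> q, w t) - f (\<pi> q', w t)) \<le> L * norm ((\<pi> q, w t) - (\<pi> q', w t))"
        by (rule L; rule order_trans[OF norm_Pair_le add_mono[OF \<pi>_in wW[OF t]]])
      also have "\<dots> \<le> L * norm (q - q')" using \<pi>_lip \<open>L \<ge> 0\<close> by (intro mult_left_mono) auto
      finally have "\<bar>1 + rho T \<tau> t * d\<bar> * norm (f (\<pi> q, w t) - f (\<pi> q', w t)) \<le> 2 * (L * norm (q - q'))"
        using rd[of t] by (intro mult_mono) auto
      then show ?thesis by (simp add: h_def flip: scaleR_diff_right)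
    qed
    have "\<exists>z. continuous_on {0..T} z \<and> (\<forall>t\<in>{0..T}. ((\<lambda>s. h s (z s)) has_integral (z t - x 0)) {0..t})"
    proof (rule caratheodory_existence[OF T_pos _ hlip])
      show "(\<lambda>t. h t (q t)) integrable_on {0..T}" if "continuous_on {0..T} q" for q
        by (rule bounded_measurable_integrable_on[OF hb[OF that]]) auto
    qed
    then obtain z where zc: "continuous_on {0..T} z" and z: "\<And>t. t \<in> {0..T} \<Longrightarrow> ((\<lambda>s. h s (z s)) has_integral (z t - x 0)) {0..t}"
      by blast
    have z0: "z 0 = x 0"
    proof -
      have "((\<lambda>s. h s (z s)) has_integral (z 0 - x 0)) {0}" using z[of 0] T_pos by simp
      from has_integral_unique[OF this has_integral_refl(2)] show ?thesis by simp
    qed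
    define k0 where "k0 t = f (x t, u t) + s *\<^sub>R (A t (dx t, 0) + src1 du dt t) + s\<^sup>2 *\<^sub>R (A t (y t, 0) + (src1 v sg t + src2 du dt dx t))" for t
    have k0: "(k0 has_integral (zs t - x 0)) {0..t}" if t: "t \<in> {0..T}" for t
    proof -
      have "(k0 has_integral ((x t - x 0) + s *\<^sub>R dx t + s\<^sup>2 *\<^sub>R y t)) {0..t}"
        unfolding k0_def by (intro has_integral_add has_integral_cmul sol[OF t] lin_integral[OF dx t] lin_integral[OF y t])
      then show ?thesis by (simp add: zs_def algebra_simps)
    qed
    have zsc: "continuous_on {0..T} zs" unfolding zs_def by (intro continuous_intros x_cont lin_cont[OF dx] lin_cont[OF y])
    have gap: "norm (z t - zs t) \<le> e * s\<^sup>2" if t: "t \<in> {0..T}" for t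
    proof -
      have cont: "continuous_on {0..T} (\<lambda>t. norm (z t - zs t))" by (intro continuous_intros zc zsc)
      have "norm (z t - zs t) \<le> (T * (e0 * s\<^sup>2)) * exp (2 * L * (t - 0))"
      proof (rule gronwall[OF cont _ _ t])
        show "0 \<le> 2 * L" using \<open>L \<ge> 0\<close> by simp
        fix r assume r: "r \<in> {0..T}"
        have ci: "(\<lambda>q. norm (z q - zs q)) integrable_on {0..r}"
          by (rule integrable_continuous_real[OF continuous_on_subset[OF cont]]) (use r in auto)
        have "((\<lambda>q. h q (z q) - k0 q) has_integral ((z r - x 0) - (zs r - x 0))) {0..r}"
          by (intro has_integral_diff z k0 r)
        then have i: "((\<lambda>q. h q (z q) - k0 q) has_integral (z r - zs r)) {0..r}" by simp
        have "norm (z r - zs r) = norm (integral {0..r} (\<lambda>q. h q (z q) - k0 q))"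
          using i by (simp add: integral_unique)
        also have "\<dots> \<le> integral {0..r} (\<lambda>q. 2 * L * norm (z q - zs q) + e0 * s\<^sup>2)"
        proof (rule integral_norm_bound_integral)
          show "(\<lambda>q. h q (z q) - k0 q) integrable_on {0..r}" using i by blast
          show "(\<lambda>q. 2 * L * norm (z q - zs q) + e0 * s\<^sup>2) integrable_on {0..r}"
            by (intro integrable_add integrable_on_mult_right ci integrable_const_ivl)
          fix q assume "q \<in> {0..r}"
          then have q: "q \<in> {0..T}" using r by auto
          have "h q (zs q) = (1 + rho T \<tau> q * d) *\<^sub>R f (zs q, w q)" using zR[OF q] by (simp add: h_def \<pi>_self)
          then have "norm (h q (zs q) - k0 q) \<le> e0 * s\<^sup>2"
            using res[of s q] s s0(3) q by (simp add: k0_def d_def w_def zs_def)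
          moreover have "norm (h q (z q) - h q (zs q)) \<le> 2 * L * norm (z q - zs q)" by (rule hlip[OF q])
          moreover have "h q (z q) - k0 q = (h q (z q) - h q (zs q)) + (h q (zs q) - k0 q)" by simp
          ultimately show "norm (h q (z q) - k0 q) \<le> 2 * L * norm (z q - zs q) + e0 * s\<^sup>2"
            by (metis norm_triangle_mono)
        qed
        also have "\<dots> = 2 * L * integral {0..r} (\<lambda>q. norm (z q - zs q)) + integral {0..r} (\<lambda>q. e0 * s\<^sup>2)"
          using ci by (subst Henstock_Kurzweil_Integration.integral_add) (auto intro: integrable_on_mult_right)
        also have "integral {0..r} (\<lambda>q. e0 * s\<^sup>2) = r * (e0 * s\<^sup>2)" using r by simp
        also have "\<dots> \<le> T * (e0 * s\<^sup>2)" using r \<open>e0 > 0\<close> by (intro mult_right_mono) auto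
        finally show "norm (z r - zs r) \<le> T * (e0 * s\<^sup>2) + 2 * L * integral {0..r} (\<lambda>q. norm (z q - zs q))" by simp
      qed
      also have "\<dots> \<le> (T * (e0 * s\<^sup>2)) * exp (2 * L * T)"
        using t \<open>L \<ge> 0\<close> \<open>e0 > 0\<close> T_pos by (intro mult_left_mono) (auto intro!: mult_left_mono)
      also have "\<dots> = (T * exp (2 * L * T)) * e0 * s\<^sup>2" by (simp add: mult_ac)
      also have "\<dots> \<le> (T * exp (2 * L * T) + 1) * e0 * s\<^sup>2"
        using \<open>e0 > 0\<close> by (intro mult_right_mono) auto
      also have "(T * exp (2 * L * T) + 1) * e0 = e" using den by (simp add: e0_def)
      finally show ?thesis .
    qed
    have zin: "norm (z t) \<le> R" if t: "t \<in> {0..T}" for t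
    proof -
      have "e * s\<^sup>2 \<le> e * s" using s1 \<open>e > 0\<close> by (intro mult_left_mono) auto
      also have "\<dots> \<le> (e + 1) * s" using s by simp
      also have "\<dots> \<le> 1" using order_trans[OF s(2) s0(5)] \<open>e > 0\<close> by (simp add: pos_le_divide_eq mult.commute)
      finally have "norm (z t - zs t) \<le> 1" using gap[OF t] by linarith
      then show ?thesis using zR[OF t] norm_triangle_ineq[of "zs t" "z t - zs t"] by simp
    qed
    show "\<exists>z. continuous_on {0..T} z \<and> z 0 = x 0 \<and>
    (\<forall>t\<in>{0..T}. ((\<lambda>r. (1 + rho T \<tau> r * (s * dt + s\<^sup>2 * sg)) *\<^sub>R f (z r, u r + s *\<^sub>R du r + s\<^sup>2 *\<^sub>R v r)) has_integral (z t - x 0)) {0..t}) \<and>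
    (\<forall>t\<in>{0..T}. norm (z t - (x t + s *\<^sub>R dx t + s\<^sup>2 *\<^sub>R y t)) \<le> e * s\<^sup>2)"
    proof (intro exI[of _ z] conjI ballI zc z0)
      fix t assume t: "t \<in> {0..T}"
      show "norm (z t - (x t + s *\<^sub>R dx t + s\<^sup>2 *\<^sub>R y t)) \<le> e * s\<^sup>2" using gap[OF t] by (simp add: zs_def)
      show "((\<lambda>r. (1 + rho T \<tau> r * (s * dt + s\<^sup>2 * sg)) *\<^sub>R f (z r, u r + s *\<^sub>R du r + s\<^sup>2 *\<^sub>R v r)) has_integral (z t - x 0)) {0..t}"
      proof (rule has_integral_eq[OF _ z[OF t]])
        fix r assume "r \<in> {0..t}"
        then have "\<pi> (z r) = z r" using t by (intro \<pi>_self zin) auto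
        then show "h r (z r) = (1 + rho T \<tau> r * (s * dt + s\<^sup>2 * sg)) *\<^sub>R f (z r, u r + s *\<^sub>R du r + s\<^sup>2 *\<^sub>R v r)"
          by (simp add: h_def d_def w_def)
      qed
    qed
  qed
qed

end

subsection \<open>Transversality of the crossing\<close>

lemma has_integral_nonneg_spike:
  fixes h :: "real \<Rightarrow> real"
  assumes "(h has_integral i) S" "negligible N" "\<And>q. q \<in> S - N \<Longrightarrow> 0 \<le> h q"
  shows "0 \<le> i"
proof -
  have "((\<lambda>q. if q \<in> N then 0 else h q) has_integral i) S"
    by (rule has_integral_spike[OF assms(2) _ assms(1)]) auto
  then show ?thesis by (rule has_integral_nonneg) (use assms(3) in auto)
qed

text \<open>By the mean value theorem on the chord from \<open>z t\<close> to \<open>z b\<close>,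
  the increment of \<open>g\<close> is \<open>g' \<xi>\<close> applied to the integral of the
  velocity, and by continuity the integrand is nonnegative near the crossing data. No chain rule
  along the trajectory is involved. The radius \<open>r\<close> is independent of the trajectory and
  \<open>k\<close> stands for the time factor, so that perturbed trajectories are covered.\<close>

lemma transversal_increase:
  fixes g :: "'a::euclidean_space \<Rightarrow> real" and f :: "'a \<times> 'b::euclidean_space \<Rightarrow> 'a"
    and g' :: "'a \<Rightarrow> 'a \<Rightarrow>\<^sub>L real"
  assumes g': "\<And>z. (g has_derivative g' z) (at z)" and g'_cont: "continuous_on UNIV g'" and f_cont: "continuous_on UNIV f"
    and transverse: "g' x0 (f (x0, w0)) > 0"
  obtains r where "r > 0"
    "\<And>(t::real) b k z w N. t \<le> b \<Longrightarrow> ((\<lambda>q. k q *\<^sub>R f (z q, w q)) has_integral (z b - z t)) {t..b} \<Longrightarrow>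
       (\<And>q. q \<in> {t..b} \<Longrightarrow> norm (z q - x0) < r) \<Longrightarrow> negligible N \<Longrightarrow>
       (\<And>q. q \<in> {t..b} - N \<Longrightarrow> norm (w q - w0) < r \<and> k q \<ge> 0) \<Longrightarrow> g (z t) \<le> g (z b)"
proof -
  \<comment> \<open>The two arguments are kept apart because \<xi> lies on the chord, whereas
    \<open>f\<close> is evaluated on the trajectory.\<close>
  have "continuous_on UNIV (\<lambda>(q, p). g' q (f p))"
    unfolding case_prod_unfold
    by (intro continuous_intros continuous_on_compose2[OF g'_cont] continuous_on_compose2[OF f_cont]) auto
  then have "isCont (\<lambda>(q, p). g' q (f p)) (x0, (x0, w0))" by (simp add: continuous_on_eq_continuous_at)
  from this[unfolded continuous_at_eps_delta, rule_format, OF transverse]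
  obtain \<delta>0 where "\<delta>0 > 0" and \<delta>0': "\<forall>y. dist y (x0, (x0, w0)) < \<delta>0 \<longrightarrow>
    dist ((\<lambda>(q, p). g' q (f p)) y) ((\<lambda>(q, p). g' q (f p)) (x0, (x0, w0))) < g' x0 (f (x0, w0))"
    by blast
  have \<delta>0: "dist (g' q (f p)) (g' x0 (f (x0, w0))) < g' x0 (f (x0, w0))"
    if "dist (q, p) (x0, (x0, w0)) < \<delta>0" for q p
    using \<delta>0'[THEN spec, THEN mp, OF that] by simp
  define r where "r = \<delta>0 / 4"
  have "r > 0" using \<open>\<delta>0 > 0\<close> by (simp add: r_def)
  have pos: "g' q (f (a, b)) > 0" if "norm (q - x0) < r" "norm (a - x0) < r" "norm (b - w0) < r" for q a b
  proof -
    have "norm ((q, (a, b)) - (x0, (x0, w0))) \<le> norm (q - x0) + (norm (a - x0) + norm (b - w0))"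
      using norm_Pair_le[of "q - x0" "(a - x0, b - w0)"] norm_Pair_le[of "a - x0" "b - w0"] by simp
    then have "dist (q, (a, b)) (x0, (x0, w0)) < \<delta>0" using that \<open>\<delta>0 > 0\<close> by (simp add: dist_norm r_def)
    from \<delta>0[OF this] show ?thesis by (simp add: dist_real_def)
  qed
  show ?thesis
  proof (rule that[OF \<open>r > 0\<close>])
    fix t b :: real and k z w N
    assume tb: "t \<le> b" and int: "((\<lambda>q. k q *\<^sub>R f (z q, w q)) has_integral (z b - z t)) {t..b}"
      and near: "\<And>q. q \<in> {t..b} \<Longrightarrow> norm (z q - x0) < r" and N: "negligible N"
      and wk: "\<And>q. q \<in> {t..b} - N \<Longrightarrow> norm (w q - w0) < r \<and> k q \<ge> 0"
    define Z where "Z = z b - z t"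
    have gd: "((\<lambda>\<theta>. g (z t + \<theta> *\<^sub>R Z)) has_field_derivative g' (z t + \<theta> *\<^sub>R Z) Z) (at \<theta>)" for \<theta>
      unfolding has_field_derivative_def
      by (rule has_derivative_eq_rhs[OF has_derivative_compose[OF _ g', of "\<lambda>\<theta>. z t + \<theta> *\<^sub>R Z" "\<lambda>h. h *\<^sub>R Z"]])
         (auto intro!: derivative_eq_intros simp: blinfun.scaleR_right mult.commute)
    obtain \<theta> where \<theta>: "0 < \<theta>" "\<theta> < 1" and mv: "g (z t + 1 *\<^sub>R Z) - g (z t + 0 *\<^sub>R Z) = (1 - 0) * g' (z t + \<theta> *\<^sub>R Z) Z"
      using MVT2[of 0 1 "\<lambda>\<theta>. g (z t + \<theta> *\<^sub>R Z)" "\<lambda>\<theta>. g' (z t + \<theta> *\<^sub>R Z) Z"] gd by auto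
    define \<xi> where "\<xi> = z t + \<theta> *\<^sub>R Z"
    have "\<xi> = (1 - \<theta>) *\<^sub>R z t + \<theta> *\<^sub>R z b" by (simp add: \<xi>_def Z_def algebra_simps)
    moreover have "z t \<in> ball x0 r" "z b \<in> ball x0 r"
      using near[of t] near[of b] tb by (auto simp: dist_norm norm_minus_commute)
    ultimately have "\<xi> \<in> ball x0 r" using \<theta> convex_ball[of x0 r] by (auto simp: convex_def)
    then have \<xi>: "norm (\<xi> - x0) < r" by (simp add: dist_norm norm_minus_commute)
    have "((\<lambda>q. g' \<xi> (k q *\<^sub>R f (z q, w q))) has_integral g' \<xi> Z) {t..b}"
      using has_integral_linear[OF int blinfun.bounded_linear_right[of "g' \<xi>"]] by (simp add: o_def Z_def)
    then have "0 \<le> g' \<xi> Z"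
    proof (rule has_integral_nonneg_spike[where N = N])
      show "negligible N" by (rule N)
      fix q assume q: "q \<in> {t..b} - N"
      then have "0 < g' \<xi> (f (z q, w q))" using wk[OF q] by (intro pos \<xi> near) auto
      then show "0 \<le> g' \<xi> (k q *\<^sub>R f (z q, w q))" using wk[OF q] by (auto simp: blinfun.scaleR_right)
    qed
    then show "g (z t) \<le> g (z b)" using mv by (simp add: \<xi>_def Z_def)
  qed
qed

context crossing_problem
begin

text \<open>The mean value theorem and transversality make \<open>g\<close> increase along the perturbed trajectory just
  before \<open>\<tau>\<close>, so that its sign on \<open>[0,\<tau>]\<close> is decided at \<open>\<tau>\<close>.\<close>

lemma stays_inside:
  shows "\<exists>d>0. \<forall>z w k. continuous_on {0..T} z \<longrightarrow> \<bar>k\<bar> \<le> d \<longrightarrow>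
     (\<forall>t\<in>{0..T}. ((\<lambda>r. (1 + rho T \<tau> r * k) *\<^sub>R f (z r, w r)) has_integral (z t - x 0)) {0..t}) \<longrightarrow>
     (\<forall>t\<in>{0..T}. norm (z t - x t) \<le> d) \<longrightarrow> (\<forall>t\<in>{0..T}. norm (w t - u t) \<le> d) \<longrightarrow> g (z \<tau>) \<le> 0 \<longrightarrow>
     (\<forall>t\<in>{0..\<tau>}. g (z t) \<le> 0)"
proof -
  obtain r where "r > 0" and incr: "\<And>(t::real) b k z w N. t \<le> b \<Longrightarrow> ((\<lambda>q. k q *\<^sub>R f (z q, w q)) has_integral (z b - z t)) {t..b} \<Longrightarrow>
       (\<And>q. q \<in> {t..b} \<Longrightarrow> norm (z q - x \<tau>) < r) \<Longrightarrow> negligible N \<Longrightarrow>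
       (\<And>q. q \<in> {t..b} - N \<Longrightarrow> norm (w q - ul) < r \<and> k q \<ge> 0) \<Longrightarrow> g (z t) \<le> g (z b)"
    by (rule transversal_increase[OF g' g'_cont f_cont transverse]) blast
  have "isCont x \<tau>"
    using continuous_on_interior[OF x_cont, of \<tau>] \<tau> by (simp add: interior_atLeastAtMost_real)
  then obtain \<eta>1 where "\<eta>1 > 0" and \<eta>1: "\<And>t. \<bar>t - \<tau>\<bar> < \<eta>1 \<Longrightarrow> norm (x t - x \<tau>) < r / 2"
    unfolding continuous_at_eps_delta using \<open>r > 0\<close> by (metis dist_norm dist_real_def half_gt_zero)
  obtain \<eta>2 N where "\<eta>2 > 0" and N: "negligible N" and \<eta>2: "\<And>t. t \<in> {\<tau> - \<eta>2<..<\<tau>} - N \<Longrightarrow> norm (u t - ul) < r / 2"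
    using ul[of "r / 2"] \<open>r > 0\<close> by auto
  define \<eta> where "\<eta> = min \<tau> (min \<eta>1 \<eta>2) / 2"
  have \<eta>: "\<eta> > 0" "\<eta> < \<eta>1" "\<eta> < \<eta>2" "\<eta> < \<tau>" using \<open>\<eta>1 > 0\<close> \<open>\<eta>2 > 0\<close> \<tau> by (auto simp: \<eta>_def min_def)
  have "compact {0..\<tau> - \<eta>}" "{0..\<tau> - \<eta>} \<noteq> {}" using \<eta> by auto
  moreover have "continuous_on {0..\<tau> - \<eta>} (\<lambda>t. g (x t))"
    by (rule continuous_on_compose2[OF g_cont continuous_on_subset[OF x_cont]]) (use \<eta> \<tau> in auto)
  ultimately obtain tm where tm: "tm \<in> {0..\<tau> - \<eta>}" "\<forall>t\<in>{0..\<tau> - \<eta>}. g (x t) \<le> g (x tm)"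
    using continuous_attains_sup[of "{0..\<tau> - \<eta>}" "\<lambda>t. g (x t)"] by blast
  \<comment> \<open>Away from \<tau> compactness gives a uniform margin \<open>\<mu> > 0\<close>; a
    small perturbation changes \<open>g\<close> by less than that.\<close>
  define \<mu> where "\<mu> = - g (x tm)"
  have "\<mu> > 0" using g_before[of tm] tm(1) \<eta> by (simp add: \<mu>_def)
  obtain B where B: "B \<ge> 0" "\<And>t. t \<in> {0..T} \<Longrightarrow> norm (x t) \<le> B" by (rule bounded_measurable_bound[OF x]) blast
  obtain L where L: "L \<ge> 0" "\<And>p q. norm p \<le> B + 1 \<Longrightarrow> norm q \<le> B + 1 \<Longrightarrow> norm (g p - g q) \<le> L * norm (p - q)"
    by (rule lipschitz_on_cball[OF g' g'_cont, of "B + 1"]) blast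
  \<comment> \<open>The first entry keeps state and control near the crossing data, the next two
    preserve the margin \<mu> away from \<tau>, and the last keeps the time factor
    nonnegative.\<close>
  define d where "d = Min {r / 4, 1, \<mu> / (L + 1), 1 / (2 * rho_bound)}"
  have "d > 0" unfolding d_def using \<open>r > 0\<close> \<open>\<mu> > 0\<close> L(1) rho_bound(2) by (subst Min_gr_iff) auto
  moreover have "d \<le> r / 4" unfolding d_def by (rule Min_le) auto
  moreover have "d \<le> 1" unfolding d_def by (rule Min_le) auto
  moreover have "d \<le> \<mu> / (L + 1)" unfolding d_def by (rule Min_le) auto
  moreover have "d \<le> 1 / (2 * rho_bound)" unfolding d_def by (rule Min_le) auto
  ultimately have d: "d > 0" "d \<le> r / 4" "d \<le> 1" "d \<le> \<mu> / (L + 1)" "d \<le> 1 / (2 * rho_bound)" .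
  show ?thesis
  proof (intro exI[of _ d] conjI allI impI ballI)
    show "d > 0" by fact
    fix z w k t
    assume zc: "continuous_on {0..T} z" and k: "\<bar>k\<bar> \<le> d"
      and z: "\<forall>t\<in>{0..T}. ((\<lambda>r. (1 + rho T \<tau> r * k) *\<^sub>R f (z r, w r)) has_integral (z t - x 0)) {0..t}"
      and zx: "\<forall>t\<in>{0..T}. norm (z t - x t) \<le> d" and wu: "\<forall>t\<in>{0..T}. norm (w t - u t) \<le> d"
      and g\<tau>: "g (z \<tau>) \<le> 0" and t: "t \<in> {0..\<tau>}"
    show "g (z t) \<le> 0"
    proof (cases "t \<le> \<tau> - \<eta>")
      case True
      have tT: "t \<in> {0..T}" using t \<tau> by auto
      have "norm (z t) \<le> B + 1" using zx[rule_format, OF tT] B(2)[OF tT] d(3) norm_triangle_ineq[of "x t" "z t - x t"] by simp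
      then have "norm (g (z t) - g (x t)) \<le> L * norm (z t - x t)"
        using B(2)[OF tT] by (intro L(2)) auto
      also have "\<dots> \<le> L * d" using zx[rule_format, OF tT] L(1) by (intro mult_left_mono) auto
      also have "\<dots> \<le> (L + 1) * d" using d(1) by simp
      also have "\<dots> \<le> \<mu>" using d(4) L(1) by (simp add: pos_le_divide_eq mult.commute)
      finally have "g (z t) - g (x t) \<le> \<mu>" by simp
      moreover have "g (x t) \<le> - \<mu>" using tm(2)[rule_format, of t] True t by (simp add: \<mu>_def)
      ultimately show ?thesis by linarith
    next
      case False
      have \<tau>T: "\<tau> \<in> {0..T}" and tT: "t \<in> {0..T}" using t \<tau> by auto
      have near: "norm (z s - x \<tau>) < r" if s: "s \<in> {t..\<tau>}" for s
      proof -
        have sT: "s \<in> {0..T}" using s t \<tau> by auto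
        have "norm (x s - x \<tau>) < r / 2" using s False \<eta> by (intro \<eta>1) auto
        moreover have "norm (z s - x s) \<le> r / 4" using zx sT d(2) by force
        ultimately show ?thesis using norm_triangle_ineq[of "z s - x s" "x s - x \<tau>"] \<open>r > 0\<close> by simp
      qed
      have "g (z t) \<le> g (z \<tau>)"
      proof (rule incr[where k = "\<lambda>q. 1 + rho T \<tau> q * k" and w = w and N = "insert \<tau> (insert t N)"])
        have "((\<lambda>q. (1 + rho T \<tau> q * k) *\<^sub>R f (z q, w q)) has_integral (z 0 - x 0)) {0}"
          using z[rule_format, of 0] T_pos by simp
        from has_integral_unique[OF this has_integral_refl(2)]
        have z0: "((\<lambda>q. (1 + rho T \<tau> q * k) *\<^sub>R f (z q, w q)) has_integral (z s - z 0)) {0..s}" if "s \<in> {0..T}" for s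
          using z that by auto
        show "((\<lambda>q. (1 + rho T \<tau> q * k) *\<^sub>R f (z q, w q)) has_integral (z \<tau> - z t)) {t..\<tau>}"
          by (rule has_integral_increment[where a = 0 and b = T and x = z, OF z0]) (use t \<tau> in auto)
        show "negligible (insert \<tau> (insert t N))" using N by simp
        fix q assume q: "q \<in> {t..\<tau>} - insert \<tau> (insert t N)"
        then have qT: "q \<in> {0..T}" using t \<tau> by auto
        have "norm (u q - ul) < r / 2" using q False \<eta> by (intro \<eta>2) auto
        moreover have "norm (w q - u q) \<le> r / 4" using wu qT d(2) by force
        ultimately have "norm (w q - ul) < r" using norm_triangle_ineq[of "w q - u q" "u q - ul"] \<open>r > 0\<close> by simp
        moreover have "\<bar>rho T \<tau> q * k\<bar> \<le> rho_bound * d" unfolding abs_mult using rho_bound k by (intro mult_mono) (auto simp: less_imp_le)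
        moreover have "rho_bound * d \<le> 1" using d(5) rho_bound(2) by (simp add: pos_le_divide_eq mult.commute)
        ultimately show "norm (w q - ul) < r \<and> 0 \<le> 1 + rho T \<tau> q * k" by auto
      qed (use t near in auto)
      then show ?thesis using g\<tau> by linarith
    qed
  qed
qed

text \<open>A direction satisfying these strict second-order inequalities would yield better competitors.\<close>

lemma no_descent:
  assumes du: "bounded_measurable T du" and v: "bounded_measurable T v"
    and dx: "lin (src1 du dt) dx" and y: "lin (\<lambda>t. src1 v sg t + src2 du dt dx t) y"
    and "\<kappa> > 0" and "\<theta> > 0"
    and act: "\<And>t i. t \<in> {0..T} \<Longrightarrow> c (u t) $ i \<ge> - \<kappa> \<Longrightarrow> c' (u t) (du t) $ i = 0 \<and>
      c' (u t) (v t) $ i + (1/2) * c'' (u t) (du t) (du t) $ i \<le> - \<theta>"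
    and \<phi>1: "\<phi>' (x T) (dx T) - dt \<le> 0" and g1: "g' (x \<tau>) (dx \<tau>) \<le> 0"
    and \<phi>2: "\<phi>' (x T) (y T) + (1/2) * \<phi>'' (x T) (dx T) (dx T) - sg < 0"
    and g2: "g' (x \<tau>) (y \<tau>) + (1/2) * g'' (x \<tau>) (dx \<tau>) (dx \<tau>) < 0"
  shows False
proof -
  note dxb = lin_bm[OF dx] and yb = lin_bm[OF y]
  obtain B1 where B1: "B1 \<ge> 0" "\<And>t. t \<in> {0..T} \<Longrightarrow> norm (x t) \<le> B1" by (rule bounded_measurable_bound[OF x]) blast
  obtain B2 where B2: "B2 \<ge> 0" "\<And>t. t \<in> {0..T} \<Longrightarrow> norm (dx t) \<le> B2" by (rule bounded_measurable_bound[OF dxb]) blast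
  obtain B3 where B3: "B3 \<ge> 0" "\<And>t. t \<in> {0..T} \<Longrightarrow> norm (y t) \<le> B3" by (rule bounded_measurable_bound[OF yb]) blast
  obtain B4 where B4: "B4 \<ge> 0" "\<And>t. t \<in> {0..T} \<Longrightarrow> norm (u t) \<le> B4" by (rule bounded_measurable_bound[OF u]) blast
  obtain B5 where B5: "B5 \<ge> 0" "\<And>t. t \<in> {0..T} \<Longrightarrow> norm (du t) \<le> B5" by (rule bounded_measurable_bound[OF du]) blast
  obtain B6 where B6: "B6 \<ge> 0" "\<And>t. t \<in> {0..T} \<Longrightarrow> norm (v t) \<le> B6" by (rule bounded_measurable_bound[OF v]) blast
  define M where "M = B1 + B2 + B3 + B4 + B5 + B6 + 1"
  have M0: "M \<ge> 0" "B1 + B2 + B3 + 1 \<le> M" using B1 B2 B3 B4 B5 B6 by (auto simp: M_def)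
  have M: "norm (x t) \<le> M" "norm (dx t) \<le> M" "norm (y t) \<le> M" "norm (u t) \<le> M" "norm (du t) \<le> M" "norm (v t) \<le> M" if "t \<in> {0..T}" for t
    using B1(1) B1(2)[OF that] B2(1) B2(2)[OF that] B3(1) B3(2)[OF that] B4(1) B4(2)[OF that] B5(1) B5(2)[OF that] B6(1) B6(2)[OF that]
    by (auto simp: M_def)
  obtain L\<phi> where L\<phi>: "L\<phi> \<ge> 0" "\<And>p q. norm p \<le> M \<Longrightarrow> norm q \<le> M \<Longrightarrow> norm (\<phi> p - \<phi> q) \<le> L\<phi> * norm (p - q)"
    by (rule lipschitz_on_cball[OF \<phi>' \<phi>'_cont, of M]) blast
  obtain Lg where Lg: "Lg \<ge> 0" "\<And>p q. norm p \<le> M \<Longrightarrow> norm q \<le> M \<Longrightarrow> norm (g p - g q) \<le> Lg * norm (p - q)"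
    by (rule lipschitz_on_cball[OF g' g'_cont, of M]) blast
  obtain Lc where Lc: "Lc \<ge> 0" "\<And>p q. norm p \<le> 3 * M \<Longrightarrow> norm q \<le> 3 * M \<Longrightarrow> norm (c p - c q) \<le> Lc * norm (p - q)"
    by (rule lipschitz_on_cball[OF c' c'_cont, of "3 * M"]) blast
  define m\<phi> where "m\<phi> = - (\<phi>' (x T) (y T) + (1/2) * \<phi>'' (x T) (dx T) (dx T) - sg)"
  define mg where "mg = - (g' (x \<tau>) (y \<tau>) + (1/2) * g'' (x \<tau>) (dx \<tau>) (dx \<tau>))"
  have m: "m\<phi> > 0" "mg > 0" using \<phi>2 g2 by (auto simp: m\<phi>_def mg_def)
  \<comment> \<open>Each strict margin is split into thirds: one for the distance between the state
    and its expansion, measured by a Lipschitz constant, one for the Taylor remainder, and one that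
    survives.\<close>
  define e where "e = Min {m\<phi> / (3 * (L\<phi> + 1)), mg / (3 * (Lg + 1)), 1}"
  have e: "e > 0" "e \<le> m\<phi> / (3 * (L\<phi> + 1))" "e \<le> mg / (3 * (Lg + 1))" "e \<le> 1"
    using m L\<phi>(1) Lg(1) by (auto simp: e_def)
  have eL: "(L\<phi> + 1) * e \<le> m\<phi> / 3" "(Lg + 1) * e \<le> mg / 3"
    using e(2,3) L\<phi>(1) Lg(1) by (auto simp: field_simps)
  obtain d where "d > 0" and inside': "\<forall>z w k. continuous_on {0..T} z \<longrightarrow> \<bar>k\<bar> \<le> d \<longrightarrow>
     (\<forall>t\<in>{0..T}. ((\<lambda>r. (1 + rho T \<tau> r * k) *\<^sub>R f (z r, w r)) has_integral (z t - x 0)) {0..t}) \<longrightarrow>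
     (\<forall>t\<in>{0..T}. norm (z t - x t) \<le> d) \<longrightarrow> (\<forall>t\<in>{0..T}. norm (w t - u t) \<le> d) \<longrightarrow> g (z \<tau>) \<le> 0 \<longrightarrow>
     (\<forall>t\<in>{0..\<tau>}. g (z t) \<le> 0)"
    using stays_inside by blast
  note inside = inside'[THEN spec, THEN spec, THEN spec, THEN mp, THEN mp, THEN mp, THEN mp, THEN mp, THEN mp]
  obtain s1 where "s1 > 0" and st: "\<forall>s. 0 < s \<and> s \<le> s1 \<longrightarrow> (\<exists>z. continuous_on {0..T} z \<and> z 0 = x 0 \<and>
    (\<forall>t\<in>{0..T}. ((\<lambda>r. (1 + rho T \<tau> r * (s * dt + s\<^sup>2 * sg)) *\<^sub>R f (z r, u r + s *\<^sub>R du r + s\<^sup>2 *\<^sub>R v r)) has_integral (z t - x 0)) {0..t}) \<and>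
    (\<forall>t\<in>{0..T}. norm (z t - (x t + s *\<^sub>R dx t + s\<^sup>2 *\<^sub>R y t)) \<le> e * s\<^sup>2))"
    using perturbed_state[OF du v dx y e(1)] by blast
  obtain s2 where "s2 > 0" and t\<phi>: "\<And>s z a b. 0 < s \<Longrightarrow> s \<le> s2 \<Longrightarrow> norm z \<le> M \<Longrightarrow> norm a \<le> M \<Longrightarrow> norm b \<le> M \<Longrightarrow>
    norm (\<phi> (z + s *\<^sub>R a + s\<^sup>2 *\<^sub>R b) - \<phi> z - s *\<^sub>R \<phi>' z a - s\<^sup>2 *\<^sub>R (\<phi>' z b + (1/2) *\<^sub>R \<phi>'' z a a)) \<le> (m\<phi> / 3) * s\<^sup>2"
    using second_order_taylor_uniform[OF \<phi>' \<phi>'' \<phi>''_cont M0(1), of "m\<phi> / 3"] m by auto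
  obtain s3 where "s3 > 0" and tg: "\<And>s z a b. 0 < s \<Longrightarrow> s \<le> s3 \<Longrightarrow> norm z \<le> M \<Longrightarrow> norm a \<le> M \<Longrightarrow> norm b \<le> M \<Longrightarrow>
    norm (g (z + s *\<^sub>R a + s\<^sup>2 *\<^sub>R b) - g z - s *\<^sub>R g' z a - s\<^sup>2 *\<^sub>R (g' z b + (1/2) *\<^sub>R g'' z a a)) \<le> (mg / 3) * s\<^sup>2"
    using second_order_taylor_uniform[OF g' g'' g''_cont M0(1), of "mg / 3"] m by auto
  obtain s4 where "s4 > 0" and tc: "\<And>s z a b. 0 < s \<Longrightarrow> s \<le> s4 \<Longrightarrow> norm z \<le> M \<Longrightarrow> norm a \<le> M \<Longrightarrow> norm b \<le> M \<Longrightarrow>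
    norm (c (z + s *\<^sub>R a + s\<^sup>2 *\<^sub>R b) - c z - s *\<^sub>R c' z a - s\<^sup>2 *\<^sub>R (c' z b + (1/2) *\<^sub>R c'' z a a)) \<le> \<theta> * s\<^sup>2"
    using second_order_taylor_uniform[OF c' c'' c''_cont M0(1) \<open>\<theta> > 0\<close>] by auto
  define k where "k = \<bar>dt\<bar> + \<bar>sg\<bar> + 1"
  have "k > 0" by (simp add: k_def)
  \<comment> \<open>Keeps the shifted crossing instant in the open interval from 0 to
    \<open>T\<close> and the shift within the range of \<open>stays_inside\<close>.\<close>
  define D where "D = Min {d, \<tau>, T - \<tau>}"
  have D: "D > 0" "D \<le> d" "D \<le> \<tau>" "D \<le> T - \<tau>" using \<open>d > 0\<close> \<tau> by (auto simp: D_def)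
  have M1: "2 * M + 1 > 0" "Lc * (2 * M) + 1 > 0" using M0(1) Lc(1) by (auto intro!: add_nonneg_pos)
  define s where "s = Min {1, s1, s2, s3, s4, D / (2 * k), d / (2 * M + 1), \<kappa> / (Lc * (2 * M) + 1)}"
  have "s > 0" unfolding s_def
    using \<open>s1 > 0\<close> \<open>s2 > 0\<close> \<open>s3 > 0\<close> \<open>s4 > 0\<close> D(1) \<open>k > 0\<close> \<open>d > 0\<close> M1 \<open>\<kappa> > 0\<close>
    by (subst Min_gr_iff) auto
  moreover have "s \<le> 1" unfolding s_def by (rule Min_le) auto
  moreover have "s \<le> s1" unfolding s_def by (rule Min_le) auto
  moreover have "s \<le> s2" unfolding s_def by (rule Min_le) auto
  moreover have "s \<le> s3" unfolding s_def by (rule Min_le) auto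
  moreover have "s \<le> s4" unfolding s_def by (rule Min_le) auto
  moreover have "s \<le> D / (2 * k)" unfolding s_def by (rule Min_le) auto
  moreover have "s \<le> d / (2 * M + 1)" unfolding s_def by (rule Min_le) auto
  moreover have "s \<le> \<kappa> / (Lc * (2 * M) + 1)" unfolding s_def by (rule Min_le) auto
  ultimately have s: "s > 0" "s \<le> 1" "s \<le> s1" "s \<le> s2" "s \<le> s3" "s \<le> s4" "s \<le> D / (2 * k)" "s \<le> d / (2 * M + 1)" "s \<le> \<kappa> / (Lc * (2 * M) + 1)" .
  have sq: "s\<^sup>2 \<le> s" "s\<^sup>2 > 0" "s\<^sup>2 \<le> 1" using s(1,2) by (auto simp: power2_eq_square mult_left_le_one_le mult_le_one)
  obtain z where zc: "continuous_on {0..T} z" and z0: "z 0 = x 0"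
    and z: "\<forall>t\<in>{0..T}. ((\<lambda>r. (1 + rho T \<tau> r * (s * dt + s\<^sup>2 * sg)) *\<^sub>R f (z r, u r + s *\<^sub>R du r + s\<^sup>2 *\<^sub>R v r)) has_integral (z t - x 0)) {0..t}"
    and gap: "\<forall>t\<in>{0..T}. norm (z t - (x t + s *\<^sub>R dx t + s\<^sup>2 *\<^sub>R y t)) \<le> e * s\<^sup>2"
    using st[THEN spec, THEN mp, OF conjI[OF s(1,3)]] by blast
  define w where "w t = u t + s *\<^sub>R du t + s\<^sup>2 *\<^sub>R v t" for t
  define zs where "zs t = x t + s *\<^sub>R dx t + s\<^sup>2 *\<^sub>R y t" for t
  define dd where "dd = s * dt + s\<^sup>2 * sg"
  have ddk: "\<bar>dd\<bar> \<le> s * k"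
  proof -
    have "\<bar>dd\<bar> \<le> s * \<bar>dt\<bar> + s\<^sup>2 * \<bar>sg\<bar>" unfolding dd_def using s(1) abs_triangle_ineq[of "s * dt" "s\<^sup>2 * sg"] by (simp add: abs_mult)
    also have "\<dots> \<le> s * \<bar>dt\<bar> + s * \<bar>sg\<bar>" using sq by (intro add_left_mono mult_right_mono) auto
    finally show ?thesis using s(1) by (simp add: k_def algebra_simps)
  qed
  have "s * (2 * k) \<le> D" using s(7) \<open>k > 0\<close> by (simp add: pos_le_divide_eq)
  then have ddD: "\<bar>dd\<bar> < D" using ddk D(1) by linarith
  have sM: "s * (2 * M + 1) \<le> d" using s(8) M1(1) by (simp only: pos_le_divide_eq)
  have sc: "s * (Lc * (2 * M) + 1) \<le> \<kappa>" using s(9) M1(2) by (simp only: pos_le_divide_eq)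
  have wb: "bounded_measurable T w" unfolding w_def[abs_def] by (intro bounded_measurable_intros u du v)
  have comb: "norm (s *\<^sub>R a + s\<^sup>2 *\<^sub>R b) \<le> s * (2 * M)" if "norm a \<le> M" "norm b \<le> M" for a b :: "'z::real_normed_vector"
  proof -
    have "norm (s *\<^sub>R a + s\<^sup>2 *\<^sub>R b) \<le> s * norm a + s\<^sup>2 * norm b"
      using norm_triangle_ineq[of "s *\<^sub>R a" "s\<^sup>2 *\<^sub>R b"] s(1) by simp
    also have "\<dots> \<le> s * M + s * M" using s(1) sq(1) that by (intro add_mono mult_mono) auto
    finally show ?thesis by (simp add: mult_ac)
  qed
  have wu: "norm (w t - u t) \<le> s * (2 * M)" if t: "t \<in> {0..T}" for t
    using comb[OF M(5,6)[OF t]] by (simp add: w_def)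
  have zsM: "norm (zs t) \<le> M - 1" if t: "t \<in> {0..T}" for t
  proof -
    have "norm (zs t) \<le> norm (x t) + norm (s *\<^sub>R dx t) + norm (s\<^sup>2 *\<^sub>R y t)"
      unfolding zs_def by (rule order_trans[OF norm_triangle_ineq add_right_mono[OF norm_triangle_ineq]])
    also have "\<dots> \<le> B1 + 1 * B2 + 1 * B3" unfolding norm_scaleR
      using B1(2)[OF t] B2(2)[OF t] B3(2)[OF t] s(1,2) sq(3) B2(1) B3(1) by (intro add_mono mult_mono) auto
    finally show ?thesis using M0(2) by simp
  qed
  have es: "e * s\<^sup>2 \<le> s" using e(1,4) sq s(1) by (smt (verit) mult_left_le_one_le)
  have zM: "norm (z t) \<le> M" if t: "t \<in> {0..T}" for t
    using gap[rule_format, OF t] zsM[OF t] es s(2) norm_triangle_ineq[of "zs t" "z t - zs t"] by (simp add: zs_def)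
  have zx: "norm (z t - x t) \<le> d" if t: "t \<in> {0..T}" for t
  proof -
    have "norm (z t - x t) \<le> norm (z t - zs t) + norm (s *\<^sub>R dx t + s\<^sup>2 *\<^sub>R y t)"
      using norm_triangle_ineq[of "z t - zs t" "zs t - x t"] by (simp add: zs_def)
    also have "\<dots> \<le> s + s * (2 * M)"
      using gap[rule_format, OF t] es comb[OF M(2,3)[OF t]] by (simp add: zs_def)
    also have "\<dots> \<le> d" using sM by (simp add: algebra_simps)
    finally show ?thesis .
  qed
  have \<tau>T: "\<tau> \<in> {0..T}" "T \<in> {0..T}" using \<tau> by auto
  have "g (z \<tau>) < 0"
  proof -
    have "norm (g (z \<tau>) - g (zs \<tau>)) \<le> Lg * norm (z \<tau> - zs \<tau>)"
      using zM[OF \<tau>T(1)] zsM[OF \<tau>T(1)] by (intro Lg(2)) auto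
    also have "\<dots> \<le> Lg * (e * s\<^sup>2)" using gap \<tau>T(1) Lg(1) by (intro mult_left_mono) (auto simp: zs_def)
    also have "\<dots> \<le> ((Lg + 1) * e) * s\<^sup>2" using e(1) by (simp add: algebra_simps)
    also have "\<dots> \<le> (mg / 3) * s\<^sup>2" using eL by (intro mult_right_mono) auto
    finally have "g (z \<tau>) - g (zs \<tau>) \<le> (mg / 3) * s\<^sup>2" by (simp only: real_norm_def abs_le_iff)
    then have 1: "g (z \<tau>) \<le> g (zs \<tau>) + (mg / 3) * s\<^sup>2" by linarith
    have mg': "g' (x \<tau>) (y \<tau>) + (1/2) *\<^sub>R g'' (x \<tau>) (dx \<tau>) (dx \<tau>) = - mg" by (simp add: mg_def)
    have "norm (g (zs \<tau>) - g (x \<tau>) - s *\<^sub>R g' (x \<tau>) (dx \<tau>) - s\<^sup>2 *\<^sub>R (- mg)) \<le> (mg / 3) * s\<^sup>2"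
      using tg[OF s(1,5) M(1,2,3)[OF \<tau>T(1)]] unfolding mg' by (simp only: zs_def)
    then have "g (zs \<tau>) - g (x \<tau>) - s * g' (x \<tau>) (dx \<tau>) - s\<^sup>2 * (- mg) \<le> (mg / 3) * s\<^sup>2"
      by (simp only: real_norm_def real_scaleR_def abs_le_iff)
    then have "g (zs \<tau>) \<le> s * g' (x \<tau>) (dx \<tau>) - s\<^sup>2 * mg + (mg / 3) * s\<^sup>2" by (simp add: g_at)
    moreover have "s * g' (x \<tau>) (dx \<tau>) \<le> 0" using s(1) g1 by (intro mult_nonneg_nonpos) auto
    ultimately have "g (z \<tau>) \<le> - (mg / 3) * s\<^sup>2" using 1 by (simp add: algebra_simps)
    moreover have "(mg / 3) * s\<^sup>2 > 0" using m sq by simp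
    ultimately show ?thesis by linarith
  qed
  then have gz: "\<forall>t\<in>{0..\<tau>}. g (z t) \<le> 0"
  proof (intro inside[OF zc])
    show "\<bar>dd\<bar> \<le> d" using ddD D(2) by linarith
    show "\<forall>t\<in>{0..T}. ((\<lambda>r. (1 + rho T \<tau> r * dd) *\<^sub>R f (z r, w r)) has_integral (z t - x 0)) {0..t}"
      using z by (simp add: dd_def w_def)
    show "\<forall>t\<in>{0..T}. norm (z t - x t) \<le> d" using zx by blast
    have "s * (2 * M) \<le> d" using sM s(1) by (simp add: algebra_simps)
    then show "\<forall>t\<in>{0..T}. norm (w t - u t) \<le> d" using wu by (blast intro: order_trans)
  qed simp
  \<comment> \<open>For a nearly active constraint the first-order term vanishes and the
    second-order slack \<theta> pays for the Taylor remainder. Any other constraint starts below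
    \<open>- \<kappa>\<close>, and the control moves too little to use up this gap.\<close>
  have adm: "c (w t) $ i \<le> 0" if t: "t \<in> {0..T}" for t i
  proof (cases "c (u t) $ i \<ge> - \<kappa>")
    case True
    define r where "r = c (w t) - c (u t) - s *\<^sub>R c' (u t) (du t) - s\<^sup>2 *\<^sub>R (c' (u t) (v t) + (1/2) *\<^sub>R c'' (u t) (du t) (du t))"
    have "norm r \<le> \<theta> * s\<^sup>2" using tc[OF s(1,6) M(4,5,6)[OF t]] by (simp add: r_def w_def)
    then have ri: "r $ i \<le> \<theta> * s\<^sup>2" using component_le_norm_cart[of r i] by linarith
    have "c (w t) $ i = c (u t) $ i + s * c' (u t) (du t) $ i + s\<^sup>2 * (c' (u t) (v t) $ i + (1/2) * c'' (u t) (du t) (du t) $ i) + r $ i"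
      by (simp add: r_def)
    also have "\<dots> \<le> 0 + s * 0 + s\<^sup>2 * (- \<theta>) + \<theta> * s\<^sup>2"
      using act[OF t True] u_adm[OF t, of i] ri less_imp_le[OF s(1)] by (intro add_mono mult_left_mono) auto
    finally show ?thesis by simp
  next
    case False
    have "norm (u t) \<le> 3 * M" using M(4)[OF t] M0(1) by linarith
    moreover have "norm (w t) \<le> 3 * M"
    proof -
      have "norm (w t) \<le> norm (u t) + norm (w t - u t)" using norm_triangle_ineq[of "u t" "w t - u t"] by simp
      moreover have "s * (2 * M) \<le> 1 * (2 * M)" by (intro mult_right_mono) (use s(2) M0(1) in auto)
      ultimately show ?thesis using M(4)[OF t] wu[OF t] by linarith
    qed
    ultimately have "norm (c (w t) - c (u t)) \<le> Lc * norm (w t - u t)" by (intro Lc(2))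
    also have "\<dots> \<le> Lc * (s * (2 * M))" using wu[OF t] Lc(1) by (intro mult_left_mono)
    also have "\<dots> \<le> \<kappa>" using sc s(1) by (simp add: algebra_simps)
    finally have "(c (w t) - c (u t)) $ i \<le> \<kappa>" using component_le_norm_cart[of "c (w t) - c (u t)" i] by linarith
    then show ?thesis using False by simp
  qed
  have "\<phi> (x T) \<le> \<phi> (z T) - dd"
  proof (rule rescaled_optimality[OF _ _ wb adm zc z0])
    show "0 < \<tau> + dd" "\<tau> + dd < T" using ddD D by linarith+
    show "((\<lambda>r. (1 + rho T \<tau> r * dd) *\<^sub>R f (z r, w r)) has_integral (z t - x 0)) {0..t}" if "t \<in> {0..T}" for t
      using z that by (simp add: dd_def w_def)
    show "g (z t) \<le> 0" if "t \<in> {0..\<tau>}" for t using gz that by blast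
  qed auto
  moreover have "\<phi> (z T) - dd < \<phi> (x T)"
  proof -
    have "norm (\<phi> (z T) - \<phi> (zs T)) \<le> L\<phi> * norm (z T - zs T)"
      using zM[OF \<tau>T(2)] zsM[OF \<tau>T(2)] by (intro L\<phi>(2)) auto
    also have "\<dots> \<le> L\<phi> * (e * s\<^sup>2)" using gap \<tau>T(2) L\<phi>(1) by (intro mult_left_mono) (auto simp: zs_def)
    also have "\<dots> \<le> ((L\<phi> + 1) * e) * s\<^sup>2" using e(1) by (simp add: algebra_simps)
    also have "\<dots> \<le> (m\<phi> / 3) * s\<^sup>2" using eL by (intro mult_right_mono) auto
    finally have "\<phi> (z T) - \<phi> (zs T) \<le> (m\<phi> / 3) * s\<^sup>2" by (simp only: real_norm_def abs_le_iff)
    then have 1: "\<phi> (z T) \<le> \<phi> (zs T) + (m\<phi> / 3) * s\<^sup>2" by linarith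
    have m\<phi>': "\<phi>' (x T) (y T) + (1/2) *\<^sub>R \<phi>'' (x T) (dx T) (dx T) = sg - m\<phi>" by (simp add: m\<phi>_def)
    have "norm (\<phi> (zs T) - \<phi> (x T) - s *\<^sub>R \<phi>' (x T) (dx T) - s\<^sup>2 *\<^sub>R (sg - m\<phi>)) \<le> (m\<phi> / 3) * s\<^sup>2"
      using t\<phi>[OF s(1,4) M(1,2,3)[OF \<tau>T(2)]] unfolding m\<phi>' by (simp only: zs_def)
    then have "\<phi> (zs T) - \<phi> (x T) - s * \<phi>' (x T) (dx T) - s\<^sup>2 * (sg - m\<phi>) \<le> (m\<phi> / 3) * s\<^sup>2"
      by (simp only: real_norm_def real_scaleR_def abs_le_iff)
    then have 2: "\<phi> (zs T) \<le> \<phi> (x T) + s * \<phi>' (x T) (dx T) + s\<^sup>2 * (sg - m\<phi>) + (m\<phi> / 3) * s\<^sup>2" by linarith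
    \<comment> \<open>This is where the first inequality of the critical cone enters: the
      first-order change of the cost is not positive.\<close>
    have 3: "s * (\<phi>' (x T) (dx T) - dt) \<le> 0" using s(1) \<phi>1 by (intro mult_nonneg_nonpos) auto
    have "\<phi> (z T) - dd \<le> \<phi> (x T) - (m\<phi> / 3) * s\<^sup>2"
      using 1 2 3 by (simp add: dd_def algebra_simps)
    moreover have "(m\<phi> / 3) * s\<^sup>2 > 0" using m sq by simp
    ultimately show ?thesis by linarith
  qed
  ultimately show False by linarith
qed

end

subsection \<open>Costates and separation\<close>

text \<open>Linearity in \<open>w\<close> is hidden by Cramer's formula; it holds because both sides
  solve the same nonsingular system.\<close>

lemma dual_coef_linear:
  fixes b :: "'l::finite \<Rightarrow> 'v::real_inner"
  assumes \<epsilon>: "\<epsilon> > 0"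
    and qual: "\<And>\<xi> :: real^'l. (\<And>i. i \<notin> I \<Longrightarrow> \<xi> $ i = 0) \<Longrightarrow> \<epsilon> * norm \<xi> \<le> norm (lin_comb b \<xi>)"
  shows "dual_coef b I (r *\<^sub>R w + s *\<^sub>R w') = r *\<^sub>R dual_coef b I w + s *\<^sub>R dual_coef b I w'"
proof -
  have "det (gram b I) \<noteq> 0" by (rule det_gram_nonzero[OF \<epsilon>]) (rule qual, blast)
  then obtain B where B: "B ** gram b I = mat 1" by (metis invertible_det_nz invertible_left_inverse)
  have inj: "X = Y" if "gram b I *v X = gram b I *v Y" for X Y
  proof -
    have "B *v (gram b I *v X) = B *v (gram b I *v Y)" using that by simp
    then show ?thesis by (simp add: matrix_vector_mul_assoc B)
  qed
  note g = gram_dual_coef[OF \<epsilon> qual]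
  have "gram b I *v (r *\<^sub>R dual_coef b I w + s *\<^sub>R dual_coef b I w') =
    r *\<^sub>R (gram b I *v dual_coef b I w) + s *\<^sub>R (gram b I *v dual_coef b I w')"
    by (simp add: matrix_vector_right_distrib matrix_vector_mult_scaleR)
  also have "\<dots> = gram b I *v dual_coef b I (r *\<^sub>R w + s *\<^sub>R w')"
    by (simp add: g vec_eq_iff)
  finally show ?thesis by (rule inj[symmetric])
qed

lemma bounded_measurable_sum:
  "finite I \<Longrightarrow> (\<And>i. i \<in> I \<Longrightarrow> bounded_measurable T (F i)) \<Longrightarrow> bounded_measurable T (\<lambda>t. \<Sum>i\<in>I. F i t)"
  by (induction I rule: finite_induct) (auto intro: bounded_measurable_const bounded_measurable_add)

lemma bounded_measurable_component:
  "bounded_measurable T w \<Longrightarrow> bounded_measurable T (\<lambda>t. w t $ i)"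
  by (rule bounded_measurable_compose[where \<Phi> = "\<lambda>w. w $ i"]) (auto intro!: continuous_intros)

lemma bounded_measurable_vecI:
  fixes w :: "real \<Rightarrow> real^'l"
  assumes "\<And>i. bounded_measurable T (\<lambda>t. w t $ i)"
  shows "bounded_measurable T w"
proof -
  have "bounded_measurable T (\<lambda>t. \<Sum>i\<in>UNIV. (w t $ i) *\<^sub>R (axis i 1 :: real^'l))"
    using assms by (intro bounded_measurable_sum bounded_measurable_scaleR bounded_measurable_const) auto
  moreover have "(\<lambda>t. \<Sum>i\<in>UNIV. (w t $ i) *\<^sub>R axis i 1) = w"
    by (simp add: fun_eq_iff vec_eq_iff axis_def if_distrib cong: if_cong)
  ultimately show ?thesis by (simp only:)
qed

lemma bounded_measurable_lin_comb:
  assumes "\<And>i. bounded_measurable T (b i)" "bounded_measurable T \<xi>"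
  shows "bounded_measurable T (\<lambda>t. lin_comb (\<lambda>i. b i t) (\<xi> t))"
  unfolding lin_comb_def
  using assms by (intro bounded_measurable_sum bounded_measurable_scaleR bounded_measurable_component) auto

lemma integral_zero_imp_AE_zero:
  fixes h :: "real \<Rightarrow> real"
  assumes h: "bounded_measurable T h" and pos: "\<And>t. t \<in> {0..T} \<Longrightarrow> 0 \<le> h t" and int: "integral {0..T} h \<le> 0"
  shows "\<exists>N. negligible N \<and> (\<forall>t\<in>{0..T} - N. h t = 0)"
proof -
  have i: "integrable (lebesgue_on {0..T}) h"
    by (intro absolutely_integrable_imp_integrable bounded_measurable_absolutely_integrable_on h) simp
  have ae: "AE t in lebesgue_on {0..T}. 0 \<le> h t" using pos by (intro AE_I2) auto
  have "integral\<^sup>L (lebesgue_on {0..T}) h \<le> 0" using lebesgue_integral_eq_integral[OF i] int by simp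
  moreover have "0 \<le> integral\<^sup>L (lebesgue_on {0..T}) h" by (rule integral_nonneg_AE[OF ae])
  ultimately have "AE t in lebesgue_on {0..T}. h t = 0"
    using integral_nonneg_eq_0_iff_AE[OF i ae] by simp
  then show ?thesis by (subst (asm) AE_lebesgue_on_iff_negligible) auto
qed

context crossing_problem
begin

section \<open>Projections onto the span of nearly active constraint gradients\<close>

definition cgrad :: "'l \<Rightarrow> real \<Rightarrow> real^'m" where
  "cgrad i t = blinfun_adj (c' (u t)) (axis i 1)"

definition active :: "real \<Rightarrow> real \<Rightarrow> 'l set" where
  "active \<kappa> t = {i. c (u t) $ i \<ge> - \<kappa>}"

definition coef :: "real \<Rightarrow> (real \<Rightarrow> real^'l) \<Rightarrow> real \<Rightarrow> real^'l" where
  "coef \<kappa> w t = dual_coef (\<lambda>i. cgrad i t) (active \<kappa> t) (w t)"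

text \<open>Where the qualification applies, this is the vector of least norm having product
  \<open>w t $ i\<close> with each gradient active at level \<kappa>. If these products come from a
  vector \<open>h\<close>, it is the orthogonal projection of \<open>h\<close> onto the span of
  those gradients.\<close>

definition lift :: "real \<Rightarrow> (real \<Rightarrow> real^'l) \<Rightarrow> real \<Rightarrow> real^'m" where
  "lift \<kappa> w t = lin_comb (\<lambda>i. cgrad i t) (coef \<kappa> w t)"

lemma cgrad_inner: "cgrad i t \<bullet> h = c' (u t) h $ i"
  by (simp add: cgrad_def blinfun_adj_inner inner_axis' )

lemma active_mono: "\<kappa> \<le> \<kappa>' \<Longrightarrow> i \<in> active \<kappa> t \<Longrightarrow> i \<in> active \<kappa>' t"
  by (auto simp: active_def)

lemma qual_active:
  assumes "\<kappa> \<le> \<delta>" "t \<in> {0..T}" "\<And>i. i \<notin> active \<kappa> t \<Longrightarrow> \<xi> $ i = 0"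
  shows "\<epsilon> * norm \<xi> \<le> norm (lin_comb (\<lambda>i. cgrad i t) \<xi>)"
  unfolding cgrad_def by (rule qual[OF assms(2)]) (use assms in \<open>auto simp: active_def\<close>)

lemma coef_outside: "\<kappa> \<le> \<delta> \<Longrightarrow> t \<in> {0..T} \<Longrightarrow> i \<notin> active \<kappa> t \<Longrightarrow> coef \<kappa> w t $ i = 0"
  unfolding coef_def by (rule dual_coef_outside[OF \<epsilon> qual_active]) auto

lemma lift_inside: "\<kappa> \<le> \<delta> \<Longrightarrow> t \<in> {0..T} \<Longrightarrow> i \<in> active \<kappa> t \<Longrightarrow> cgrad i t \<bullet> lift \<kappa> w t = w t $ i"
  unfolding coef_def lift_def by (rule dual_coef_inside[OF \<epsilon> qual_active]) auto

lemma norm_coef: "\<kappa> \<le> \<delta> \<Longrightarrow> t \<in> {0..T} \<Longrightarrow> norm (coef \<kappa> w t) \<le> norm (w t) / \<epsilon>\<^sup>2"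
  unfolding coef_def by (rule norm_dual_coef[OF \<epsilon> qual_active]) auto

lemma norm_lift: "\<kappa> \<le> \<delta> \<Longrightarrow> t \<in> {0..T} \<Longrightarrow> norm (lift \<kappa> w t) \<le> norm (w t) / \<epsilon>"
  unfolding coef_def lift_def by (rule norm_lin_comb_dual_coef[OF \<epsilon> qual_active]) auto

lemma coef_linear: "\<kappa> \<le> \<delta> \<Longrightarrow> t \<in> {0..T} \<Longrightarrow>
    coef \<kappa> (\<lambda>t. r *\<^sub>R w t + s *\<^sub>R w' t) t = r *\<^sub>R coef \<kappa> w t + s *\<^sub>R coef \<kappa> w' t"
  unfolding coef_def by (rule dual_coef_linear[OF \<epsilon> qual_active]) auto

lemma cgrad_bm: "bounded_measurable T (cgrad i)"
  unfolding cgrad_def[abs_def] by (intro bounded_measurable_adj[OF c'_cont u] bounded_measurable_const)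

lemma c_u_bm: "bounded_measurable T (\<lambda>t. c (u t) $ i)"
  by (rule bounded_measurable_component[OF bounded_measurable_compose[OF u c_cont]])

lemma active_sets: "{t \<in> space (lebesgue_on {0..T}). i \<in> active \<kappa> t} \<in> sets (lebesgue_on {0..T})"
  unfolding active_def mem_Collect_eq
  by (rule borel_measurable_le[OF borel_measurable_const bounded_measurableD[OF c_u_bm]])

lemma coef_measurable:
  assumes w: "w \<in> borel_measurable (lebesgue_on {0..T})"
  shows "coef \<kappa> w \<in> borel_measurable (lebesgue_on {0..T})"
  unfolding coef_def[abs_def]
proof (rule borel_measurable_dual_coef[OF bounded_measurableD[OF cgrad_bm] active_sets])
  fix i
  have "continuous_on UNIV (\<lambda>w :: real^'l. w $ i)" by (intro continuous_intros)
  from measurable_compose[OF w borel_measurable_continuous_onI[OF this]]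
  show "(\<lambda>t. w t $ i) \<in> borel_measurable (lebesgue_on {0..T})" .
qed

lemma coef_bm:
  assumes w: "bounded_measurable T w" and \<kappa>: "\<kappa> \<le> \<delta>"
  shows "bounded_measurable T (coef \<kappa> w)"
  unfolding bounded_measurable_def
proof
  show "coef \<kappa> w \<in> borel_measurable (lebesgue_on {0..T})" by (rule coef_measurable[OF bounded_measurableD[OF w]])
  obtain B where B: "B \<ge> 0" "\<And>t. t \<in> {0..T} \<Longrightarrow> norm (w t) \<le> B" by (rule bounded_measurable_bound[OF w]) blast
  have "norm (coef \<kappa> w t) \<le> B / \<epsilon>\<^sup>2" if "t \<in> {0..T}" for t
    by (rule order_trans[OF norm_coef[OF \<kappa> that]]) (use B(2)[OF that] in \<open>simp add: divide_right_mono\<close>)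
  then show "\<exists>B. \<forall>t\<in>{0..T}. norm (coef \<kappa> w t) \<le> B" by blast
qed

lemma lift_bm: "bounded_measurable T w \<Longrightarrow> \<kappa> \<le> \<delta> \<Longrightarrow> bounded_measurable T (lift \<kappa> w)"
  unfolding lift_def[abs_def] by (intro bounded_measurable_lin_comb cgrad_bm coef_bm)

section \<open>The costate as a function of \<alpha> and \<gamma>\<close>

definition p\<phi> :: "real \<Rightarrow> real^'n" where "p\<phi> = (SOME p. costate T (blinfun_adj (\<phi>' (x T)) 1) p)"
definition pg :: "real \<Rightarrow> real^'n" where "pg = (SOME p. costate \<tau> (blinfun_adj (g' (x \<tau>)) 1) p)"

lemma p\<phi>: "costate T (blinfun_adj (\<phi>' (x T)) 1) p\<phi>"
  using someI_ex[OF costate_exists[of T "blinfun_adj (\<phi>' (x T)) 1"]] T_pos by (simp add: p\<phi>_def)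

lemma pg: "costate \<tau> (blinfun_adj (g' (x \<tau>)) 1) pg"
  using someI_ex[OF costate_exists[of \<tau> "blinfun_adj (g' (x \<tau>)) 1"]] \<tau> by (simp add: pg_def)

text \<open>Switching the second summand off at \<tau> produces the jump prescribed by \<gamma>.
  Linearity in (\<alpha>, \<gamma>) reduces all later limits of multipliers to limits of two real
  numbers.\<close>

definition p :: "real \<Rightarrow> real \<Rightarrow> real \<Rightarrow> real^'n" where
  "p \<alpha> \<gamma> t = \<alpha> *\<^sub>R p\<phi> t + \<gamma> *\<^sub>R (if t < \<tau> then pg t else 0)"

lemma p_expand: "p \<alpha> \<gamma> t = \<alpha> *\<^sub>R p 1 0 t + \<gamma> *\<^sub>R p 0 1 t"
  by (simp add: p_def)

lemma p\<phi>_bm: "bounded_measurable T p\<phi>"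
  using p\<phi> by (intro bounded_measurable_continuous) (simp add: costate_def)

lemma pg_bm: "bounded_measurable T (\<lambda>t. if t < \<tau> then pg t else 0)"
proof -
  define h where "h t = pg (min t \<tau>)" for t
  have "continuous_on {0..T} h"
    unfolding h_def by (rule continuous_on_compose2[of "{0..\<tau>}" pg]) (use pg \<tau> in \<open>auto simp: costate_def intro!: continuous_intros\<close>)
  then have h: "bounded_measurable T h" by (rule bounded_measurable_continuous)
  have "{t \<in> {0..T}. t < \<tau>} = {0..T} \<inter> {..<\<tau>}" by auto
  then have "{t \<in> {0..T}. t < \<tau>} \<in> sets (lebesgue_on {0..T})" by (simp add: sets_restrict_space_iff)
  then have "bounded_measurable T (\<lambda>t. if t < \<tau> then h t else 0)"
    by (intro bounded_measurable_If h bounded_measurable_const)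
  moreover have "(\<lambda>t. if t < \<tau> then h t else 0) = (\<lambda>t. if t < \<tau> then pg t else 0)"
    by (auto simp: h_def)
  ultimately show ?thesis by simp
qed

lemma p_bm: "bounded_measurable T (p \<alpha> \<gamma>)"
  unfolding p_def[abs_def] by (intro bounded_measurable_intros p\<phi>_bm pg_bm)

text \<open>The gradient of the Hamiltonian with respect to the control along the reference
  trajectory.\<close>

definition q :: "real \<Rightarrow> real \<Rightarrow> real \<Rightarrow> real^'m" where
  "q \<alpha> \<gamma> t = snd (blinfun_adj (A t) (p \<alpha> \<gamma> t))"

lemma q_inner: "q \<alpha> \<gamma> t \<bullet> h = p \<alpha> \<gamma> t \<bullet> A t (0, h)"
  using blinfun_adj_inner[of "A t" "p \<alpha> \<gamma> t" "(0, h)"] by (simp add: q_def inner_prod_def)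

lemma q_bm: "bounded_measurable T (q \<alpha> \<gamma>)"
  unfolding q_def[abs_def] by (intro bounded_measurable_intros A_adj_bm p_bm)

lemma q_expand: "q \<alpha> \<gamma> t = \<alpha> *\<^sub>R q 1 0 t + \<gamma> *\<^sub>R q 0 1 t"
  unfolding q_def by (subst p_expand) (simp add: blinfun_adj_add blinfun_adj_scaleR)

text \<open>The coefficients of the projection of \<open>q\<close> at the fixed level \<delta>. They
  are defined for all (\<alpha>, \<gamma>) and linear in them, whether or not \<open>q\<close> lies
  in the span of the active gradients; that it does is part of \<open>first_order\<close>.\<close>

definition a :: "real \<Rightarrow> real \<Rightarrow> real \<Rightarrow> real^'l" where
  "a \<alpha> \<gamma> = coef \<delta> (\<lambda>t. \<chi> i. cgrad i t \<bullet> q \<alpha> \<gamma> t)"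

lemma a_bm: "bounded_measurable T (a \<alpha> \<gamma>)"
  unfolding a_def by (intro coef_bm bounded_measurable_vecI order_refl) (simp add: bounded_measurable_inner cgrad_bm q_bm)

lemma a_expand:
  assumes "t \<in> {0..T}"
  shows "a \<alpha> \<gamma> t = \<alpha> *\<^sub>R a 1 0 t + \<gamma> *\<^sub>R a 0 1 t"
proof -
  have "(\<lambda>t. \<chi> i. cgrad i t \<bullet> q \<alpha> \<gamma> t) = (\<lambda>t. \<alpha> *\<^sub>R (\<chi> i. cgrad i t \<bullet> q 1 0 t) + \<gamma> *\<^sub>R (\<chi> i. cgrad i t \<bullet> q 0 1 t))"
    by (subst q_expand) (simp add: fun_eq_iff vec_eq_iff inner_add_right)
  then show ?thesis unfolding a_def by (simp only: coef_linear[OF order_refl assms])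
qed

text \<open>Superposition of the adjoint identities on \<open>{0..T}\<close> and on
  \<open>{0..\<tau>}\<close>. The value of the integrand at the jump does not influence the
  integral.\<close>

lemma costate_pairing:
  assumes l: "lin r y" and r: "bounded_measurable T r"
  shows "\<alpha> * \<phi>' (x T) (y T) + \<gamma> * g' (x \<tau>) (y \<tau>) = integral {0..T} (\<lambda>t. p \<alpha> \<gamma> t \<bullet> r t)"
proof -
  have 1: "((\<lambda>s. p\<phi> s \<bullet> r s) has_integral \<phi>' (x T) (y T)) {0..T}"
    using adjoint_identity[OF p\<phi> _ l r] T_pos by (simp add: blinfun_adj_inner)
  have 2: "((\<lambda>s. pg s \<bullet> r s) has_integral g' (x \<tau>) (y \<tau>)) {0..\<tau>}"
    using adjoint_identity[OF pg _ l r] \<tau> by (simp add: blinfun_adj_inner)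
  have "((\<lambda>s. if s \<in> {0..\<tau>} then pg s \<bullet> r s else 0) has_integral g' (x \<tau>) (y \<tau>)) {0..T}"
    using 2 \<tau> by (subst has_integral_restrict) auto
  then have "((\<lambda>s. (if s < \<tau> then pg s else 0) \<bullet> r s) has_integral g' (x \<tau>) (y \<tau>)) {0..T}"
    by (rule has_integral_spike[OF negligible_sing[of \<tau>], rotated]) auto
  then have "((\<lambda>s. \<alpha> * (p\<phi> s \<bullet> r s) + \<gamma> * ((if s < \<tau> then pg s else 0) \<bullet> r s)) has_integral
      \<alpha> * \<phi>' (x T) (y T) + \<gamma> * g' (x \<tau>) (y \<tau>)) {0..T}"
    using 1 by (intro has_integral_add has_integral_mult_right)
  then show ?thesis by (simp add: p_def inner_add_left integral_unique)
qed

section \<open>Admissible second-order corrections and separation\<close>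

definition adm2 :: "(real \<Rightarrow> real^'m) \<Rightarrow> real \<Rightarrow> real \<Rightarrow> (real \<Rightarrow> real^'m) \<Rightarrow> bool" where
  "adm2 du \<kappa> \<theta> v \<longleftrightarrow> bounded_measurable T v \<and>
    (\<forall>t\<in>{0..T}. \<forall>i\<in>active \<kappa> t. c' (u t) (v t) $ i + (1/2) * c'' (u t) (du t) (du t) $ i \<le> - \<theta>)"

definition curv :: "(real \<Rightarrow> real^'m) \<Rightarrow> real \<Rightarrow> real^'l" where
  "curv du t = (1/2) *\<^sub>R c'' (u t) (du t) (du t)"

lemma curv_bm: "bounded_measurable T du \<Longrightarrow> bounded_measurable T (curv du)"
  unfolding curv_def[abs_def] by (intro bounded_measurable_intros bounded_measurable_blinfun2[OF c''_cont u])

text \<open>The products \<open>- curv du t $ i - \<theta>\<close> with the nearly active gradients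
  attain the constraint with equality, and the lift stays bounded since the qualification is uniform
  in time. This correction also serves to evaluate the separation inequality exactly.\<close>

lemma adm2_lift:
  assumes du: "bounded_measurable T du" and \<kappa>: "\<kappa> \<le> \<delta>"
  shows "adm2 du \<kappa> \<theta> (lift \<kappa> (\<lambda>t. - curv du t + (- \<theta>) *\<^sub>R (\<chi> i. 1)))"
  unfolding adm2_def
proof (intro conjI ballI)
  show "bounded_measurable T (lift \<kappa> (\<lambda>t. - curv du t + (- \<theta>) *\<^sub>R (\<chi> i. 1)))"
    by (intro lift_bm[OF _ \<kappa>] bounded_measurable_intros curv_bm du)
  fix t i assume t: "t \<in> {0..T}" and i: "i \<in> active \<kappa> t"
  show "c' (u t) (lift \<kappa> (\<lambda>t. - curv du t + (- \<theta>) *\<^sub>R (\<chi> i. 1)) t) $ i + (1/2) * c'' (u t) (du t) (du t) $ i \<le> - \<theta>"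
    using lift_inside[OF \<kappa> t i, of "\<lambda>t. - curv du t + (- \<theta>) *\<^sub>R (\<chi> i. 1)"]
    by (simp add: cgrad_inner curv_def)
qed

text \<open>The two corrections may use different levels and slacks. Passing to the minima is
  harmless, because a smaller level activates fewer constraints and a smaller slack asks for
  less.\<close>

lemma adm2_convex:
  assumes "adm2 du \<kappa> \<theta> v" "adm2 du \<kappa>' \<theta>' v'" "r \<ge> 0" "s \<ge> 0" "r + s = 1"
  shows "adm2 du (min \<kappa> \<kappa>') (min \<theta> \<theta>') (\<lambda>t. r *\<^sub>R v t + s *\<^sub>R v' t)"
  unfolding adm2_def
proof (intro conjI ballI)
  show "bounded_measurable T (\<lambda>t. r *\<^sub>R v t + s *\<^sub>R v' t)"
    using assms(1,2) by (intro bounded_measurable_intros) (auto simp: adm2_def)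
  fix t i assume t: "t \<in> {0..T}" and "i \<in> active (min \<kappa> \<kappa>') t"
  then have i: "i \<in> active \<kappa> t" "i \<in> active \<kappa>' t" by (auto simp: active_def)
  define k where "k = (1/2) * c'' (u t) (du t) (du t) $ i"
  have 1: "c' (u t) (v t) $ i + k \<le> - min \<theta> \<theta>'" and 2: "c' (u t) (v' t) $ i + k \<le> - min \<theta> \<theta>'"
    using assms(1,2) t i unfolding adm2_def k_def by (smt (verit))+
  have e1: "c' (u t) (r *\<^sub>R v t + s *\<^sub>R v' t) $ i = r * c' (u t) (v t) $ i + s * c' (u t) (v' t) $ i"
    by (simp add: blinfun.bilinear_simps)
  have e2: "r * (X + k) + s * (Y + k) = r * X + s * Y + (r + s) * k" for X Y by (simp add: algebra_simps)
  have "c' (u t) (r *\<^sub>R v t + s *\<^sub>R v' t) $ i + k = r * (c' (u t) (v t) $ i + k) + s * (c' (u t) (v' t) $ i + k)"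
    unfolding e1 e2 assms(5) by simp
  also have "\<dots> \<le> r * (- min \<theta> \<theta>') + s * (- min \<theta> \<theta>')"
    using assms(3,4) 1 2 by (intro add_mono mult_left_mono) auto
  also have "\<dots> = - min \<theta> \<theta>'" using assms(5) by (metis distrib_right mult_1)
  finally show "c' (u t) (r *\<^sub>R v t + s *\<^sub>R v' t) $ i + (1/2) * c'' (u t) (du t) (du t) $ i \<le> - min \<theta> \<theta>'"
    by (simp add: k_def)
qed

lemma src1_linear: "src1 (\<lambda>t. r *\<^sub>R v t + s *\<^sub>R v' t) (r * sg + s * sg') t = r *\<^sub>R src1 v sg t + s *\<^sub>R src1 v' sg' t"
proof -
  have "(0, r *\<^sub>R v t + s *\<^sub>R v' t) = r *\<^sub>R (0 :: real^'n, v t) + s *\<^sub>R (0, v' t)" by simp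
  then have "A t (0, r *\<^sub>R v t + s *\<^sub>R v' t) = r *\<^sub>R A t (0, v t) + s *\<^sub>R A t (0, v' t)"
    by (simp only: blinfun.add_right blinfun.scaleR_right)
  then show ?thesis by (simp add: src1_def algebra_simps)
qed

text \<open>The increments are affine in the correction \<open>(v, sg, y)\<close>, the quadratic
  terms being constants of the fixed direction; hence their convexity. Levels and slacks are
  existentially quantified in \<open>P\<close>, so one separating functional works for all of
  them.\<close>

lemma separation:
  assumes du: "bounded_measurable T du" and dx: "lin (src1 du dt) dx"
    and \<kappa>0: "\<kappa>0 > 0" "\<kappa>0 \<le> \<delta>"
    and tangent: "\<And>t i. t \<in> {0..T} \<Longrightarrow> i \<in> active \<kappa>0 t \<Longrightarrow> c' (u t) (du t) $ i = 0"
    and \<phi>1: "\<phi>' (x T) (dx T) - dt \<le> 0" and g1: "g' (x \<tau>) (dx \<tau>) \<le> 0"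
  obtains \<alpha> \<gamma> where "\<alpha> \<ge> 0" "\<gamma> \<ge> 0" "\<alpha> + \<gamma> = 1"
    "\<And>v sg y \<kappa> \<theta>. 0 < \<kappa> \<Longrightarrow> \<kappa> \<le> \<kappa>0 \<Longrightarrow> \<theta> > 0 \<Longrightarrow> adm2 du \<kappa> \<theta> v \<Longrightarrow> lin (\<lambda>t. src1 v sg t + src2 du dt dx t) y \<Longrightarrow>
      0 \<le> \<alpha> * (\<phi>' (x T) (y T) + (1/2) * \<phi>'' (x T) (dx T) (dx T) - sg) + \<gamma> * (g' (x \<tau>) (y \<tau>) + (1/2) * g'' (x \<tau>) (dx \<tau>) (dx \<tau>))"
proof -
  define P where "P v sg y \<longleftrightarrow> lin (\<lambda>t. src1 v sg t + src2 du dt dx t) y \<and> (\<exists>\<kappa> \<theta>. 0 < \<kappa> \<and> \<kappa> \<le> \<kappa>0 \<and> \<theta> > 0 \<and> adm2 du \<kappa> \<theta> v)" for v sg y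
  define k1 where "k1 = (1/2) * \<phi>'' (x T) (dx T) (dx T)"
  define k2 where "k2 = (1/2) * g'' (x \<tau>) (dx \<tau>) (dx \<tau>)"
  define F where "F = (\<lambda>(v :: real \<Rightarrow> real^'m, sg, y). (\<phi>' (x T) (y T) + k1 - sg, g' (x \<tau>) (y \<tau>) + k2))"
  define W where "W = F ` {(v, sg, y). P v sg y}"
  define S where "S = {..<0 :: real} \<times> {..<0 :: real}"
  have dxb: "bounded_measurable T dx" by (rule lin_bm[OF dx])
  have "convex W"
  proof (rule convexI)
    fix X Y :: "real \<times> real" and r s :: real
    assume "X \<in> W" "Y \<in> W" and rs: "0 \<le> r" "0 \<le> s" "r + s = 1"
    then obtain v sg y v' sg' y' where X: "X = F (v, sg, y)" "P v sg y" and Y: "Y = F (v', sg', y')" "P v' sg' y'"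
      by (auto simp: W_def)
    define V where "V t = r *\<^sub>R v t + s *\<^sub>R v' t" for t
    define Z where "Z t = r *\<^sub>R y t + s *\<^sub>R y' t" for t
    define G where "G = r * sg + s * sg'"
    have "lin (\<lambda>t. r *\<^sub>R (src1 v sg t + src2 du dt dx t) + s *\<^sub>R (src1 v' sg' t + src2 du dt dx t)) Z"
      unfolding Z_def using X Y by (intro lin_combination) (auto simp: P_def)
    moreover have "r *\<^sub>R (src1 v sg t + src2 du dt dx t) + s *\<^sub>R (src1 v' sg' t + src2 du dt dx t) = src1 V G t + src2 du dt dx t" for t
    proof -
      have "r *\<^sub>R src2 du dt dx t + s *\<^sub>R src2 du dt dx t = src2 du dt dx t" using rs(3) by (simp flip: scaleR_left_distrib)
      then show ?thesis unfolding V_def[abs_def] G_def src1_linear by (simp add: algebra_simps)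
    qed
    ultimately have l: "lin (\<lambda>t. src1 V G t + src2 du dt dx t) Z" by simp
    from X(2) Y(2) obtain \<kappa> \<theta> \<kappa>' \<theta>' where k: "0 < \<kappa>" "\<kappa> \<le> \<kappa>0" "\<theta> > 0" "adm2 du \<kappa> \<theta> v"
      "0 < \<kappa>'" "\<kappa>' \<le> \<kappa>0" "\<theta>' > 0" "adm2 du \<kappa>' \<theta>' v'" by (auto simp: P_def)
    have "adm2 du (min \<kappa> \<kappa>') (min \<theta> \<theta>') V" unfolding V_def by (rule adm2_convex[OF k(4,8) rs])
    then have "P V G Z" unfolding P_def using l k by (intro conjI exI[of _ "min \<kappa> \<kappa>'"] exI[of _ "min \<theta> \<theta>'"]) auto
    then have "F (V, G, Z) \<in> W" by (auto simp: W_def)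
    moreover have "F (V, G, Z) = r *\<^sub>R X + s *\<^sub>R Y"
    proof -
      have "r * k1 + s * k1 = k1" "r * k2 + s * k2 = k2" using rs(3) by (metis distrib_right mult_1)+
      then show ?thesis by (simp add: F_def X Y Z_def G_def blinfun.bilinear_simps algebra_simps)
    qed
    ultimately show "r *\<^sub>R X + s *\<^sub>R Y \<in> W" by simp
  qed
  moreover have "W \<noteq> {}"
  proof -
    define v where "v = lift \<kappa>0 (\<lambda>t. - curv du t + (- 1) *\<^sub>R (\<chi> i. 1))"
    have v: "adm2 du \<kappa>0 1 v" unfolding v_def by (rule adm2_lift[OF du \<kappa>0(2)])
    then have "bounded_measurable T (\<lambda>t. src1 v 0 t + src2 du dt dx t)"
      by (intro bounded_measurable_add src1_bm src2_bm du dxb) (simp add: adm2_def)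
    then obtain y where "lin (\<lambda>t. src1 v 0 t + src2 du dt dx t) y" using lin_exists by blast
    then have "P v 0 y" unfolding P_def using v \<kappa>0 by (intro conjI exI[of _ \<kappa>0] exI[of _ "1 :: real"]) auto
    then show ?thesis by (auto simp: W_def)
  qed
  moreover have "convex S" unfolding S_def by (intro convex_Times) auto
  moreover have "S \<noteq> {}"
  proof -
    have "(- 1, - 1) \<in> S" by (simp add: S_def)
    then show ?thesis by blast
  qed
  moreover have "S \<inter> W = {}"
  proof (rule ccontr)
    assume "S \<inter> W \<noteq> {}"
    then obtain X where "X \<in> S" "X \<in> W" by blast
    then obtain v sg y where Pv: "P v sg y" and "F (v, sg, y) \<in> S" by (auto simp: W_def)
    then have neg: "\<phi>' (x T) (y T) + k1 - sg < 0" "g' (x \<tau>) (y \<tau>) + k2 < 0"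
      by (simp_all add: S_def F_def)
    from Pv obtain \<kappa> \<theta> where k: "0 < \<kappa>" "\<kappa> \<le> \<kappa>0" "\<theta> > 0" "adm2 du \<kappa> \<theta> v" and l: "lin (\<lambda>t. src1 v sg t + src2 du dt dx t) y"
      by (auto simp: P_def)
    show False
    proof (rule no_descent[OF du _ dx l k(1,3) _ \<phi>1 g1])
      show "bounded_measurable T v" using k(4) by (simp add: adm2_def)
      fix t i assume t: "t \<in> {0..T}" and "c (u t) $ i \<ge> - \<kappa>"
      then have i: "i \<in> active \<kappa> t" by (simp add: active_def)
      show "c' (u t) (du t) $ i = 0 \<and> c' (u t) (v t) $ i + (1/2) * c'' (u t) (du t) (du t) $ i \<le> - \<theta>"
        using tangent[OF t active_mono[OF k(2) i]] k(4) t i by (auto simp: adm2_def)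
    qed (use neg in \<open>simp_all add: k1_def k2_def\<close>)
  qed
  ultimately obtain n \<beta> where n: "n \<noteq> 0" "\<And>X. X \<in> S \<Longrightarrow> n \<bullet> X \<le> \<beta>" "\<And>X. X \<in> W \<Longrightarrow> \<beta> \<le> n \<bullet> X"
    using separating_hyperplane_sets[of S W] by metis
  obtain n1 n2 where n12: "n = (n1, n2)" by (metis surj_pair)
  have S\<beta>: "n1 * r + n2 * s \<le> \<beta>" if "r < 0" "s < 0" for r s
    using n(2)[of "(r, s)"] that by (simp add: S_def n12 inner_prod_def)
  \<comment> \<open>The origin lies in the closure of the quadrant, so the separating level cannot
    be negative.\<close>
  have "\<beta> \<ge> 0"
  proof (rule ccontr)
    assume "\<not> \<beta> \<ge> 0"
    define D where "D = \<bar>n1\<bar> + \<bar>n2\<bar> + 1"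
    have "D > 0" by (simp add: D_def add_nonneg_pos)
    define e where "e = - \<beta> / (2 * D)"
    have "e > 0" unfolding e_def using \<open>\<not> \<beta> \<ge> 0\<close> \<open>D > 0\<close> by (intro divide_pos_pos) auto
    have "n1 * (- e) + n2 * (- e) \<le> \<beta>" using \<open>e > 0\<close> by (intro S\<beta>) auto
    then have "- \<beta> \<le> (n1 + n2) * e" by (simp add: algebra_simps)
    also have "\<dots> \<le> D * e" unfolding D_def using \<open>e > 0\<close> by (intro mult_right_mono) auto
    also have "\<dots> = - \<beta> / 2" using \<open>D > 0\<close> by (simp add: e_def)
    finally show False using \<open>\<not> \<beta> \<ge> 0\<close> by simp
  qed
  \<comment> \<open>With a negative coefficient the functional would be unbounded above on the
    quadrant. The witness is chosen to exceed \<beta>.\<close>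
  have n1: "n1 \<ge> 0"
  proof (rule ccontr)
    assume "\<not> n1 \<ge> 0"
    then have "n1 * ((\<beta> + \<bar>n2\<bar> + 1) / n1) + n2 * (- 1) \<le> \<beta>"
      using \<open>\<beta> \<ge> 0\<close> by (intro S\<beta>) (auto simp: divide_pos_neg)
    then have "\<beta> + \<bar>n2\<bar> + 1 - n2 \<le> \<beta>" using \<open>\<not> n1 \<ge> 0\<close> by simp
    then show False by linarith
  qed
  have n2: "n2 \<ge> 0"
  proof (rule ccontr)
    assume "\<not> n2 \<ge> 0"
    then have "n1 * (- 1) + n2 * ((\<beta> + \<bar>n1\<bar> + 1) / n2) \<le> \<beta>"
      using \<open>\<beta> \<ge> 0\<close> by (intro S\<beta>) (auto simp: divide_pos_neg)
    then have "\<beta> + \<bar>n1\<bar> + 1 - n1 \<le> \<beta>" using \<open>\<not> n2 \<ge> 0\<close> by simp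
    then show False by linarith
  qed
  have ns: "n1 + n2 > 0" using n(1) n1 n2 by (auto simp: n12 zero_prod_def)
  show ?thesis
  proof (rule that[of "n1 / (n1 + n2)" "n2 / (n1 + n2)"])
    show "n1 / (n1 + n2) + n2 / (n1 + n2) = 1" using ns by (simp flip: add_divide_distrib)
    fix v sg y \<kappa> \<theta>
    assume "0 < \<kappa>" "\<kappa> \<le> \<kappa>0" "\<theta> > 0" "adm2 du \<kappa> \<theta> v" "lin (\<lambda>t. src1 v sg t + src2 du dt dx t) y"
    then have "P v sg y" by (auto simp: P_def)
    then have "F (v, sg, y) \<in> W" by (auto simp: W_def)
    then have "0 \<le> n1 * (\<phi>' (x T) (y T) + k1 - sg) + n2 * (g' (x \<tau>) (y \<tau>) + k2)"
      using n(3)[of "F (v, sg, y)"] \<open>\<beta> \<ge> 0\<close> by (simp add: F_def n12 inner_prod_def)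
    then have "0 \<le> (n1 * (\<phi>' (x T) (y T) + k1 - sg) + n2 * (g' (x \<tau>) (y \<tau>) + k2)) / (n1 + n2)"
      using ns by simp
    then show "0 \<le> n1 / (n1 + n2) * (\<phi>' (x T) (y T) + (1/2) * \<phi>'' (x T) (dx T) (dx T) - sg) +
      n2 / (n1 + n2) * (g' (x \<tau>) (y \<tau>) + (1/2) * g'' (x \<tau>) (dx \<tau>) (dx \<tau>))"
      by (simp add: add_divide_distrib k1_def k2_def)
  qed (use n1 n2 ns in auto)
qed

end

subsection \<open>Multipliers for bounded directions\<close>

lemma bounded_measurable_integral_add:
  "bounded_measurable T F \<Longrightarrow> bounded_measurable T G \<Longrightarrow>
    integral {0..T} (\<lambda>t. F t + G t) = integral {0..T} F + integral {0..T} G"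
  by (intro Henstock_Kurzweil_Integration.integral_add bounded_measurable_integrable_on) auto

lemma bounded_measurable_continuous_bound:
  assumes F: "bounded_measurable T F" and \<Phi>: "continuous_on UNIV \<Phi>"
  obtains B where "B \<ge> 0" "\<And>t. t \<in> {0..T} \<Longrightarrow> norm (\<Phi> (F t)) \<le> B"
proof -
  obtain B where B: "\<And>t. t \<in> {0..T} \<Longrightarrow> norm (F t) \<le> B" using F by (rule bounded_measurable_bound) blast
  have "bounded (\<Phi> ` cball 0 B)"
    by (intro compact_imp_bounded compact_continuous_image continuous_on_subset[OF \<Phi>]) auto
  then obtain C where C: "C > 0" "\<forall>z\<in>\<Phi> ` cball 0 B. norm z \<le> C" unfolding bounded_pos by blast
  then show ?thesis using B by (intro that[of C]) auto
qed

lemma affine_nonneg_imp_slope_nonneg: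
  fixes X Y :: real
  assumes "\<And>r. r \<ge> 0 \<Longrightarrow> 0 \<le> X + r * Y"
  shows "0 \<le> Y"
proof (rule ccontr)
  assume Y: "\<not> 0 \<le> Y"
  have "0 \<le> X + ((\<bar>X\<bar> + 1) / (- Y)) * Y" using Y by (intro assms divide_nonneg_pos) auto
  also have "((\<bar>X\<bar> + 1) / (- Y)) * Y = - (\<bar>X\<bar> + 1)" using Y by simp
  finally show False by linarith
qed

context crossing_problem
begin

text \<open>The part of the multiplier conditions that does not depend on the critical direction. As
  \<open>p\<close>, \<open>q\<close> and \<open>a\<close> are linear in (\<alpha>, \<gamma>), it
  describes a closed subset of a segment.\<close>

definition first_order :: "real \<Rightarrow> real \<Rightarrow> bool" where
  "first_order \<alpha> \<gamma> \<longleftrightarrow> \<alpha> \<ge> 0 \<and> \<gamma> \<ge> 0 \<and> \<alpha> + \<gamma> = 1 \<and>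
    integral {0..T} (\<lambda>t. rho T \<tau> t * (p \<alpha> \<gamma> t \<bullet> f (x t, u t))) = \<alpha> \<and>
    (\<exists>N. negligible N \<and> (\<forall>t\<in>{0..T} - N. q \<alpha> \<gamma> t = lin_comb (\<lambda>i. cgrad i t) (a \<alpha> \<gamma> t) \<and>
      (\<forall>i. a \<alpha> \<gamma> t $ i \<le> 0 \<and> (c (u t) $ i < 0 \<longrightarrow> a \<alpha> \<gamma> t $ i = 0))))"

text \<open>The multiplier of the control constraint is \<open>\<nu> = - a \<alpha> \<gamma>\<close>.\<close>

definition J :: "real \<Rightarrow> real \<Rightarrow> (real \<Rightarrow> real^'m) \<Rightarrow> real \<Rightarrow> (real \<Rightarrow> real^'n) \<Rightarrow> real \<Rightarrow> real" where
  "J \<alpha> \<gamma> du dt dx t = p \<alpha> \<gamma> t \<bullet> src2 du dt dx t - a \<alpha> \<gamma> t \<bullet> curv du t"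

text \<open>The second-order increment of the Lagrangian in the given direction. The factor 1/2
  against \<open>Omega\<close> is that of the Taylor expansion, and the linearized state is passed
  as an argument instead of being chosen.\<close>

definition half_Omega :: "real \<Rightarrow> real \<Rightarrow> (real \<Rightarrow> real^'m) \<Rightarrow> real \<Rightarrow> (real \<Rightarrow> real^'n) \<Rightarrow> real" where
  "half_Omega \<alpha> \<gamma> du dt dx = integral {0..T} (J \<alpha> \<gamma> du dt dx) +
     (1/2) * (\<alpha> * \<phi>'' (x T) (dx T) (dx T) + \<gamma> * g'' (x \<tau>) (dx \<tau>) (dx \<tau>))"

lemma J_bm: "bounded_measurable T du \<Longrightarrow> bounded_measurable T dx \<Longrightarrow> bounded_measurable T (J \<alpha> \<gamma> du dt dx)"
  unfolding J_def[abs_def] by (intro bounded_measurable_intros p_bm a_bm src2_bm curv_bm)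

text \<open>Once the costate has eliminated the state correction, the separation inequality is
  affine in the remaining free data. Varying the second-order time shift gives the integral
  condition, adding multiples of cone directions gives support and sign of the multiplier, and
  letting the slack tend to 0 gives the inequality for the quadratic form.\<close>

lemma multipliers_bounded:
  assumes du: "bounded_measurable T du" and dx: "lin (src1 du dt) dx"
    and \<kappa>0: "\<kappa>0 > 0" "\<kappa>0 \<le> \<delta>"
    and tangent: "\<And>t i. t \<in> {0..T} \<Longrightarrow> i \<in> active \<kappa>0 t \<Longrightarrow> c' (u t) (du t) $ i = 0"
    and \<phi>1: "\<phi>' (x T) (dx T) - dt \<le> 0" and g1: "g' (x \<tau>) (dx \<tau>) \<le> 0"
  shows "\<exists>\<alpha> \<gamma>. first_order \<alpha> \<gamma> \<and> 0 \<le> half_Omega \<alpha> \<gamma> du dt dx"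
proof -
  obtain \<alpha> \<gamma> where pos: "\<alpha> \<ge> 0" "\<gamma> \<ge> 0" "\<alpha> + \<gamma> = 1"
    and sep: "\<And>v sg y \<kappa> \<theta>. 0 < \<kappa> \<Longrightarrow> \<kappa> \<le> \<kappa>0 \<Longrightarrow> \<theta> > 0 \<Longrightarrow> adm2 du \<kappa> \<theta> v \<Longrightarrow> lin (\<lambda>t. src1 v sg t + src2 du dt dx t) y \<Longrightarrow>
      0 \<le> \<alpha> * (\<phi>' (x T) (y T) + (1/2) * \<phi>'' (x T) (dx T) (dx T) - sg) + \<gamma> * (g' (x \<tau>) (y \<tau>) + (1/2) * g'' (x \<tau>) (dx \<tau>) (dx \<tau>))"
    by (rule separation[OF du dx \<kappa>0 tangent \<phi>1 g1]) blast+
  note dxb = lin_bm[OF dx]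
  define P where "P = p \<alpha> \<gamma>"
  define Q where "Q = q \<alpha> \<gamma>"
  define H where "H = integral {0..T} (\<lambda>t. rho T \<tau> t * (P t \<bullet> f (x t, u t)))"
  define E where "E = integral {0..T} (\<lambda>t. P t \<bullet> src2 du dt dx t) +
    (1/2) * (\<alpha> * \<phi>'' (x T) (dx T) (dx T) + \<gamma> * g'' (x \<tau>) (dx \<tau>) (dx \<tau>))"
  have Pb: "bounded_measurable T P" unfolding P_def by (rule p_bm)
  have Qb: "bounded_measurable T Q" unfolding Q_def by (rule q_bm)
  \<comment> \<open>The correction \<open>y\<close> no longer appears: \<open>v\<close> and
    \<open>sg\<close> enter linearly, and \<open>E\<close> depends on the direction only.\<close>
  have key: "0 \<le> integral {0..T} (\<lambda>t. Q t \<bullet> v t) + sg * (H - \<alpha>) + E"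
    if \<kappa>: "0 < \<kappa>" "\<kappa> \<le> \<kappa>0" and \<theta>: "\<theta> > 0" and adm: "adm2 du \<kappa> \<theta> v" for v sg \<kappa> \<theta>
  proof -
    have v: "bounded_measurable T v" using adm by (simp add: adm2_def)
    have r: "bounded_measurable T (\<lambda>t. src1 v sg t + src2 du dt dx t)"
      by (intro bounded_measurable_add src1_bm src2_bm du dxb v)
    then obtain y where y: "lin (\<lambda>t. src1 v sg t + src2 du dt dx t) y" using lin_exists by blast
    have "\<alpha> * \<phi>' (x T) (y T) + \<gamma> * g' (x \<tau>) (y \<tau>) = integral {0..T} (\<lambda>t. P t \<bullet> (src1 v sg t + src2 du dt dx t))"
      unfolding P_def by (rule costate_pairing[OF y r])
    also have "(\<lambda>t. P t \<bullet> (src1 v sg t + src2 du dt dx t)) =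
      (\<lambda>t. (Q t \<bullet> v t + sg * (rho T \<tau> t * (P t \<bullet> f (x t, u t)))) + P t \<bullet> src2 du dt dx t)"
      by (simp add: fun_eq_iff Q_def P_def q_inner src1_def inner_add_right)
    also have "integral {0..T} \<dots> = (integral {0..T} (\<lambda>t. Q t \<bullet> v t) + integral {0..T} (\<lambda>t. sg * (rho T \<tau> t * (P t \<bullet> f (x t, u t))))) +
      integral {0..T} (\<lambda>t. P t \<bullet> src2 du dt dx t)"
      by (subst bounded_measurable_integral_add, intro bounded_measurable_intros Pb Qb v f_xu, intro bounded_measurable_intros Pb src2_bm du dxb,
          subst bounded_measurable_integral_add, intro bounded_measurable_intros Qb v, intro bounded_measurable_intros Pb f_xu, rule refl)
    also have "integral {0..T} (\<lambda>t. sg * (rho T \<tau> t * (P t \<bullet> f (x t, u t)))) = sg * H"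
      unfolding H_def by simp
    finally show ?thesis using sep[OF \<kappa> \<theta> adm y] by (simp add: E_def algebra_simps)
  qed
  define v0 where "v0 \<kappa> \<theta> = lift \<kappa> (\<lambda>t. - curv du t + (- \<theta>) *\<^sub>R (\<chi> i. 1))" for \<kappa> \<theta>
  have adm0: "adm2 du \<kappa> \<theta> (v0 \<kappa> \<theta>)" if "\<kappa> \<le> \<kappa>0" for \<kappa> \<theta>
    unfolding v0_def by (rule adm2_lift[OF du]) (use that \<kappa>0 in linarith)
  have v0b: "bounded_measurable T (v0 \<kappa> \<theta>)" if "\<kappa> \<le> \<kappa>0" for \<kappa> \<theta> using adm0[OF that] by (simp add: adm2_def)
  \<comment> \<open>\<open>sg\<close> is an arbitrary real number, so its coefficient must
    vanish.\<close>
  have "H = \<alpha>"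
  proof (rule ccontr)
    assume ne: "H \<noteq> \<alpha>"
    define X where "X = integral {0..T} (\<lambda>t. Q t \<bullet> v0 \<kappa>0 1 t) + E"
    have "0 \<le> X + (- (X + 1) / (H - \<alpha>)) * (H - \<alpha>)"
      using key[OF \<kappa>0(1) order_refl _ adm0[OF order_refl], of 1 "- (X + 1) / (H - \<alpha>)"] by (simp add: X_def algebra_simps)
    then show False using ne by simp
  qed
  \<comment> \<open>Any nonnegative multiple of such a \<open>v\<close> may be added to an
    admissible correction, so the inequality passes to its slope.\<close>
  have cone: "0 \<le> integral {0..T} (\<lambda>t. Q t \<bullet> v t)"
    if \<kappa>: "0 < \<kappa>" "\<kappa> \<le> \<kappa>0" and v: "bounded_measurable T v" and vc: "\<And>t i. t \<in> {0..T} \<Longrightarrow> i \<in> active \<kappa> t \<Longrightarrow> cgrad i t \<bullet> v t \<le> 0" for v \<kappa>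
  proof (rule affine_nonneg_imp_slope_nonneg)
    fix r :: real assume r: "r \<ge> 0"
    have "adm2 du \<kappa> 1 (\<lambda>t. v0 \<kappa> 1 t + r *\<^sub>R v t)"
      unfolding adm2_def
    proof (intro conjI ballI)
      show "bounded_measurable T (\<lambda>t. v0 \<kappa> 1 t + r *\<^sub>R v t)" by (intro bounded_measurable_intros v0b \<kappa> v)
      fix t i assume t: "t \<in> {0..T}" and i: "i \<in> active \<kappa> t"
      have "c' (u t) (v0 \<kappa> 1 t) $ i + (1/2) * c'' (u t) (du t) (du t) $ i \<le> - 1"
        using adm0[OF \<kappa>(2), of 1] t i by (simp add: adm2_def)
      moreover have "r * c' (u t) (v t) $ i \<le> 0" using vc[OF t i] r by (intro mult_nonneg_nonpos) (auto simp: cgrad_inner)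
      ultimately show "c' (u t) (v0 \<kappa> 1 t + r *\<^sub>R v t) $ i + (1/2) * c'' (u t) (du t) (du t) $ i \<le> - 1"
        by (simp add: blinfun.bilinear_simps)
    qed
    from key[OF \<kappa> _ this, of 0]
    have "0 \<le> integral {0..T} (\<lambda>t. Q t \<bullet> v0 \<kappa> 1 t + r * (Q t \<bullet> v t)) + E" by (simp add: inner_add_right)
    also have "integral {0..T} (\<lambda>t. Q t \<bullet> v0 \<kappa> 1 t + r * (Q t \<bullet> v t)) = integral {0..T} (\<lambda>t. Q t \<bullet> v0 \<kappa> 1 t) + integral {0..T} (\<lambda>t. r * (Q t \<bullet> v t))"
      by (rule bounded_measurable_integral_add) (intro bounded_measurable_intros Qb v0b \<kappa> v)+
    finally show "0 \<le> (integral {0..T} (\<lambda>t. Q t \<bullet> v0 \<kappa> 1 t) + E) + r * integral {0..T} (\<lambda>t. Q t \<bullet> v t)" by simp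
  qed
  define \<beta> where "\<beta> t = (\<chi> i. cgrad i t \<bullet> Q t)" for t
  have \<beta>b: "bounded_measurable T \<beta>"
    unfolding \<beta>_def[abs_def] by (intro bounded_measurable_vecI) (simp add: bounded_measurable_inner cgrad_bm Qb)
  have a_eq: "a \<alpha> \<gamma> = coef \<delta> \<beta>" by (simp add: a_def \<beta>_def[abs_def] Q_def)
  \<comment> \<open>The part \<open>R\<close> of \<open>Q\<close> orthogonal to the nearly active
    gradients is tangent, so \<open>- R\<close> may be tested. This forces the integral of
    \<open>R t \<bullet> R t\<close> to vanish.\<close>
  have proj: "\<exists>N. negligible N \<and> (\<forall>t\<in>{0..T} - N. Q t = lift \<kappa> \<beta> t)" if \<kappa>: "0 < \<kappa>" "\<kappa> \<le> \<kappa>0" for \<kappa>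
  proof -
    have \<kappa>\<delta>: "\<kappa> \<le> \<delta>" using \<kappa> \<kappa>0 by linarith
    define R where "R t = Q t - lift \<kappa> \<beta> t" for t
    have Rb: "bounded_measurable T R" unfolding R_def[abs_def] by (intro bounded_measurable_intros Qb lift_bm \<beta>b \<kappa>\<delta>)
    have R0: "cgrad i t \<bullet> R t = 0" if "t \<in> {0..T}" "i \<in> active \<kappa> t" for t i
      using lift_inside[OF \<kappa>\<delta> that, of \<beta>] by (simp add: R_def inner_diff_right \<beta>_def)
    have QR: "Q t \<bullet> R t = R t \<bullet> R t" if t: "t \<in> {0..T}" for t
    proof -
      have "lift \<kappa> \<beta> t \<bullet> R t = (\<Sum>i\<in>UNIV. coef \<kappa> \<beta> t $ i * (cgrad i t \<bullet> R t))" unfolding lift_def by (rule inner_lin_comb)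
      also have "\<dots> = 0"
        using coef_outside[OF \<kappa>\<delta> t, of _ \<beta>] R0[OF t] by (intro sum.neutral) (metis mult_eq_0_iff)
      finally show ?thesis by (simp add: R_def inner_diff_left)
    qed
    have "0 \<le> integral {0..T} (\<lambda>t. Q t \<bullet> (- R t))"
      by (rule cone[OF \<kappa>]) (auto intro!: bounded_measurable_uminus Rb simp: R0)
    also have "integral {0..T} (\<lambda>t. Q t \<bullet> (- R t)) = integral {0..T} (\<lambda>t. - (R t \<bullet> R t))"
      by (rule integral_cong) (simp add: QR)
    finally have "integral {0..T} (\<lambda>t. R t \<bullet> R t) \<le> 0" by simp
    then obtain N where "negligible N" "\<forall>t\<in>{0..T} - N. R t \<bullet> R t = 0"
      using integral_zero_imp_AE_zero[OF bounded_measurable_inner[OF Rb Rb]] by auto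
    then show ?thesis by (intro exI[of _ N]) (auto simp: R_def)
  qed
  \<comment> \<open>The null set in \<open>proj\<close> depends on the level, so only countably many
    levels are usable. They tend to 0, and each strictly inactive constraint eventually lies below
    them.\<close>
  define \<kappa>s where "\<kappa>s n = \<kappa>0 / real (Suc n)" for n
  have \<kappa>s: "0 < \<kappa>s n" "\<kappa>s n \<le> \<kappa>0" "\<kappa>s n \<le> \<delta>" for n
    using \<kappa>0 by (auto simp: \<kappa>s_def field_simps) (smt (verit) mult_nonneg_nonneg of_nat_0_le_iff)+
  obtain Ns where Ns: "\<And>n. negligible (Ns n)" "\<And>n t. t \<in> {0..T} - Ns n \<Longrightarrow> Q t = lift (\<kappa>s n) \<beta> t"
    using proj[OF \<kappa>s(1,2)] by metis
  define N where "N = (\<Union>n. Ns n)"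
  have N: "negligible N" unfolding N_def using Ns(1) by (intro negligible_countable_Union) auto
  have Nlift: "Q t = lift (\<kappa>s n) \<beta> t" if "t \<in> {0..T} - N" for t n
    using Ns(2)[of t n] that by (auto simp: N_def)
  \<comment> \<open>All these coefficient vectors represent the same \<open>Q t\<close>, and the
    gradients active at level \<delta> are linearly independent.\<close>
  have supp: "coef (\<kappa>s n) \<beta> t = coef (\<kappa>s 0) \<beta> t" if t: "t \<in> {0..T} - N" for t n
  proof (rule lin_comb_inj[OF \<epsilon> qual_active[OF order_refl]])
    show "t \<in> {0..T}" using t by simp
    show "coef (\<kappa>s n) \<beta> t $ i = 0" if "i \<notin> active \<delta> t" for i n
      using coef_outside[OF \<kappa>s(3)] active_mono[OF \<kappa>s(3)] t that by blast
    then show "coef (\<kappa>s 0) \<beta> t $ i = 0" if "i \<notin> active \<delta> t" for i using that .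
    show "lin_comb (\<lambda>i. cgrad i t) (coef (\<kappa>s n) \<beta> t) = lin_comb (\<lambda>i. cgrad i t) (coef (\<kappa>s 0) \<beta> t)"
      using Nlift[OF t, of n] Nlift[OF t, of 0] by (simp add: lift_def)
  qed
  have inact: "coef (\<kappa>s 0) \<beta> t $ i = 0" if t: "t \<in> {0..T} - N" and neg: "c (u t) $ i < 0" for t i
  proof -
    define m where "m = - c (u t) $ i"
    have "m > 0" using neg by (simp add: m_def)
    obtain n :: nat where "\<kappa>0 / m < real n" using reals_Archimedean2 by blast
    then have "\<kappa>0 < real n * m" using \<open>m > 0\<close> by (simp add: pos_divide_less_eq)
    also have "\<dots> \<le> real (Suc n) * m" using \<open>m > 0\<close> by (intro mult_right_mono) auto
    finally have "\<kappa>s n < m" by (simp add: \<kappa>s_def pos_divide_less_eq mult.commute)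
    then have "i \<notin> active (\<kappa>s n) t" by (simp add: active_def m_def)
    then show ?thesis using coef_outside[OF \<kappa>s(3), of t i n \<beta>] supp[OF t, of n] t by simp
  qed
  \<comment> \<open>\<open>Q t\<close> lies in the span of the gradients active at level \<delta>,
    so projecting there changes neither the vector nor its coefficients.\<close>
  have a\<kappa>: "a \<alpha> \<gamma> t = coef (\<kappa>s 0) \<beta> t" if t: "t \<in> {0..T} - N" for t
  proof -
    have tT: "t \<in> {0..T}" using t by simp
    define X where "X = coef (\<kappa>s 0) \<beta> t"
    have X0: "X $ i = 0" if "i \<notin> active \<delta> t" for i
      using coef_outside[OF \<kappa>s(3)[of 0] tT, of i \<beta>] active_mono[OF \<kappa>s(3)[of 0], of i t] that by (auto simp: X_def)
    have QX: "Q t = lin_comb (\<lambda>i. cgrad i t) X" using Nlift[OF t, of 0] by (simp add: lift_def X_def)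
    define Y where "Y = lin_comb (\<lambda>i. cgrad i t) X - lift \<delta> \<beta> t"
    have Y0: "cgrad i t \<bullet> Y = 0" if "i \<in> active \<delta> t" for i
      using lift_inside[OF order_refl tT that, of \<beta>] by (simp add: Y_def inner_diff_right \<beta>_def QX)
    have "Y = lin_comb (\<lambda>i. cgrad i t) (X - coef \<delta> \<beta> t)" by (simp add: Y_def lift_def lin_comb_diff)
    then have "Y \<bullet> Y = (\<Sum>i\<in>UNIV. (X - coef \<delta> \<beta> t) $ i * (cgrad i t \<bullet> Y))" by (metis inner_lin_comb)
    also have "\<dots> = 0"
    proof (intro sum.neutral ballI)
      fix i show "(X - coef \<delta> \<beta> t) $ i * (cgrad i t \<bullet> Y) = 0"
        by (cases "i \<in> active \<delta> t") (simp_all add: Y0 X0 coef_outside[OF order_refl tT])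
    qed
    finally have XQ: "lin_comb (\<lambda>i. cgrad i t) X = lin_comb (\<lambda>i. cgrad i t) (coef \<delta> \<beta> t)" by (simp add: Y_def lift_def)
    have "X = coef \<delta> \<beta> t"
    proof (rule lin_comb_inj[OF \<epsilon> qual_active[OF order_refl tT]])
      show "X $ i = 0" if "i \<notin> active \<delta> t" for i by (rule X0[OF that])
      show "coef \<delta> \<beta> t $ i = 0" if "i \<notin> active \<delta> t" for i by (rule coef_outside[OF order_refl tT that])
    qed (use XQ in auto)
    then show ?thesis by (simp add: a_eq X_def)
  qed
  have Qa: "Q t = lin_comb (\<lambda>i. cgrad i t) (a \<alpha> \<gamma> t)" if "t \<in> {0..T} - N" for t
    using Nlift[OF that, of 0] a\<kappa>[OF that] by (simp add: lift_def)
  have Qv: "Q t \<bullet> v = (\<Sum>i\<in>UNIV. a \<alpha> \<gamma> t $ i * (cgrad i t \<bullet> v))" if "t \<in> {0..T} - N" for t v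
    using Qa[OF that] by (simp add: inner_lin_comb)
  have aout: "a \<alpha> \<gamma> t $ i = 0" if "t \<in> {0..T} - N" "i \<notin> active \<kappa>0 t" for t i
    using inact[OF that(1), of i] a\<kappa>[OF that(1)] that(2) \<kappa>0 by (simp add: active_def)
  have Qlift: "Q t \<bullet> lift \<kappa>0 w t = a \<alpha> \<gamma> t \<bullet> w t" if t: "t \<in> {0..T} - N" for t w
  proof -
    have "Q t \<bullet> lift \<kappa>0 w t = (\<Sum>i\<in>UNIV. a \<alpha> \<gamma> t $ i * (cgrad i t \<bullet> lift \<kappa>0 w t))" by (rule Qv[OF t])
    also have "\<dots> = (\<Sum>i\<in>UNIV. a \<alpha> \<gamma> t $ i \<bullet> w t $ i)"
    proof (rule sum.cong[OF refl])
      fix i show "a \<alpha> \<gamma> t $ i * (cgrad i t \<bullet> lift \<kappa>0 w t) = a \<alpha> \<gamma> t $ i \<bullet> w t $ i"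
        using lift_inside[OF \<kappa>0(2), of t i w] aout[OF t, of i] t by (cases "i \<in> active \<kappa>0 t") auto
    qed
    finally show ?thesis by (simp add: inner_vec_def)
  qed
  have sign: "\<exists>M. negligible M \<and> (\<forall>t\<in>{0..T} - M. a \<alpha> \<gamma> t $ i \<le> 0)" for i
  proof -
    \<comment> \<open>The lift of \<eta> decreases constraint \<open>i\<close> exactly where its
      coefficient is positive. The cone inequality then bounds the integral of the positive part by
      0.\<close>
    define \<eta> where "\<eta> t = (if 0 < a \<alpha> \<gamma> t $ i then (axis i (-1) :: real^'l) else 0)" for t
    have "{t \<in> space (lebesgue_on {0..T}). 0 < a \<alpha> \<gamma> t $ i} \<in> sets (lebesgue_on {0..T})"
      by (rule borel_measurable_less[OF borel_measurable_const bounded_measurableD[OF bounded_measurable_component[OF a_bm]]])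
    then have \<eta>b: "bounded_measurable T \<eta>" unfolding \<eta>_def[abs_def]
      by (intro bounded_measurable_If bounded_measurable_const) simp
    have \<eta>0: "\<eta> t $ j \<le> 0" for t j by (simp add: \<eta>_def axis_def)
    have "0 \<le> integral {0..T} (\<lambda>t. Q t \<bullet> lift \<kappa>0 \<eta> t)"
      by (rule cone[OF \<kappa>0(1) order_refl lift_bm[OF \<eta>b \<kappa>0(2)]]) (simp add: lift_inside[OF \<kappa>0(2)] \<eta>0)
    also have "\<dots> = integral {0..T} (\<lambda>t. a \<alpha> \<gamma> t \<bullet> \<eta> t)"
      by (rule integral_spike[OF N]) (simp add: Qlift)
    also have "(\<lambda>t. a \<alpha> \<gamma> t \<bullet> \<eta> t) = (\<lambda>t. - max 0 (a \<alpha> \<gamma> t $ i))"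
      by (auto simp: fun_eq_iff \<eta>_def inner_axis)
    finally have "integral {0..T} (\<lambda>t. max 0 (a \<alpha> \<gamma> t $ i)) \<le> 0" by simp
    moreover have "bounded_measurable T (\<lambda>t. max 0 (a \<alpha> \<gamma> t $ i))"
      by (rule bounded_measurable_compose[OF bounded_measurable_component[OF a_bm]]) (intro continuous_intros)
    ultimately obtain M where "negligible M" and M: "\<forall>t\<in>{0..T} - M. max 0 (a \<alpha> \<gamma> t $ i) = 0"
      using integral_zero_imp_AE_zero[of T "\<lambda>t. max 0 (a \<alpha> \<gamma> t $ i)"] by auto
    moreover have "a \<alpha> \<gamma> t $ i \<le> 0" if "t \<in> {0..T} - M" for t using M that by (metis max.cobounded2)
    ultimately show ?thesis by blast
  qed
  then obtain Ms where Ms: "\<And>i. negligible (Ms i)" "\<And>i t. t \<in> {0..T} - Ms i \<Longrightarrow> a \<alpha> \<gamma> t $ i \<le> 0" by metis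
  have "first_order \<alpha> \<gamma>"
    unfolding first_order_def
  proof (intro conjI pos exI[of _ "N \<union> (\<Union>i. Ms i)"] ballI allI impI)
    show "integral {0..T} (\<lambda>t. rho T \<tau> t * (p \<alpha> \<gamma> t \<bullet> f (x t, u t))) = \<alpha>"
      using \<open>H = \<alpha>\<close> by (simp add: H_def P_def)
    show "negligible (N \<union> (\<Union>i. Ms i))" using N Ms(1) by (intro negligible_Un negligible_Union) auto
    fix t i assume t: "t \<in> {0..T} - (N \<union> (\<Union>i. Ms i))"
    show "q \<alpha> \<gamma> t = lin_comb (\<lambda>i. cgrad i t) (a \<alpha> \<gamma> t)" using Qa[of t] t by (simp add: Q_def)
    show "a \<alpha> \<gamma> t $ i \<le> 0" using Ms(2)[of t i] t by auto
    assume "c (u t) $ i < 0"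
    then show "a \<alpha> \<gamma> t $ i = 0" using inact[of t i] a\<kappa>[of t] t by simp
  qed
  moreover have "0 \<le> half_Omega \<alpha> \<gamma> du dt dx"
  proof -
    define S where "S = integral {0..T} (\<lambda>t. a \<alpha> \<gamma> t \<bullet> (\<chi> i. 1))"
    \<comment> \<open>The correction attaining the slack constraint with equality makes the control
      term explicit: it is the curvature term of \<open>J\<close> plus a multiple of
      \<theta>.\<close>
    have Ssplit: "0 \<le> half_Omega \<alpha> \<gamma> du dt dx - \<theta> * S" if \<theta>: "\<theta> > 0" for \<theta>
    proof -
      have "0 \<le> integral {0..T} (\<lambda>t. Q t \<bullet> v0 \<kappa>0 \<theta> t) + E"
        using key[OF \<kappa>0(1) order_refl \<theta> adm0[OF order_refl], of 0] by simp
      also have "integral {0..T} (\<lambda>t. Q t \<bullet> v0 \<kappa>0 \<theta> t) = integral {0..T} (\<lambda>t. a \<alpha> \<gamma> t \<bullet> (- curv du t + (- \<theta>) *\<^sub>R (\<chi> i. 1)))"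
        unfolding v0_def by (rule integral_spike[OF N]) (simp only: Qlift)
      also have "\<dots> = integral {0..T} (\<lambda>t. - (a \<alpha> \<gamma> t \<bullet> curv du t) + (- \<theta>) * (a \<alpha> \<gamma> t \<bullet> (\<chi> i. 1)))"
        by (simp add: inner_diff_right inner_add_right)
      also have "\<dots> = integral {0..T} (\<lambda>t. - (a \<alpha> \<gamma> t \<bullet> curv du t)) + integral {0..T} (\<lambda>t. (- \<theta>) * (a \<alpha> \<gamma> t \<bullet> (\<chi> i. 1)))"
        by (rule bounded_measurable_integral_add) (intro bounded_measurable_intros a_bm curv_bm du)+
      also have "integral {0..T} (\<lambda>t. (- \<theta>) * (a \<alpha> \<gamma> t \<bullet> (\<chi> i. 1))) = - \<theta> * S" by (simp add: S_def)
      also have "E = half_Omega \<alpha> \<gamma> du dt dx - integral {0..T} (\<lambda>t. - (a \<alpha> \<gamma> t \<bullet> curv du t))"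
      proof -
        have "integral {0..T} (J \<alpha> \<gamma> du dt dx) = integral {0..T} (\<lambda>t. P t \<bullet> src2 du dt dx t + - (a \<alpha> \<gamma> t \<bullet> curv du t))"
          by (simp add: J_def[abs_def] P_def)
        also have "\<dots> = integral {0..T} (\<lambda>t. P t \<bullet> src2 du dt dx t) + integral {0..T} (\<lambda>t. - (a \<alpha> \<gamma> t \<bullet> curv du t))"
          by (rule bounded_measurable_integral_add) (intro bounded_measurable_intros Pb a_bm src2_bm curv_bm du dxb)+
        finally show ?thesis by (simp add: E_def half_Omega_def)
      qed
      finally show ?thesis by simp
    qed
    show ?thesis
    proof (rule ccontr)
      assume neg: "\<not> ?thesis"
      define h where "h = half_Omega \<alpha> \<gamma> du dt dx"
      define D where "D = \<bar>S\<bar> + 1"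
      have D: "D > 0" "- S \<le> D" by (auto simp: D_def)
      \<comment> \<open>Small enough for the slack term to consume at most half of the supposedly
        negative value.\<close>
      define \<theta> where "\<theta> = - h / (2 * D)"
      have "\<theta> > 0" unfolding \<theta>_def using neg D by (intro divide_pos_pos) (auto simp: h_def)
      have "\<theta> * D = - h / 2" using D by (simp add: \<theta>_def)
      moreover have "- \<theta> * S \<le> \<theta> * D"
      proof -
        have "\<theta> * (- S) \<le> \<theta> * D" using D \<open>\<theta> > 0\<close> by (intro mult_left_mono) auto
        then show ?thesis by simp
      qed
      ultimately show False using Ssplit[OF \<open>\<theta> > 0\<close>] neg by (simp add: h_def)
    qed
  qed
  ultimately show ?thesis by blast
qed

end

subsection \<open>Square-integrable directions\<close>

context crossing_problem
begin

text \<open>Critical directions in \<open>L\<^sup>2\<close> are approximated by truncating and projecting them to the following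
  vector space. This perturbs the two values \<open>ell\<close>, whose signs are restored by adding a small element of the
  space: the image of the space under \<open>ell\<close> is a subspace of the plane, hence closed and spanned by finitely
  many vectors.\<close>

definition dir :: "(real \<Rightarrow> real^'m) \<Rightarrow> real \<Rightarrow> (real \<Rightarrow> real^'n) \<Rightarrow> bool" where
  "dir du dt dx \<longleftrightarrow> bounded_measurable T du \<and> lin (src1 du dt) dx \<and>
     (\<exists>\<kappa>>0. \<kappa> \<le> \<delta> \<and> (\<forall>t\<in>{0..T}. \<forall>i\<in>active \<kappa> t. c' (u t) (du t) $ i = 0))"

definition ell :: "real \<Rightarrow> (real \<Rightarrow> real^'n) \<Rightarrow> real \<times> real" where
  "ell dt dx = (\<phi>' (x T) (dx T) - dt, g' (x \<tau>) (dx \<tau>))"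

lemma dir_combination:
  assumes "dir du dt dx" "dir du' dt' dx'"
  shows "dir (\<lambda>t. r *\<^sub>R du t + s *\<^sub>R du' t) (r * dt + s * dt') (\<lambda>t. r *\<^sub>R dx t + s *\<^sub>R dx' t)"
  unfolding dir_def
proof (intro conjI)
  show "bounded_measurable T (\<lambda>t. r *\<^sub>R du t + s *\<^sub>R du' t)"
    using assms by (intro bounded_measurable_intros) (auto simp: dir_def)
  have "lin (\<lambda>t. r *\<^sub>R src1 du dt t + s *\<^sub>R src1 du' dt' t) (\<lambda>t. r *\<^sub>R dx t + s *\<^sub>R dx' t)"
    using assms by (intro lin_combination) (auto simp: dir_def)
  then show "lin (src1 (\<lambda>t. r *\<^sub>R du t + s *\<^sub>R du' t) (r * dt + s * dt')) (\<lambda>t. r *\<^sub>R dx t + s *\<^sub>R dx' t)"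
    by (simp add: src1_linear[abs_def])
  obtain \<kappa> \<kappa>' where k: "\<kappa> > 0" "\<kappa> \<le> \<delta>" "\<forall>t\<in>{0..T}. \<forall>i\<in>active \<kappa> t. c' (u t) (du t) $ i = 0"
    "\<kappa>' > 0" "\<kappa>' \<le> \<delta>" "\<forall>t\<in>{0..T}. \<forall>i\<in>active \<kappa>' t. c' (u t) (du' t) $ i = 0"
    using assms by (auto simp: dir_def)
  show "\<exists>\<kappa>>0. \<kappa> \<le> \<delta> \<and> (\<forall>t\<in>{0..T}. \<forall>i\<in>active \<kappa> t. c' (u t) (r *\<^sub>R du t + s *\<^sub>R du' t) $ i = 0)"
  proof (intro exI[of _ "min \<kappa> \<kappa>'"] conjI ballI)
    fix t i assume t: "t \<in> {0..T}" and "i \<in> active (min \<kappa> \<kappa>') t"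
    then have "i \<in> active \<kappa> t" "i \<in> active \<kappa>' t" by (auto simp: active_def)
    then show "c' (u t) (r *\<^sub>R du t + s *\<^sub>R du' t) $ i = 0"
      using k(3,6) t by (simp add: blinfun.bilinear_simps)
  qed (use k in auto)
qed

lemma ell_combination: "ell (r * dt + s * dt') (\<lambda>t. r *\<^sub>R dx t + s *\<^sub>R dx' t) = r *\<^sub>R ell dt dx + s *\<^sub>R ell dt' dx'"
  by (simp add: ell_def blinfun.bilinear_simps algebra_simps)

lemma dir_zero: "dir (\<lambda>_. 0) 0 (\<lambda>_. 0)"
proof -
  have "lin (src1 (\<lambda>_. 0) 0) (\<lambda>_. 0)"
    by (auto simp: lin_def src1_def zero_prod_def[symmetric] blinfun.zero_right)
  then show ?thesis using \<delta> by (auto simp: dir_def bounded_measurable_const blinfun.zero_right)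
qed

lemma dir_sum:
  assumes "finite B" "\<And>b. b \<in> B \<Longrightarrow> dir (E b) (Et b) (Xx b)"
  shows "dir (\<lambda>t. \<Sum>b\<in>B. w b *\<^sub>R E b t) (\<Sum>b\<in>B. w b * Et b) (\<lambda>t. \<Sum>b\<in>B. w b *\<^sub>R Xx b t) \<and>
    ell (\<Sum>b\<in>B. w b * Et b) (\<lambda>t. \<Sum>b\<in>B. w b *\<^sub>R Xx b t) = (\<Sum>b\<in>B. w b *\<^sub>R ell (Et b) (Xx b))"
  using assms
proof (induction B rule: finite_induct)
  case empty
  then show ?case using dir_zero by (simp add: ell_def blinfun.zero_right zero_prod_def)
next
  case (insert b B)
  then have IH: "dir (\<lambda>t. \<Sum>b\<in>B. w b *\<^sub>R E b t) (\<Sum>b\<in>B. w b * Et b) (\<lambda>t. \<Sum>b\<in>B. w b *\<^sub>R Xx b t)"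
    "ell (\<Sum>b\<in>B. w b * Et b) (\<lambda>t. \<Sum>b\<in>B. w b *\<^sub>R Xx b t) = (\<Sum>b\<in>B. w b *\<^sub>R ell (Et b) (Xx b))" by auto
  show ?case
    using dir_combination[OF insert.prems[of b] IH(1), of "w b" 1] ell_combination[of "w b" "Et b" 1 "\<Sum>b\<in>B. w b * Et b" "Xx b" "\<lambda>t. \<Sum>b\<in>B. w b *\<^sub>R Xx b t"]
      IH(2) insert.hyps by simp
qed

lemma subspace_ell: "subspace {ell dt dx | du dt dx. dir du dt dx}"
proof (rule subspaceI)
  have "ell 0 (\<lambda>_. 0) = 0" by (simp add: ell_def blinfun.zero_right zero_prod_def)
  then show "0 \<in> {ell dt dx | du dt dx. dir du dt dx}" using dir_zero by force
  fix X Y assume "X \<in> {ell dt dx | du dt dx. dir du dt dx}" "Y \<in> {ell dt dx | du dt dx. dir du dt dx}"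
  then obtain du dt dx du' dt' dx' where "X = ell dt dx" "dir du dt dx" "Y = ell dt' dx'" "dir du' dt' dx'" by blast
  then show "X + Y \<in> {ell dt dx | du dt dx. dir du dt dx}"
    using dir_combination[of du dt dx du' dt' dx' 1 1] ell_combination[of 1 dt 1 dt' dx dx'] by force
next
  fix r X assume "X \<in> {ell dt dx | du dt dx. dir du dt dx}"
  then obtain du dt dx where "X = ell dt dx" "dir du dt dx" by blast
  then show "r *\<^sub>R X \<in> {ell dt dx | du dt dx. dir du dt dx}"
    using dir_combination[OF _ dir_zero, of du dt dx r 0] ell_combination[of r dt 0 0 dx "\<lambda>_. 0"] by force
qed

lemma multipliers_dir:
  assumes "dir du dt dx" "fst (ell dt dx) \<le> 0" "snd (ell dt dx) \<le> 0"
  shows "\<exists>\<alpha> \<gamma>. first_order \<alpha> \<gamma> \<and> 0 \<le> half_Omega \<alpha> \<gamma> du dt dx"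
proof -
  from assms(1) obtain \<kappa> where "bounded_measurable T du" "lin (src1 du dt) dx" "\<kappa> > 0" "\<kappa> \<le> \<delta>"
    and t: "\<forall>t\<in>{0..T}. \<forall>i\<in>active \<kappa> t. c' (u t) (du t) $ i = 0" by (auto simp: dir_def)
  then show ?thesis using assms(2,3)
    by (intro multipliers_bounded[of du dt dx \<kappa>]) (auto simp: ell_def)
qed

text \<open>For fixed (\<alpha>, \<gamma>) the costate and the multiplier are bounded, so one
  constant serves all directions. The quadratic growth provides the integrable majorants for
  directions in L2.\<close>

lemma J_bound:
  obtains K where "K \<ge> 0" "\<And>du dt dx t. t \<in> {0..T} \<Longrightarrow>
    \<bar>J \<alpha> \<gamma> du dt dx t\<bar> \<le> K * ((norm (dx t) + norm (du t))\<^sup>2 + \<bar>dt\<bar> * (norm (dx t) + norm (du t)))"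
proof -
  obtain C where C: "C \<ge> 0" "\<And>t h. t \<in> {0..T} \<Longrightarrow> norm (A t h) \<le> C * norm h" by (rule A_bound) blast
  obtain Bf where Bf: "Bf \<ge> 0" "\<And>t. t \<in> {0..T} \<Longrightarrow> norm (f'' (x t, u t)) \<le> Bf"
    by (rule bounded_measurable_continuous_bound[OF xu f''_cont]) blast
  obtain Bc where Bc: "Bc \<ge> 0" "\<And>t. t \<in> {0..T} \<Longrightarrow> norm (c'' (u t)) \<le> Bc"
    by (rule bounded_measurable_continuous_bound[OF u c''_cont]) blast
  obtain Bp where Bp: "Bp \<ge> 0" "\<And>t. t \<in> {0..T} \<Longrightarrow> norm (p \<alpha> \<gamma> t) \<le> Bp" by (rule bounded_measurable_bound[OF p_bm]) blast
  obtain Ba where Ba: "Ba \<ge> 0" "\<And>t. t \<in> {0..T} \<Longrightarrow> norm (a \<alpha> \<gamma> t) \<le> Ba" by (rule bounded_measurable_bound[OF a_bm]) blast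
  define R where "R = rho_bound"
  have R: "R \<ge> 0" "\<And>t. \<bar>rho T \<tau> t\<bar> \<le> R" using rho_bound by (auto simp: R_def less_imp_le)
  define K where "K = Bp * Bf + Bp * (R * C) + Ba * Bc"
  have K0: "Bp * Bf \<ge> 0" "Bp * (R * C) \<ge> 0" "Ba * Bc \<ge> 0" using Bp(1) Bf(1) R(1) C(1) Ba(1) Bc(1) by auto
  show ?thesis
  proof (rule that[of K])
    show "K \<ge> 0" using K0 by (simp add: K_def)
    fix du :: "real \<Rightarrow> real^'m" and dt :: real and dx :: "real \<Rightarrow> real^'n" and t assume t: "t \<in> {0..T}"
    define m where "m = norm (dx t) + norm (du t)"
    have m: "m \<ge> 0" "norm (dx t, du t) \<le> m" "norm (du t) \<le> m" by (auto simp: m_def norm_Pair_le)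
    have f2: "norm (f'' (x t, u t) (dx t, du t) (dx t, du t)) \<le> Bf * m * m"
      by (rule order_trans[OF blinfun_quadratic_bound]) (intro mult_mono Bf(2) t m(2) mult_nonneg_nonneg Bf(1) m(1) norm_ge_zero)
    have c2: "norm (c'' (u t) (du t) (du t)) \<le> Bc * m * m"
      by (rule order_trans[OF blinfun_quadratic_bound]) (intro mult_mono Bc(2) t m(3) mult_nonneg_nonneg Bc(1) m(1) norm_ge_zero)
    have A1: "norm (A t (dx t, du t)) \<le> C * m"
      by (rule order_trans[OF C(2)[OF t]]) (intro mult_left_mono m(2) C(1))
    have "norm (src2 du dt dx t) \<le> norm ((1/2) *\<^sub>R f'' (x t, u t) (dx t, du t) (dx t, du t)) + norm ((rho T \<tau> t * dt) *\<^sub>R A t (dx t, du t))"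
      unfolding src2_def by (rule norm_triangle_ineq)
    also have "\<dots> \<le> Bf * m * m + (R * \<bar>dt\<bar>) * (C * m)"
    proof (rule add_mono)
      have "norm ((1/2) *\<^sub>R f'' (x t, u t) (dx t, du t) (dx t, du t)) \<le> norm (f'' (x t, u t) (dx t, du t) (dx t, du t))" by simp
      then show "norm ((1/2) *\<^sub>R f'' (x t, u t) (dx t, du t) (dx t, du t)) \<le> Bf * m * m" using f2 by linarith
      show "norm ((rho T \<tau> t * dt) *\<^sub>R A t (dx t, du t)) \<le> (R * \<bar>dt\<bar>) * (C * m)"
        unfolding norm_scaleR abs_mult by (intro mult_mono R A1 mult_nonneg_nonneg) auto
    qed
    finally have s2: "norm (src2 du dt dx t) \<le> Bf * m * m + (R * \<bar>dt\<bar>) * (C * m)" .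
    have "\<bar>J \<alpha> \<gamma> du dt dx t\<bar> \<le> \<bar>p \<alpha> \<gamma> t \<bullet> src2 du dt dx t\<bar> + \<bar>a \<alpha> \<gamma> t \<bullet> curv du t\<bar>"
      unfolding J_def by (rule abs_triangle_ineq4)
    also have "\<dots> \<le> Bp * (Bf * m * m + (R * \<bar>dt\<bar>) * (C * m)) + Ba * (Bc * m * m)"
    proof (rule add_mono)
      show "\<bar>p \<alpha> \<gamma> t \<bullet> src2 du dt dx t\<bar> \<le> Bp * (Bf * m * m + (R * \<bar>dt\<bar>) * (C * m))"
        by (rule order_trans[OF Cauchy_Schwarz_ineq2]) (intro mult_mono Bp t s2 norm_ge_zero)
      have "norm (curv du t) \<le> Bc * m * m" using c2 by (simp add: curv_def) (smt (verit) norm_ge_zero)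
      then show "\<bar>a \<alpha> \<gamma> t \<bullet> curv du t\<bar> \<le> Ba * (Bc * m * m)"
        by (intro order_trans[OF Cauchy_Schwarz_ineq2] mult_mono Ba t) auto
    qed
    also have "\<dots> = (Bp * Bf + Ba * Bc) * m\<^sup>2 + (Bp * (R * C)) * (\<bar>dt\<bar> * m)"
      by (simp add: algebra_simps power2_eq_square)
    also have "\<dots> \<le> K * m\<^sup>2 + K * (\<bar>dt\<bar> * m)"
      using K0 m(1) by (intro add_mono mult_right_mono) (auto simp: K_def)
    finally show "\<bar>J \<alpha> \<gamma> du dt dx t\<bar> \<le> K * ((norm (dx t) + norm (du t))\<^sup>2 + \<bar>dt\<bar> * (norm (dx t) + norm (du t)))"
      by (simp add: m_def algebra_simps)
  qed
qed

lemma J_tendsto: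
  assumes "(\<lambda>k. duk k t) \<longlonglongrightarrow> du t" "dtk \<longlonglongrightarrow> dt" "(\<lambda>k. dxk k t) \<longlonglongrightarrow> dx t"
  shows "(\<lambda>k. J \<alpha> \<gamma> (duk k) (dtk k) (dxk k) t) \<longlonglongrightarrow> J \<alpha> \<gamma> du dt dx t"
  unfolding J_def src2_def curv_def by (intro tendsto_intros assms)

text \<open>Dominated convergence. The controls are only dominated by a multiple of
  \<open>norm (du t) + 1\<close>, while states and time shifts are bounded by a constant, so the
  majorant is of the order of \<open>(norm (du t))\<^sup>2 + 1\<close>.\<close>

lemma half_Omega_converges:
  assumes L2: "(\<lambda>t. (norm (du t))\<^sup>2) integrable_on {0..T}"
    and bm: "\<And>k. bounded_measurable T (duk k)" "\<And>k. bounded_measurable T (dxk k)"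
    and du: "\<And>t. t \<in> {0..T} \<Longrightarrow> (\<lambda>k. duk k t) \<longlonglongrightarrow> du t" and dt: "dtk \<longlonglongrightarrow> dt"
    and dx: "\<And>t. t \<in> {0..T} \<Longrightarrow> (\<lambda>k. dxk k t) \<longlonglongrightarrow> dx t"
    and C: "C \<ge> 0" "\<And>k t. t \<in> {0..T} \<Longrightarrow> norm (duk k t) \<le> C * (norm (du t) + 1)" "\<And>k t. t \<in> {0..T} \<Longrightarrow> norm (dxk k t) \<le> C" "\<And>k. \<bar>dtk k\<bar> \<le> C"
  shows "(\<lambda>k. half_Omega \<alpha> \<gamma> (duk k) (dtk k) (dxk k)) \<longlonglongrightarrow> half_Omega \<alpha> \<gamma> du dt dx"
    and "J \<alpha> \<gamma> du dt dx integrable_on {0..T}"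
proof -
  obtain K where K: "K \<ge> 0" "\<And>du dt dx t. t \<in> {0..T} \<Longrightarrow>
    \<bar>J \<alpha> \<gamma> du dt dx t\<bar> \<le> K * ((norm (dx t) + norm (du t))\<^sup>2 + \<bar>dt\<bar> * (norm (dx t) + norm (du t)))" by (rule J_bound) blast
  \<comment> \<open>With \<open>D = norm (du t) + 1\<close> the two terms of \<open>J_bound\<close>
    contribute 4 and 2 times \<open>C\<^sup>2 * D\<^sup>2\<close>, and \<open>D\<^sup>2\<close> is
    at most twice the last factor.\<close>
  define h where "h t = K * (12 * C\<^sup>2) * ((norm (du t))\<^sup>2 + 1)" for t
  have hi: "h integrable_on {0..T}" unfolding h_def[abs_def]
    by (intro integrable_on_mult_right integrable_add L2 integrable_const_ivl)
  have Jh: "norm (J \<alpha> \<gamma> (duk k) (dtk k) (dxk k) t) \<le> h t" if t: "t \<in> {0..T}" for k t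
  proof -
    define D where "D = norm (du t) + 1"
    have D: "D \<ge> 1" by (simp add: D_def)
    define m where "m = norm (dxk k t) + norm (duk k t)"
    have "C * 1 \<le> C * D" using C(1) D by (intro mult_left_mono) auto
    then have m: "0 \<le> m" "m \<le> 2 * C * D" using C(2)[OF t, of k] C(3)[OF t, of k] by (auto simp: m_def D_def)
    have CD: "0 \<le> 2 * C * D" using C(1) D by simp
    have "\<bar>dtk k\<bar> * m \<le> C * (2 * C * D)" using C(1) C(4)[of k] m by (intro mult_mono) auto
    also have "\<dots> = (2 * C\<^sup>2) * D" by (simp add: power2_eq_square)
    also have "\<dots> \<le> (2 * C\<^sup>2) * D\<^sup>2" using D by (intro mult_left_mono) (auto simp: power2_eq_square)
    finally have 1: "\<bar>dtk k\<bar> * m \<le> (2 * C\<^sup>2) * D\<^sup>2" .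
    have "m\<^sup>2 \<le> (2 * C * D)\<^sup>2" using m by (intro power_mono)
    also have "\<dots> = (4 * C\<^sup>2) * D\<^sup>2" by (simp add: power_mult_distrib)
    finally have "m\<^sup>2 + \<bar>dtk k\<bar> * m \<le> (6 * C\<^sup>2) * D\<^sup>2" using 1 by (simp add: algebra_simps)
    also have "\<dots> \<le> (6 * C\<^sup>2) * (2 * ((norm (du t))\<^sup>2 + 1))"
    proof (rule mult_left_mono)
      have "0 \<le> (norm (du t) - 1)\<^sup>2" by simp
      then show "D\<^sup>2 \<le> 2 * ((norm (du t))\<^sup>2 + 1)" by (simp add: D_def power2_eq_square algebra_simps)
    qed simp
    finally have "K * (m\<^sup>2 + \<bar>dtk k\<bar> * m) \<le> K * ((6 * C\<^sup>2) * (2 * ((norm (du t))\<^sup>2 + 1)))" using K(1) by (rule mult_left_mono)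
    also have "K * ((6 * C\<^sup>2) * (2 * ((norm (du t))\<^sup>2 + 1))) = h t" by (simp add: h_def)
    finally show ?thesis using K(2)[OF t, where du = "duk k" and dt = "dtk k" and dx = "dxk k"]
      unfolding m_def real_norm_def by (rule order_trans[rotated])
  qed
  have Ji: "J \<alpha> \<gamma> (duk k) (dtk k) (dxk k) integrable_on {0..T}" for k
    by (rule bounded_measurable_integrable_on[OF J_bm[OF bm]]) auto
  have Jt: "(\<lambda>k. J \<alpha> \<gamma> (duk k) (dtk k) (dxk k) t) \<longlonglongrightarrow> J \<alpha> \<gamma> du dt dx t" if "t \<in> {0..T}" for t
    by (rule J_tendsto[where duk = duk and dtk = dtk and dxk = dxk and du = du and dt = dt and dx = dx])
       (intro du dt dx that)+
  show "J \<alpha> \<gamma> du dt dx integrable_on {0..T}" by (rule dominated_convergence(1)[OF Ji hi Jh Jt])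
  have "(\<lambda>k. integral {0..T} (J \<alpha> \<gamma> (duk k) (dtk k) (dxk k))) \<longlonglongrightarrow> integral {0..T} (J \<alpha> \<gamma> du dt dx)"
    by (rule dominated_convergence(2)[OF Ji hi Jh Jt])
  moreover have "(\<lambda>k. dxk k T) \<longlonglongrightarrow> dx T" "(\<lambda>k. dxk k \<tau>) \<longlonglongrightarrow> dx \<tau>" using dx \<tau> by auto
  ultimately show "(\<lambda>k. half_Omega \<alpha> \<gamma> (duk k) (dtk k) (dxk k)) \<longlonglongrightarrow> half_Omega \<alpha> \<gamma> du dt dx"
    unfolding half_Omega_def by (intro tendsto_intros)
qed

text \<open>Every condition is linear in (\<alpha>, \<gamma>) or a closed inequality, so it passes
  to the limit at each instant outside the union of countably many null sets.\<close>

lemma first_order_closed: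
  assumes fo: "\<And>k. first_order (\<alpha>s k) (\<gamma>s k)" and lim: "\<alpha>s \<longlonglongrightarrow> \<alpha>" "\<gamma>s \<longlonglongrightarrow> \<gamma>"
  shows "first_order \<alpha> \<gamma>"
proof -
  define h where "h \<alpha> \<gamma> = integral {0..T} (\<lambda>t. rho T \<tau> t * (p \<alpha> \<gamma> t \<bullet> f (x t, u t)))" for \<alpha> \<gamma>
  have h: "h \<alpha> \<gamma> = \<alpha> * h 1 0 + \<gamma> * h 0 1" for \<alpha> \<gamma>
  proof -
    have "(\<lambda>t. rho T \<tau> t * (p \<alpha> \<gamma> t \<bullet> f (x t, u t))) = (\<lambda>t. \<alpha> * (rho T \<tau> t * (p 1 0 t \<bullet> f (x t, u t))) + \<gamma> * (rho T \<tau> t * (p 0 1 t \<bullet> f (x t, u t))))"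
      by (subst p_expand) (simp add: fun_eq_iff inner_add_left algebra_simps)
    then have "h \<alpha> \<gamma> = integral {0..T} (\<lambda>t. \<alpha> * (rho T \<tau> t * (p 1 0 t \<bullet> f (x t, u t))) + \<gamma> * (rho T \<tau> t * (p 0 1 t \<bullet> f (x t, u t))))"
      by (simp add: h_def)
    also have "\<dots> = integral {0..T} (\<lambda>t. \<alpha> * (rho T \<tau> t * (p 1 0 t \<bullet> f (x t, u t)))) + integral {0..T} (\<lambda>t. \<gamma> * (rho T \<tau> t * (p 0 1 t \<bullet> f (x t, u t))))"
      by (rule bounded_measurable_integral_add) (intro bounded_measurable_intros p_bm f_xu)+
    finally show ?thesis by (simp add: h_def)
  qed
  have fo': "\<alpha>s k \<ge> 0" "\<gamma>s k \<ge> 0" "\<alpha>s k + \<gamma>s k = 1" "h (\<alpha>s k) (\<gamma>s k) = \<alpha>s k" for k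
    using fo[of k] by (auto simp: first_order_def h_def)
  have "\<forall>k. \<exists>N. negligible N \<and> (\<forall>t\<in>{0..T} - N. q (\<alpha>s k) (\<gamma>s k) t = lin_comb (\<lambda>i. cgrad i t) (a (\<alpha>s k) (\<gamma>s k) t) \<and>
      (\<forall>i. a (\<alpha>s k) (\<gamma>s k) t $ i \<le> 0 \<and> (c (u t) $ i < 0 \<longrightarrow> a (\<alpha>s k) (\<gamma>s k) t $ i = 0)))"
    using fo by (simp add: first_order_def)
  from choice[OF this] obtain Ns where Ns: "\<And>k. negligible (Ns k)"
    and N: "\<And>k. \<forall>t\<in>{0..T} - Ns k. q (\<alpha>s k) (\<gamma>s k) t = lin_comb (\<lambda>i. cgrad i t) (a (\<alpha>s k) (\<gamma>s k) t) \<and>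
      (\<forall>i. a (\<alpha>s k) (\<gamma>s k) t $ i \<le> 0 \<and> (c (u t) $ i < 0 \<longrightarrow> a (\<alpha>s k) (\<gamma>s k) t $ i = 0))" by blast
  have qlim: "(\<lambda>k. q (\<alpha>s k) (\<gamma>s k) t) \<longlonglongrightarrow> q \<alpha> \<gamma> t" for t
    by (subst (1 2) q_expand) (intro tendsto_intros lim)
  have alim: "(\<lambda>k. a (\<alpha>s k) (\<gamma>s k) t) \<longlonglongrightarrow> a \<alpha> \<gamma> t" if "t \<in> {0..T}" for t
    by (subst (1 2) a_expand[OF that]) (intro tendsto_intros lim)
  show ?thesis
    unfolding first_order_def
  proof (intro conjI exI[of _ "\<Union>k. Ns k"] ballI allI impI)
    show "\<alpha> \<ge> 0" by (rule LIMSEQ_le_const[OF lim(1)]) (use fo' in auto)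
    show "\<gamma> \<ge> 0" by (rule LIMSEQ_le_const[OF lim(2)]) (use fo' in auto)
    have "(\<lambda>k. \<alpha>s k + \<gamma>s k) \<longlonglongrightarrow> \<alpha> + \<gamma>" by (intro tendsto_intros lim)
    then show "\<alpha> + \<gamma> = 1" by (simp add: fo'(3) LIMSEQ_const_iff)
    have "(\<lambda>k. h (\<alpha>s k) (\<gamma>s k)) \<longlonglongrightarrow> h \<alpha> \<gamma>" by (subst (1 2) h) (intro tendsto_intros lim)
    then have "\<alpha>s \<longlonglongrightarrow> h \<alpha> \<gamma>" by (simp add: fo'(4))
    then show "integral {0..T} (\<lambda>t. rho T \<tau> t * (p \<alpha> \<gamma> t \<bullet> f (x t, u t))) = \<alpha>"
      using LIMSEQ_unique lim(1) by (auto simp: h_def)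
    show "negligible (\<Union>k. Ns k)" using Ns by (intro negligible_countable_Union) auto
    fix t i assume "t \<in> {0..T} - (\<Union>k. Ns k)"
    then have t: "t \<in> {0..T}" and tN: "t \<in> {0..T} - Ns k" for k by auto
    have "(\<lambda>k. lin_comb (\<lambda>i. cgrad i t) (a (\<alpha>s k) (\<gamma>s k) t)) \<longlonglongrightarrow> lin_comb (\<lambda>i. cgrad i t) (a \<alpha> \<gamma> t)"
      unfolding lin_comb_def by (intro tendsto_intros alim[OF t])
    moreover have "lin_comb (\<lambda>i. cgrad i t) (a (\<alpha>s k) (\<gamma>s k) t) = q (\<alpha>s k) (\<gamma>s k) t" for k using N[of k] tN[of k] by simp
    ultimately have "(\<lambda>k. q (\<alpha>s k) (\<gamma>s k) t) \<longlonglongrightarrow> lin_comb (\<lambda>i. cgrad i t) (a \<alpha> \<gamma> t)" by simp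
    then show "q \<alpha> \<gamma> t = lin_comb (\<lambda>i. cgrad i t) (a \<alpha> \<gamma> t)" using LIMSEQ_unique qlim by blast
    have ai: "(\<lambda>k. a (\<alpha>s k) (\<gamma>s k) t $ i) \<longlonglongrightarrow> a \<alpha> \<gamma> t $ i" by (intro tendsto_intros alim[OF t])
    show "a \<alpha> \<gamma> t $ i \<le> 0" by (rule LIMSEQ_le_const2[OF ai]) (use N tN in blast)
    assume "c (u t) $ i < 0"
    then have "a (\<alpha>s k) (\<gamma>s k) t $ i = 0" for k using N tN by blast
    then show "a \<alpha> \<gamma> t $ i = 0" using ai by (simp add: LIMSEQ_const_iff)
  qed
qed

text \<open>Expanding in (\<alpha>, \<gamma>) separates the convergence of the multipliers from that
  of the directions, so the limit needs no joint estimate.\<close>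

lemma half_Omega_expand:
  assumes "J 1 0 du dt dx integrable_on {0..T}" "J 0 1 du dt dx integrable_on {0..T}"
  shows "half_Omega \<alpha> \<gamma> du dt dx = \<alpha> * half_Omega 1 0 du dt dx + \<gamma> * half_Omega 0 1 du dt dx"
proof -
  have "integral {0..T} (J \<alpha> \<gamma> du dt dx) = integral {0..T} (\<lambda>t. \<alpha> * J 1 0 du dt dx t + \<gamma> * J 0 1 du dt dx t)"
    by (rule integral_cong) (subst J_def, subst p_expand, subst a_expand, auto simp: J_def inner_add_left algebra_simps)
  also have "\<dots> = \<alpha> * integral {0..T} (J 1 0 du dt dx) + \<gamma> * integral {0..T} (J 0 1 du dt dx)"
    using assms by (subst Henstock_Kurzweil_Integration.integral_add) (auto intro: integrable_on_mult_right)
  finally show ?thesis by (simp add: half_Omega_def algebra_simps)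
qed

text \<open>The multipliers found for the approximating directions vary with them but stay in a
  compact square. A convergent subsequence suffices, because the first-order conditions are closed
  and the quadratic form converges together with the directions.\<close>

theorem multipliers_L2:
  assumes dum: "du \<in> borel_measurable (lebesgue_on {0..T})" and L2: "(\<lambda>t. (norm (du t))\<^sup>2) integrable_on {0..T}"
    and tangent: "\<And>t i. t \<in> {0..T} \<Longrightarrow> c (u t) $ i = 0 \<Longrightarrow> c' (u t) (du t) $ i = 0"
    and dx: "lin (src1 du dt) dx" and \<phi>1: "\<phi>' (x T) (dx T) - dt \<le> 0" and g1: "g' (x \<tau>) (dx \<tau>) \<le> 0"
  shows "\<exists>\<alpha> \<gamma>. first_order \<alpha> \<gamma> \<and> 0 \<le> half_Omega \<alpha> \<gamma> du dt dx"
proof -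
  have L1: "(\<lambda>t. norm (du t)) integrable_on {0..T}"
  proof -
    have "(\<lambda>t. norm (du t)) absolutely_integrable_on {0..T}"
    proof (rule measurable_bounded_by_integrable_imp_absolutely_integrable[where g = "\<lambda>t. (norm (du t))\<^sup>2 + 1"])
      show "(\<lambda>t. norm (du t)) \<in> borel_measurable (lebesgue_on {0..T})" by (rule measurable_compose[OF dum borel_measurable_norm])
      show "(\<lambda>t. (norm (du t))\<^sup>2 + 1) integrable_on {0..T}" by (intro integrable_add L2 integrable_const_ivl)
      fix t
      have "0 \<le> (norm (du t) - 1/2)\<^sup>2" by simp
      then show "norm (norm (du t)) \<le> (norm (du t))\<^sup>2 + 1" by (simp add: power2_eq_square algebra_simps)
    qed auto
    then show ?thesis by (simp add: absolutely_integrable_on_def)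
  qed
  define \<kappa>s where "\<kappa>s k = \<delta> / real (Suc k)" for k
  have \<kappa>s: "0 < \<kappa>s k" "\<kappa>s k \<le> \<delta>" for k
  proof -
    have "\<delta> * 1 \<le> \<delta> * real (Suc k)" using \<delta> by (intro mult_left_mono) auto
    then show "0 < \<kappa>s k" "\<kappa>s k \<le> \<delta>" using \<delta> by (auto simp: \<kappa>s_def pos_divide_le_eq)
  qed
  \<comment> \<open>Large values are replaced by 0 and not rescaled: \<open>cut k t\<close> equals
    \<open>du t\<close> for all large \<open>k\<close>, and it is tangent wherever
    \<open>du t\<close> is.\<close>
  define cut where "cut k t = (if norm (du t) \<le> real k then du t else 0)" for k t
  have cutb: "bounded_measurable T (cut k)" for k
    unfolding bounded_measurable_def
  proof
    have "{t \<in> space (lebesgue_on {0..T}). norm (du t) \<le> real k} \<in> sets (lebesgue_on {0..T})"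
      by (rule borel_measurable_le[OF measurable_compose[OF dum borel_measurable_norm] borel_measurable_const])
    then show "cut k \<in> borel_measurable (lebesgue_on {0..T})" unfolding cut_def[abs_def]
      by (intro measurable_If dum borel_measurable_const) auto
    show "\<exists>B. \<forall>t\<in>{0..T}. norm (cut k t) \<le> B" by (intro exI[of _ "real k"]) (simp add: cut_def)
  qed
  have cut_le: "norm (cut k t) \<le> norm (du t)" for k t by (simp add: cut_def)
  define \<beta> where "\<beta> k t = (\<chi> i. cgrad i t \<bullet> cut k t)" for k t
  have \<beta>b: "bounded_measurable T (\<beta> k)" for k
    unfolding \<beta>_def[abs_def] by (intro bounded_measurable_vecI) (simp add: bounded_measurable_inner cgrad_bm cutb)
  \<comment> \<open>Removes the component along the gradients active at level
    \<open>\<kappa>s k\<close>. At each instant the nearly active constraints are eventually the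
    active ones, to which \<open>du t\<close> is already tangent, so \<open>v k t\<close> finally
    equals \<open>du t\<close>.\<close>
  define v where "v k t = cut k t - lift (\<kappa>s k) (\<beta> k) t" for k t
  have vb: "bounded_measurable T (v k)" for k
    unfolding v_def[abs_def] by (intro bounded_measurable_intros cutb lift_bm \<beta>b \<kappa>s)
  have v_tan: "c' (u t) (v k t) $ i = 0" if "t \<in> {0..T}" "i \<in> active (\<kappa>s k) t" for k t i
    using lift_inside[OF \<kappa>s(2) that, of "\<beta> k"] by (simp add: v_def inner_diff_right \<beta>_def flip: cgrad_inner)
  obtain Bc where Bc: "Bc \<ge> 0" "\<And>t. t \<in> {0..T} \<Longrightarrow> norm (c' (u t)) \<le> Bc"
    by (rule bounded_measurable_continuous_bound[OF u c'_cont]) blast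
  define Cv where "Cv = 1 + Bc / \<epsilon>"
  have Cv: "Cv \<ge> 0" using Bc \<epsilon> by (simp add: Cv_def)
  have v_le: "norm (v k t) \<le> Cv * norm (du t)" if t: "t \<in> {0..T}" for k t
  proof -
    have "\<beta> k t = c' (u t) (cut k t)" by (simp add: \<beta>_def cgrad_inner vec_eq_iff)
    then have "norm (\<beta> k t) \<le> Bc * norm (du t)"
      using Bc(2)[OF t] cut_le[of k t] by (auto intro!: order_trans[OF norm_blinfun] mult_mono Bc(1))
    then have "norm (lift (\<kappa>s k) (\<beta> k) t) \<le> (Bc * norm (du t)) / \<epsilon>"
      using \<epsilon> by (intro order_trans[OF norm_lift[OF \<kappa>s(2) t]] divide_right_mono) auto
    then have "norm (v k t) \<le> norm (du t) + (Bc * norm (du t)) / \<epsilon>"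
      unfolding v_def using cut_le[of k t] by (intro order_trans[OF norm_triangle_ineq4 add_mono])
    then show ?thesis by (simp add: Cv_def algebra_simps)
  qed
  have v_lim: "(\<lambda>k. v k t) \<longlonglongrightarrow> du t" if t: "t \<in> {0..T}" for t
  proof (rule tendsto_eventually)
    have "eventually (\<lambda>k. norm (du t) \<le> real k) sequentially"
      using eventually_ge_at_top[of "nat \<lceil>norm (du t)\<rceil>"] by eventually_elim linarith
    moreover have "eventually (\<lambda>k. \<forall>i. c (u t) $ i < 0 \<longrightarrow> \<kappa>s k < - c (u t) $ i) sequentially"
    proof (rule eventually_all_finite)
      fix i
      have "\<kappa>s \<longlonglongrightarrow> 0" unfolding \<kappa>s_def[abs_def] using lim_const_over_n[of \<delta>] by (rule LIMSEQ_Suc)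
      then show "eventually (\<lambda>k. c (u t) $ i < 0 \<longrightarrow> \<kappa>s k < - c (u t) $ i) sequentially"
        by (cases "c (u t) $ i < 0") (auto dest: order_tendstoD(2)[of _ _ _ "- c (u t) $ i"])
    qed
    ultimately show "eventually (\<lambda>k. v k t = du t) sequentially"
    proof eventually_elim
      case (elim k)
      have ct: "cut k t = du t" using elim by (simp add: cut_def)
      have b0: "\<beta> k t $ i = 0" if "i \<in> active (\<kappa>s k) t" for i
      proof -
        have "\<not> c (u t) $ i < 0" using elim(2) that by (force simp: active_def)
        then have "c (u t) $ i = 0" using u_adm[OF t, of i] by simp
        then show ?thesis using tangent[OF t] by (simp add: \<beta>_def ct cgrad_inner)
      qed
      have "lift (\<kappa>s k) (\<beta> k) t \<bullet> lift (\<kappa>s k) (\<beta> k) t = (\<Sum>i\<in>UNIV. coef (\<kappa>s k) (\<beta> k) t $ i * (cgrad i t \<bullet> lift (\<kappa>s k) (\<beta> k) t))"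
        by (subst (1) lift_def) (rule inner_lin_comb)
      also have "\<dots> = 0"
      proof (intro sum.neutral ballI)
        fix i show "coef (\<kappa>s k) (\<beta> k) t $ i * (cgrad i t \<bullet> lift (\<kappa>s k) (\<beta> k) t) = 0"
          by (cases "i \<in> active (\<kappa>s k) t") (simp_all add: lift_inside[OF \<kappa>s(2) t] b0 coef_outside[OF \<kappa>s(2) t])
      qed
      finally show ?case by (simp add: v_def ct)
    qed
  qed
  have "\<exists>y. lin (src1 (v k) dt) y" for k by (rule lin_exists[OF src1_bm[OF vb]])
  then obtain y where y: "\<And>k. lin (src1 (v k) dt) (y k)" by metis
  have vdir: "dir (v k) dt (y k)" for k
    unfolding dir_def using vb y \<kappa>s v_tan by blast
  obtain CA where CA: "CA \<ge> 0" "\<And>t h. t \<in> {0..T} \<Longrightarrow> norm (A t h) \<le> CA * norm h" by (rule A_bound) blast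
  obtain CS where CS: "CS \<ge> 0" "\<And>r1 r2 y1 y2 t. lin r1 y1 \<Longrightarrow> lin r2 y2 \<Longrightarrow> (\<lambda>t. norm (r1 t - r2 t)) integrable_on {0..T} \<Longrightarrow>
    t \<in> {0..T} \<Longrightarrow> norm (y1 t - y2 t) \<le> CS * integral {0..T} (\<lambda>t. norm (r1 t - r2 t))" by (rule lin_stable) blast
  have srcd: "src1 (v k) dt t - src1 du dt t = A t (0, v k t - du t)" for k t
    by (simp add: src1_def flip: blinfun.diff_right)
  define I where "I k = integral {0..T} (\<lambda>t. norm (src1 (v k) dt t - src1 du dt t))" for k
  have Adum: "(\<lambda>t. norm (A t (0, v k t - du t))) \<in> borel_measurable (lebesgue_on {0..T})" for k
  proof -
    have m1: "(\<lambda>t. ((x t, u t), (0 :: real^'n, v k t - du t))) \<in> borel_measurable (lebesgue_on {0..T})"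
      using bounded_measurableD[OF xu] bounded_measurableD[OF vb[of k]] dum by measurable
    have m2: "continuous_on UNIV (\<lambda>z. norm (f' (fst z) (snd z)))"
      by (intro continuous_intros continuous_on_compose2[OF f'_cont]) auto
    from measurable_compose[OF m1 borel_measurable_continuous_onI[OF m2]] show ?thesis by simp
  qed
  have dom: "norm (norm (A t (0, v k t - du t))) \<le> CA * ((Cv + 1) * norm (du t))" if t: "t \<in> {0..T}" for k t
  proof -
    have "norm (v k t - du t) \<le> Cv * norm (du t) + norm (du t)" using norm_triangle_ineq4[of "v k t" "du t"] v_le[OF t, of k] by linarith
    then have "CA * norm (v k t - du t) \<le> CA * ((Cv + 1) * norm (du t))"
      using CA(1) by (intro mult_left_mono) (auto simp: algebra_simps)
    then show ?thesis using CA(2)[OF t, of "(0, v k t - du t)"] by simp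
  qed
  have domi: "(\<lambda>t. CA * ((Cv + 1) * norm (du t))) integrable_on {0..T}" by (intro integrable_on_mult_right L1)
  have Ai: "(\<lambda>t. norm (A t (0, v k t - du t))) integrable_on {0..T}" for k
    using measurable_bounded_by_integrable_imp_absolutely_integrable[OF Adum _ domi dom]
    by (simp add: absolutely_integrable_on_def)
  have "I \<longlonglongrightarrow> integral {0..T} (\<lambda>t. 0 :: real)"
    unfolding I_def srcd
  proof (rule dominated_convergence(2)[OF Ai domi dom])
    fix t assume t: "t \<in> {0..T}"
    have "(\<lambda>k. norm (A t (0, v k t - du t))) \<longlonglongrightarrow> norm (A t (0, du t - du t))"
      by (intro tendsto_intros v_lim[OF t])
    then show "(\<lambda>k. norm (A t (0, v k t - du t))) \<longlonglongrightarrow> 0" by (simp add: zero_prod_def[symmetric] blinfun.zero_right)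
  qed
  then have I0: "I \<longlonglongrightarrow> 0" by simp
  have ydx: "norm (y k t - dx t) \<le> CS * I k" if "t \<in> {0..T}" for k t
    unfolding I_def using CS(2)[OF y dx _ that] Ai[of k] by (simp add: srcd)
  have y_lim: "(\<lambda>k. y k t) \<longlonglongrightarrow> dx t" if t: "t \<in> {0..T}" for t
  proof -
    have "(\<lambda>k. CS * I k) \<longlonglongrightarrow> 0" using tendsto_mult_left[OF I0, of CS] by simp
    then have "(\<lambda>k. y k t - dx t) \<longlonglongrightarrow> 0"
      by (rule Lim_null_comparison[rotated]) (use ydx[OF t] in \<open>simp add: always_eventually\<close>)
    then show ?thesis by (simp add: LIM_zero_iff)
  qed
  define S where "S = {ell dt dx | du dt dx. dir du dt dx}"
  have S: "subspace S" unfolding S_def by (rule subspace_ell)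
  obtain B where BS: "B \<subseteq> S" and orth: "pairwise orthogonal B" and n1: "\<And>b. b \<in> B \<Longrightarrow> norm b = 1"
    and ind: "independent B" and span: "span B = S" by (rule orthonormal_basis_subspace[OF S]) blast
  have finB: "finite B" using ind by (rule independent_imp_finite)
  have "\<forall>b\<in>B. \<exists>e. dir (fst e) (fst (snd e)) (snd (snd e)) \<and> b = ell (fst (snd e)) (snd (snd e))"
  proof
    fix b assume "b \<in> B"
    with BS obtain du' dt' dx' where "b = ell dt' dx'" "dir du' dt' dx'" by (auto simp: S_def)
    then show "\<exists>e. dir (fst e) (fst (snd e)) (snd (snd e)) \<and> b = ell (fst (snd e)) (snd (snd e))"
      by (intro exI[of _ "(du', dt', dx')"]) simp
  qed
  from bchoice[OF this] obtain e where e: "\<forall>b\<in>B. dir (fst (e b)) (fst (snd (e b))) (snd (snd (e b))) \<and> b = ell (fst (snd (e b))) (snd (snd (e b)))"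
    by blast
  define E where "E b = fst (e b)" for b
  define Et where "Et b = fst (snd (e b))" for b
  define Xx where "Xx b = snd (snd (e b))" for b
  have Edir: "dir (E b) (Et b) (Xx b)" and Eell: "ell (Et b) (Xx b) = b" if "b \<in> B" for b
    using e that by (auto simp: E_def Et_def Xx_def)
  have ell_lim: "(\<lambda>k. ell dt (y k)) \<longlonglongrightarrow> ell dt dx"
    unfolding ell_def using \<tau> by (intro tendsto_intros y_lim) auto
  have yS: "ell dt (y k) \<in> S" for k using vdir[of k] by (auto simp: S_def)
  have dxS: "ell dt dx \<in> S"
    using closed_sequentially[OF closed_subspace[OF S], of "\<lambda>k. ell dt (y k)"] yS ell_lim by blast
  \<comment> \<open>Coordinates of the discrepancy in an orthonormal basis of the image. Since they
    tend to 0, adding fixed preimages of the basis vectors with these weights leaves the limit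
    direction unchanged.\<close>
  define w where "w k b = (ell dt dx - ell dt (y k)) \<bullet> b" for k b
  have w_lim: "(\<lambda>k. w k b) \<longlonglongrightarrow> 0" for b
  proof -
    have "(\<lambda>k. w k b) \<longlonglongrightarrow> (ell dt dx - ell dt dx) \<bullet> b" unfolding w_def by (intro tendsto_intros ell_lim)
    then show ?thesis by simp
  qed
  have wsum: "(\<Sum>b\<in>B. w k b *\<^sub>R b) = ell dt dx - ell dt (y k)" for k
    unfolding w_def by (rule orthonormal_basis_expand[OF orth n1 _ finB]) (use dxS yS S span in \<open>auto intro: subspace_diff\<close>)
  define duk where "duk k t = v k t + (\<Sum>b\<in>B. w k b *\<^sub>R E b t)" for k t
  define dtk where "dtk k = dt + (\<Sum>b\<in>B. w k b * Et b)" for k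
  define dxk where "dxk k t = y k t + (\<Sum>b\<in>B. w k b *\<^sub>R Xx b t)" for k t
  have sumdir: "dir (\<lambda>t. \<Sum>b\<in>B. w k b *\<^sub>R E b t) (\<Sum>b\<in>B. w k b * Et b) (\<lambda>t. \<Sum>b\<in>B. w k b *\<^sub>R Xx b t)"
    and sumell: "ell (\<Sum>b\<in>B. w k b * Et b) (\<lambda>t. \<Sum>b\<in>B. w k b *\<^sub>R Xx b t) = ell dt dx - ell dt (y k)" for k
    using dir_sum[OF finB Edir, where w = "w k"] wsum[of k] by (simp_all add: Eell cong: sum.cong)
  have dk: "dir (duk k) (dtk k) (dxk k)" for k
    using dir_combination[OF vdir[of k] sumdir[of k], of 1 1] by (simp add: duk_def[abs_def] dtk_def dxk_def[abs_def])
  \<comment> \<open>The corrected directions have exactly the values of the limit direction, hence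
    inherit the signs required by the bounded case.\<close>
  have ellk: "ell (dtk k) (dxk k) = ell dt dx" for k
    using ell_combination[of 1 dt 1 "\<Sum>b\<in>B. w k b * Et b" "y k" "\<lambda>t. \<Sum>b\<in>B. w k b *\<^sub>R Xx b t"] sumell[of k]
    by (simp add: dtk_def dxk_def[abs_def])
  have "\<exists>z. first_order (fst z) (snd z) \<and> 0 \<le> half_Omega (fst z) (snd z) (duk k) (dtk k) (dxk k)" for k
    using multipliers_dir[OF dk[of k]] \<phi>1 g1 by (simp add: ellk) (simp add: ell_def)
  then obtain zs where zs: "\<And>k. first_order (fst (zs k)) (snd (zs k))"
    "\<And>k. 0 \<le> half_Omega (fst (zs k)) (snd (zs k)) (duk k) (dtk k) (dxk k)" by metis
  have duk_bm: "bounded_measurable T (duk k)" and dxk_bm: "bounded_measurable T (dxk k)" for k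
    using dk[of k] lin_bm by (auto simp: dir_def)
  have duk_lim: "(\<lambda>k. duk k t) \<longlonglongrightarrow> du t" if t: "t \<in> {0..T}" for t
  proof -
    have "(\<lambda>k. duk k t) \<longlonglongrightarrow> du t + (\<Sum>b\<in>B. 0 *\<^sub>R E b t)" unfolding duk_def by (intro tendsto_intros v_lim[OF t] w_lim)
    then show ?thesis by simp
  qed
  have dxk_lim: "(\<lambda>k. dxk k t) \<longlonglongrightarrow> dx t" if t: "t \<in> {0..T}" for t
  proof -
    have "(\<lambda>k. dxk k t) \<longlonglongrightarrow> dx t + (\<Sum>b\<in>B. 0 *\<^sub>R Xx b t)" unfolding dxk_def by (intro tendsto_intros y_lim[OF t] w_lim)
    then show ?thesis by simp
  qed
  have dtk_lim: "dtk \<longlonglongrightarrow> dt"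
  proof -
    have "dtk \<longlonglongrightarrow> dt + (\<Sum>b\<in>B. 0 * Et b)" unfolding dtk_def by (intro tendsto_intros w_lim)
    then show ?thesis by simp
  qed
  have "\<exists>W. \<forall>b\<in>B. \<forall>k. \<bar>w k b\<bar> \<le> W"
  proof -
    have "\<exists>W. \<forall>k. \<bar>w k b\<bar> \<le> W" for b
      using w_lim[of b] by (metis Bseq_def convergentI convergent_imp_Bseq real_norm_def)
    then obtain W where W: "\<And>b k. \<bar>w k b\<bar> \<le> W b" by metis
    show ?thesis
    proof (intro exI[of _ "\<Sum>b\<in>B. \<bar>W b\<bar>"] ballI allI)
      fix b k assume "b \<in> B"
      have "\<bar>w k b\<bar> \<le> \<bar>W b\<bar>" using W[of k b] by linarith
      also have "\<dots> \<le> (\<Sum>b\<in>B. \<bar>W b\<bar>)" using finB \<open>b \<in> B\<close> by (intro member_le_sum) auto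
      finally show "\<bar>w k b\<bar> \<le> (\<Sum>b\<in>B. \<bar>W b\<bar>)" .
    qed
  qed
  then obtain W where W: "\<And>b k. b \<in> B \<Longrightarrow> \<bar>w k b\<bar> \<le> W" by blast
  have "\<exists>M. \<forall>t\<in>{0..T}. norm (E b t) \<le> M \<and> norm (Xx b t) \<le> M" if "b \<in> B" for b
  proof -
    have bb: "bounded_measurable T (E b)" "bounded_measurable T (Xx b)"
      using Edir[OF that] lin_bm by (auto simp: dir_def)
    obtain M1 where "\<And>t. t \<in> {0..T} \<Longrightarrow> norm (E b t) \<le> M1" by (rule bounded_measurable_bound[OF bb(1)]) blast
    moreover obtain M2 where "\<And>t. t \<in> {0..T} \<Longrightarrow> norm (Xx b t) \<le> M2" by (rule bounded_measurable_bound[OF bb(2)]) blast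
    ultimately show ?thesis by (intro exI[of _ "max M1 M2"]) (auto simp: le_max_iff_disj)
  qed
  then have "\<forall>b\<in>B. \<exists>M. \<forall>t\<in>{0..T}. norm (E b t) \<le> M \<and> norm (Xx b t) \<le> M" by blast
  from bchoice[OF this] obtain Mb where Mb: "\<forall>b\<in>B. \<forall>t\<in>{0..T}. norm (E b t) \<le> Mb b \<and> norm (Xx b t) \<le> Mb b" by blast
  define M where "M = (\<Sum>b\<in>B. \<bar>W\<bar> * \<bar>Mb b\<bar>)"
  have "M \<ge> 0" by (simp add: M_def sum_nonneg)
  have Wabs: "\<bar>w k b\<bar> \<le> \<bar>W\<bar>" if "b \<in> B" for k b using W[OF that, of k] by linarith
  have sumE: "norm (\<Sum>b\<in>B. w k b *\<^sub>R E b t) \<le> M" if t: "t \<in> {0..T}" for k t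
    unfolding M_def
  proof (rule sum_norm_le)
    fix b assume b: "b \<in> B"
    have "norm (E b t) \<le> \<bar>Mb b\<bar>" using Mb b t by (meson abs_ge_self order_trans)
    then show "norm (w k b *\<^sub>R E b t) \<le> \<bar>W\<bar> * \<bar>Mb b\<bar>" unfolding norm_scaleR using Wabs[OF b] by (intro mult_mono) auto
  qed
  have sumEx: "norm (\<Sum>b\<in>B. w k b *\<^sub>R Xx b t) \<le> M" if t: "t \<in> {0..T}" for k t
    unfolding M_def
  proof (rule sum_norm_le)
    fix b assume b: "b \<in> B"
    have "norm (Xx b t) \<le> \<bar>Mb b\<bar>" using Mb b t by (meson abs_ge_self order_trans)
    then show "norm (w k b *\<^sub>R Xx b t) \<le> \<bar>W\<bar> * \<bar>Mb b\<bar>" unfolding norm_scaleR using Wabs[OF b] by (intro mult_mono) auto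
  qed
  obtain Bx where Bx: "Bx \<ge> 0" "\<And>t. t \<in> {0..T} \<Longrightarrow> norm (dx t) \<le> Bx" by (rule bounded_measurable_bound[OF lin_bm[OF dx]]) blast
  have "Bseq I" using I0 by (metis convergentI convergent_imp_Bseq)
  then obtain BI where BI: "\<And>k. \<bar>I k\<bar> \<le> BI" by (auto simp: Bseq_def)
  have "Bseq dtk" using dtk_lim by (metis convergentI convergent_imp_Bseq)
  then obtain Bt where Bt: "\<And>k. \<bar>dtk k\<bar> \<le> Bt" by (auto simp: Bseq_def)
  \<comment> \<open>A single constant for all the bounds that the dominated convergence asks for;
    each summand covers one of them.\<close>
  define C where "C = Cv + M + Bx + CS * \<bar>BI\<bar> + \<bar>Bt\<bar>"
  have Cpos: "0 \<le> CS * \<bar>BI\<bar>" using CS(1) by simp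
  have C0: "C \<ge> 0" using Cv \<open>M \<ge> 0\<close> Bx(1) Cpos by (simp add: C_def)
  have C1: "norm (duk k t) \<le> C * (norm (du t) + 1)" if t: "t \<in> {0..T}" for k t
  proof -
    have "norm (duk k t) \<le> norm (v k t) + norm (\<Sum>b\<in>B. w k b *\<^sub>R E b t)" unfolding duk_def by (rule norm_triangle_ineq)
    also have "\<dots> \<le> Cv * norm (du t) + M" using v_le[OF t, of k] sumE[OF t, of k] by linarith
    also have "\<dots> \<le> C * norm (du t) + C"
    proof (intro add_mono mult_right_mono)
      show "Cv \<le> C" "M \<le> C" using Cv \<open>M \<ge> 0\<close> Bx(1) Cpos by (auto simp: C_def)
    qed simp
    finally show ?thesis by (simp add: algebra_simps)
  qed
  have C2: "norm (dxk k t) \<le> C" if t: "t \<in> {0..T}" for k t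
  proof -
    have "CS * I k \<le> CS * \<bar>BI\<bar>" using CS(1) BI[of k] by (intro mult_left_mono) auto
    then have "norm (y k t) \<le> Bx + CS * \<bar>BI\<bar>"
      using norm_triangle_ineq[of "dx t" "y k t - dx t"] Bx(2)[OF t] ydx[OF t, of k] by simp
    moreover have "norm (dxk k t) \<le> norm (y k t) + norm (\<Sum>b\<in>B. w k b *\<^sub>R Xx b t)" unfolding dxk_def by (rule norm_triangle_ineq)
    ultimately show ?thesis using sumEx[OF t, of k] Cv by (simp add: C_def)
  qed
  have C3: "\<bar>dtk k\<bar> \<le> C" for k using Bt[of k] Cv \<open>M \<ge> 0\<close> Bx(1) Cpos by (simp add: C_def)
  note conv = half_Omega_converges[OF L2 duk_bm dxk_bm duk_lim dtk_lim dxk_lim C0 C1 C2 C3]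
  have zs_in: "zs k \<in> {0..1} \<times> {0..1}" for k
    using zs(1)[of k] by (auto simp: first_order_def mem_Times_iff)
  have "compact ({0..1 :: real} \<times> {0..1 :: real})" by (intro compact_Times) auto
  then obtain z r where r: "strict_mono r" and z: "(zs \<circ> r) \<longlonglongrightarrow> z"
    using zs_in unfolding compact_def by metis
  define \<alpha> where "\<alpha> = fst z"
  define \<gamma> where "\<gamma> = snd z"
  have lim: "(\<lambda>k. fst (zs (r k))) \<longlonglongrightarrow> \<alpha>" "(\<lambda>k. snd (zs (r k))) \<longlonglongrightarrow> \<gamma>"
    using tendsto_fst[OF z] tendsto_snd[OF z] by (auto simp: \<alpha>_def \<gamma>_def o_def)
  have "first_order \<alpha> \<gamma>" by (rule first_order_closed[OF zs(1) lim])
  moreover have "0 \<le> half_Omega \<alpha> \<gamma> du dt dx"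
  proof (rule LIMSEQ_le_const)
    have sub: "(\<lambda>k. half_Omega a1 a2 (duk (r k)) (dtk (r k)) (dxk (r k))) \<longlonglongrightarrow> half_Omega a1 a2 du dt dx" for a1 a2
      using LIMSEQ_subseq_LIMSEQ[OF conv(1) r] by (simp add: o_def)
    have Ji: "J a1 a2 (duk k) (dtk k) (dxk k) integrable_on {0..T}" for a1 a2 k
      by (rule bounded_measurable_integrable_on[OF J_bm[OF duk_bm dxk_bm]]) auto
    have e1: "half_Omega \<alpha> \<gamma> du dt dx = \<alpha> * half_Omega 1 0 du dt dx + \<gamma> * half_Omega 0 1 du dt dx"
      by (rule half_Omega_expand[OF conv(2) conv(2)])
    have e2: "half_Omega (fst (zs (r k))) (snd (zs (r k))) (duk (r k)) (dtk (r k)) (dxk (r k)) =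
      fst (zs (r k)) * half_Omega 1 0 (duk (r k)) (dtk (r k)) (dxk (r k)) + snd (zs (r k)) * half_Omega 0 1 (duk (r k)) (dtk (r k)) (dxk (r k))" for k
      by (rule half_Omega_expand[OF Ji Ji])
    show "(\<lambda>k. half_Omega (fst (zs (r k))) (snd (zs (r k))) (duk (r k)) (dtk (r k)) (dxk (r k))) \<longlonglongrightarrow> half_Omega \<alpha> \<gamma> du dt dx"
      unfolding e1 e2 by (intro tendsto_intros lim sub)
    show "\<exists>N. \<forall>n\<ge>N. 0 \<le> half_Omega (fst (zs (r n))) (snd (zs (r n))) (duk (r n)) (dtk (r n)) (dxk (r n))"
      using zs(2) by blast
  qed
  ultimately show ?thesis by blast
qed

end

subsection \<open>Lagrange multipliers and the quadratic form\<close>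

lemma primitive_continuous:
  fixes h :: "real \<Rightarrow> 'a::banach"
  assumes P: "\<And>t. t \<in> {a..b} \<Longrightarrow> (h has_integral (P t - P a)) {a..t}"
  shows "continuous_on {a..b} P"
proof (cases "a \<le> b")
  case True
  have "continuous_on {a..b} (\<lambda>t. P a + integral {a..t} h)"
    by (intro continuous_intros indefinite_integral_continuous_1) (use P[of b] True in auto)
  then show ?thesis
  proof (rule continuous_on_eq)
    fix t assume "t \<in> {a..b}"
    then show "P a + integral {a..t} h = P t" using integral_unique[OF P[of t]] by simp
  qed
qed simp

text \<open>The definitions use the Lebesgue integral, the argument the gauge integral; for
  absolutely integrable functions they agree. The set \<open>N\<close> lets the control be exchanged
  for its representative in the same step.\<close>

lemma lebesgue_integral_eq_integral_spike:
  fixes h :: "'a::euclidean_space \<Rightarrow> real"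
  assumes h: "h absolutely_integrable_on S" and S: "S \<in> sets lebesgue" and N: "negligible N"
    and k: "\<And>t. t \<in> S - N \<Longrightarrow> k t = h t"
  shows "integral\<^sup>L (lebesgue_on S) k = integral S h"
proof -
  have "k absolutely_integrable_on S" using h N k by (rule absolutely_integrable_spike)
  then have "integral\<^sup>L (lebesgue_on S) k = integral S k"
    by (intro lebesgue_integral_eq_integral absolutely_integrable_imp_integrable S)
  also have "\<dots> = integral S h" by (rule integral_spike[OF N]) (simp add: k)
  finally show ?thesis .
qed

lemma grad_eqI:
  fixes F :: "'a::euclidean_space \<Rightarrow> real"
  assumes "(F has_derivative (\<lambda>h. D \<bullet> h)) (at z)"
  shows "grad F z = D"
proof -
  have "(F has_derivative blinfun_inner_right D) (at z)" using assms by (simp add: blinfun_inner_right.rep_eq)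
  then have "grad F z = blinfun_adj (blinfun_inner_right D) 1" by (rule grad_eq_blinfun_adj)
  moreover have "blinfun_adj (blinfun_inner_right D) 1 \<bullet> h = D \<bullet> h" for h
    by (simp add: blinfun_adj_inner blinfun_inner_right.rep_eq)
  ultimately show ?thesis by (metis vector_eq_rdot)
qed

lemma borel_measurable_blinfun_quadratic:
  fixes G :: "'a::euclidean_space \<Rightarrow> 'b::euclidean_space \<Rightarrow>\<^sub>L 'b \<Rightarrow>\<^sub>L 'c::euclidean_space"
  assumes "continuous_on UNIV G" "F \<in> borel_measurable M" "h \<in> borel_measurable M"
  shows "(\<lambda>t. G (F t) (h t) (h t)) \<in> borel_measurable M"
  by (rule borel_measurable_continuous_Pair[where H = "\<lambda>z h. G z h h", OF assms(2,3)])
     (intro continuous_intros continuous_on_compose2[OF assms(1)], auto)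

lemma borel_measurable_blinfun_apply:
  fixes G :: "'a::euclidean_space \<Rightarrow> 'b::euclidean_space \<Rightarrow>\<^sub>L 'c::euclidean_space"
  assumes "continuous_on UNIV G" "F \<in> borel_measurable M" "h \<in> borel_measurable M"
  shows "(\<lambda>t. G (F t) (h t)) \<in> borel_measurable M"
  by (rule borel_measurable_continuous_Pair[where H = "\<lambda>z h. G z h", OF assms(2,3)])
     (intro continuous_intros continuous_on_compose2[OF assms(1)], auto)

context crossing_problem
begin

text \<open>\<open>Omega\<close> is written with Lebesgue integrals, so the integrability obtained
  as a limit of gauge integrals has to be strengthened. Measurability and an integrable majorant do
  this.\<close>

lemma J_absolutely_integrable:
  assumes du: "du \<in> borel_measurable (lebesgue_on {0..T})" and L2: "(\<lambda>t. (norm (du t))\<^sup>2) integrable_on {0..T}"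
    and dx: "bounded_measurable T dx"
  shows "J \<alpha> \<gamma> du dt dx absolutely_integrable_on {0..T}"
proof -
  obtain K where K: "K \<ge> 0" "\<And>du dt dx t. t \<in> {0..T} \<Longrightarrow>
    \<bar>J \<alpha> \<gamma> du dt dx t\<bar> \<le> K * ((norm (dx t) + norm (du t))\<^sup>2 + \<bar>dt\<bar> * (norm (dx t) + norm (du t)))" by (rule J_bound) blast
  obtain B where B: "B \<ge> 0" "\<And>t. t \<in> {0..T} \<Longrightarrow> norm (dx t) \<le> B" by (rule bounded_measurable_bound[OF dx]) blast
  define h where "h t = K * ((2 * B\<^sup>2 + 2 * (norm (du t))\<^sup>2) + \<bar>dt\<bar> * (B + ((norm (du t))\<^sup>2 + 1)))" for t
  have rho: "bounded_measurable T (\<lambda>t. rho T \<tau> t * dt)" by (intro bounded_measurable_intros)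
  show ?thesis
  proof (rule measurable_bounded_by_integrable_imp_absolutely_integrable[where g = h])
    show "J \<alpha> \<gamma> du dt dx \<in> borel_measurable (lebesgue_on {0..T})"
      unfolding J_def[abs_def] src2_def curv_def
      by (intro borel_measurable_diff borel_measurable_inner borel_measurable_add borel_measurable_scaleR
          borel_measurable_const borel_measurable_blinfun_quadratic f''_cont c''_cont borel_measurable_blinfun_apply f'_cont
          borel_measurable_Pair du bounded_measurableD[OF dx] bounded_measurableD[OF p_bm] bounded_measurableD[OF a_bm]
          bounded_measurableD[OF x] bounded_measurableD[OF u] bounded_measurableD[OF rho])
    show "h integrable_on {0..T}" unfolding h_def[abs_def]
      by (intro integrable_on_mult_right integrable_add L2 integrable_const_ivl)
    fix t assume t: "t \<in> {0..T}"
    define m n where "m = norm (dx t)" and "n = norm (du t)"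
    have m: "0 \<le> m" "m \<le> B" using B t by (auto simp: m_def)
    have "0 \<le> (m - n)\<^sup>2" by simp
    moreover have "m\<^sup>2 \<le> B\<^sup>2" using m by (intro power_mono)
    ultimately have 1: "(m + n)\<^sup>2 \<le> 2 * B\<^sup>2 + 2 * n\<^sup>2" by (simp add: power2_eq_square algebra_simps)
    have "0 \<le> (n - 1/2)\<^sup>2" by simp
    then have "n \<le> n\<^sup>2 + 1" by (simp add: power2_eq_square algebra_simps)
    then have 2: "\<bar>dt\<bar> * (m + n) \<le> \<bar>dt\<bar> * (B + (n\<^sup>2 + 1))" using m by (intro mult_left_mono) auto
    have "K * ((m + n)\<^sup>2 + \<bar>dt\<bar> * (m + n)) \<le> h t"
      unfolding h_def n_def[symmetric] by (intro mult_left_mono add_mono 1 2 K(1))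
    then show "norm (J \<alpha> \<gamma> du dt dx t) \<le> h t"
      using K(2)[OF t, where du = du and dt = dt and dx = dx] unfolding m_def n_def real_norm_def by (rule order_trans[rotated])
  qed simp
qed

section \<open>Derivatives of the Hamiltonians\<close>

lemma f_fst_has_derivative: "((\<lambda>y. f (y, u t)) has_derivative (\<lambda>h. A t (h, 0))) (at (x t))"
  by (rule has_derivative_compose[where g = f and f = "\<lambda>y. (y, u t)", OF _ f']) (auto intro!: derivative_eq_intros)

lemma f_snd_has_derivative: "((\<lambda>w. f (x t, w)) has_derivative (\<lambda>h. A t (0, h))) (at (u t))"
  by (rule has_derivative_compose[where g = f and f = "\<lambda>w. (x t, w)", OF _ f']) (auto intro!: derivative_eq_intros)

lemma grad_Ham: "grad (\<lambda>y. Ham f y P (u t)) (x t) = fst (blinfun_adj (A t) P)"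
proof (rule grad_eqI)
  have "((\<lambda>y. P \<bullet> f (y, u t)) has_derivative (\<lambda>h. P \<bullet> A t (h, 0))) (at (x t))"
    by (rule has_derivative_inner_right[OF f_fst_has_derivative])
  moreover have "P \<bullet> A t (h, 0) = fst (blinfun_adj (A t) P) \<bullet> h" for h
    using blinfun_adj_inner[of "A t" P "(h, 0)"] by (simp add: inner_prod_def)
  ultimately show "((\<lambda>y. Ham f y P (u t)) has_derivative (\<lambda>h. fst (blinfun_adj (A t) P) \<bullet> h)) (at (x t))"
    by (simp add: Ham_def)
qed

lemma grad_Ham_aug:
  "grad (\<lambda>w. Ham_aug f c (x t) P w \<nu>) (u t) = snd (blinfun_adj (A t) P) + lin_comb (\<lambda>i. cgrad i t) \<nu>"
proof (rule grad_eqI)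
  have "((\<lambda>w. P \<bullet> f (x t, w) + \<nu> \<bullet> c w) has_derivative (\<lambda>h. P \<bullet> A t (0, h) + \<nu> \<bullet> c' (u t) h)) (at (u t))"
    by (intro has_derivative_add has_derivative_inner_right f_snd_has_derivative c')
  moreover have "P \<bullet> A t (0, h) + \<nu> \<bullet> c' (u t) h = (snd (blinfun_adj (A t) P) + lin_comb (\<lambda>i. cgrad i t) \<nu>) \<bullet> h" for h
    using blinfun_adj_inner[of "A t" P "(0, h)"]
    by (simp add: inner_prod_def inner_add_left inner_lin_comb cgrad_inner) (simp add: inner_vec_def)
  ultimately show "((\<lambda>w. Ham_aug f c (x t) P w \<nu>) has_derivative
      (\<lambda>h. (snd (blinfun_adj (A t) P) + lin_comb (\<lambda>i. cgrad i t) \<nu>) \<bullet> h)) (at (u t))"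
    by (simp add: Ham_aug_def)
qed

lemma deriv1_Ham: "deriv1 (\<lambda>(y, w). Ham f y P w) (x t, u t) h = P \<bullet> A t h"
proof (rule deriv1_eq)
  have "((\<lambda>z. P \<bullet> f z) has_derivative (\<lambda>h. P \<bullet> A t h)) (at (x t, u t))" by (intro has_derivative_inner_right f')
  then show "((\<lambda>(y, w). Ham f y P w) has_derivative (\<lambda>h. P \<bullet> A t h)) (at (x t, u t))"
    by (simp add: Ham_def case_prod_unfold)
qed

lemma deriv2_Ham_aug:
  "deriv2 (\<lambda>(y, w). Ham_aug f c y P w \<nu>) (x t, u t) h h = P \<bullet> f'' (x t, u t) h h + \<nu> \<bullet> c'' (u t) (snd h) (snd h)"
proof -
  have "(\<lambda>z. deriv1 (\<lambda>(y, w). Ham_aug f c y P w \<nu>) z h) = (\<lambda>z. P \<bullet> f' z h + \<nu> \<bullet> c' (snd z) (snd h))"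
  proof
    fix z
    have "((\<lambda>z. P \<bullet> f z + \<nu> \<bullet> c (snd z)) has_derivative (\<lambda>h. P \<bullet> f' z h + \<nu> \<bullet> c' (snd z) (snd h))) (at z)"
      by (intro has_derivative_add has_derivative_inner_right f'
          has_derivative_compose[where g = c and f = snd, OF _ c']) (auto intro!: derivative_eq_intros)
    then show "deriv1 (\<lambda>(y, w). Ham_aug f c y P w \<nu>) z h = P \<bullet> f' z h + \<nu> \<bullet> c' (snd z) (snd h)"
      by (intro deriv1_eq) (simp add: Ham_aug_def case_prod_unfold)
  qed
  moreover have "((\<lambda>z. P \<bullet> f' z h + \<nu> \<bullet> c' (snd z) (snd h)) has_derivative
      (\<lambda>k. P \<bullet> f'' (x t, u t) k h + \<nu> \<bullet> c'' (u t) (snd k) (snd h))) (at (x t, u t))"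
  proof (intro has_derivative_add has_derivative_inner_right)
    show "((\<lambda>z. f' z h) has_derivative (\<lambda>k. f'' (x t, u t) k h)) (at (x t, u t))"
      by (rule bounded_linear.has_derivative[OF blinfun.bounded_linear_left f''])
    have "((\<lambda>z. c' (snd z)) has_derivative (\<lambda>k. c'' (u t) (snd k))) (at (x t, u t))"
      by (rule has_derivative_compose[where g = c' and f = snd and g' = "c'' (u t)"]) (auto intro!: derivative_eq_intros c'')
    then show "((\<lambda>z. c' (snd z) (snd h)) has_derivative (\<lambda>k. c'' (u t) (snd k) (snd h))) (at (x t, u t))"
      by (rule bounded_linear.has_derivative[OF blinfun.bounded_linear_left])
  qed
  ultimately show ?thesis unfolding deriv2_def by (simp add: deriv1_eq)
qed

section \<open>Existence and uniqueness of the costate for the given control\<close>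

lemma costate_lipschitz:
  assumes p0: "costate b p1 p0" and b: "b \<in> {0..T}"
  obtains L where "L \<ge> 0" "\<And>s t. 0 \<le> s \<Longrightarrow> s \<le> t \<Longrightarrow> t \<le> b \<Longrightarrow> norm (p0 t - p0 s) \<le> L * (t - s)"
proof -
  have "bounded_measurable b p0" using p0 by (intro bounded_measurable_continuous) (simp add: costate_def)
  from bounded_measurable_adj[OF f'_cont xu_subinterval[OF b xu] this]
  have "bounded_measurable b (\<lambda>t. - fst (blinfun_adj (A t) (p0 t)))"
    by (intro bounded_measurable_uminus bounded_measurable_fst)
  then obtain L where L: "L \<ge> 0" "\<And>t. t \<in> {0..b} \<Longrightarrow> norm (- fst (blinfun_adj (A t) (p0 t))) \<le> L"
    by (rule bounded_measurable_bound) blast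
  show ?thesis
  proof (rule that[OF L(1)])
    fix s t assume st: "0 \<le> s" "s \<le> t" "t \<le> b"
    show "norm (p0 t - p0 s) \<le> L * (t - s)"
    proof (rule primitive_lipschitz[where a = 0 and b = b])
      show "((\<lambda>t. - fst (blinfun_adj (A t) (p0 t))) has_integral (p0 r - p0 0)) {0..r}" if "r \<in> {0..b}" for r
        by (rule costate_increment[OF p0 that])
    qed (use L st in auto)
  qed
qed

lemma costate_AE_derivative:
  assumes "costate b p1 p0" "0 \<le> b"
  shows "\<exists>N. negligible N \<and> (\<forall>t\<in>{0..b} - N. (p0 has_vector_derivative - fst (blinfun_adj (A t) (p0 t))) (at t))"
  by (rule primitive_AE_has_vector_derivative[OF costate_increment[OF assms(1)] assms(2)])

text \<open>Here and below \<open>u'\<close> is the given optimal control, which agrees with the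
  representative \<open>u\<close> outside a null set.\<close>

lemma is_costate_p:
  assumes N: "negligible N" and u': "\<And>t. t \<in> {0..T} - N \<Longrightarrow> u' t = u t"
  shows "is_costate T f \<phi> g u' x \<tau> \<alpha> \<gamma> (p \<alpha> \<gamma>)"
proof -
  obtain L1 where L1: "L1 \<ge> 0" "\<And>s t. 0 \<le> s \<Longrightarrow> s \<le> t \<Longrightarrow> t \<le> T \<Longrightarrow> norm (p\<phi> t - p\<phi> s) \<le> L1 * (t - s)"
    by (rule costate_lipschitz[OF p\<phi>]) (use T_pos in auto)
  obtain L2 where L2: "L2 \<ge> 0" "\<And>s t. 0 \<le> s \<Longrightarrow> s \<le> t \<Longrightarrow> t \<le> \<tau> \<Longrightarrow> norm (pg t - pg s) \<le> L2 * (t - s)"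
    by (rule costate_lipschitz[OF pg]) (use \<tau> in auto)
  obtain N1 where N1: "negligible N1" "\<forall>t\<in>{0..T} - N1. (p\<phi> has_vector_derivative - fst (blinfun_adj (A t) (p\<phi> t))) (at t)"
    using costate_AE_derivative[OF p\<phi> T_pos] by blast
  obtain N2 where N2: "negligible N2" "\<forall>t\<in>{0..\<tau>} - N2. (pg has_vector_derivative - fst (blinfun_adj (A t) (pg t))) (at t)"
    using costate_AE_derivative[OF pg] \<tau> by auto
  \<comment> \<open>\<open>pl\<close> and \<open>pr\<close> agree with the costate on one side of
    \<tau> each and are continuous up to \<tau>, so they carry the one-sided limits.\<close>
  define pl where "pl t = \<alpha> *\<^sub>R p\<phi> t + \<gamma> *\<^sub>R pg t" for t
  define pr where "pr t = \<alpha> *\<^sub>R p\<phi> t" for t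
  have p_pl: "pl t = p \<alpha> \<gamma> t" if "t < \<tau>" for t using that by (simp add: pl_def p_def)
  have p_pr: "pr t = p \<alpha> \<gamma> t" if "\<tau> \<le> t" for t using that by (simp add: pr_def p_def)
  have cpg: "continuous_on {0..\<tau>} pg" and cp\<phi>: "continuous_on {0..T} p\<phi>" using pg p\<phi> by (auto simp: costate_def)
  have cl: "continuous_on {0..\<tau>} pl" unfolding pl_def
    by (intro continuous_intros cpg continuous_on_subset[OF cp\<phi>]) (use \<tau> in auto)
  have cr: "continuous_on {\<tau>..T} pr" unfolding pr_def
    by (intro continuous_intros continuous_on_subset[OF cp\<phi>]) (use \<tau> in auto)
  have "absolutely_continuous_on {0..<\<tau>} (p \<alpha> \<gamma>)"
  proof (rule lipschitz_imp_absolutely_continuous_on[where L = "\<bar>\<alpha>\<bar> * L1 + \<bar>\<gamma>\<bar> * L2"])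
    fix s t assume st: "s \<in> {0..<\<tau>}" "t \<in> {0..<\<tau>}" "s \<le> t"
    have "p \<alpha> \<gamma> t - p \<alpha> \<gamma> s = \<alpha> *\<^sub>R (p\<phi> t - p\<phi> s) + \<gamma> *\<^sub>R (pg t - pg s)"
      using st by (simp add: p_def scaleR_diff_right)
    also have "norm \<dots> \<le> \<bar>\<alpha>\<bar> * norm (p\<phi> t - p\<phi> s) + \<bar>\<gamma>\<bar> * norm (pg t - pg s)"
      by (rule order_trans[OF norm_triangle_ineq]) simp
    also have "\<dots> \<le> \<bar>\<alpha>\<bar> * (L1 * (t - s)) + \<bar>\<gamma>\<bar> * (L2 * (t - s))"
      using st \<tau> by (intro add_mono mult_left_mono L1 L2) auto
    finally show "norm (p \<alpha> \<gamma> t - p \<alpha> \<gamma> s) \<le> (\<bar>\<alpha>\<bar> * L1 + \<bar>\<gamma>\<bar> * L2) * (t - s)" by (simp add: algebra_simps)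
  qed
  moreover have "absolutely_continuous_on {\<tau><..T} (p \<alpha> \<gamma>)"
  proof (rule lipschitz_imp_absolutely_continuous_on[where L = "\<bar>\<alpha>\<bar> * L1"])
    fix s t assume st: "s \<in> {\<tau><..T}" "t \<in> {\<tau><..T}" "s \<le> t"
    have "p \<alpha> \<gamma> t - p \<alpha> \<gamma> s = \<alpha> *\<^sub>R (p\<phi> t - p\<phi> s)"
      using st by (simp add: p_def scaleR_diff_right)
    also have "norm \<dots> = \<bar>\<alpha>\<bar> * norm (p\<phi> t - p\<phi> s)" by simp
    also have "\<dots> \<le> \<bar>\<alpha>\<bar> * (L1 * (t - s))"
      using st \<tau> by (intro mult_left_mono L1) auto
    finally show "norm (p \<alpha> \<gamma> t - p \<alpha> \<gamma> s) \<le> (\<bar>\<alpha>\<bar> * L1) * (t - s)" by (simp add: algebra_simps)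
  qed
  moreover have "AE t in lebesgue_on {0..T}.
      (p \<alpha> \<gamma> has_vector_derivative - grad (\<lambda>y. Ham f y (p \<alpha> \<gamma> t) (u' t)) (x t)) (at t)"
  proof (subst AE_lebesgue_on_iff_negligible, simp, intro exI[of _ "N \<union> N1 \<union> N2 \<union> {\<tau>}"] conjI ballI)
    show "negligible (N \<union> N1 \<union> N2 \<union> {\<tau>})" using N N1(1) N2(1) by simp
    fix t assume t: "t \<in> {0..T} - (N \<union> N1 \<union> N2 \<union> {\<tau>})"
    have g: "- grad (\<lambda>y. Ham f y (p \<alpha> \<gamma> t) (u' t)) (x t) = - fst (blinfun_adj (A t) (p \<alpha> \<gamma> t))"
      using u'[of t] t by (simp add: grad_Ham)
    have d\<phi>: "(p\<phi> has_vector_derivative - fst (blinfun_adj (A t) (p\<phi> t))) (at t)" using N1(2) t by blast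
    consider "t < \<tau>" | "\<tau> < t" using t by fastforce
    then show "(p \<alpha> \<gamma> has_vector_derivative - grad (\<lambda>y. Ham f y (p \<alpha> \<gamma> t) (u' t)) (x t)) (at t)"
    proof cases
      case 1
      have "t \<in> {0..\<tau>} - N2" using t 1 by auto
      then have dg: "(pg has_vector_derivative - fst (blinfun_adj (A t) (pg t))) (at t)" using N2(2) by blast
      have "(pl has_vector_derivative \<alpha> *\<^sub>R (- fst (blinfun_adj (A t) (p\<phi> t))) + \<gamma> *\<^sub>R (- fst (blinfun_adj (A t) (pg t)))) (at t)"
        unfolding pl_def by (intro has_vector_derivative_add has_vector_derivative_scaleR[of "\<lambda>_. r" 0 for r, simplified] d\<phi> dg)
      also have "\<alpha> *\<^sub>R (- fst (blinfun_adj (A t) (p\<phi> t))) + \<gamma> *\<^sub>R (- fst (blinfun_adj (A t) (pg t))) = - fst (blinfun_adj (A t) (p \<alpha> \<gamma> t))"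
        using 1 by (simp add: p_def blinfun_adj_add blinfun_adj_scaleR)
      finally show ?thesis unfolding g
        by (rule has_vector_derivative_transform_within_open[of _ _ _ "{..<\<tau>}"]) (use 1 p_pl in auto)
    next
      case 2
      have "(pr has_vector_derivative \<alpha> *\<^sub>R (- fst (blinfun_adj (A t) (p\<phi> t)))) (at t)"
        unfolding pr_def by (intro has_vector_derivative_scaleR[of "\<lambda>_. r" 0 for r, simplified] d\<phi>)
      also have "\<alpha> *\<^sub>R (- fst (blinfun_adj (A t) (p\<phi> t))) = - fst (blinfun_adj (A t) (p \<alpha> \<gamma> t))"
        using 2 by (simp add: p_def blinfun_adj_scaleR)
      finally show ?thesis unfolding g
        by (rule has_vector_derivative_transform_within_open[of _ _ _ "{\<tau><..}"]) (use 2 p_pr in auto)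
    qed
  qed
  moreover have "p \<alpha> \<gamma> T = \<alpha> *\<^sub>R grad \<phi> (x T)"
    using costate_end[OF p\<phi> T_pos] \<tau> by (simp add: p_def grad_eq_blinfun_adj[OF \<phi>'])
  moreover have "\<exists>pl pr. (p \<alpha> \<gamma> \<longlongrightarrow> pl) (at_left \<tau>) \<and> (p \<alpha> \<gamma> \<longlongrightarrow> pr) (at_right \<tau>) \<and> pl - pr = \<gamma> *\<^sub>R grad g (x \<tau>)"
  proof (rule exI[of _ "pl \<tau>"], rule exI[of _ "pr \<tau>"], intro conjI)
    have ev: "eventually (\<lambda>t. pl t = p \<alpha> \<gamma> t) (at_left \<tau>)"
      using p_pl by (auto simp: eventually_at_filter)
    show "(p \<alpha> \<gamma> \<longlongrightarrow> pl \<tau>) (at_left \<tau>)"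
      by (rule Lim_transform_eventually[OF continuous_on_Icc_at_leftD[OF cl \<tau>(1)] ev])
    have ev: "eventually (\<lambda>t. pr t = p \<alpha> \<gamma> t) (at_right \<tau>)"
      using p_pr by (auto simp: eventually_at_filter)
    show "(p \<alpha> \<gamma> \<longlongrightarrow> pr \<tau>) (at_right \<tau>)"
      by (rule Lim_transform_eventually[OF continuous_on_Icc_at_rightD[OF cr \<tau>(2)] ev])
    show "pl \<tau> - pr \<tau> = \<gamma> *\<^sub>R grad g (x \<tau>)"
      using costate_end[OF pg] \<tau> by (simp add: pl_def pr_def grad_eq_blinfun_adj[OF g'])
  qed
  ultimately show ?thesis unfolding is_costate_def by blast
qed

text \<open>An interval that avoids \<tau> lies on one side of the jump, where absolute continuity
  turns the almost everywhere equation into an integral equation.\<close>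

lemma is_costate_integral:
  assumes N: "negligible N" and u': "\<And>t. t \<in> {0..T} - N \<Longrightarrow> u' t = u t"
    and P: "is_costate T f \<phi> g u' x \<tau> \<alpha> \<gamma> P" and sb: "0 \<le> s" "s \<le> b" "b \<le> T" "\<tau> \<notin> {s..b}"
  shows "((\<lambda>t. - fst (blinfun_adj (A t) (P t))) has_integral (P b - P s)) {s..b}"
proof -
  have "AE t in lebesgue_on {0..T}. (P has_vector_derivative - grad (\<lambda>y. Ham f y (P t) (u' t)) (x t)) (at t)"
    and ac: "absolutely_continuous_on {0..<\<tau>} P" "absolutely_continuous_on {\<tau><..T} P"
    using P by (auto simp: is_costate_def)
  then obtain M where M: "negligible M" "\<forall>t\<in>{0..T} - M. (P has_vector_derivative - grad (\<lambda>y. Ham f y (P t) (u' t)) (x t)) (at t)"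
    by (auto simp: AE_lebesgue_on_iff_negligible)
  show ?thesis
  proof (rule fundamental_theorem_of_calculus_absolutely_continuous[OF sb(2), where N = "N \<union> M"])
    show "absolutely_continuous_on {s..b} P"
    proof (cases "b < \<tau>")
      case True
      then show ?thesis using sb by (intro absolutely_continuous_on_subset[OF ac(1)]) auto
    next
      case False
      then show ?thesis using sb by (intro absolutely_continuous_on_subset[OF ac(2)]) auto
    qed
    show "negligible (N \<union> M)" using N M(1) by simp
    fix t assume "t \<in> {s..b} - (N \<union> M)"
    then have t: "t \<in> {0..T} - N" "t \<in> {0..T} - M" using sb by auto
    have "(P has_vector_derivative - grad (\<lambda>y. Ham f y (P t) (u' t)) (x t)) (at t)" using M(2) t(2) by blast
    then have "(P has_vector_derivative - fst (blinfun_adj (A t) (P t))) (at t)" using u'[OF t(1)] by (simp add: grad_Ham)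
    then show "(P has_vector_derivative - fst (blinfun_adj (A t) (P t))) (at t within {s..b})"
      by (rule has_vector_derivative_at_within)
  qed
qed

text \<open>Needed because \<open>Omega\<close> selects some costate. The difference of two costates
  solves the homogeneous adjoint equation, vanishes after \<tau> since it vanishes at
  \<open>T\<close>, has no jump because the prescribed jumps cancel, and so vanishes before \<tau>
  as well.\<close>

lemma is_costate_unique:
  assumes N: "negligible N" and u': "\<And>t. t \<in> {0..T} - N \<Longrightarrow> u' t = u t"
    and P: "is_costate T f \<phi> g u' x \<tau> \<alpha> \<gamma> P" and Q: "is_costate T f \<phi> g u' x \<tau> \<alpha> \<gamma> Q"
    and t: "t \<in> {0..T}" "t \<noteq> \<tau>"
  shows "P t = Q t"
proof -
  define e where "e t = P t - Q t" for t
  obtain C where C: "C \<ge> 0" "\<And>t. t \<in> {0..T} \<Longrightarrow> norm (A t) \<le> C"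
    by (rule bounded_measurable_continuous_bound[OF xu f'_cont]) blast
  have inc: "((\<lambda>t. - fst (blinfun_adj (A t) (e t))) has_integral (e b - e s)) {s..b}"
    if "0 \<le> s" "s \<le> b" "b \<le> T" "\<tau> \<notin> {s..b}" for s b
  proof -
    have "((\<lambda>t. - fst (blinfun_adj (A t) (P t)) - - fst (blinfun_adj (A t) (Q t))) has_integral (P b - P s) - (Q b - Q s)) {s..b}"
      by (intro has_integral_diff is_costate_integral[OF N u' P that] is_costate_integral[OF N u' Q that])
    moreover have "- fst (blinfun_adj (A t) (P t)) - - fst (blinfun_adj (A t) (Q t)) = - fst (blinfun_adj (A t) (e t))" for t
    proof -
      have "blinfun_adj (A t) (P t) = blinfun_adj (A t) (e t) + blinfun_adj (A t) (Q t)"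
        by (simp add: e_def flip: blinfun_adj_add)
      then show ?thesis by simp
    qed
    moreover have "P b - P s - (Q b - Q s) = e b - e s" by (simp add: e_def)
    ultimately show ?thesis by (simp only:)
  qed
  \<comment> \<open>The factor does not depend on \<open>s\<close> and \<open>b\<close>, so
    \<open>b\<close> may tend to \<tau> from the left.\<close>
  have bound: "norm (e s) \<le> norm (e b) * exp (C * T)" if sb: "0 \<le> s" "s \<le> b" "b \<le> T" "\<tau> \<notin> {s..b}" for s b
  proof -
    have ec: "continuous_on {s..b} e" by (rule primitive_continuous[OF inc]) (use sb in auto)
    then have nc: "continuous_on {s..b} (\<lambda>t. norm (e t))" by (intro continuous_intros)
    have "norm (e s) \<le> norm (e b) * exp (C * (b - s))"
    proof (rule gronwall_backward[where z = "\<lambda>t. norm (e t)", OF nc C(1)])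
      fix r assume r: "r \<in> {s..b}"
      have i: "((\<lambda>t. - fst (blinfun_adj (A t) (e t))) has_integral (e b - e r)) {r..b}"
        by (rule inc) (use sb r in auto)
      have ni: "(\<lambda>t. norm (e t)) integrable_on {r..b}"
        by (rule integrable_continuous_real[OF continuous_on_subset[OF nc]]) (use r in auto)
      have "norm (e b - e r) = norm (integral {r..b} (\<lambda>t. - fst (blinfun_adj (A t) (e t))))"
        by (simp only: integral_unique[OF i])
      also have "\<dots> \<le> integral {r..b} (\<lambda>t. C * norm (e t))"
      proof (rule integral_norm_bound_integral)
        show "(\<lambda>t. - fst (blinfun_adj (A t) (e t))) integrable_on {r..b}" using i by blast
        show "(\<lambda>t. C * norm (e t)) integrable_on {r..b}" using ni by (rule integrable_on_mult_right)
        fix t assume t: "t \<in> {r..b}"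
        have "norm (fst (blinfun_adj (A t) (e t))) \<le> norm (blinfun_adj (A t) (e t))"
          by (metis norm_fst_le prod.collapse)
        also have "\<dots> \<le> norm (A t) * norm (e t)" by (rule norm_blinfun_adj)
        also have "\<dots> \<le> C * norm (e t)" using C(2)[of t] t r sb by (intro mult_right_mono) auto
        finally show "norm (- fst (blinfun_adj (A t) (e t))) \<le> C * norm (e t)" by simp
      qed
      also have "\<dots> = C * integral {r..b} (\<lambda>t. norm (e t))" by simp
      finally show "norm (e r) \<le> norm (e b) + C * integral {r..b} (\<lambda>t. norm (e t))"
        using norm_triangle_ineq3[of "e r" "e b"] by (simp add: norm_minus_commute)
    qed (use sb in auto)
    also have "\<dots> \<le> norm (e b) * exp (C * T)" using C(1) sb by (intro mult_left_mono) (auto intro!: mult_left_mono)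
    finally show ?thesis .
  qed
  have eT: "e T = 0" using P Q by (simp add: e_def is_costate_def)
  have right: "e s = 0" if "\<tau> < s" "s \<le> T" for s using bound[of s T] that \<tau> eT by auto
  obtain Pl Pr where Pl: "(P \<longlongrightarrow> Pl) (at_left \<tau>)" and Pr: "(P \<longlongrightarrow> Pr) (at_right \<tau>)" and PJ: "Pl - Pr = \<gamma> *\<^sub>R grad g (x \<tau>)"
    using P unfolding is_costate_def by blast
  obtain Ql Qr where Ql: "(Q \<longlongrightarrow> Ql) (at_left \<tau>)" and Qr: "(Q \<longlongrightarrow> Qr) (at_right \<tau>)" and QJ: "Ql - Qr = \<gamma> *\<^sub>R grad g (x \<tau>)"
    using Q unfolding is_costate_def by blast
  have "(e \<longlongrightarrow> Pr - Qr) (at_right \<tau>)" unfolding e_def by (intro tendsto_diff Pr Qr)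
  moreover have "eventually (\<lambda>t. 0 = e t) (at_right \<tau>)"
    unfolding eventually_at_right_field using right \<tau> by (intro exI[of _ T]) auto
  then have "(e \<longlongrightarrow> 0) (at_right \<tau>)" by (rule Lim_transform_eventually[rotated]) simp
  ultimately have "Pr - Qr = 0" by (rule tendsto_unique[OF trivial_limit_at_right_real])
  then have "Pl - Ql = 0" using PJ QJ by (simp add: algebra_simps)
  moreover have "(e \<longlongrightarrow> Pl - Ql) (at_left \<tau>)" unfolding e_def by (intro tendsto_diff Pl Ql)
  ultimately have el: "((\<lambda>b. norm (e b) * exp (C * T)) \<longlongrightarrow> 0) (at_left \<tau>)" by (auto intro!: tendsto_eq_intros)
  have left: "e s = 0" if "0 \<le> s" "s < \<tau>" for s
  proof -
    have "eventually (\<lambda>b. norm (e s) \<le> norm (e b) * exp (C * T)) (at_left \<tau>)"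
      unfolding eventually_at_left_field using that \<tau> by (intro exI[of _ s]) (auto intro!: bound)
    with el have "norm (e s) \<le> 0" by (rule tendsto_lowerbound) simp
    then show ?thesis by simp
  qed
  show ?thesis using left[of t] right[of t] t by (cases "t < \<tau>") (auto simp: e_def)
qed

text \<open>Nontriviality comes from \<alpha> + \<gamma> = 1, and boundedness of \<nu> from the
  uniform bound on the projection coefficients.\<close>

lemma lagrange_multiplier:
  assumes N: "negligible N" and u': "\<And>t. t \<in> {0..T} - N \<Longrightarrow> u' t = u t" and fo: "first_order \<alpha> \<gamma>"
  shows "(\<alpha>, \<gamma>, \<lambda>t. - a \<alpha> \<gamma> t) \<in> lagrange_multipliers T f \<phi> g c u' x \<tau>"
proof -
  obtain M where M: "negligible M" "\<forall>t\<in>{0..T} - M. q \<alpha> \<gamma> t = lin_comb (\<lambda>i. cgrad i t) (a \<alpha> \<gamma> t) \<and>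
      (\<forall>i. a \<alpha> \<gamma> t $ i \<le> 0 \<and> (c (u t) $ i < 0 \<longrightarrow> a \<alpha> \<gamma> t $ i = 0))" using fo unfolding first_order_def by blast
  have NM: "negligible (N \<union> M)" using N M(1) by simp
  have ab: "bounded_measurable T (\<lambda>t. - a \<alpha> \<gamma> t)" by (intro bounded_measurable_intros a_bm)
  then obtain B where B: "\<And>t. t \<in> {0..T} \<Longrightarrow> norm (- a \<alpha> \<gamma> t) \<le> B" by (rule bounded_measurable_bound) blast
  have "(\<lambda>t. - a \<alpha> \<gamma> t) \<in> Linf_space T"
    unfolding Linf_space_def using bounded_measurableD[OF ab] B by (auto intro!: exI[of _ B] AE_I2)
  moreover have "AE t in lebesgue_on {0..T}. (\<forall>i. (- a \<alpha> \<gamma> t) $ i \<ge> 0) \<and> - a \<alpha> \<gamma> t \<bullet> c (u' t) = 0"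
  proof (subst AE_lebesgue_on_iff_negligible, simp, intro exI[of _ "N \<union> M"] conjI ballI NM allI)
    fix t i assume t: "t \<in> {0..T} - (N \<union> M)"
    then have a: "\<And>i. a \<alpha> \<gamma> t $ i \<le> 0" "\<And>i. c (u t) $ i < 0 \<Longrightarrow> a \<alpha> \<gamma> t $ i = 0" using M(2) by auto
    show "(- a \<alpha> \<gamma> t) $ i \<ge> 0" using a(1)[of i] by simp
    have "a \<alpha> \<gamma> t $ i * c (u t) $ i = 0" for i
      using a(2)[of i] u_adm[of t i] t by (cases "c (u t) $ i < 0") auto
    then have "a \<alpha> \<gamma> t \<bullet> c (u t) = 0" unfolding inner_vec_def by (intro sum.neutral) simp
    then show "- a \<alpha> \<gamma> t \<bullet> c (u' t) = 0" using u'[of t] t by simp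
  qed
  moreover have "AE t in lebesgue_on {0..T}. grad (\<lambda>w. Ham_aug f c (x t) (p \<alpha> \<gamma> t) w (- a \<alpha> \<gamma> t)) (u' t) = 0"
  proof (subst AE_lebesgue_on_iff_negligible, simp, intro exI[of _ "N \<union> M"] conjI ballI NM)
    fix t assume t: "t \<in> {0..T} - (N \<union> M)"
    then have "q \<alpha> \<gamma> t = lin_comb (\<lambda>i. cgrad i t) (a \<alpha> \<gamma> t)" using M(2) by auto
    moreover have "lin_comb (\<lambda>i. cgrad i t) (- a \<alpha> \<gamma> t) = - lin_comb (\<lambda>i. cgrad i t) (a \<alpha> \<gamma> t)"
      by (simp add: lin_comb_def sum_negf)
    ultimately show "grad (\<lambda>w. Ham_aug f c (x t) (p \<alpha> \<gamma> t) w (- a \<alpha> \<gamma> t)) (u' t) = 0"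
      using u'[of t] t by (simp add: grad_Ham_aug q_def)
  qed
  moreover have "(LINT t|lebesgue_on {0..T}. rho T \<tau> t * Ham f (x t) (p \<alpha> \<gamma> t) (u' t)) = \<alpha>"
  proof -
    have "bounded_measurable T (\<lambda>t. rho T \<tau> t * (p \<alpha> \<gamma> t \<bullet> f (x t, u t)))" by (intro bounded_measurable_intros p_bm f_xu)
    then have "(LINT t|lebesgue_on {0..T}. rho T \<tau> t * Ham f (x t) (p \<alpha> \<gamma> t) (u' t)) =
        integral {0..T} (\<lambda>t. rho T \<tau> t * (p \<alpha> \<gamma> t \<bullet> f (x t, u t)))"
      by (intro lebesgue_integral_eq_integral_spike[OF _ _ N] bounded_measurable_absolutely_integrable_on) (auto simp: Ham_def u')
    then show ?thesis using fo by (simp add: first_order_def)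
  qed
  moreover have "\<alpha> \<ge> 0" "\<not> (\<alpha> = 0 \<and> \<gamma> = 0)" using fo by (auto simp: first_order_def)
  ultimately show ?thesis
    unfolding lagrange_multipliers_def using is_costate_p[OF N u', of \<alpha> \<gamma>] by blast
qed

text \<open>Combined with \<open>lin_unique\<close> this identifies the linearized state selected in
  \<open>Omega\<close> on all of \<open>{0..T}\<close>.\<close>

lemma is_linearized_state_lin:
  assumes N: "negligible N" and u': "\<And>t. t \<in> {0..T} - N \<Longrightarrow> u' t = u t"
    and du': "\<And>t. t \<in> {0..T} - N \<Longrightarrow> du' t = du t"
    and y: "is_linearized_state T f u' x \<tau> du' dt y"
  shows "lin (src1 du dt) y"
proof -
  have ac: "absolutely_continuous_on {0..T} y" and y0: "y 0 = 0" and "AE t in lebesgue_on {0..T}.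
      (y has_vector_derivative deriv1 f (x t, u' t) (y t, du' t) + (rho T \<tau> t * dt) *\<^sub>R f (x t, u' t)) (at t)"
    using y by (auto simp: is_linearized_state_def)
  then obtain M where M: "negligible M" "\<forall>t\<in>{0..T} - M.
      (y has_vector_derivative deriv1 f (x t, u' t) (y t, du' t) + (rho T \<tau> t * dt) *\<^sub>R f (x t, u' t)) (at t)"
    by (auto simp: AE_lebesgue_on_iff_negligible)
  have int: "((\<lambda>s. A s (y s, 0) + src1 du dt s) has_integral (y t - y 0)) {0..t}" if t: "t \<in> {0..T}" for t
  proof (rule fundamental_theorem_of_calculus_absolutely_continuous[where N = "N \<union> M"])
    show "0 \<le> t" using t by simp
    show "absolutely_continuous_on {0..t} y" using t by (intro absolutely_continuous_on_subset[OF ac]) auto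
    show "negligible (N \<union> M)" using N M(1) by simp
    fix s assume "s \<in> {0..t} - (N \<union> M)"
    then have s: "s \<in> {0..T} - N" "s \<in> {0..T} - M" using t by auto
    have "(y s, du s) = (y s, 0) + (0, du s)" by simp
    then have "A s (y s, du s) = A s (y s, 0) + A s (0, du s)" by (simp only: blinfun.add_right)
    then have "deriv1 f (x s, u' s) (y s, du' s) + (rho T \<tau> s * dt) *\<^sub>R f (x s, u' s) = A s (y s, 0) + src1 du dt s"
      using u'[OF s(1)] du'[OF s(1)] by (simp add: deriv1_eq[OF f'] src1_def)
    moreover have "(y has_vector_derivative deriv1 f (x s, u' s) (y s, du' s) + (rho T \<tau> s * dt) *\<^sub>R f (x s, u' s)) (at s)"
      using M(2) s(2) by blast
    ultimately show "(y has_vector_derivative A s (y s, 0) + src1 du dt s) (at s within {0..t})"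
      by (simp add: has_vector_derivative_at_within)
  qed
  show ?thesis unfolding lin_def using int primitive_continuous[OF int] by (simp add: y0)
qed

lemma Omega_eq_half_Omega:
  assumes N: "negligible N" and u': "\<And>t. t \<in> {0..T} - N \<Longrightarrow> u' t = u t"
    and du': "\<And>t. t \<in> {0..T} - N \<Longrightarrow> du' t = du t"
    and dum: "du \<in> borel_measurable (lebesgue_on {0..T})" and L2: "(\<lambda>t. (norm (du t))\<^sup>2) integrable_on {0..T}"
    and y: "is_linearized_state T f u' x \<tau> du' dt dx"
  shows "Omega T f \<phi> g c u' x \<tau> \<alpha> \<gamma> (\<lambda>t. - a \<alpha> \<gamma> t) du' dt = 2 * half_Omega \<alpha> \<gamma> du dt dx"
proof -
  define y' where "y' = (SOME y. is_linearized_state T f u' x \<tau> du' dt y)"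
  define P where "P = (SOME p. is_costate T f \<phi> g u' x \<tau> \<alpha> \<gamma> p)"
  have "is_linearized_state T f u' x \<tau> du' dt y'" unfolding y'_def by (rule someI[where P = "is_linearized_state T f u' x \<tau> du' dt", OF y])
  note l = is_linearized_state_lin[OF N u' du' y] is_linearized_state_lin[OF N u' du' this]
  have y': "y' t = dx t" if "t \<in> {0..T}" for t by (rule lin_unique[OF l(2,1) that])
  have "is_costate T f \<phi> g u' x \<tau> \<alpha> \<gamma> P" unfolding P_def
    by (rule someI[where P = "is_costate T f \<phi> g u' x \<tau> \<alpha> \<gamma>", OF is_costate_p[OF N u']])
  then have P: "P t = p \<alpha> \<gamma> t" if "t \<in> {0..T}" "t \<noteq> \<tau>" for t
    by (intro is_costate_unique[OF N u' _ is_costate_p[OF N u'] that])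
  \<comment> \<open>The integrand is affine in the time shift: \<open>j 0\<close> is half of the
    second-derivative term of \<open>Omega\<close>, and \<open>j 1 t - j 0 t\<close> is the
    integrand of its mixed term. Both integrals thus exist because \<open>J\<close> is absolutely
    integrable.\<close>
  define j where "j r = J \<alpha> \<gamma> du r dx" for r
  have ji: "j r absolutely_integrable_on {0..T}" for r unfolding j_def by (rule J_absolutely_integrable[OF dum L2 lin_bm[OF l(1)]])
  have ji': "j r integrable_on {0..T}" for r using ji[of r] by (simp add: absolutely_integrable_on_def)
  have j_eq: "j r t = (1/2) * (p \<alpha> \<gamma> t \<bullet> f'' (x t, u t) (dx t, du t) (dx t, du t) - a \<alpha> \<gamma> t \<bullet> c'' (u t) (du t) (du t)) +
      r * (rho T \<tau> t * (p \<alpha> \<gamma> t \<bullet> A t (dx t, du t)))" for r t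
    by (simp add: j_def J_def src2_def curv_def inner_add_right algebra_simps)
  have N': "negligible (N \<union> {\<tau>})" using N by simp
  have "(LINT t|lebesgue_on {0..T}. deriv2 (\<lambda>(y, w). Ham_aug f c y (P t) w (- a \<alpha> \<gamma> t)) (x t, u' t) (y' t, du' t) (y' t, du' t)) =
      integral {0..T} (\<lambda>t. 2 * j 0 t)"
  proof (rule lebesgue_integral_eq_integral_spike[OF _ _ N'])
    show "(\<lambda>t. 2 * j 0 t) absolutely_integrable_on {0..T}"
      using absolutely_integrable_scaleR_left[OF ji[of 0], of 2] by simp
    fix t assume "t \<in> {0..T} - (N \<union> {\<tau>})"
    then show "deriv2 (\<lambda>(y, w). Ham_aug f c y (P t) w (- a \<alpha> \<gamma> t)) (x t, u' t) (y' t, du' t) (y' t, du' t) = 2 * j 0 t"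
      by (simp add: u' du' y' P deriv2_Ham_aug j_eq)
  qed simp
  moreover have "(LINT t|lebesgue_on {0..T}. rho T \<tau> t * deriv1 (\<lambda>(y, w). Ham f y (P t) w) (x t, u' t) (y' t, du' t)) =
      integral {0..T} (\<lambda>t. j 1 t - j 0 t)"
  proof (rule lebesgue_integral_eq_integral_spike[OF _ _ N'])
    show "(\<lambda>t. j 1 t - j 0 t) absolutely_integrable_on {0..T}" by (intro set_integral_diff(1) ji)
    fix t assume "t \<in> {0..T} - (N \<union> {\<tau>})"
    then show "rho T \<tau> t * deriv1 (\<lambda>(y, w). Ham f y (P t) w) (x t, u' t) (y' t, du' t) = j 1 t - j 0 t"
      by (simp add: u' du' y' P deriv1_Ham j_eq)
  qed simp
  moreover have "integral {0..T} (j dt) = integral {0..T} (j 0) + dt * integral {0..T} (\<lambda>t. j 1 t - j 0 t)"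
  proof -
    have "integral {0..T} (j dt) = integral {0..T} (\<lambda>t. j 0 t + dt * (j 1 t - j 0 t))"
      by (rule integral_cong) (simp add: j_eq)
    also have "\<dots> = integral {0..T} (j 0) + integral {0..T} (\<lambda>t. dt * (j 1 t - j 0 t))"
      by (intro Henstock_Kurzweil_Integration.integral_add integrable_on_mult_right integrable_diff ji')
    finally show ?thesis by simp
  qed
  moreover have "y' T = dx T" "y' \<tau> = dx \<tau>" using y' \<tau> by auto
  ultimately show ?thesis
    unfolding Omega_def Let_def y'_def[symmetric] P_def[symmetric] half_Omega_def
    by (simp add: deriv2_eq[OF \<phi>' \<phi>''] deriv2_eq[OF g' g''] j_def algebra_simps)
qed

theorem multipliers_nonneg:
  assumes N: "negligible N" and u': "\<And>t. t \<in> {0..T} - N \<Longrightarrow> u' t = u t"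
    and du': "\<And>t. t \<in> {0..T} - N \<Longrightarrow> du' t = du t"
    and dum: "du \<in> borel_measurable (lebesgue_on {0..T})" and L2: "(\<lambda>t. (norm (du t))\<^sup>2) integrable_on {0..T}"
    and tangent: "\<And>t i. t \<in> {0..T} \<Longrightarrow> c (u t) $ i = 0 \<Longrightarrow> c' (u t) (du t) $ i = 0"
    and y: "is_linearized_state T f u' x \<tau> du' dt dx"
    and \<phi>1: "\<phi>' (x T) (dx T) - dt \<le> 0" and g1: "g' (x \<tau>) (dx \<tau>) \<le> 0"
  shows "\<exists>(\<alpha>, \<gamma>, \<nu>)\<in>lagrange_multipliers T f \<phi> g c u' x \<tau>. Omega T f \<phi> g c u' x \<tau> \<alpha> \<gamma> \<nu> du' dt \<ge> 0"
proof -
  obtain \<alpha> \<gamma> where "first_order \<alpha> \<gamma>" "0 \<le> half_Omega \<alpha> \<gamma> du dt dx"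
    using multipliers_L2[OF dum L2 tangent is_linearized_state_lin[OF N u' du' y] \<phi>1 g1] by blast
  then show ?thesis
    using lagrange_multiplier[OF N u'] Omega_eq_half_Omega[OF N u' du' dum L2 y, of \<alpha> \<gamma>]
    by (intro bexI[of _ "(\<alpha>, \<gamma>, \<lambda>t. - a \<alpha> \<gamma> t)"]) auto
qed

end

subsection \<open>The original problem\<close>

lemma is_state_integral:
  assumes x: "is_state T f x0 u x" and N: "negligible N" and v: "\<And>t. t \<in> {0..T} - N \<Longrightarrow> v t = u t"
    and t: "t \<in> {0..T}"
  shows "((\<lambda>s. f (x s, v s)) has_integral (x t - x 0)) {0..t}"
proof -
  have ac: "absolutely_continuous_on {0..T} x" and "AE t in lebesgue_on {0..T}. (x has_vector_derivative f (x t, u t)) (at t)"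
    using x by (auto simp: is_state_def)
  then obtain M where M: "negligible M" "\<forall>t\<in>{0..T} - M. (x has_vector_derivative f (x t, u t)) (at t)"
    by (auto simp: AE_lebesgue_on_iff_negligible)
  show ?thesis
  proof (rule fundamental_theorem_of_calculus_absolutely_continuous[where N = "N \<union> M"])
    show "0 \<le> t" using t by simp
    show "absolutely_continuous_on {0..t} x" using t by (intro absolutely_continuous_on_subset[OF ac]) auto
    show "negligible (N \<union> M)" using N M(1) by simp
    fix s assume "s \<in> {0..t} - (N \<union> M)"
    then have s: "s \<in> {0..T} - N" "s \<in> {0..T} - M" using t by auto
    have "(x has_vector_derivative f (x s, u s)) (at s)" using M(2) s(2) by blast
    then show "(x has_vector_derivative f (x s, v s)) (at s within {0..t})"
      using v[OF s(1)] by (simp add: has_vector_derivative_at_within)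
  qed
qed

lemma component_has_derivative:
  fixes c :: "'a::real_normed_vector \<Rightarrow> real^'l"
  assumes "(c has_derivative c') (at z)"
  shows "((\<lambda>w. c w $ i) has_derivative (\<lambda>h. c' h $ i)) (at z)"
  by (rule bounded_linear.has_derivative[OF bounded_linear_vec_nth assms])

lemma grad_component:
  fixes c :: "'a::euclidean_space \<Rightarrow> real^'l" and c' :: "'a \<Rightarrow>\<^sub>L (real^'l)"
  assumes "(c has_derivative c') (at z)"
  shows "grad (\<lambda>w. c w $ i) z = blinfun_adj c' (axis i 1)"
  by (rule grad_eqI) (use component_has_derivative[OF assms, of i] in \<open>simp add: blinfun_adj_inner inner_axis'\<close>)

lemma negligible_sets_lebesgue_on:
  assumes "negligible N"
  shows "{t \<in> space (lebesgue_on S). t \<in> N} \<in> sets (lebesgue_on S)"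
proof -
  have "{t \<in> space (lebesgue_on S). t \<in> N} = S \<inter> N" by auto
  moreover have "S \<inter> N \<in> (\<inter>) S ` sets lebesgue" using negligible_imp_sets[OF assms] by blast
  ultimately show ?thesis by (simp only: sets_restrict_space)
qed

text \<open>On the exceptional set the control is replaced by one of its values at a good instant.
  Any property of the values that holds outside the set, such as admissibility, the bound or the
  qualification, then holds everywhere.\<close>

lemma representative_avoiding_negligible:
  fixes T :: real
  assumes u: "u \<in> borel_measurable (lebesgue_on {0..T})" and "T > 0" and N: "negligible N"
  obtains v where "v \<in> borel_measurable (lebesgue_on {0..T})" "\<And>t. t \<in> {0..T} - N \<Longrightarrow> v t = u t"
    "\<And>t. t \<in> {0..T} \<Longrightarrow> \<exists>s\<in>{0..T} - N. v t = u s"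
proof -
  have "negligible {0..T} \<longleftrightarrow> {0<..<T} = {}"
    using negligible_interval(1)[of 0 T] by (simp only: box_real)
  then have "\<not> negligible {0..T}" using \<open>T > 0\<close> by simp
  then have "\<not> {0..T} \<subseteq> N" using N negligible_subset by blast
  then obtain t0 where t0: "t0 \<in> {0..T} - N" by blast
  have "(\<lambda>t. if t \<in> N then u t0 else u t) \<in> borel_measurable (lebesgue_on {0..T})"
    by (intro measurable_If u borel_measurable_const negligible_sets_lebesgue_on N)
  then show ?thesis by (rule that) (use t0 in auto)
qed

text \<open>A wrong sign at some instant would, by the intermediate value theorem, produce a second
  zero between it and the neighbourhood of \<tau> where the sign is known.\<close>

lemma single_zero_signs:
  fixes h :: "real \<Rightarrow> real"
  assumes h: "continuous_on {a..b} h" and \<tau>: "a < \<tau>" "\<tau> < b" and "\<eta> > 0"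
    and left: "\<And>t. t \<in> {\<tau> - \<eta><..\<tau>} \<Longrightarrow> h t \<le> 0" and right: "\<And>t. t \<in> {\<tau><..<\<tau> + \<eta>} \<Longrightarrow> h t > 0"
    and nz: "\<And>t. t \<in> {a..b} \<Longrightarrow> t \<noteq> \<tau> \<Longrightarrow> h t \<noteq> 0"
  shows "h \<tau> = 0" and "t \<in> {a..<\<tau>} \<Longrightarrow> h t < 0" and "t \<in> {\<tau><..b} \<Longrightarrow> h t > 0"
proof -
  have "continuous_on {\<tau>..b} h" by (rule continuous_on_subset[OF h]) (use \<tau> in auto)
  then have lim: "(h \<longlongrightarrow> h \<tau>) (at_right \<tau>)" using \<tau>(2) by (rule continuous_on_Icc_at_rightD)
  have "eventually (\<lambda>t. 0 \<le> h t) (at_right \<tau>)"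
    unfolding eventually_at_right_field using right \<open>\<eta> > 0\<close> by (intro exI[of _ "\<tau> + \<eta>"]) (auto intro: less_imp_le)
  then have "0 \<le> h \<tau>" using tendsto_lowerbound[OF lim] by simp
  then show "h \<tau> = 0" using left[of \<tau>] \<open>\<eta> > 0\<close> by simp
  show "h t < 0" if t: "t \<in> {a..<\<tau>}"
  proof (rule ccontr)
    assume ht: "\<not> h t < 0"
    define s where "s = max t (\<tau> - \<eta> / 2)"
    have s: "t \<le> s" "s < \<tau>" "h s \<le> 0" using t \<open>\<eta> > 0\<close> left[of s] by (auto simp: s_def)
    have "\<exists>r\<ge>t. r \<le> s \<and> h r = 0"
      by (rule IVT2') (use s t ht \<tau> in \<open>auto intro: continuous_on_subset[OF h]\<close>)
    then show False using nz s t \<tau> by fastforce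
  qed
  show "h t > 0" if t: "t \<in> {\<tau><..b}"
  proof (rule ccontr)
    assume ht: "\<not> h t > 0"
    define s where "s = min t (\<tau> + \<eta> / 2)"
    have s: "s \<le> t" "\<tau> < s" using t \<open>\<eta> > 0\<close> by (auto simp: s_def)
    moreover have "h s > 0" using right[of s] s \<open>\<eta> > 0\<close> by (auto simp: s_def)
    ultimately have "\<exists>r\<ge>s. r \<le> t \<and> h r = 0"
      by (intro IVT2') (use t ht \<tau> in \<open>auto intro: continuous_on_subset[OF h]\<close>)
    then show False using nz s t \<tau> by fastforce
  qed
qed

lemma crisis_cost_single_crossing:
  assumes \<tau>: "0 < \<tau>" "\<tau> < T" and x: "\<And>t. t \<in> {0..T} \<Longrightarrow> x t \<notin> K \<longleftrightarrow> \<tau> < t"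
  shows "crisis_cost T \<phi> K x = \<phi> (x T) + (T - \<tau>)"
proof -
  have "((\<lambda>_. 1 :: real) has_integral (T - \<tau>)) {\<tau>..T}" using has_integral_const_real[of "1 :: real" \<tau> T] \<tau> by simp
  then have "((\<lambda>t. if t \<in> {\<tau>..T} then 1 else 0 :: real) has_integral (T - \<tau>)) {0..T}"
    using \<tau> by (subst has_integral_restrict) auto
  moreover have "(LINT t|lebesgue_on {0..T}. indicator (- K) (x t)) = integral {0..T} (\<lambda>t. if t \<in> {\<tau>..T} then 1 else 0 :: real)"
  proof (rule lebesgue_integral_eq_integral_spike[OF _ _ negligible_sing[of \<tau>]])
    show "(\<lambda>t. if t \<in> {\<tau>..T} then 1 else 0 :: real) absolutely_integrable_on {0..T}"
      using calculation by (intro nonnegative_absolutely_integrable_1) auto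
    show "indicator (- K) (x t) = (if t \<in> {\<tau>..T} then 1 else 0 :: real)" if "t \<in> {0..T} - {\<tau>}" for t
      using x[of t] that by (auto simp: indicator_def)
  qed simp
  ultimately show ?thesis by (simp add: crisis_cost_def integral_unique)
qed

text \<open>A change on a null set may destroy the one-sided limit itself; this essential version of
  it survives.\<close>

lemma at_left_limit_AE:
  fixes u :: "real \<Rightarrow> 'a::real_normed_vector"
  assumes lim: "(u \<longlongrightarrow> ul) (at_left \<tau>)" and \<tau>: "0 < \<tau>" "\<tau> < T" and N: "negligible N"
    and v: "\<And>t. t \<in> {0..T} - N \<Longrightarrow> v t = u t" and "e > 0"
  shows "\<exists>\<eta>>0. \<exists>N. negligible N \<and> (\<forall>t\<in>{\<tau> - \<eta><..<\<tau>} - N. norm (v t - ul) < e)"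
proof -
  have "eventually (\<lambda>t. dist (u t) ul < e) (at_left \<tau>)" using lim \<open>e > 0\<close> by (rule tendstoD)
  then obtain b where b: "b < \<tau>" "\<And>t. b < t \<Longrightarrow> t < \<tau> \<Longrightarrow> dist (u t) ul < e"
    unfolding eventually_at_left_field by blast
  have "norm (v t - ul) < e" if "t \<in> {\<tau> - min \<tau> (\<tau> - b)<..<\<tau>} - N" for t
    using v[of t] b(2)[of t] that \<tau> by (auto simp: dist_norm)
  then show ?thesis using b(1) \<tau> N by (intro exI[of _ "min \<tau> (\<tau> - b)"] conjI exI[of _ N]) auto
qed

text \<open>Transversality only says that the derivative is nonzero; its sign comes from the
  direction of the crossing. Were it negative, \<open>transversal_increase\<close> for
  \<open>- g\<close> would make \<open>g\<close> at least \<open>g (x \<tau>)\<close> just before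
  \<tau>.\<close>

lemma crossing_derivative_nonneg:
  fixes g :: "'a::euclidean_space \<Rightarrow> real" and f :: "'a \<times> 'b::euclidean_space \<Rightarrow> 'a"
    and g' :: "'a \<Rightarrow> 'a \<Rightarrow>\<^sub>L real" and \<tau> :: real
  assumes g': "\<And>z. (g has_derivative g' z) (at z)" and g'_cont: "continuous_on UNIV g'" and f_cont: "continuous_on UNIV f"
    and "0 < \<tau>" and xc: "continuous_on {0..\<tau>} x"
    and sol: "\<And>t. t \<in> {0..\<tau>} \<Longrightarrow> ((\<lambda>s. f (x s, u s)) has_integral (x t - x 0)) {0..t}"
    and before: "\<And>t. t \<in> {0..<\<tau>} \<Longrightarrow> g (x t) < g (x \<tau>)"
    and ul: "\<And>e. e > 0 \<Longrightarrow> \<exists>\<eta>>0. \<exists>N. negligible N \<and> (\<forall>t\<in>{\<tau> - \<eta><..<\<tau>} - N. norm (u t - ul) < e)"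
  shows "0 \<le> g' (x \<tau>) (f (x \<tau>, ul))"
proof (rule ccontr)
  assume neg: "\<not> 0 \<le> g' (x \<tau>) (f (x \<tau>, ul))"
  have "((\<lambda>z. - g z) has_derivative (- g' z)) (at z)" for z
    using has_derivative_minus[OF g'[of z]] by (simp add: uminus_blinfun.rep_eq)
  moreover have "continuous_on UNIV (\<lambda>z. - g' z)" by (intro continuous_intros g'_cont)
  moreover have "0 < (- g' (x \<tau>)) (f (x \<tau>, ul))" using neg by (simp add: blinfun.minus_left)
  ultimately obtain r where r: "r > 0"
    "\<And>(t::real) b k z w N. t \<le> b \<Longrightarrow> ((\<lambda>q. k q *\<^sub>R f (z q, w q)) has_integral (z b - z t)) {t..b} \<Longrightarrow>
       (\<And>q. q \<in> {t..b} \<Longrightarrow> norm (z q - x \<tau>) < r) \<Longrightarrow> negligible N \<Longrightarrow>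
       (\<And>q. q \<in> {t..b} - N \<Longrightarrow> norm (w q - ul) < r \<and> k q \<ge> 0) \<Longrightarrow> - g (z t) \<le> - g (z b)"
    by (rule transversal_increase[where g = "\<lambda>z. - g z" and g' = "\<lambda>z. - g' z", OF _ _ f_cont]) blast+
  obtain \<eta> N where \<eta>: "\<eta> > 0" and N: "negligible N" "\<forall>t\<in>{\<tau> - \<eta><..<\<tau>} - N. norm (u t - ul) < r" using ul[OF r(1)] by blast
  obtain d where d: "d > 0" "\<forall>t\<in>{0..\<tau>}. dist t \<tau> < d \<longrightarrow> dist (x t) (x \<tau>) < r"
    using xc[unfolded continuous_on_iff, rule_format, of \<tau> r] r(1) \<open>0 < \<tau>\<close> by auto
  define t where "t = \<tau> - min \<tau> (min \<eta> d) / 2"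
  have t: "0 \<le> t" "t < \<tau>" "\<tau> - \<eta> < t" "\<tau> - t < d" using \<open>0 < \<tau>\<close> \<eta> d(1) by (auto simp: t_def min_def)
  have "- g (x t) \<le> - g (x \<tau>)"
  proof (rule r(2)[where k = "\<lambda>_. 1" and w = u and N = "N \<union> {\<tau>}"])
    show "((\<lambda>q. 1 *\<^sub>R f (x q, u q)) has_integral (x \<tau> - x t)) {t..\<tau>}"
      using has_integral_increment[where a = 0 and b = \<tau>, OF sol, of t \<tau>] t by simp
    show "norm (x q - x \<tau>) < r" if "q \<in> {t..\<tau>}" for q
      using d(2)[rule_format, of q] that t by (simp add: dist_norm)
    show "negligible (N \<union> {\<tau>})" using N(1) by simp
    show "norm (u q - ul) < r \<and> (1::real) \<ge> 0" if "q \<in> {t..\<tau>} - (N \<union> {\<tau>})" for q using N(2) that t by auto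
  qed (use t in auto)
  then show False using before[of t] t by simp
qed

theorem lemma4p4:
  fixes T \<tau> c1 c2 \<epsilon> \<delta> :: real
    and x0 :: "real^'n"
    and U :: "(real^'m) set"
    and f :: "(real^'n) \<times> (real^'m) \<Rightarrow> real^'n"
    and \<phi> g :: "real^'n \<Rightarrow> real"
    and K :: "(real^'n) set"
    and c :: "real^'m \<Rightarrow> real^'l"
    and ub :: "real \<Rightarrow> real^'m"
    and xb :: "real \<Rightarrow> real^'n"
  assumes "T > 0"
    and "U \<noteq> {}" and "closed U"
    and "C2 f"
    and "c1 > 0" and "c2 > 0"
    and "\<forall>x. \<forall>u\<in>U. norm (f (x, u)) \<le> c1 * norm x + c2"
    and "\<forall>x. (\<lambda>u. f (x, u)) ` U \<noteq> {} \<and> compact ((\<lambda>u. f (x, u)) ` U) \<and> convex ((\<lambda>u. f (x, u)) ` U)"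
    and "C2 \<phi>"
    and "closed K" and "interior K \<noteq> {}"
    and "global_minimizer T f x0 U \<phi> K ub xb"
    and bounded_control: "ub \<in> Linf_space T"
    and "C2 c" and "U = {u. \<forall>i. c u $ i \<le> 0}"
    and "\<epsilon> > 0" and "\<delta> > 0" and "control_qualification T c ub \<epsilon> \<delta>"
    and "C2 g" and "K = {x. g x \<le> 0}"
    and "crossing_out T K xb \<tau>"
    and "\<forall>t. crossing_out T K xb t \<or> crossing_in T K xb t \<longrightarrow> t = \<tau>"
    and "transverse_at f g ub xb \<tau>"
    and "\<forall>t\<in>{0..T} - {\<tau>}. g (xb t) \<noteq> 0"
  shows "\<forall>(\<delta>u, \<delta>\<tau>) \<in> critical_cone T f \<phi> g c ub xb \<tau>.
           \<exists>(\<alpha>, \<gamma>, \<nu>) \<in> lagrange_multipliers T f \<phi> g c ub xb \<tau>.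
             Omega T f \<phi> g c ub xb \<tau> \<alpha> \<gamma> \<nu> \<delta>u \<delta>\<tau> \<ge> 0"
proof (clarify)
  fix \<delta>u \<delta>\<tau> assume cone: "(\<delta>u, \<delta>\<tau>) \<in> critical_cone T f \<phi> g c ub xb \<tau>"
  obtain f' f'' where f': "\<And>z. (f has_derivative blinfun_apply (f' z)) (at z)"
    and f'': "\<And>z. (f' has_derivative blinfun_apply (f'' z)) (at z)" and f''c: "continuous_on UNIV f''"
    using \<open>C2 f\<close> unfolding C2_def by blast
  obtain \<phi>' \<phi>'' where \<phi>': "\<And>z. (\<phi> has_derivative blinfun_apply (\<phi>' z)) (at z)"
    and \<phi>'': "\<And>z. (\<phi>' has_derivative blinfun_apply (\<phi>'' z)) (at z)" and \<phi>''c: "continuous_on UNIV \<phi>''"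
    using \<open>C2 \<phi>\<close> unfolding C2_def by blast
  obtain g' g'' where g': "\<And>z. (g has_derivative blinfun_apply (g' z)) (at z)"
    and g'': "\<And>z. (g' has_derivative blinfun_apply (g'' z)) (at z)" and g''c: "continuous_on UNIV g''"
    using \<open>C2 g\<close> unfolding C2_def by blast
  obtain c' c'' where c': "\<And>z. (c has_derivative blinfun_apply (c' z)) (at z)"
    and c'': "\<And>z. (c' has_derivative blinfun_apply (c'' z)) (at z)" and c''c: "continuous_on UNIV c''"
    using \<open>C2 c\<close> unfolding C2_def by blast
  have ubm: "ub \<in> borel_measurable (lebesgue_on {0..T})" and ubU: "\<And>t. t \<in> {0..T} \<Longrightarrow> ub t \<in> U"
    and state: "is_state T f x0 ub xb"
    and best: "\<And>v y. v \<in> controls T U \<Longrightarrow> is_state T f x0 v y \<Longrightarrow> crisis_cost T \<phi> K xb \<le> crisis_cost T \<phi> K y"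
    using \<open>global_minimizer T f x0 U \<phi> K ub xb\<close> unfolding global_minimizer_def controls_def by auto
  have x0: "xb 0 = x0" using state by (simp add: is_state_def)
  \<comment> \<open>The bound and the qualification hold only almost everywhere. Their exceptional
    sets are collected in \<open>N\<close> and removed together by changing the
    representative.\<close>
  obtain M where "AE t in lebesgue_on {0..T}. norm (ub t) \<le> M" using bounded_control by (auto simp: Linf_space_def)
  then obtain N1 where N1: "negligible N1" "\<forall>t\<in>{0..T} - N1. norm (ub t) \<le> M"
    by (auto simp: AE_lebesgue_on_iff_negligible)
  \<comment> \<open>The sum may run over all indices, since the coefficients vanish outside the
    nearly active ones.\<close>
  have "AE t in lebesgue_on {0..T}. \<forall>\<xi> :: real^'l. (\<forall>i. c (ub t) $ i < - \<delta> \<longrightarrow> \<xi> $ i = 0) \<longrightarrow>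
      \<epsilon> * norm \<xi> \<le> norm (lin_comb (\<lambda>i. blinfun_adj (c' (ub t)) (axis i 1)) \<xi>)"
    using \<open>control_qualification T c ub \<epsilon> \<delta>\<close> unfolding control_qualification_def Let_def
  proof (rule eventually_mono, intro allI impI)
    fix t and \<xi> :: "real^'l"
    assume q: "\<forall>\<xi> :: real^'l. (\<forall>i. i \<notin> {i. c (ub t) $ i \<ge> - \<delta>} \<longrightarrow> \<xi> $ i = 0) \<longrightarrow>
        \<epsilon> * norm \<xi> \<le> norm (\<Sum>i\<in>{i. c (ub t) $ i \<ge> - \<delta>}. (\<xi> $ i) *\<^sub>R grad (\<lambda>w. c w $ i) (ub t))"
      and \<xi>: "\<forall>i. c (ub t) $ i < - \<delta> \<longrightarrow> \<xi> $ i = 0"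
    have "lin_comb (\<lambda>i. blinfun_adj (c' (ub t)) (axis i 1)) \<xi> =
        (\<Sum>i\<in>{i. c (ub t) $ i \<ge> - \<delta>}. (\<xi> $ i) *\<^sub>R grad (\<lambda>w. c w $ i) (ub t))"
      unfolding lin_comb_def grad_component[OF c'] by (rule sum.mono_neutral_right) (use \<xi> in auto)
    then show "\<epsilon> * norm \<xi> \<le> norm (lin_comb (\<lambda>i. blinfun_adj (c' (ub t)) (axis i 1)) \<xi>)"
      using q[rule_format, of \<xi>] \<xi> by auto
  qed
  then obtain N2 where N2: "negligible N2" "\<forall>t\<in>{0..T} - N2. \<forall>\<xi> :: real^'l. (\<forall>i. c (ub t) $ i < - \<delta> \<longrightarrow> \<xi> $ i = 0) \<longrightarrow>
      \<epsilon> * norm \<xi> \<le> norm (lin_comb (\<lambda>i. blinfun_adj (c' (ub t)) (axis i 1)) \<xi>)"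
    by (auto simp: AE_lebesgue_on_iff_negligible)
  define N where "N = N1 \<union> N2"
  have N: "negligible N" using N1(1) N2(1) by (simp add: N_def)
  obtain u where um: "u \<in> borel_measurable (lebesgue_on {0..T})" and u_eq: "\<And>t. t \<in> {0..T} - N \<Longrightarrow> u t = ub t"
    and us: "\<And>t. t \<in> {0..T} \<Longrightarrow> \<exists>s\<in>{0..T} - N. u t = ub s"
    by (rule representative_avoiding_negligible[OF ubm \<open>T > 0\<close> N]) blast
  have ub: "bounded_measurable T u"
    unfolding bounded_measurable_def
  proof (intro conjI um exI[of _ M] ballI)
    fix t assume "t \<in> {0..T}"
    then obtain s where "s \<in> {0..T} - N" "u t = ub s" using us by blast
    then show "norm (u t) \<le> M" using N1(2) by (simp add: N_def)
  qed
  have u_adm: "c (u t) $ i \<le> 0" if "t \<in> {0..T}" for t i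
    using us[OF that] ubU \<open>U = {u. \<forall>i. c u $ i \<le> 0}\<close> by auto
  have sol: "((\<lambda>s. f (xb s, u s)) has_integral (xb t - xb 0)) {0..t}" if "t \<in> {0..T}" for t
    by (rule is_state_integral[OF state N u_eq that])
  have qual: "\<epsilon> * norm \<xi> \<le> norm (lin_comb (\<lambda>i. blinfun_adj (c' (u t)) (axis i 1)) \<xi>)"
    if t: "t \<in> {0..T}" and \<xi>: "\<And>i. c (u t) $ i < - \<delta> \<Longrightarrow> \<xi> $ i = 0" for t and \<xi> :: "real^'l"
  proof -
    obtain s where s: "s \<in> {0..T} - N" "u t = ub s" using us[OF t] by blast
    then show ?thesis using N2(2)[rule_format, of s \<xi>] \<xi> by (simp add: N_def)
  qed
  have xc: "continuous_on {0..T} xb" by (rule primitive_continuous[OF sol])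
  have gc: "continuous_on UNIV g" "continuous_on UNIV g'" "continuous_on UNIV f"
    using has_derivative_continuous_on[of UNIV g, OF g'] has_derivative_continuous_on[of UNIV g', OF g'']
      has_derivative_continuous_on[of UNIV f, OF f'] by auto
  have gxc: "continuous_on {0..T} (\<lambda>t. g (xb t))" by (rule continuous_on_compose2[OF gc(1) xc]) simp
  obtain \<eta> where \<tau>: "0 < \<tau>" "\<tau> < T" and \<eta>: "\<eta> > 0" "\<And>t. t \<in> {\<tau> - \<eta><..\<tau>} \<Longrightarrow> g (xb t) \<le> 0"
    "\<And>t. t \<in> {\<tau><..<\<tau> + \<eta>} \<Longrightarrow> g (xb t) > 0"
    using \<open>crossing_out T K xb \<tau>\<close> \<open>K = {x. g x \<le> 0}\<close> unfolding crossing_out_def by (auto simp: not_le)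
  have nz: "g (xb t) \<noteq> 0" if "t \<in> {0..T}" "t \<noteq> \<tau>" for t
    using \<open>\<forall>t\<in>{0..T} - {\<tau>}. g (xb t) \<noteq> 0\<close> that by blast
  have g_at: "g (xb \<tau>) = 0" by (rule single_zero_signs(1)[OF gxc \<tau> \<eta> nz])
  have g_before: "g (xb t) < 0" if "t \<in> {0..<\<tau>}" for t by (rule single_zero_signs(2)[OF gxc \<tau> \<eta> nz that])
  have g_after: "g (xb t) > 0" if "t \<in> {\<tau><..T}" for t by (rule single_zero_signs(3)[OF gxc \<tau> \<eta> nz that])
  have cost: "crisis_cost T \<phi> K xb = \<phi> (xb T) + (T - \<tau>)"
  proof (rule crisis_cost_single_crossing[OF \<tau>])
    fix t assume "t \<in> {0..T}"
    then consider "t \<in> {0..<\<tau>}" | "t = \<tau>" | "t \<in> {\<tau><..T}" by fastforce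
    then show "xb t \<notin> K \<longleftrightarrow> \<tau> < t"
      by cases (use g_at g_before[of t] g_after[of t] \<open>K = {x. g x \<le> 0}\<close> in auto)
  qed
  obtain ul where lim: "(ub \<longlongrightarrow> ul) (at_left \<tau>)" and tr: "f (xb \<tau>, ul) \<bullet> grad g (xb \<tau>) \<noteq> 0"
    using \<open>transverse_at f g ub xb \<tau>\<close> unfolding transverse_at_def by blast
  have ul: "\<exists>\<eta>>0. \<exists>N. negligible N \<and> (\<forall>t\<in>{\<tau> - \<eta><..<\<tau>} - N. norm (u t - ul) < e)" if "e > 0" for e
    by (rule at_left_limit_AE[OF lim \<tau> N u_eq that])
  have "g' (xb \<tau>) (f (xb \<tau>, ul)) \<noteq> 0"
    using tr by (simp add: grad_eq_blinfun_adj[OF g'] inner_commute[of "f (xb \<tau>, ul)"] blinfun_adj_inner)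
  moreover have "0 \<le> g' (xb \<tau>) (f (xb \<tau>, ul))"
  proof (rule crossing_derivative_nonneg[where x = xb and u = u, OF g' gc(2,3) \<tau>(1)])
    show "continuous_on {0..\<tau>} xb" by (rule continuous_on_subset[OF xc]) (use \<tau> in auto)
  qed (use sol g_at g_before ul \<tau> in auto)
  ultimately have transverse: "0 < g' (xb \<tau>) (f (xb \<tau>, ul))" by simp
  \<comment> \<open>The representative only has to satisfy the pointwise assumptions and the
    integral equation. Optimality concerns the trajectory, which both controls share.\<close>
  interpret crossing_problem T \<tau> f f' f'' \<phi> \<phi>' \<phi>'' g g' g'' c c' c'' u xb ul \<epsilon> \<delta>
  proof
    fix v y assume v: "v \<in> borel_measurable (lebesgue_on {0..T})" "\<And>t i. t \<in> {0..T} \<Longrightarrow> c (v t) $ i \<le> 0"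
      and y: "is_state T f (xb 0) v y"
    have "v \<in> controls T U" using v \<open>U = {u. \<forall>i. c u $ i \<le> 0}\<close> by (auto simp: controls_def)
    then show "\<phi> (xb T) + (T - \<tau>) \<le> crisis_cost T \<phi> {z. g z \<le> 0} y"
      using best[of v y] y x0 cost \<open>K = {x. g x \<le> 0}\<close> by simp
  qed (fact \<tau> f' f'' f''c \<phi>' \<phi>'' \<phi>''c g' g'' g''c c' c'' c''c ub u_adm sol \<open>\<epsilon> > 0\<close> \<open>\<delta> > 0\<close> qual g_before g_at transverse ul)+
  obtain \<delta>x where \<delta>u: "\<delta>u \<in> L2_space T" and lin: "is_linearized_state T f ub xb \<tau> \<delta>u \<delta>\<tau> \<delta>x"
    and \<phi>1: "deriv1 \<phi> (xb T) (\<delta>x T) - \<delta>\<tau> \<le> 0" and g1: "deriv1 g (xb \<tau>) (\<delta>x \<tau>) = 0"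
    and tangent: "\<forall>i. AE t in lebesgue_on {0..T}. c (ub t) $ i = 0 \<longrightarrow> deriv1 (\<lambda>w. c w $ i) (ub t) (\<delta>u t) = 0"
    using cone unfolding critical_cone_def by auto
  have "\<forall>i. \<exists>N. negligible N \<and> (\<forall>t\<in>{0..T} - N. c (ub t) $ i = 0 \<longrightarrow> c' (ub t) (\<delta>u t) $ i = 0)"
    using tangent by (simp add: AE_lebesgue_on_iff_negligible deriv1_eq[OF component_has_derivative[OF c']])
  from choice[OF this] obtain Nc where Nc: "\<And>i. negligible (Nc i)"
    "\<And>i t. t \<in> {0..T} - Nc i \<Longrightarrow> c (ub t) $ i = 0 \<Longrightarrow> c' (ub t) (\<delta>u t) $ i = 0" by blast
  define D where "D = N \<union> (\<Union>i. Nc i)"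
  have D: "negligible D" unfolding D_def using N Nc(1) by (intro negligible_Un negligible_Union) auto
  \<comment> \<open>Tangency is given almost everywhere. The zero vector is tangent to every
    constraint, so this modification makes it hold at each instant.\<close>
  define du where "du t = (if t \<in> D then 0 else \<delta>u t)" for t
  have \<delta>um: "\<delta>u \<in> borel_measurable (lebesgue_on {0..T})" and \<delta>u2: "integrable (lebesgue_on {0..T}) (\<lambda>t. (norm (\<delta>u t))\<^sup>2)"
    using \<delta>u by (auto simp: L2_space_def)
  have dum: "du \<in> borel_measurable (lebesgue_on {0..T})"
    unfolding du_def[abs_def] by (intro measurable_If \<delta>um borel_measurable_const negligible_sets_lebesgue_on D)
  have "(\<lambda>t. (norm (\<delta>u t))\<^sup>2) integrable_on {0..T}" using \<delta>u2 by (intro integrable_on_lebesgue_on) auto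
  then have L2: "(\<lambda>t. (norm (du t))\<^sup>2) integrable_on {0..T}"
    by (rule integrable_spike[OF _ D]) (simp add: du_def)
  show "\<exists>(\<alpha>, \<gamma>, \<nu>)\<in>lagrange_multipliers T f \<phi> g c ub xb \<tau>. Omega T f \<phi> g c ub xb \<tau> \<alpha> \<gamma> \<nu> \<delta>u \<delta>\<tau> \<ge> 0"
  proof (rule multipliers_nonneg[OF D _ _ dum L2 _ lin])
    show "ub t = u t" "\<delta>u t = du t" if "t \<in> {0..T} - D" for t
      using that u_eq[of t] by (auto simp: D_def du_def)
    show "c' (u t) (du t) $ i = 0" if "t \<in> {0..T}" "c (u t) $ i = 0" for t i
    proof (cases "t \<in> D")
      case False
      then show ?thesis using that u_eq[of t] Nc(2)[of t i] by (auto simp: D_def du_def)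
    qed (simp add: du_def blinfun.zero_right)
    show "\<phi>' (xb T) (\<delta>x T) - \<delta>\<tau> \<le> 0" using \<phi>1 by (simp add: deriv1_eq[OF \<phi>'])
    show "g' (xb \<tau>) (\<delta>x \<tau>) \<le> 0" using g1 by (simp add: deriv1_eq[OF g'])
  qed
qed

end
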